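(* Let $A$ and $B$ be Borel subsets of $\mathbb{R}^{n}$ and let $1 \le m < n$ be an integer. (i) If $\dim A > m$ and $\dim B > m$, then $$\gamma_{n,m}\left(\{V\in G(n,m): \mathcal H^m(P_V(A)\cap P_V(B))>0\}\right)>0.$$ (ii) If $\dim A > 2m$ and $\dim B > 2m$, then $$\gamma_{n,m}\left(\{V\in G(n,m): \operatorname{Int}(P_V(A)\cap P_V(B))\neq \emptyset\}\right)>0.$$ (iii) If $\dim A > m$, $\dim B \leq m$ and $\dim A + \dim B > 2m$, then for every $\epsilon > 0$, $$\gamma_{n,m}\left(\{V\in G(n,m): \dim (P_V(A)\cap P_V(B)) > \dim B - \epsilon\}\right)>0.$$
   Context: $\dim$ denotes Hausdorff dimension and $\mathcal H^m$ the $m$-dimensional Hausdorff measure. $G(n,m)$ is the Grassmannian of $m$-dimensional linear subspaces of $\mathbb{R}^n$, $\gamma_{n,m}$ its orthogonally invariant Borel probability (Haar) measure, and $P_V:\mathbb{R}^n\to V$ the orthogonal projection onto $V$. $\operatorname{Int}$ denotes the interior relative to $V$. *)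

theory Defs
  imports "HOL-Analysis.Analysis" "HOL-Probability.Probability"
begin

definition hausdorff_pre :: "real \<Rightarrow> real \<Rightarrow> 'a::metric_space set \<Rightarrow> ennreal" where
  "hausdorff_pre s \<delta> A =
     (INF C \<in> {C :: nat \<Rightarrow> 'a set. A \<subseteq> (\<Union>i. C i) \<and> (\<forall>i. bounded (C i) \<and> diameter (C i) \<le> \<delta>)}.
        (\<Sum>i. ennreal (diameter (C i) powr s)))"

definition hausdorff_measure :: "real \<Rightarrow> 'a::metric_space set \<Rightarrow> ennreal" where
  "hausdorff_measure s A = (SUP \<delta> \<in> {0<..}. hausdorff_pre s \<delta> A)"

definition hausdorff_dim :: "'a::metric_space set \<Rightarrow> real" where
  "hausdorff_dim A = Inf {s. s > 0 \<and> hausdorff_measure s A = 0}"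

definition orth_proj :: "'a::real_inner set \<Rightarrow> 'a \<Rightarrow> 'a" where
  "orth_proj V x = (SOME y. y \<in> V \<and> (\<forall>v\<in>V. (x - y) \<bullet> v = 0))"

definition grassmannian :: "nat \<Rightarrow> (real^'n) set set" where
  "grassmannian m = {V. subspace V \<and> dim V = m}"

definition grassmannian_borel :: "nat \<Rightarrow> (real^'n) set measure" where
  "grassmannian_borel m = vimage_algebra (grassmannian m) (\<lambda>V. matrix (orth_proj V)) borel"

definition grassmann_haar :: "nat \<Rightarrow> (real^'n) set measure \<Rightarrow> bool" where
  "grassmann_haar m \<gamma> \<longleftrightarrow>
     sets \<gamma> = sets (grassmannian_borel m) \<and> prob_space \<gamma> \<and>
     (\<forall>f. orthogonal_transformation f \<longrightarrow>
        (\<forall>S \<in> sets \<gamma>. (\<lambda>V. f ` V) ` S \<in> sets \<gamma> \<and> emeasure \<gamma> ((\<lambda>V. f ` V) ` S) = emeasure \<gamma> S))"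

text \<open>Positive (outer) measure: not contained in any null set.\<close>

definition pos_measure :: "'a measure \<Rightarrow> 'a set \<Rightarrow> bool" where
  "pos_measure M S \<longleftrightarrow> \<not> (\<exists>N \<in> null_sets M. S \<subseteq> N)"

end

(*
Choose Frostman measures mu on a compact subset of A and nu on a compact subset of B, and let
J_t(V) be t^(-m/2) times the integral of exp(-|P_V(x - y)|^2 / (2 t)) with respect to mu x nu.
Rotation invariance of the Haar measure gives a positive lower bound for the average of J_t over V,
uniformly for small t. On the other hand J_t(V) is, on the Fourier side, a pairing of the two
projected measures; it is dominated uniformly in t by a Sobolev norm of order a/2 of P_V mu plus a
Sobolev norm of order -a/2 of P_V nu, that is, an (m - a)-energy. The growth of mu and nu makes both
integrable in V, so by dominated convergence J_t(V) cannot tend to 0 for almost every V.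
It does tend to 0 as soon as P_V nu does not charge the projection of the support of mu, as one sees
by restricting nu to small neighbourhoods of that compact set. If the intersection of the projected
supports is null for the r-dimensional Hausdorff measure, then P_V nu does not charge it, because it
has finite r-energy (r = m - a < m) or a square integrable density (r = m). If a > m, both projections
have continuous densities; when the intersection has no interior, one of them vanishes at each point,
and again J_t(V) tends to 0.
*)
theory Submission
  imports Defs
begin

section \<open>Dyadic content and Frostman measures\<close>

text \<open>The thresholds come from balancing two demands on the Sobolev order \<open>a\<close>.
  For a damped measure of growth \<open>s\<close> the norm of order \<open>a / 2\<close> of its
  projections has a finite average if \<open>m + a < s\<close> and \<open>m + a < n\<close>; the
  negative norm is an \<open>(m - a)\<close>-energy and asks for growth above \<open>m - a\<close>.
  Hence a small \<open>a > 0\<close> serves (i), \<open>m - a\<close> slightly below the dimension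
  of \<open>B\<close> serves (iii), and \<open>a > m\<close> for both sets serves (ii). Two
  obstacles shape the rest. A Frostman measure must sit on a compact part of a Borel set of possibly
  infinite Hausdorff measure, so the argument runs through dyadic content, which is continuous along
  increasing sequences, and through Souslin schemes. And a plane is Lebesgue null, so integral
  bounds for a Fourier transform on the whole space say nothing about its values on
  \<open>V\<close>; multiplying the measure by a Gaussian (\<open>damp\<close>) spreads each value
  over a neighbourhood of the plane. Gaussians are used throughout because they split along
  \<open>V\<close> and its complement, and because rotation invariance then controls their averages
  over \<open>V\<close> up to constants.\<close>

definition lev :: "nat \<Rightarrow> real^'n \<Rightarrow> ('n \<Rightarrow> int)" where
  "lev k x = (\<lambda>i. \<lfloor>2 ^ k * x $ i\<rfloor>)"

text \<open>A cube is coded by its generation and its corner, so that covers are sets of codes; \<open>wt s k\<close> is the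
  \<open>s\<close>-th power of the side length \<open>2\<^sup>-\<^sup>k\<close> and \<open>dcont\<close> the resulting dyadic content.\<close>

definition dcube :: "nat \<times> ('n \<Rightarrow> int) \<Rightarrow> (real^'n) set" where
  "dcube c = {x. lev (fst c) x = snd c}"

definition wt :: "real \<Rightarrow> nat \<Rightarrow> real" where
  "wt s k = 2 powr (- (s * real k))"

text \<open>As the mass of a point measure the sum of weights gets subadditivity, countable
  additivity and continuity from below from general measure theory, also for infinite families of
  codes.\<close>

definition cost :: "real \<Rightarrow> (nat \<times> ('n::finite \<Rightarrow> int)) set \<Rightarrow> ennreal" where
  "cost s \<C> = emeasure (point_measure UNIV (\<lambda>c. ennreal (wt s (fst c)))) \<C>"

definition dcont :: "real \<Rightarrow> (real^'n) set \<Rightarrow> ennreal" where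
  "dcont s A = (INF \<C> \<in> {\<C>. A \<subseteq> \<Union>(dcube ` \<C>)}. cost s \<C>)"

lemma wt_pos [simp]: "0 < wt s k"
  by (simp add: wt_def)

lemma wt_mono: "0 \<le> s \<Longrightarrow> j \<le> k \<Longrightarrow> wt s k \<le> wt s j"
  by (simp add: wt_def mult_left_mono)

text \<open>A coarser corner coordinate is the integer quotient of the finer one by
  \<open>2 ^ (k - j)\<close>, so the finer code determines the coarser one.\<close>

lemma lev_mono:
  assumes "j \<le> k" "lev k x = lev k y"
  shows "lev j x = lev j y"
proof
  fix i
  have *: "lev j z i = lev k z i div 2 ^ (k - j)" for z :: "real^'a"
  proof -
    have "(2::real) ^ k = 2 ^ j * 2 ^ (k - j)"
      using assms(1) by (metis le_add_diff_inverse power_add)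
    then have "2 ^ j * z $ i = (2 ^ k * z $ i) / real_of_int (2 ^ (k - j))"
      by simp
    then have "\<lfloor>2 ^ j * z $ i\<rfloor> = \<lfloor>2 ^ k * z $ i\<rfloor> div 2 ^ (k - j)"
      using floor_divide_real_eq_div[of "2 ^ (k - j)" "2 ^ k * z $ i"] by simp
    then show ?thesis by (simp add: lev_def)
  qed
  show "lev j x i = lev j y i"
    using assms(2) by (simp add: *)
qed

lemma dcube_nested:
  assumes "fst c \<le> fst d" "x \<in> dcube c" "x \<in> dcube d"
  shows "dcube d \<subseteq> dcube c"
proof
  fix y assume "y \<in> dcube d"
  then have "lev (fst c) y = lev (fst c) x"
    using assms by (intro lev_mono[OF assms(1)]) (simp add: dcube_def)
  then show "y \<in> dcube c" using assms by (simp add: dcube_def)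
qed

lemma dcube_eqI:
  assumes "fst c = fst d" "x \<in> dcube c" "x \<in> dcube d"
  shows "c = d"
  using assms by (auto simp: dcube_def prod_eq_iff)

lemma cost_mono: "\<C> \<subseteq> \<D> \<Longrightarrow> cost s \<C> \<le> cost s \<D>"
  by (simp add: cost_def emeasure_mono sets_point_measure)

lemma cost_finite_sum: "finite \<C> \<Longrightarrow> cost s \<C> = (\<Sum>c\<in>\<C>. ennreal (wt s (fst c)))"
  by (simp add: cost_def emeasure_point_measure_finite2)

lemma cost_singleton [simp]: "cost s {c} = ennreal (wt s (fst c))"
  by (simp add: cost_finite_sum)

lemma cost_empty [simp]: "cost s {} = 0"
  by (simp add: cost_finite_sum)

lemma cost_Un: "cost s (\<C> \<union> \<D>) \<le> cost s \<C> + cost s \<D>"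
  by (simp add: cost_def emeasure_subadditive sets_point_measure)

lemma cost_Un_disjoint: "\<C> \<inter> \<D> = {} \<Longrightarrow> cost s (\<C> \<union> \<D>) = cost s \<C> + cost s \<D>"
  by (simp add: cost_def plus_emeasure sets_point_measure)

lemma cost_UN: "cost s (\<Union>i. \<C> i) \<le> (\<Sum>i. cost s (\<C> i))" for \<C> :: "nat \<Rightarrow> _"
  by (simp add: cost_def emeasure_subadditive_countably sets_point_measure)

text \<open>Codes are countable: \<open>to_nat\<close> cuts \<open>C\<close> into slices
  \<open>E i\<close> of at most one code. Subadditivity bounds the refined cover slice by slice, and
  additivity on the disjoint slices reassembles \<open>cost s C\<close>.\<close>

lemma cost_refine:
  assumes "\<And>c. c \<in> C \<Longrightarrow> cost s (\<D> c) \<le> t * ennreal (wt s (fst c))"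
  shows "cost s (\<Union>c\<in>C. \<D> c) \<le> t * cost s C"
proof -
  define E where "E i = {c \<in> C. to_nat c = i}" for i
  define F where "F i = (\<Union>c\<in>E i. \<D> c)" for i
  have E: "E i = {} \<or> (\<exists>c\<in>C. E i = {c})" for i
  proof (cases "\<exists>c\<in>C. to_nat c = i")
    case True
    then obtain c where c: "c \<in> C" "to_nat c = i" by auto
    then have "E i = {c}" by (auto simp: E_def)
    then show ?thesis using c by auto
  next
    case False
    then have "E i = {}" by (auto simp: E_def)
    then show ?thesis by simp
  qed
  have F: "cost s (F i) \<le> t * cost s (E i)" for i
    using E[of i] assms by (auto simp: F_def)
  have "(\<Union>c\<in>C. \<D> c) = (\<Union>i. F i)"
    by (auto simp: F_def E_def)
  then have "cost s (\<Union>c\<in>C. \<D> c) \<le> (\<Sum>i. cost s (F i))"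
    using cost_UN[of s F] by simp
  also have "\<dots> \<le> (\<Sum>i. t * cost s (E i))"
    by (intro suminf_le F) auto
  also have "\<dots> = t * (\<Sum>i. cost s (E i))"
    by simp
  also have "(\<Sum>i. cost s (E i)) = cost s (\<Union>i. E i)"
    unfolding cost_def
    by (rule suminf_emeasure) (auto simp: sets_point_measure disjoint_family_on_def E_def)
  also have "(\<Union>i. E i) = C"
    by (auto simp: E_def)
  finally show ?thesis .
qed

lemma dcont_le: "A \<subseteq> \<Union>(dcube ` \<C>) \<Longrightarrow> dcont s A \<le> cost s \<C>"
  unfolding dcont_def by (rule INF_lower) auto

lemma dcont_lessE:
  assumes "dcont s A < y"
  obtains \<C> where "A \<subseteq> \<Union>(dcube ` \<C>)" "cost s \<C> < y"
  using assms unfolding dcont_def by (auto simp: INF_less_iff)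

lemma dcont_mono: "A \<subseteq> B \<Longrightarrow> dcont s A \<le> dcont s B"
  unfolding dcont_def by (rule INF_superset_mono) auto

lemma dcont_empty [simp]: "dcont s {} = 0"
  using dcont_le[of "{}" "{}" s] by simp

lemma dcont_null_UN:
  assumes "\<And>i::nat. dcont s (R i) = 0"
  shows "dcont s (\<Union>i. R i) = 0"
proof -
  have "dcont s (\<Union>i. R i) \<le> 0 + ennreal e" if "e > 0" for e
  proof -
    have "\<exists>\<C>. R i \<subseteq> \<Union>(dcube ` \<C>) \<and> cost s \<C> < ennreal (e * (1/2) ^ Suc i)" for i
      using dcont_lessE[of s "R i" "ennreal (e * (1/2) ^ Suc i)"] assms[of i] that
      by (metis ennreal_less_zero_iff mult_pos_pos zero_less_divide_1_iff zero_less_numeral zero_less_power)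
    then obtain \<C> where C: "\<And>i. R i \<subseteq> \<Union>(dcube ` \<C> i)" "\<And>i. cost s (\<C> i) < ennreal (e * (1/2) ^ Suc i)"
      by metis
    have "dcont s (\<Union>i. R i) \<le> cost s (\<Union>i. \<C> i)"
      by (rule dcont_le) (use C(1) in fastforce)
    also have "\<dots> \<le> (\<Sum>i. cost s (\<C> i))"
      by (rule cost_UN)
    also have "\<dots> \<le> (\<Sum>i. ennreal (e * (1/2) ^ Suc i))"
      by (intro suminf_le less_imp_le[OF C(2)]) auto
    also have "\<dots> = ennreal e"
    proof (rule suminf_ennreal_eq)
      show "(\<lambda>i. e * (1/2) ^ Suc i) sums e"
        using sums_mult[OF power_half_series, of e] by simp
    qed (use that in auto)
    finally show ?thesis by simp
  qed
  then have "dcont s (\<Union>i. R i) \<le> 0"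
    by (rule ennreal_le_epsilon)
  then show ?thesis by simp
qed

lemma dcont_Un: "dcont s (A \<union> B) \<le> dcont s A + dcont s B"
proof (rule ennreal_le_epsilon)
  fix e :: real assume e: "0 < e" and fin: "dcont s A + dcont s B < top"
  have "dcont s A < dcont s A + ennreal (e/2)" "dcont s B < dcont s B + ennreal (e/2)"
    using e fin by (auto simp: ennreal_add_eq_top less_top)
  then obtain \<C> \<D> where C: "A \<subseteq> \<Union>(dcube ` \<C>)" "cost s \<C> < dcont s A + ennreal (e/2)"
    and D: "B \<subseteq> \<Union>(dcube ` \<D>)" "cost s \<D> < dcont s B + ennreal (e/2)"
    by (meson dcont_lessE)
  have "dcont s (A \<union> B) \<le> cost s (\<C> \<union> \<D>)"
    by (rule dcont_le) (use C D in auto)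
  also have "\<dots> \<le> cost s \<C> + cost s \<D>" by (rule cost_Un)
  also have "\<dots> \<le> (dcont s A + ennreal (e/2)) + (dcont s B + ennreal (e/2))"
    using C D by (intro add_mono) auto
  also have "\<dots> = dcont s A + dcont s B + (ennreal (e/2) + ennreal (e/2))"
    by (simp add: algebra_simps)
  also have "ennreal (e/2) + ennreal (e/2) = ennreal e"
    using e by (simp flip: ennreal_plus)
  finally show "dcont s (A \<union> B) \<le> dcont s A + dcont s B + ennreal e" .
qed

lemma cost_le_if_finite_le:
  assumes "\<And>M'. finite M' \<Longrightarrow> M' \<subseteq> M \<Longrightarrow> cost s M' \<le> y"
  shows "cost s M \<le> y"
proof -
  define E where "E i = {c \<in> M. to_nat c \<le> i}" for i
  have fin: "finite (E i)" for i
  proof (rule finite_imageD)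
    show "finite (to_nat ` E i)"
      by (rule finite_subset[of _ "{..i}"]) (auto simp: E_def)
    show "inj_on to_nat (E i)" by (rule inj_on_subset[OF inj_to_nat]) auto
  qed
  have "cost s (\<Union>i. E i) = (SUP i. cost s (E i))"
    unfolding cost_def
    by (rule SUP_emeasure_incseq[symmetric]) (auto simp: sets_point_measure incseq_def E_def)
  also have "(\<Union>i. E i) = M" by (auto simp: E_def)
  finally show ?thesis
    using assms fin by (auto intro!: SUP_least simp: E_def)
qed

text \<open>Replace the cover of \<open>\<Union>n. A n\<close> by the maximal cubes that are nearly full for some \<open>A n\<close>: a near optimal cover
  of one \<open>A n\<close> cannot improve on finitely many of them, and what they miss has content zero.\<close>

lemma dcont_incseq_aux:
  fixes A :: "nat \<Rightarrow> (real^'n) set" and t :: real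
  assumes s: "0 \<le> s" and inc: "incseq A" and t: "0 < t" "t < 1"
    and fin: "(SUP n. dcont s (A n)) < \<infinity>"
  shows "ennreal t * dcont s (\<Union>n. A n) \<le> (SUP n. dcont s (A n))"
proof -
  define L where "L = (SUP n. dcont s (A n))"
  have leL: "dcont s (A n) \<le> L" for n
    by (auto simp: L_def intro: SUP_upper)
  have finA: "dcont s (A n) < \<infinity>" for n
    using leL[of n] fin by (auto simp: L_def intro: le_less_trans)
  define S where "S n = {c. ennreal t * ennreal (wt s (fst c)) \<le> dcont s (A n \<inter> dcube c)}" for n
  have S_inc: "S n \<subseteq> S n'" if "n \<le> n'" for n n'
  proof
    fix c assume "c \<in> S n"
    moreover have "dcont s (A n \<inter> dcube c) \<le> dcont s (A n' \<inter> dcube c)"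
      using inc that by (intro dcont_mono) (auto simp: incseq_def)
    ultimately show "c \<in> S n'" by (auto simp: S_def)
  qed
  define U where "U = (\<Union>n. S n)"
  have ne: "dcube c \<noteq> {}" if cU: "c \<in> U" for c
  proof
    assume "dcube c = {}"
    moreover obtain n where "ennreal t * ennreal (wt s (fst c)) \<le> dcont s (A n \<inter> dcube c)"
      using cU unfolding U_def S_def by blast
    ultimately have "ennreal t * ennreal (wt s (fst c)) \<le> 0" by simp
    moreover have "0 < ennreal t * ennreal (wt s (fst c))"
      using t by (simp add: ennreal_zero_less_mult_iff)
    ultimately show False by (meson leD)
  qed
  define M where "M = {c \<in> U. \<forall>c'\<in>U. dcube c \<subseteq> dcube c' \<longrightarrow> fst c \<le> fst c'}"
  have cov: "\<exists>m\<in>M. dcube c \<subseteq> dcube m" if cU: "c \<in> U" for c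
  proof -
    obtain m where m: "m \<in> U \<and> dcube c \<subseteq> dcube m"
      "\<And>y. y \<in> U \<and> dcube c \<subseteq> dcube y \<Longrightarrow> fst m \<le> fst y"
      using ex_has_least_nat[of "\<lambda>d. d \<in> U \<and> dcube c \<subseteq> dcube d" c fst] cU by blast
    then have "m \<in> M" unfolding M_def by blast
    then show ?thesis using m by blast
  qed
  define R where "R n = A n - \<Union>(dcube ` S n)" for n
  have R0: "dcont s (R n) = 0" for n
  proof -
    have finR: "dcont s (R n) < \<infinity>"
      using dcont_mono[of "R n" "A n" s] finA[of n] by (auto simp: R_def intro: le_less_trans)
    obtain r where r: "dcont s (R n) = ennreal r" "0 \<le> r"
      using finR by (cases "dcont s (R n)") auto
    \<comment> \<open>A covering cube that meets \<open>R n\<close> is not in \<open>S n\<close>,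
      hence its part of \<open>A n\<close> has a cover costing less than \<open>t\<close> times its
      weight. Refining all of them shrinks an almost optimal cover by the factor
      \<open>t < 1\<close>, which is possible only for content zero.\<close>
    have "r \<le> t * (r + \<eta>)" if \<eta>: "\<eta> > 0" for \<eta>
    proof -
      have "dcont s (R n) < dcont s (R n) + ennreal \<eta>"
        using finR \<eta> by auto
      then obtain \<C> where C: "R n \<subseteq> \<Union>(dcube ` \<C>)" "cost s \<C> < dcont s (R n) + ennreal \<eta>"
        by (rule dcont_lessE)
      define C' where "C' = {c \<in> \<C>. dcube c \<inter> R n \<noteq> {}}"
      have "\<exists>\<D>. A n \<inter> dcube c \<subseteq> \<Union>(dcube ` \<D>) \<and> cost s \<D> < ennreal t * ennreal (wt s (fst c))" if "c \<in> C'" for c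
      proof -
        have "c \<notin> S n" using that by (auto simp: C'_def R_def)
        then have "dcont s (A n \<inter> dcube c) < ennreal t * ennreal (wt s (fst c))"
          by (auto simp: S_def)
        then show ?thesis by (meson dcont_lessE)
      qed
      then obtain \<D> where D: "\<And>c. c \<in> C' \<Longrightarrow> A n \<inter> dcube c \<subseteq> \<Union>(dcube ` \<D> c)"
         "\<And>c. c \<in> C' \<Longrightarrow> cost s (\<D> c) < ennreal t * ennreal (wt s (fst c))"
        by metis
      have "R n \<subseteq> \<Union>(dcube ` (\<Union>c\<in>C'. \<D> c))"
      proof
        fix x assume x: "x \<in> R n"
        then obtain c where c: "c \<in> \<C>" "x \<in> dcube c" using C by auto
        then have "c \<in> C'" "x \<in> A n" using x by (auto simp: C'_def R_def)
        then show "x \<in> \<Union>(dcube ` (\<Union>c\<in>C'. \<D> c))" using D(1) c by fastforce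
      qed
      then have "dcont s (R n) \<le> cost s (\<Union>c\<in>C'. \<D> c)" by (rule dcont_le)
      also have "\<dots> \<le> ennreal t * cost s C'"
        by (rule cost_refine) (auto intro: less_imp_le D)
      also have "\<dots> \<le> ennreal t * cost s \<C>"
        by (intro mult_left_mono cost_mono) (auto simp: C'_def)
      also have "\<dots> \<le> ennreal t * (dcont s (R n) + ennreal \<eta>)"
        using C by (intro mult_left_mono) auto
      finally have "ennreal r \<le> ennreal (t * (r + \<eta>))"
        using r \<eta> t by (simp add: ennreal_mult flip: ennreal_plus)
      then show ?thesis using t r \<eta> by simp
    qed
    then have *: "r - t * r \<le> t * \<eta>" if "\<eta> > 0" for \<eta>
      using that by (force simp: algebra_simps)
    have "r = 0"
    proof (rule ccontr)
      assume "r \<noteq> 0"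
      then have pos: "r - t * r > 0" using r t by (simp add: algebra_simps)
      show False using *[of "(r - t * r) / 2"] pos t
        by (smt (verit) divide_pos_pos field_sum_of_halves mult_less_cancel_right2 mult_left_less_imp_less)
    qed
    then show ?thesis using r by simp
  qed
  have fin_le: "ennreal t * cost s M' \<le> L" if M': "finite M'" "M' \<subseteq> M" for M'
  proof (cases "M' = {}")
    case False
    have "\<exists>n. c \<in> S n" if "c \<in> M'" for c
      using that M' by (auto simp: M_def U_def)
    then obtain N where N: "\<And>c. c \<in> M' \<Longrightarrow> c \<in> S (N c)" by metis
    define n where "n = Max (N ` M')"
    have MS: "c \<in> S n" if "c \<in> M'" for c
      using N[OF that] S_inc[of "N c" n] that M' by (auto simp: n_def)
    define w where "w = Min ((\<lambda>c. wt s (fst c)) ` M')"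
    have w: "w > 0" "\<And>c. c \<in> M' \<Longrightarrow> w \<le> wt s (fst c)"
      using M' False by (auto simp: w_def)
    have "ennreal t * cost s M' \<le> dcont s (A n)"
    proof (rule ennreal_le_epsilon)
      fix e :: real assume e: "0 < e"
      \<comment> \<open>The bound by \<open>(1 - t) * w\<close> is the amount saved below by
        exchanging one cube that is at least as heavy as the lightest member of \<open>M'\<close>;
        the bound by \<open>e\<close> is the error allowed.\<close>
      define \<eta> where "\<eta> = min e ((1 - t) * w)"
      have \<eta>: "\<eta> > 0" "\<eta> \<le> e" "\<eta> \<le> (1 - t) * w" using e t w by (auto simp: \<eta>_def)
      have "dcont s (A n) < dcont s (A n) + ennreal \<eta>"
        using finA[of n] \<eta> by auto
      then obtain \<C> where C: "A n \<subseteq> \<Union>(dcube ` \<C>)" "cost s \<C> < dcont s (A n) + ennreal \<eta>"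
        by (rule dcont_lessE)
      \<comment> \<open>By maximality of \<open>Q\<close> a strictly coarser cube \<open>P\<close>
        around it is not in \<open>U\<close>, so \<open>A n\<close> inside \<open>P\<close> has a
        cover costing less than \<open>t * wt s (fst P)\<close>. Exchanging \<open>P\<close> for it
        would bring the cover below \<open>dcont s (A n)\<close>.\<close>
      have noanc: False if P: "P \<in> \<C>" and Q: "Q \<in> M'" and lt: "fst P < fst Q" and sub: "dcube Q \<subseteq> dcube P" for P Q
      proof -
        have "Q \<in> M" using M' Q by auto
        then have "P \<notin> U" using sub lt unfolding M_def by force
        then have "dcont s (A n \<inter> dcube P) < ennreal t * ennreal (wt s (fst P))"
          by (auto simp: U_def S_def not_le)
        then obtain \<D> where D: "A n \<inter> dcube P \<subseteq> \<Union>(dcube ` \<D>)" "cost s \<D> < ennreal t * ennreal (wt s (fst P))"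
          by (rule dcont_lessE)
        let ?C = "(\<C> - {P}) \<union> \<D>"
        have "A n \<subseteq> \<Union>(dcube ` ?C)"
        proof
          fix x assume x: "x \<in> A n"
          then obtain c where c: "c \<in> \<C>" "x \<in> dcube c" using C by auto
          show "x \<in> \<Union>(dcube ` ?C)"
            using c D(1) x by (cases "c = P") auto
        qed
        then have "dcont s (A n) \<le> cost s ?C" by (rule dcont_le)
        also have "\<dots> \<le> cost s (\<C> - {P}) + cost s \<D>" by (rule cost_Un)
        also have "\<dots> \<le> cost s (\<C> - {P}) + ennreal (t * wt s (fst P))"
          using less_imp_le[OF D(2)] t by (intro add_left_mono) (simp add: ennreal_mult less_imp_le)
        finally have 1: "dcont s (A n) \<le> cost s (\<C> - {P}) + ennreal (t * wt s (fst P))" .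
        have 2: "cost s \<C> = cost s (\<C> - {P}) + ennreal (wt s (fst P))"
          using cost_Un_disjoint[of "\<C> - {P}" "{P}" s] P by (simp add: insert_absorb)
        have finC: "cost s \<C> < \<infinity>" using C(2) finA[of n] by (auto intro: less_trans)
        then have finC': "cost s (\<C> - {P}) < \<infinity>" using 2 by auto
        obtain a where a: "dcont s (A n) = ennreal a" "a \<ge> 0" using finA[of n] by (cases "dcont s (A n)") auto
        obtain b where b: "cost s (\<C> - {P}) = ennreal b" "b \<ge> 0" using finC' by (cases "cost s (\<C> - {P})") auto
        have 3: "a \<le> b + t * wt s (fst P)"
          using 1 a b t wt_pos[of s "fst P"] by (simp flip: ennreal_plus)
        have 4: "b + wt s (fst P) < a + \<eta>"
          using C(2) 2 a b \<eta> wt_pos[of s "fst P"] by (simp flip: ennreal_plus add: ennreal_less_iff less_imp_le)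
        have "w \<le> wt s (fst P)"
          using w(2)[OF Q] wt_mono[of s "fst P" "fst Q"] s lt by auto
        then have "(1 - t) * w \<le> (1 - t) * wt s (fst P)" using t by (intro mult_left_mono) auto
        then show False using 3 4 \<eta>(3) by (simp add: algebra_simps)
      qed
      \<comment> \<open>Dyadic cubes are nested or disjoint, and no covering cube that meets
        \<open>Q\<close> is strictly coarser; so those inside \<open>Q\<close> cover
        \<open>A n\<close> there, and distinct members of \<open>M'\<close> use disjoint parts of
        the cover.\<close>
      define CQ where "CQ Q = {P \<in> \<C>. dcube P \<noteq> {} \<and> dcube P \<subseteq> dcube Q}" for Q
      have covQ: "A n \<inter> dcube Q \<subseteq> \<Union>(dcube ` CQ Q)" if Q: "Q \<in> M'" for Q
      proof
        fix x assume x: "x \<in> A n \<inter> dcube Q"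
        then obtain P where P: "P \<in> \<C>" "x \<in> dcube P" using C by auto
        have "\<not> fst P < fst Q"
          using noanc[OF P(1) Q] dcube_nested[of P Q x] P x by auto
        then have "dcube P \<subseteq> dcube Q"
          using dcube_nested[of Q P x] P x by auto
        then have "P \<in> CQ Q" using P by (auto simp: CQ_def)
        then show "x \<in> \<Union>(dcube ` CQ Q)" using P by blast
      qed
      have disj: "disjoint_family_on CQ M'"
        unfolding disjoint_family_on_def
      proof (intro ballI impI)
        fix Q Q' assume Q: "Q \<in> M'" "Q' \<in> M'" "Q \<noteq> Q'"
        have "False" if "P \<in> CQ Q" "P \<in> CQ Q'" for P
        proof -
          have "dcube P \<noteq> {}" using that(1) by (simp add: CQ_def)
          then obtain x where "x \<in> dcube P" by blast
          then have x: "x \<in> dcube Q" "x \<in> dcube Q'" using that by (auto simp: CQ_def)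
          have QM: "Q \<in> M" "Q' \<in> M" using Q M' by auto
          have "fst Q' \<le> fst Q" if "fst Q \<le> fst Q'"
            using dcube_nested[OF that x] QM unfolding M_def by auto
          moreover have "fst Q \<le> fst Q'" if "fst Q' \<le> fst Q"
            using dcube_nested[OF that x(2,1)] QM unfolding M_def by auto
          ultimately have "fst Q = fst Q'" by linarith
          then show False using dcube_eqI[of Q Q' x] x Q by auto
        qed
        then show "CQ Q \<inter> CQ Q' = {}" by auto
      qed
      have "ennreal t * cost s M' = (\<Sum>Q\<in>M'. ennreal t * ennreal (wt s (fst Q)))"
        using M' by (simp add: cost_finite_sum sum_distrib_left)
      also have "\<dots> \<le> (\<Sum>Q\<in>M'. cost s (CQ Q))"
      proof (rule sum_mono)
        fix Q assume Q: "Q \<in> M'"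
        have "ennreal t * ennreal (wt s (fst Q)) \<le> dcont s (A n \<inter> dcube Q)"
          using MS[OF Q] by (auto simp: S_def)
        also have "\<dots> \<le> cost s (CQ Q)" by (rule dcont_le[OF covQ[OF Q]])
        finally show "ennreal t * ennreal (wt s (fst Q)) \<le> cost s (CQ Q)" .
      qed
      also have "\<dots> = cost s (\<Union>Q\<in>M'. CQ Q)"
        unfolding cost_def using M' disj
        by (intro sum_emeasure) (auto simp: sets_point_measure)
      also have "\<dots> \<le> cost s \<C>"
        by (intro cost_mono) (auto simp: CQ_def)
      also have "\<dots> \<le> dcont s (A n) + ennreal \<eta>" using C by auto
      also have "\<dots> \<le> dcont s (A n) + ennreal e"
        using \<eta> by (intro add_left_mono ennreal_leI) auto
      finally show "ennreal t * cost s M' \<le> dcont s (A n) + ennreal e" .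
    qed
    then show ?thesis using leL[of n] by auto
  qed auto
  have "ennreal t * cost s M \<le> L"
  proof -
    have "cost s M \<le> L * ennreal (1 / t)"
    proof (rule cost_le_if_finite_le)
      fix M' assume "finite M'" "M' \<subseteq> M"
      then have "ennreal t * cost s M' * ennreal (1 / t) \<le> L * ennreal (1 / t)"
        by (intro mult_right_mono fin_le) auto
      moreover have "ennreal t * cost s M' * ennreal (1 / t) = cost s M' * (ennreal t * ennreal (1 / t))"
        by (simp only: ac_simps)
      moreover have "ennreal t * ennreal (1 / t) = 1"
        using t by (simp flip: ennreal_mult)
      ultimately show "cost s M' \<le> L * ennreal (1 / t)" by simp
    qed
    then have "ennreal t * cost s M \<le> ennreal t * (L * ennreal (1 / t))"
      by (intro mult_left_mono) auto
    also have "\<dots> = L * (ennreal t * ennreal (1 / t))" by (simp only: ac_simps)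
    also have "ennreal t * ennreal (1 / t) = 1"
        using t by (simp flip: ennreal_mult)
    finally show ?thesis by simp
  qed
  moreover have "dcont s (\<Union>n. A n) \<le> cost s M"
  proof -
    have "(\<Union>n. A n) \<subseteq> \<Union>(dcube ` M) \<union> (\<Union>n. R n)"
    proof
      fix x assume "x \<in> (\<Union>n. A n)"
      then obtain n where n: "x \<in> A n" by auto
      show "x \<in> \<Union>(dcube ` M) \<union> (\<Union>n. R n)"
      proof (cases "x \<in> R n")
        case False
        then obtain c where "c \<in> S n" "x \<in> dcube c" using n by (auto simp: R_def)
        then show ?thesis using cov[of c] by (auto simp: U_def)
      qed auto
    qed
    then have "dcont s (\<Union>n. A n) \<le> dcont s (\<Union>(dcube ` M) \<union> (\<Union>n. R n))" by (rule dcont_mono)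
    also have "\<dots> \<le> dcont s (\<Union>(dcube ` M)) + dcont s (\<Union>n. R n)" by (rule dcont_Un)
    also have "dcont s (\<Union>n. R n) = 0" by (intro dcont_null_UN R0)
    also have "dcont s (\<Union>(dcube ` M)) \<le> cost s M" by (rule dcont_le) auto
    finally show ?thesis by simp
  qed
  ultimately show ?thesis
    unfolding L_def[symmetric] by (meson mult_left_mono order_trans zero_le)
qed

lemma dcont_incseq:
  fixes A :: "nat \<Rightarrow> (real^'n) set"
  assumes "0 \<le> s" "incseq A"
  shows "dcont s (\<Union>n. A n) = (SUP n. dcont s (A n))"
proof (rule antisym)
  show "(SUP n. dcont s (A n)) \<le> dcont s (\<Union>n. A n)"
    by (intro SUP_least dcont_mono) auto
  show "dcont s (\<Union>n. A n) \<le> (SUP n. dcont s (A n))"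
  proof (cases "(SUP n. dcont s (A n)) = \<infinity>")
    case False
    then have fin: "(SUP n. dcont s (A n)) < \<infinity>" unfolding infinity_ennreal_def by (rule top.not_eq_extremum[THEN iffD1])
    note aux = dcont_incseq_aux[OF assms _ _ fin]
    obtain l where l: "(SUP n. dcont s (A n)) = ennreal l" "l \<ge> 0"
      using fin by (cases "(SUP n. dcont s (A n))") auto
    \<comment> \<open>One factor, here \<open>1/2\<close>, suffices to exclude an infinite content;
      between finite numbers \<open>t\<close> may then tend to 1.\<close>
    have "dcont s (\<Union>n. A n) \<noteq> \<infinity>"
      using aux[of "1/2"] l by (auto simp: ennreal_mult_top top_unique)
    then obtain d where d: "dcont s (\<Union>n. A n) = ennreal d" "d \<ge> 0"
      by (cases "dcont s (\<Union>n. A n)") auto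
    have "d \<le> l"
    proof (rule field_le_mult_one_interval)
      fix z :: real assume z: "0 < z" "z < 1"
      show "z * d \<le> l" using aux[OF z] l d z by (simp flip: ennreal_mult)
    qed
    then show ?thesis using l d by (simp add: ennreal_leI)
  next
    case True
    then show ?thesis by (simp only: infinity_ennreal_def top_greatest)
  qed
qed

section \<open>Souslin schemes and Borel sets\<close>

text \<open>Souslin schemes \<open>X \<subseteq> K\<close> indexed by finite words. For these the capacitability argument works with
  continuity of \<open>dcont\<close> along increasing sequences alone, and they form a class containing all Borel sets.\<close>

definition captured :: "'a::topological_space set \<Rightarrow> bool" where
  "captured A \<longleftrightarrow> (\<exists>X K. X [] = A \<and> (\<forall>w i j. i \<le> j \<longrightarrow> X (w @ [i]) \<subseteq> X (w @ [j])) \<and>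
     (\<forall>w. (\<Union>i::nat. X (w @ [i])) = X w) \<and> (\<forall>w. closed (K w)) \<and> (\<forall>w. X w \<subseteq> K w) \<and>
     (\<forall>w i. K (w @ [i]) \<subseteq> K w) \<and> (\<forall>f. (\<Inter>k. K (map f [0..<k])) \<subseteq> A))"

lemma closed_captured: "closed A \<Longrightarrow> captured A"
  unfolding captured_def by (rule exI[of _ "\<lambda>_. A"], rule exI[of _ "\<lambda>_. A"]) auto

lemma captured_decreasing:
  assumes "\<And>w i. K (w @ [i]) \<subseteq> K w" "k \<le> l"
  shows "K (map f [0..<l]) \<subseteq> K (map f [0..<k])"
  using assms(2)
proof (induction rule: dec_induct)
  case (step n)
  then show ?case using assms(1)[of "map f [0..<n]" "f n"] by auto
qed auto

text \<open>The first letter \<open>n\<close> of a word admits the schemes of \<open>A 0\<close>,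
  ..., \<open>A n\<close>, which then read the remaining letters in common; taking all of them
  rather than the \<open>n\<close>-th alone makes \<open>X'\<close> increasing in that letter. Along
  a branch finitely many decreasing sequences of closed sets are united, so a point of all the
  unions stays in one of the sequences forever.\<close>

lemma captured_UN:
  assumes "\<And>j::nat. captured (A j)"
  shows "captured (\<Union>j. A j)"
proof -
  have "\<forall>j. \<exists>X K. X [] = A j \<and> (\<forall>w i i'. i \<le> i' \<longrightarrow> X (w @ [i]) \<subseteq> X (w @ [i'])) \<and>
     (\<forall>w. (\<Union>i::nat. X (w @ [i])) = X w) \<and> (\<forall>w. closed (K w)) \<and> (\<forall>w. X w \<subseteq> K w) \<and>
     (\<forall>w i. K (w @ [i]) \<subseteq> K w) \<and> (\<forall>f. (\<Inter>k. K (map f [0..<k])) \<subseteq> A j)"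
    using assms unfolding captured_def by blast
  then obtain X K where XK: "\<And>j. X j [] = A j"
     "\<And>j w i i'. i \<le> i' \<Longrightarrow> X j (w @ [i]) \<subseteq> X j (w @ [i'])"
     "\<And>j w. (\<Union>i::nat. X j (w @ [i])) = X j w"
     "\<And>j w. closed (K j w)" "\<And>j w. X j w \<subseteq> K j w"
     "\<And>j w i. K j (w @ [i]) \<subseteq> K j w"
     "\<And>j f. (\<Inter>k. K j (map f [0..<k])) \<subseteq> A j"
    by metis
  define X' where "X' w = (case w of [] \<Rightarrow> (\<Union>j. A j) | n # v \<Rightarrow> (\<Union>j\<in>{..n}. X j v))" for w
  define K' where "K' w = (case w of [] \<Rightarrow> UNIV | n # v \<Rightarrow> (\<Union>j\<in>{..n}. K j v))" for w
  have X': "X' [] = (\<Union>j. A j)" "X' (n # v) = (\<Union>j\<in>{..n}. X j v)" for n v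
    by (auto simp: X'_def)
  have K': "K' [] = UNIV" "K' (n # v) = (\<Union>j\<in>{..n}. K j v)" for n v
    by (auto simp: K'_def)
  show ?thesis unfolding captured_def
  proof (rule exI[of _ X'], rule exI[of _ K'], intro conjI allI impI)
    show "X' (w @ [i]) \<subseteq> X' (w @ [j])" if "i \<le> j" for w i j
    proof (cases w)
      case Nil
      have "{..i} \<subseteq> {..j}" using that by auto
      then show ?thesis using Nil by (simp only: X' append.simps) (rule UN_mono, auto)
    next
      case (Cons n v)
      then show ?thesis using XK(2)[OF that, of _ v] by (auto simp: X')
    qed
    show "(\<Union>i. X' (w @ [i])) = X' w" for w
    proof (cases w)
      case Nil
      then show ?thesis by (auto simp: X' XK(1))
    next
      case (Cons n v)
      have "(\<Union>i. X' (w @ [i])) = (\<Union>j\<in>{..n}. \<Union>i. X j (v @ [i]))"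
        unfolding Cons append.simps X' by (rule SUP_commute)
      then show ?thesis by (simp only: XK(3) X' Cons)
    qed
    show "closed (K' w)" for w
      by (cases w) (auto simp: K' XK(4))
    show "X' w \<subseteq> K' w" for w
      by (cases w) (auto simp: K' X' dest: XK(5)[THEN subsetD])
    show "K' (w @ [i]) \<subseteq> K' w" for w i
      by (cases w) (auto simp: K' dest: XK(6)[THEN subsetD])
    show "(\<Inter>k. K' (map f [0..<k])) \<subseteq> (\<Union>j. A j)" for f
    proof
      fix x assume x: "x \<in> (\<Inter>k. K' (map f [0..<k]))"
      define g where "g = f \<circ> Suc"
      have "map f [0..<Suc k] = f 0 # map g [0..<k]" for k
        by (simp only: upt_conv_Cons[OF zero_less_Suc] list.map map_Suc_upt[symmetric] g_def map_map)
      then have *: "\<exists>j\<le>f 0. x \<in> K j (map g [0..<k])" for k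
        using x[THEN INT_D, of "Suc k"] by (simp only: K') auto
      have "\<exists>j\<le>f 0. \<forall>k. x \<in> K j (map g [0..<k])"
      proof (rule ccontr)
        assume "\<not> ?thesis"
        then obtain k where k: "\<And>j. j \<le> f 0 \<Longrightarrow> x \<notin> K j (map g [0..<k j])" by metis
        define l where "l = Max (k ` {..f 0})"
        obtain j where j: "j \<le> f 0" "x \<in> K j (map g [0..<l])" using *[of l] by auto
        have "k j \<le> l" using j by (auto simp: l_def)
        then have "x \<in> K j (map g [0..<k j])"
          using captured_decreasing[of "K j" "k j" l g] XK(6) j by blast
        then show False using k j by auto
      qed
      then show "x \<in> (\<Union>j. A j)" using XK(7) by blast
    qed
  qed (simp add: X')
qed

text \<open>All schemes run at once: the letter at position \<open>p\<close> is handed to the scheme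
  number \<open>fst (prod_decode p)\<close>, so a new letter extends one subword and leaves the
  others as they are. Every scheme receives infinitely many letters along a branch.\<close>

lemma captured_INT:
  assumes "\<And>j::nat. captured (A j)"
  shows "captured (\<Inter>j. A j)"
proof -
  have "\<forall>j. \<exists>X K. X [] = A j \<and> (\<forall>w i i'. i \<le> i' \<longrightarrow> X (w @ [i]) \<subseteq> X (w @ [i'])) \<and>
     (\<forall>w. (\<Union>i::nat. X (w @ [i])) = X w) \<and> (\<forall>w. closed (K w)) \<and> (\<forall>w. X w \<subseteq> K w) \<and>
     (\<forall>w i. K (w @ [i]) \<subseteq> K w) \<and> (\<forall>f. (\<Inter>k. K (map f [0..<k])) \<subseteq> A j)"
    using assms unfolding captured_def by blast
  then obtain X K where XK: "\<And>j. X j [] = A j"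
     "\<And>j w i i'. i \<le> i' \<Longrightarrow> X j (w @ [i]) \<subseteq> X j (w @ [i'])"
     "\<And>j w. (\<Union>i::nat. X j (w @ [i])) = X j w"
     "\<And>j w. closed (K j w)" "\<And>j w. X j w \<subseteq> K j w"
     "\<And>j w i. K j (w @ [i]) \<subseteq> K j w"
     "\<And>j f. (\<Inter>k. K j (map f [0..<k])) \<subseteq> A j"
    by metis
  define N where "N j = {p. fst (prod_decode p) = j}" for j :: nat
  define L where "L j w = nths w (N j)" for j and w :: "nat list"
  have L: "L j (w @ [i]) = L j w @ (if fst (prod_decode (length w)) = j then [i] else [])" for j w i
    by (simp add: L_def N_def nths_append)
  have L0: "L j [] = []" for j by (simp add: L_def)
  define X' where "X' w = (\<Inter>j. X j (L j w))" for w
  define K' where "K' w = (\<Inter>j. K j (L j w))" for w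
  show ?thesis unfolding captured_def
  proof (rule exI[of _ X'], rule exI[of _ K'], intro conjI allI impI)
    show "X' [] = (\<Inter>j. A j)" by (simp add: X'_def L0 XK)
    show "X' (w @ [i]) \<subseteq> X' (w @ [j])" if "i \<le> j" for w i j
    proof
      fix x assume x: "x \<in> X' (w @ [i])"
      have "x \<in> X l (L l (w @ [j]))" for l
        using x[unfolded X'_def, THEN INT_D, of l] XK(2)[OF that, of l "L l w"] by (auto simp: L split: if_splits)
      then show "x \<in> X' (w @ [j])" by (simp add: X'_def)
    qed
    show "(\<Union>i. X' (w @ [i])) = X' w" for w
    proof
      show "(\<Union>i. X' (w @ [i])) \<subseteq> X' w"
      proof
        fix x assume "x \<in> (\<Union>i. X' (w @ [i]))"
        then obtain i where x: "x \<in> X' (w @ [i])" by auto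
        have "x \<in> X l (L l w)" for l
          using x[unfolded X'_def, THEN INT_D, of l] XK(3)[of l "L l w"] by (auto simp: L split: if_splits)
        then show "x \<in> X' w" by (simp add: X'_def)
      qed
      show "X' w \<subseteq> (\<Union>i. X' (w @ [i]))"
      proof
        fix x assume x: "x \<in> X' w"
        define j0 where "j0 = fst (prod_decode (length w))"
        have "x \<in> X j0 (L j0 w)" using x by (auto simp: X'_def)
        then obtain i where i: "x \<in> X j0 (L j0 w @ [i])" using XK(3)[of j0 "L j0 w"] by auto
        have "x \<in> X l (L l (w @ [i]))" for l
          using i x by (cases "l = j0") (auto simp: L X'_def j0_def)
        then show "x \<in> (\<Union>i. X' (w @ [i]))" by (auto simp: X'_def)
      qed
    qed
    show "closed (K' w)" for w
      by (auto simp: K'_def XK(4))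
    show "X' w \<subseteq> K' w" for w
      by (auto simp: K'_def X'_def intro: XK(5)[THEN subsetD])
    show "K' (w @ [i]) \<subseteq> K' w" for w i
    proof
      fix x assume x: "x \<in> K' (w @ [i])"
      have "x \<in> K l (L l w)" for l
        using x[unfolded K'_def, THEN INT_D, of l] XK(6)[of l "L l w"] by (auto simp: L split: if_splits)
      then show "x \<in> K' w" by (simp add: K'_def)
    qed
    show "(\<Inter>k. K' (map f [0..<k])) \<subseteq> (\<Inter>j. A j)" for f
    proof
      fix x assume x: "x \<in> (\<Inter>k. K' (map f [0..<k]))"
      have "x \<in> A j" for j
      proof -
        \<comment> \<open>The letters of \<open>f\<close> that reach scheme \<open>j\<close>, in
          order: \<open>prod_encode (j, l)\<close> increases with \<open>l\<close>, and before
          position \<open>k\<close> exactly \<open>c k\<close> of them have been read.\<close>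
        define g where "g l = f (prod_encode (j, l))" for l
        have inj: "prod_encode (j, l) < prod_encode (j, l') \<longleftrightarrow> l < l'" for l l'
        proof -
          have sm: "strict_mono (\<lambda>l. prod_encode (j, l))"
            by (rule strict_mono_Suc_iff[THEN iffD2]) (simp add: prod_encode_def)
          show ?thesis using strict_mono_less[OF sm] by simp
        qed
        define c where "c k = card {l. prod_encode (j, l) < k}" for k
        have c: "c (prod_encode (j, l)) = l" for l by (simp add: c_def inj)
        have Lm: "L j (map f [0..<k]) = map g [0..<c k]" for k
        proof (induction k)
          case 0
          then show ?case by (simp add: L0 c_def)
        next
          case (Suc k)
          show ?case
          proof (cases "fst (prod_decode k) = j")
            case True
            define l where "l = snd (prod_decode k)"
            have k: "k = prod_encode (j, l)" using True by (simp add: l_def flip: True)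
            have "{l'. prod_encode (j, l') < Suc k} = {..l}"
              using inj by (auto simp: k less_Suc_eq le_less)
            then have "c (Suc k) = Suc l" by (simp add: c_def)
            moreover have "c k = l" using c k by simp
            ultimately show ?thesis using Suc True by (simp add: L g_def k)
          next
            case False
            have "{l'. prod_encode (j, l') < Suc k} = {l'. prod_encode (j, l') < k}"
              using False by (auto simp: less_Suc_eq)
            then have "c (Suc k) = c k" by (simp add: c_def)
            then show ?thesis using Suc False by (simp add: L)
          qed
        qed
        have "x \<in> K j (map g [0..<l])" for l
        proof -
          have "x \<in> K' (map f [0..<prod_encode (j, l)])" using x by blast
          then have "x \<in> K j (L j (map f [0..<prod_encode (j, l)]))" unfolding K'_def by blast
          then show ?thesis by (simp add: Lm c)
        qed
        then show ?thesis using XK(7)[of j g] by blast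
      qed
      then show "x \<in> (\<Inter>j. A j)" by blast
    qed
  qed
qed

lemma open_captured: 
  assumes "open (U :: 'a::metric_space set)"
  shows "captured U"
proof (cases "U = UNIV")
  case False
  define F where "F n = {x. 1 / real (Suc n) \<le> infdist x (- U)}" for n
  have ne: "- U \<noteq> {}" using False by auto
  have "U = (\<Union>n. F n)"
  proof (intro equalityI subsetI)
    fix x assume "x \<in> U"
    then have "x \<notin> closure (- U)" using assms by (simp add: closed_Compl)
    then have "infdist x (- U) > 0" using ne in_closure_iff_infdist_zero[of "- U" x] infdist_nonneg[of x "- U"] by linarith
    then obtain n where "1 / real (Suc n) < infdist x (- U)" using nat_approx_posE by blast
    then show "x \<in> (\<Union>n. F n)" by (auto simp: F_def intro: less_imp_le)
  next
    fix x assume "x \<in> (\<Union>n. F n)"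
    then obtain n where n: "1 / real (Suc n) \<le> infdist x (- U)" by (auto simp: F_def)
    have "0 < 1 / real (Suc n)" by simp
    then have "infdist x (- U) > 0" using n by linarith
    then show "x \<in> U" by (metis ComplI infdist_zero less_irrefl)
  qed
  moreover have "closed (F n)" for n
    unfolding F_def by (intro closed_Collect_le continuous_intros)
  ultimately show ?thesis using captured_UN[of F] closed_captured by auto
qed (simp add: closed_captured)

text \<open>The class is not visibly closed under complements, so the induction over the generated
  sigma-algebra carries a set and its complement together.\<close>

lemma borel_captured:
  fixes A :: "'a::metric_space set"
  assumes "A \<in> sets borel"
  shows "captured A"
proof -
  have "A \<in> sigma_sets UNIV (Collect closed)"
    using assms by (simp add: borel_eq_closed)
  then have "captured A \<and> captured (- A)"
  proof induction
    case (Basic a)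
    then show ?case by (auto intro: closed_captured open_captured)
  next
    case Empty
    then show ?case by (auto intro: closed_captured)
  next
    case (Compl a)
    then show ?case by (simp add: Compl_eq_Diff_UNIV[symmetric])
  next
    case (Union a)
    have "- (\<Union>i. a i) = (\<Inter>i. - a i)" by auto
    then show ?case using Union captured_UN[of a] captured_INT[of "\<lambda>i. - a i"] by auto
  qed
  then show ?thesis by simp
qed

text \<open>Continuity of the content along increasing sequences lets each next letter be chosen so
  that the content of \<open>X\<close> stays above \<open>c\<close>. No lower bound is claimed for
  the content of the intersection of the \<open>K k\<close>; its place is taken later by measures
  carried by the sets \<open>E k\<close>.\<close>

lemma captured_compact_sequence:
  fixes A :: "(real^'n) set"
  assumes "captured A" "bounded A" "c < dcont s A" "0 \<le> s"
  obtains E K :: "nat \<Rightarrow> (real^'n) set" where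
    "\<And>k. compact (K k)" "\<And>k. E k \<subseteq> K k" "\<And>k. K (Suc k) \<subseteq> K k" "\<And>k. c < dcont s (E k)" "(\<Inter>k. K k) \<subseteq> A"
proof -
  obtain X K where XK0: "X [] = A \<and> (\<forall>w i i'. i \<le> i' \<longrightarrow> X (w @ [i]) \<subseteq> X (w @ [i'])) \<and>
     (\<forall>w. (\<Union>i::nat. X (w @ [i])) = X w) \<and> (\<forall>w. closed (K w)) \<and> (\<forall>w. X w \<subseteq> K w) \<and>
     (\<forall>w i. K (w @ [i]) \<subseteq> K w) \<and> (\<forall>f. (\<Inter>k. K (map f [0..<k])) \<subseteq> A)"
    using assms(1) unfolding captured_def by (elim exE)
  have XK: "X [] = A"
     "\<And>w i i'. i \<le> i' \<Longrightarrow> X (w @ [i]) \<subseteq> X (w @ [i'])"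
     "\<And>w. (\<Union>i::nat. X (w @ [i])) = X w"
     "\<And>w. closed (K w)" "\<And>w. X w \<subseteq> K w"
     "\<And>w i. K (w @ [i]) \<subseteq> K w"
     "\<And>f. (\<Inter>k. K (map f [0..<k])) \<subseteq> A"
    using XK0 by simp_all
  have step: "\<exists>i. c < dcont s (X (w @ [i]))" if "c < dcont s (X w)" for w
  proof -
    have "incseq (\<lambda>i. X (w @ [i]))" using XK(2) by (auto simp: incseq_def)
    then have "c < (SUP i. dcont s (X (w @ [i])))"
      using dcont_incseq[OF assms(4), of "\<lambda>i. X (w @ [i])"] that XK(3)[of w] by simp
    then show ?thesis by (auto simp: less_SUP_iff)
  qed
  obtain W :: "nat \<Rightarrow> nat list" where W: "W 0 = []" "\<And>k. c < dcont s (X (W k))" "\<And>k. \<exists>i. W (Suc k) = W k @ [i]"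
    using dependent_nat_choice[of "\<lambda>k w. c < dcont s (X w) \<and> (k = 0 \<longrightarrow> w = [])" "\<lambda>k w w'. \<exists>i. w' = w @ [i]"]
      step assms(3) XK(1) by (metis nat.distinct(2))
  then obtain f where f: "\<And>k. W (Suc k) = W k @ [f k]" by metis
  have Wf: "W k = map f [0..<k]" for k
    by (induction k) (auto simp: W f)
  have XA: "X (W k) \<subseteq> A" for k
  proof (induction k)
    case (Suc k)
    then show ?case using XK(3)[of "W k"] f[of k] by auto
  qed (simp add: W XK)
  show thesis
  proof (rule that[of "\<lambda>k. K (W k) \<inter> closure A" "\<lambda>k. X (W k)"])
    show "compact (K (W k) \<inter> closure A)" for k
      using assms(2) XK(4) by (simp add: closed_Int_compact)
    show "X (W k) \<subseteq> K (W k) \<inter> closure A" for k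
      using XA[of k] XK(5) closure_subset by blast
    show "K (W (Suc k)) \<inter> closure A \<subseteq> K (W k) \<inter> closure A" for k
      using XK(6) by (auto simp: f)
    show "c < dcont s (X (W k))" for k by (rule W)
    show "(\<Inter>k. K (W k) \<inter> closure A) \<subseteq> A"
      using XK(7)[of f] by (auto simp: Wf)
  qed
qed

section \<open>Discrete measures bounded by cube weights\<close>

text \<open>Points are inserted one at a time, each with the largest mass that keeps all cubes up to generation \<open>N\<close>
  admissible; then every point lies in a saturated cube.\<close>

lemma greedy_measure:
  fixes F :: "(real^'n) set"
  assumes "finite F"
  shows "\<exists>m::real^'n \<Rightarrow> real. (\<forall>x. 0 \<le> m x) \<and> (\<forall>k\<le>N. \<forall>x. sum m (F \<inter> dcube (k, lev k x)) \<le> wt s k) \<and>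
     (\<forall>p\<in>F. \<exists>k\<le>N. sum m (F \<inter> dcube (k, lev k p)) = wt s k)"
  using assms
proof induction
  case empty
  show ?case by (intro exI[of _ "\<lambda>_. 0"]) (auto intro: less_imp_le)
next
  case (insert p F)
  then obtain m :: "real^'n \<Rightarrow> real" where m: "\<And>x. 0 \<le> m x"
     "\<And>k x. k \<le> N \<Longrightarrow> sum m (F \<inter> dcube (k, lev k x)) \<le> wt s k"
     "\<And>p. p \<in> F \<Longrightarrow> \<exists>k\<le>N. sum m (F \<inter> dcube (k, lev k p)) = wt s k"
    by blast
  define slack where "slack k = wt s k - sum m (F \<inter> dcube (k, lev k p))" for k
  define t where "t = Min (slack ` {..N})"
  have t0: "0 \<le> t" using m(2) by (auto simp: t_def slack_def)
  have tle: "t \<le> slack k" if "k \<le> N" for k using that by (auto simp: t_def)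
  have "t \<in> slack ` {..N}" unfolding t_def by (intro Min_in) auto
  then obtain k0 where k0: "k0 \<le> N" "t = slack k0" by auto
  define m' where "m' = m(p := t)"
  have eqF: "sum m' (F \<inter> D) = sum m (F \<inter> D)" for D
    by (rule sum.cong) (use insert.hyps in \<open>auto simp: m'_def\<close>)
  have S1: "sum m' (insert p F \<inter> D) = t + sum m (F \<inter> D)" if "p \<in> D" for D
    using that insert.hyps eqF[of D] by (simp add: m'_def)
  have S2: "sum m' (insert p F \<inter> D) = sum m (F \<inter> D)" if "p \<notin> D" for D
    using that eqF[of D] by simp
  have same: "dcube (k, lev k x) = dcube (k, lev k p)" if "p \<in> dcube (k, lev k x)" for k x
    using that by (simp add: dcube_def)
  have le: "sum m' (insert p F \<inter> dcube (k, lev k x)) \<le> wt s k" if "k \<le> N" for k x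
  proof (cases "p \<in> dcube (k, lev k x)")
    case True
    then show ?thesis using S1[OF True] same[OF True] tle[OF that] by (simp add: slack_def)
  next
    case False
    then show ?thesis using S2[OF False] m(2)[OF that, of x] by simp
  qed
  show ?case
  proof (intro exI[of _ m'] conjI allI impI ballI)
    show "0 \<le> m' x" for x using m t0 by (simp add: m'_def)
    show "sum m' (insert p F \<inter> dcube (k, lev k x)) \<le> wt s k" if "k \<le> N" for k x by (rule le[OF that])
    fix q assume q: "q \<in> insert p F"
    show "\<exists>k\<le>N. sum m' (insert p F \<inter> dcube (k, lev k q)) = wt s k"
    proof (cases "q = p")
      case True
      have "p \<in> dcube (k0, lev k0 p)" by (simp add: dcube_def)
      then have "sum m' (insert p F \<inter> dcube (k0, lev k0 p)) = wt s k0"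
        using S1 k0 by (simp add: slack_def)
      then show ?thesis using True k0 by auto
    next
      case False
      then obtain k where k: "k \<le> N" "sum m (F \<inter> dcube (k, lev k q)) = wt s k" using q m(3) by auto
      \<comment> \<open>Masses only increase and admissibility caps them, so a cube that was
        saturated stays saturated.\<close>
      have "sum m (F \<inter> dcube (k, lev k q)) \<le> sum m' (insert p F \<inter> dcube (k, lev k q))"
        using S1[of "dcube (k, lev k q)"] S2[of "dcube (k, lev k q)"] t0 by (cases "p \<in> dcube (k, lev k q)") auto
      then show ?thesis using le[OF k(1), of q] k by (intro exI[of _ k]) auto
    qed
  qed
qed

text \<open>Assign to each point its coarsest saturated cube. By minimality of the generation these
  cubes are equal or disjoint; they cover \<open>A\<close>, and since each is saturated its weight
  equals its mass, so the cost of the cover is at most the total mass.\<close>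

lemma saturated_total:
  fixes F :: "(real^'n) set" and m :: "real^'n \<Rightarrow> real"
  assumes F: "finite F" and m: "\<And>x. 0 \<le> m x"
    and sat: "\<And>p. p \<in> F \<Longrightarrow> \<exists>k\<le>N. sum m (F \<inter> dcube (k, lev k p)) = wt s k"
    and cov: "\<And>x. x \<in> A \<Longrightarrow> \<exists>p\<in>F. lev N p = lev N x"
  shows "dcont s A \<le> ennreal (sum m F)"
proof -
  define P where "P k p \<longleftrightarrow> k \<le> N \<and> sum m (F \<inter> dcube (k, lev k p)) = wt s k" for k p
  define kk where "kk p = (LEAST k. P k p)" for p
  have kk: "P (kk p) p" if "p \<in> F" for p
    using sat[OF that] unfolding kk_def P_def by (rule LeastI_ex)
  have kk_le: "kk p \<le> k" if "P k p" for p k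
    using that unfolding kk_def by (rule Least_le)
  define c where "c p = (kk p, lev (kk p) p)" for p
  have key: "c p = c q" if pq: "p \<in> F" "q \<in> F" "y \<in> dcube (c p)" "y \<in> dcube (c q)" "kk p \<le> kk q" for p q y
  proof -
    have "lev (kk p) q = lev (kk p) y"
      using pq by (intro lev_mono[OF pq(5)]) (simp add: dcube_def c_def)
    then have l: "lev (kk p) q = lev (kk p) p" using pq by (simp add: dcube_def c_def)
    then have "P (kk p) q" using kk[OF pq(1)] by (simp add: P_def)
    then have "kk q \<le> kk p" by (rule kk_le)
    then have "kk q = kk p" using pq by simp
    then show ?thesis using l by (simp add: c_def)
  qed
  have disj: "dcube d \<inter> dcube d' = {}" if d: "d \<in> c ` F" "d' \<in> c ` F" "d \<noteq> d'" for d d'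
  proof (rule ccontr)
    assume "dcube d \<inter> dcube d' \<noteq> {}"
    then obtain y where y: "y \<in> dcube d" "y \<in> dcube d'" by blast
    obtain p q where pq: "p \<in> F" "q \<in> F" "d = c p" "d' = c q" using d by blast
    show False
      using key[of p q y] key[of q p y] y pq d(3) by (cases "kk p \<le> kk q") auto
  qed
  have "A \<subseteq> \<Union>(dcube ` c ` F)"
  proof
    fix x assume "x \<in> A"
    then obtain p where p: "p \<in> F" "lev N p = lev N x" using cov by auto
    have "kk p \<le> N" using kk[OF p(1)] by (simp add: P_def)
    then have "lev (kk p) x = lev (kk p) p" using lev_mono[of "kk p" N p x] p by simp
    then show "x \<in> \<Union>(dcube ` c ` F)" using p by (auto simp: dcube_def c_def)
  qed
  then have "dcont s A \<le> cost s (c ` F)" by (rule dcont_le)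
  also have "\<dots> = ennreal (\<Sum>d\<in>c ` F. wt s (fst d))"
    using F by (simp add: cost_finite_sum less_imp_le)
  also have "(\<Sum>d\<in>c ` F. wt s (fst d)) = (\<Sum>d\<in>c ` F. sum m (F \<inter> dcube d))"
    by (rule sum.cong) (use kk in \<open>auto simp: P_def c_def\<close>)
  also have "\<dots> = sum m (\<Union>d\<in>c ` F. F \<inter> dcube d)"
  proof (rule sum.UNION_disjoint[symmetric])
    show "\<forall>d\<in>c ` F. \<forall>d'\<in>c ` F. d \<noteq> d' \<longrightarrow> F \<inter> dcube d \<inter> (F \<inter> dcube d') = {}"
      using disj by blast
  qed (use F in auto)
  also have "\<dots> \<le> sum m F"
    using F m by (intro sum_mono2) auto
  finally show ?thesis by (simp add: ennreal_leI)
qed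

lemma finite_lev_image:
  fixes E :: "(real^'n) set"
  assumes "bounded E"
  shows "finite (lev N ` E)"
proof -
  obtain B where B: "\<And>x. x \<in> E \<Longrightarrow> norm x \<le> B" using assms by (auto simp: bounded_iff)
  have "lev N ` E \<subseteq> (PiE UNIV (\<lambda>_. {\<lfloor>- (2 ^ N * B)\<rfloor>..\<lfloor>2 ^ N * B\<rfloor>}))"
  proof safe
    fix x i assume x: "x \<in> E"
    have "\<bar>x $ i\<bar> \<le> B" using B[OF x] component_le_norm_cart[of x i] by linarith
    then have "- (2 ^ N * B) \<le> 2 ^ N * x $ i" "2 ^ N * x $ i \<le> 2 ^ N * B"
      using mult_left_mono[of "x $ i" B "2 ^ N"] mult_left_mono[of "- B" "x $ i" "2 ^ N"] by (auto simp: abs_le_iff)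
    then show "lev N x i \<in> {\<lfloor>- (2 ^ N * B)\<rfloor>..\<lfloor>2 ^ N * B\<rfloor>}"
      by (auto simp: lev_def intro!: floor_mono)
  qed auto
  then show ?thesis by (rule finite_subset) (intro finite_PiE, auto)
qed

text \<open>Finitely many points are enough to represent every cube of generation \<open>N\<close>
  that meets \<open>E\<close>, so saturated cubes around these points cover all of
  \<open>E\<close>.\<close>

lemma discrete_frostman:
  fixes E :: "(real^'n) set"
  assumes "bounded E"
  obtains F and m :: "real^'n \<Rightarrow> real" where "finite F" "F \<subseteq> E" "\<And>x. 0 \<le> m x"
    "\<And>k x. k \<le> N \<Longrightarrow> sum m (F \<inter> dcube (k, lev k x)) \<le> wt s k" "dcont s E \<le> ennreal (sum m F)"
proof -
  have "finite (lev N ` E)" by (rule finite_lev_image[OF assms])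
  then obtain F where F: "finite F" "F \<subseteq> E" "lev N ` F = lev N ` E"
    by (metis finite_subset_image subset_refl)
  obtain m :: "real^'n \<Rightarrow> real" where m: "\<And>x. 0 \<le> m x"
     "\<And>k x. k \<le> N \<Longrightarrow> sum m (F \<inter> dcube (k, lev k x)) \<le> wt s k"
     "\<And>p. p \<in> F \<Longrightarrow> \<exists>k\<le>N. sum m (F \<inter> dcube (k, lev k p)) = wt s k"
    using greedy_measure[OF F(1), of N s] by blast
  have "\<exists>p\<in>F. lev N p = lev N x" if "x \<in> E" for x
    using F(3) that by (metis imageE imageI)
  then have "dcont s E \<le> ennreal (sum m F)"
    by (intro saturated_total[OF F(1) m(1) m(3)])
  then show thesis using that F m by blast
qed

section \<open>Weak limits by means of a space-filling curve\<close>

text \<open>The building block of Schoenberg's space-filling curve. The curve carries discrete measures on bounded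
  sets to \<open>[0,1]\<close>, where Helly selection provides weak limits.\<close>

definition zigzag :: "real \<Rightarrow> real" where
  "zigzag t = max 0 (min 1 (1/2 - cos (pi * t)))"

lemma zigzag_bounds: "0 \<le> zigzag t" "zigzag t \<le> 1"
  unfolding zigzag_def by (rule max.cobounded1, rule max.boundedI) (simp, rule min.cobounded1)

lemma continuous_on_zigzag [continuous_intros]:
  fixes f :: "'a::t2_space \<Rightarrow> real"
  shows "continuous_on S f \<Longrightarrow> continuous_on S (\<lambda>x. zigzag (f x))"
  unfolding zigzag_def by (intro continuous_intros)

lemma zigzag_even: "zigzag (2 * real n + t) = zigzag t"
proof -
  have "cos (pi * (2 * real n + t)) = cos (2 * pi * of_int (int n) + pi * t)"
    by (simp add: algebra_simps)
  also have "\<dots> = cos (pi * t)"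
    by (simp only: cos_add cos_int_2pin sin_int_2pin mult_1 mult_zero_left diff_zero)
  finally show ?thesis by (simp add: zigzag_def)
qed

lemma zigzag_low: "0 \<le> t \<Longrightarrow> t \<le> 1/3 \<Longrightarrow> zigzag t = 0"
proof -
  assume t: "0 \<le> t" "t \<le> 1/3"
  have "cos (pi / 3) \<le> cos (pi * t)"
    using t by (intro cos_monotone_0_pi_le) (auto simp: field_simps)
  then show ?thesis by (simp add: zigzag_def cos_60)
qed

lemma zigzag_high: "2/3 \<le> t \<Longrightarrow> t \<le> 1 \<Longrightarrow> zigzag t = 1"
proof -
  assume t: "2/3 \<le> t" "t \<le> 1"
  have "cos (pi * t) \<le> cos (pi - pi / 3)"
    using t by (intro cos_monotone_0_pi_le) (auto simp: field_simps)
  then have "cos (pi * t) \<le> - (1/2)" by (simp only: cos_pi_minus cos_60)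
  then show ?thesis by (simp add: zigzag_def)
qed

text \<open>The number with ternary digits \<open>2 * b k\<close> does it: multiplication by
  \<open>3 ^ k\<close> moves the first \<open>k\<close> digits into an even integer, which
  \<open>zigzag\<close> ignores, and the remaining fraction lies in \<open>[0, 1/3]\<close> or
  \<open>[2/3, 1]\<close> according to \<open>b k\<close>.\<close>

lemma ternary_digits:
  fixes b :: "nat \<Rightarrow> nat"
  assumes b: "\<And>k. b k \<le> 1"
  obtains t where "0 \<le> t" "t \<le> 1" "\<And>k. zigzag (3 ^ k * t) = real (b k)"
proof -
  define T where "T k = (\<Sum>l. 2 * real (b (k + l)) * (1/3) ^ Suc l)" for k
  have geo: "(\<lambda>l. 2 * (1/3) ^ Suc l) sums (1::real)"
    using sums_mult[OF geometric_sums[of "1/3::real"], of "2/3"] by simp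
  have le: "2 * real (b (k + l)) * (1/3) ^ Suc l \<le> 2 * (1/3) ^ Suc l" for k l
    using b[of "k + l"] by (intro mult_right_mono) auto
  have sm: "summable (\<lambda>l. 2 * real (b (k + l)) * (1/3) ^ Suc l)" for k
    by (rule summable_comparison_test'[OF sums_summable[OF geo]]) (use le[of k] in auto)
  have T0: "0 \<le> T k" for k unfolding T_def by (intro suminf_nonneg sm) auto
  have T1: "T k \<le> 1" for k
    unfolding T_def using suminf_le[OF le sm sums_summable[OF geo]] sums_unique[OF geo] by simp
  have rec: "3 * T k = 2 * real (b k) + T (Suc k)" for k
  proof -
    have "T k = (\<Sum>l. 2 * real (b (k + Suc l)) * (1/3) ^ Suc (Suc l)) + 2 * real (b (k + 0)) * (1/3) ^ Suc 0"
      unfolding T_def by (subst suminf_split_head[OF sm]) simp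
    also have "(\<Sum>l. 2 * real (b (k + Suc l)) * (1/3) ^ Suc (Suc l)) = (\<Sum>l. (1/3) * (2 * real (b (Suc k + l)) * (1/3) ^ Suc l))"
      by (intro suminf_cong) simp
    also have "\<dots> = (1/3) * T (Suc k)"
      unfolding T_def by (rule suminf_mult[OF sm])
    finally show ?thesis by simp
  qed
  have N: "\<exists>N::nat. 3 ^ k * T 0 = 2 * real N + T k" for k
  proof (induction k)
    case 0
    show ?case by (intro exI[of _ 0]) simp
  next
    case (Suc k)
    then obtain N where "3 ^ k * T 0 = 2 * real N + T k" by auto
    then have "3 ^ Suc k * T 0 = 2 * real (3 * N + b k) + T (Suc k)"
      using rec[of k] by simp
    then show ?case by blast
  qed
  have "zigzag (3 ^ k * T 0) = real (b k)" for k
  proof -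
    obtain N :: nat where "3 ^ k * T 0 = 2 * real N + T k" using N by blast
    then have z: "zigzag (3 ^ k * T 0) = zigzag (T k)" by (simp add: zigzag_even)
    have "b k = 0 \<or> b k = 1" using b[of k] by auto
    then show ?thesis
      using z rec[of k] T0[of "Suc k"] T1[of "Suc k"] zigzag_low[of "T k"] zigzag_high[of "T k"] by auto
  qed
  then show thesis using that T0 T1 by blast
qed

lemma binary_digits:
  assumes "0 \<le> x" "x < (1::real)"
  obtains b :: "nat \<Rightarrow> nat" where "\<And>j. b j \<le> 1" "(\<lambda>j. real (b j) * (1/2) ^ Suc j) sums x"
proof -
  define b where "b j = nat (\<lfloor>2 ^ Suc j * x\<rfloor> mod 2)" for j
  have bb: "real (b j) = of_int (\<lfloor>2 ^ Suc j * x\<rfloor> mod 2)" for j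
    by (simp add: b_def)
  have fl: "\<lfloor>2 ^ Suc j * x\<rfloor> div 2 = \<lfloor>2 ^ j * x\<rfloor>" for j
    using floor_divide_real_eq_div[of 2 "2 ^ Suc j * x"] by simp
  have part: "(\<Sum>j<J. real (b j) * (1/2) ^ Suc j) = of_int \<lfloor>2 ^ J * x\<rfloor> / 2 ^ J" for J
  proof (induction J)
    case 0
    have "\<lfloor>x\<rfloor> = 0" using assms by (simp add: floor_eq_iff)
    then show ?case by simp
  next
    case (Suc J)
    have "of_int \<lfloor>2 ^ Suc J * x\<rfloor> = (2::real) * of_int (\<lfloor>2 ^ Suc J * x\<rfloor> div 2) + of_int (\<lfloor>2 ^ Suc J * x\<rfloor> mod 2)"
      by (metis mult_div_mod_eq of_int_add of_int_mult of_int_numeral)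
    then have *: "of_int \<lfloor>2 ^ Suc J * x\<rfloor> = 2 * of_int \<lfloor>2 ^ J * x\<rfloor> + real (b J)"
      by (simp only: fl bb)
    show ?case using Suc by (simp only: sum.lessThan_Suc *) (simp add: field_simps)
  qed
  have "(\<lambda>J. of_int \<lfloor>2 ^ J * x\<rfloor> / 2 ^ J) \<longlonglongrightarrow> x"
  proof (rule real_tendsto_sandwich)
    have "(\<lambda>J. x - (1/2) ^ J) \<longlonglongrightarrow> x - 0" by (intro tendsto_intros) auto
    then show "(\<lambda>J. x - (1/2) ^ J) \<longlonglongrightarrow> x" by simp
    show "\<forall>\<^sub>F J in sequentially. x - (1/2) ^ J \<le> of_int \<lfloor>2 ^ J * x\<rfloor> / 2 ^ J"
    proof (rule always_eventually, rule allI)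
      fix J
      have "2 ^ J * x - 1 \<le> of_int \<lfloor>2 ^ J * x\<rfloor>" by linarith
      then have "(2 ^ J * x - 1) / 2 ^ J \<le> of_int \<lfloor>2 ^ J * x\<rfloor> / 2 ^ J" by (intro divide_right_mono) auto
      then show "x - (1/2) ^ J \<le> of_int \<lfloor>2 ^ J * x\<rfloor> / 2 ^ J" by (simp add: diff_divide_distrib power_divide)
    qed
    show "\<forall>\<^sub>F J in sequentially. of_int \<lfloor>2 ^ J * x\<rfloor> / 2 ^ J \<le> x"
    proof (rule always_eventually, rule allI)
      fix J
      have "of_int \<lfloor>2 ^ J * x\<rfloor> \<le> 2 ^ J * x" by linarith
      then show "of_int \<lfloor>2 ^ J * x\<rfloor> / 2 ^ J \<le> x" by (simp add: field_simps)
    qed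
  qed simp
  then have "(\<lambda>j. real (b j) * (1/2) ^ Suc j) sums x"
    unfolding sums_def by (simp only: part)
  moreover have "b j \<le> 1" for j by (simp add: b_def nat_le_iff) 
  ultimately show thesis using that by blast
qed

text \<open>The binary digit \<open>j\<close> of coordinate \<open>i\<close> is read off the ternary
  digit of \<open>t\<close> at position \<open>to_nat (i, j)\<close>; different pairs use different
  positions, so all digits can be prescribed at once.\<close>

definition schoenberg :: "real \<Rightarrow> real^'n" where
  "schoenberg t = (\<chi> i. \<Sum>j. zigzag (3 ^ to_nat (i, j) * t) * (1/2) ^ Suc j)"

lemma continuous_schoenberg: "continuous_on UNIV (schoenberg :: real \<Rightarrow> real^'n)"
  unfolding schoenberg_def
proof (intro continuous_on_vec_lambda)
  fix i :: 'n
  have "uniform_limit UNIV (\<lambda>n t. \<Sum>j<n. zigzag (3 ^ to_nat (i, j) * t) * (1/2) ^ Suc j)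
     (\<lambda>t. \<Sum>j. zigzag (3 ^ to_nat (i, j) * t) * (1/2) ^ Suc j) sequentially"
  proof (rule Weierstrass_m_test)
    show "norm (zigzag (3 ^ to_nat (i, j) * t) * (1/2) ^ Suc j) \<le> (1/2) ^ Suc j" for j t
      using zigzag_bounds[of "3 ^ to_nat (i, j) * t"] by (auto simp: abs_mult intro!: mult_left_le_one_le)
    show "summable (\<lambda>j. (1/2::real) ^ Suc j)" using power_half_series by (rule sums_summable)
  qed
  then show "continuous_on UNIV (\<lambda>t. \<Sum>j. zigzag (3 ^ to_nat (i, j) * t) * (1/2) ^ Suc j)"
    by (rule uniform_limit_theorem[rotated]) (auto intro!: always_eventually continuous_intros)
qed

lemma schoenberg_surj:
  fixes x :: "real^'n"
  assumes "\<And>i. 0 \<le> x $ i" "\<And>i. x $ i < 1"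
  obtains t where "0 \<le> t" "t \<le> 1" "schoenberg t = x"
proof -
  have "\<exists>b. (\<forall>j. b j \<le> (1::nat)) \<and> (\<lambda>j. real (b j) * (1/2) ^ Suc j) sums (x $ i)" for i
    using binary_digits[OF assms(1,2)] by metis
  then obtain b where b: "\<And>i j. b i j \<le> (1::nat)" "\<And>i. (\<lambda>j. real (b i j) * (1/2) ^ Suc j) sums (x $ i)"
    by metis
  \<comment> \<open>Positions that encode no pair receive the digit 0.\<close>
  define d where "d k = (if \<exists>i j. k = to_nat (i::'n, j::nat) then (let p = (from_nat k :: 'n \<times> nat) in b (fst p) (snd p)) else 0)" for k
  have "d k \<le> 1" for k by (simp add: d_def Let_def b del: One_nat_def)
  then obtain t where t: "0 \<le> t" "t \<le> 1" "\<And>k. zigzag (3 ^ k * t) = real (d k)"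
    using ternary_digits by blast
  have "d (to_nat (i, j)) = b i j" for i j by (auto simp: d_def Let_def)
  then have "schoenberg t $ i = x $ i" for i
    using sums_unique[OF b(2)[of i]] by (simp add: schoenberg_def t)
  then show thesis using that t by (simp add: vec_eq_iff)
qed

lemma curve_through_bounded:
  fixes E :: "(real^'n) set"
  assumes "bounded E"
  obtains g :: "real \<Rightarrow> real^'n" where "continuous_on UNIV g" "E \<subseteq> g ` {0..1}"
proof -
  obtain B where B: "B > 0" "\<And>x. x \<in> E \<Longrightarrow> norm x \<le> B" using assms by (auto simp: bounded_pos)
  \<comment> \<open>Stretching by \<open>2 * B + 1\<close> instead of \<open>2 * B\<close> keeps the
    rescaled coordinates strictly below 1, as \<open>schoenberg_surj\<close> requires.\<close>
  define g :: "real \<Rightarrow> real^'n" where "g t = (2 * B + 1) *\<^sub>R schoenberg t - vec B" for t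
  have "x \<in> g ` {0..1}" if x: "x \<in> E" for x
  proof -
    have xi: "\<bar>x $ i\<bar> \<le> B" for i using B(2)[OF x] component_le_norm_cart[of x i] by linarith
    obtain t where t: "0 \<le> t" "t \<le> 1" "schoenberg t = (1 / (2 * B + 1)) *\<^sub>R (x + vec B)"
    proof (rule schoenberg_surj)
      show "0 \<le> ((1 / (2 * B + 1)) *\<^sub>R (x + vec B)) $ i" for i
        using xi[of i] B by (auto simp: abs_le_iff)
      show "((1 / (2 * B + 1)) *\<^sub>R (x + vec B)) $ i < 1" for i
      proof -
        have "(x $ i + B) / (2 * B + 1) < 1" using xi[of i] B by (simp add: divide_less_eq abs_le_iff)
        then show ?thesis by simp
      qed
    qed
    then have "g t = x" using B by (simp add: g_def)
    then show ?thesis using t by force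
  qed
  moreover have "continuous_on UNIV g"
    unfolding g_def by (intro continuous_intros continuous_schoenberg)
  ultimately show thesis using that by blast
qed

lemma sum_UNION_le:
  fixes m :: "'a \<Rightarrow> real"
  assumes "finite I" "\<And>i. i \<in> I \<Longrightarrow> finite (Q i)" "\<And>x. 0 \<le> m x"
  shows "sum m (\<Union>i\<in>I. Q i) \<le> (\<Sum>i\<in>I. sum m (Q i))"
  using assms(1,2)
proof induction
  case (insert i I)
  have "sum m (\<Union>j\<in>insert i I. Q j) = sum m (Q i \<union> ((\<Union>j\<in>I. Q j) - Q i))"
    by (rule arg_cong[where f = "sum m"]) auto
  also have "\<dots> = sum m (Q i) + sum m ((\<Union>j\<in>I. Q j) - Q i)"
    using insert.hyps insert.prems by (intro sum.union_disjoint) auto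
  also have "sum m ((\<Union>j\<in>I. Q j) - Q i) \<le> sum m (\<Union>j\<in>I. Q j)"
    using insert.hyps insert.prems assms(3) by (intro sum_mono2) auto
  also have "sum m (\<Union>j\<in>I. Q j) \<le> (\<Sum>j\<in>I. sum m (Q j))"
    using insert by simp
  finally show ?case using insert.hyps by simp
qed simp

text \<open>In a ball of radius at most the side length of generation \<open>k\<close> each integer
  coordinate of the code differs from that of the centre by at most 1, which leaves
  \<open>3 ^ CARD('n)\<close> cubes.\<close>

lemma cball_cubes:
  fixes F :: "(real^'n) set" and m :: "real^'n \<Rightarrow> real"
  assumes F: "finite F" and m: "\<And>x. 0 \<le> m x"
    and le: "\<And>x. sum m (F \<inter> dcube (k, lev k x)) \<le> wt s k" and r: "2 ^ k * r \<le> 1"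
  shows "sum m (F \<inter> cball x r) \<le> 3 ^ CARD('n) * wt s k"
proof -
  define \<Delta> where "\<Delta> = PiE (UNIV :: 'n set) (\<lambda>_. {-1, 0, 1::int})"
  have \<Delta>: "finite \<Delta>" "card \<Delta> = 3 ^ CARD('n)" by (auto simp: \<Delta>_def finite_PiE card_PiE numeral_3_eq_3)
  define Q where "Q \<delta> = F \<inter> dcube (k, \<lambda>i. lev k x i + \<delta> i)" for \<delta>
  have "F \<inter> cball x r \<subseteq> (\<Union>\<delta>\<in>\<Delta>. Q \<delta>)"
  proof
    fix y assume y: "y \<in> F \<inter> cball x r"
    define \<delta> where "\<delta> i = lev k y i - lev k x i" for i
    have "\<delta> i \<in> {-1, 0, 1}" for i
    proof -
      have "\<bar>y $ i - x $ i\<bar> \<le> r"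
        using y component_le_norm_cart[of "y - x" i] by (auto simp: dist_norm norm_minus_commute)
      then have "2 ^ k * \<bar>y $ i - x $ i\<bar> \<le> 2 ^ k * r" by (intro mult_left_mono) auto
      then have "2 ^ k * \<bar>y $ i - x $ i\<bar> \<le> 1" using r by linarith
      then have "\<bar>2 ^ k * (y $ i - x $ i)\<bar> \<le> 1" by (simp add: abs_mult)
      then have "\<bar>2 ^ k * y $ i - 2 ^ k * x $ i\<bar> \<le> 1" by (simp add: right_diff_distrib)
      then have "\<bar>\<lfloor>2 ^ k * y $ i\<rfloor> - \<lfloor>2 ^ k * x $ i\<rfloor>\<bar> \<le> 1" by linarith
      then show ?thesis by (auto simp: \<delta>_def lev_def abs_le_iff)
    qed
    then have "\<delta> \<in> \<Delta>" by (auto simp: \<Delta>_def PiE_def)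
    moreover have "y \<in> Q \<delta>" using y by (simp add: Q_def dcube_def \<delta>_def)
    ultimately show "y \<in> (\<Union>\<delta>\<in>\<Delta>. Q \<delta>)" by blast
  qed
  then have "sum m (F \<inter> cball x r) \<le> sum m (\<Union>\<delta>\<in>\<Delta>. Q \<delta>)"
    using F m \<Delta> by (intro sum_mono2) (auto simp: Q_def)
  also have "\<dots> \<le> (\<Sum>\<delta>\<in>\<Delta>. sum m (Q \<delta>))"
    using F m \<Delta> by (intro sum_UNION_le) (auto simp: Q_def)
  also have "\<dots> \<le> (\<Sum>\<delta>\<in>\<Delta>. wt s k)"
  proof (rule sum_mono)
    fix \<delta>
    show "sum m (Q \<delta>) \<le> wt s k"
    proof (cases "Q \<delta> = {}")
      case False
      then obtain y where "y \<in> Q \<delta>" by auto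
      then have "Q \<delta> = F \<inter> dcube (k, lev k y)" by (auto simp: Q_def dcube_def)
      then show ?thesis using le by simp
    qed (simp add: less_imp_le)
  qed
  also have "\<dots> = 3 ^ CARD('n) * wt s k" by (simp add: \<Delta>)
  finally show ?thesis .
qed

text \<open>Each atom is moved to a parameter that the curve sends to it. The interval
  \<open>{-1<..1}\<close> contains \<open>[0, 1]\<close> and has the half-open shape used by
  tightness.\<close>

lemma point_measure_curve:
  fixes F :: "(real^'n) set" and m :: "real^'n \<Rightarrow> real" and g :: "real \<Rightarrow> real^'n"
  assumes F: "finite F" "F \<subseteq> g ` {0..1}" and m: "\<And>x. 0 \<le> m x" "sum m F = 1"
  obtains \<rho> :: "real measure" where "real_distribution \<rho>" "measure \<rho> {-1<..1} = 1"
    "\<And>f :: real^'n \<Rightarrow> real. f \<in> borel_measurable borel \<Longrightarrow> g \<in> borel_measurable borel \<Longrightarrow> (\<integral>t. f (g t) \<partial>\<rho>) = (\<Sum>x\<in>F. m x * f x)"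
proof -
  have "\<forall>x\<in>F. \<exists>t. t \<in> {0..1} \<and> g t = x" using F(2) by blast
  then obtain \<tau> where \<tau>: "\<And>x. x \<in> F \<Longrightarrow> \<tau> x \<in> {0..1}" "\<And>x. x \<in> F \<Longrightarrow> g (\<tau> x) = x" by metis
  define P where "P = point_measure F (\<lambda>x. ennreal (m x))"
  have eP: "emeasure P F = 1"
    using F m by (simp add: P_def emeasure_point_measure_finite)
  have "prob_space P" by (rule prob_spaceI) (simp add: eP P_def space_point_measure, simp add: eP flip: P_def)
  have meas: "\<tau> \<in> measurable P borel" by (simp add: P_def measurable_def space_point_measure sets_point_measure)
  define \<rho> where "\<rho> = distr P borel \<tau>"
  interpret P: prob_space P by fact
  have "prob_space \<rho>" unfolding \<rho>_def by (rule P.prob_space_distr[OF meas])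
  then have rd: "real_distribution \<rho>"
    by (simp add: real_distribution_def real_distribution_axioms_def \<rho>_def)
  have sP: "space P = F" by (simp add: P_def space_point_measure)
  have "measure \<rho> {-1<..1} = measure P (\<tau> -` {-1<..1} \<inter> space P)"
    unfolding \<rho>_def by (rule measure_distr[OF meas]) auto
  also have "\<tau> -` {-1<..1} \<inter> space P = space P" using \<tau>(1) by (force simp: sP)
  finally have m1: "measure \<rho> {-1<..1} = 1" by (simp add: P.prob_space)
  show thesis
  proof (rule that[OF rd m1])
    fix f :: "real^'n \<Rightarrow> real" assume f: "f \<in> borel_measurable borel" and g: "g \<in> borel_measurable borel"
    have "(\<integral>t. f (g t) \<partial>\<rho>) = (\<integral>x. f (g (\<tau> x)) \<partial>P)"
      unfolding \<rho>_def by (rule integral_distr[OF meas]) (use f g in measurable)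
    also have "\<dots> = (\<Sum>x\<in>F. m x * f (g (\<tau> x)))"
      unfolding P_def using F(1) m(1) by (subst lebesgue_integral_point_measure_finite) auto
    also have "\<dots> = (\<Sum>x\<in>F. m x * f x)" by (intro sum.cong) (auto simp: \<tau>)
    finally show "(\<integral>t. f (g t) \<partial>\<rho>) = (\<Sum>x\<in>F. m x * f x)" .
  qed
qed

text \<open>Helly's selection theorem concerns measures on the line. The curve carries the discrete
  measures there, where they are tight, and carries the limit back; \<open>f (g t)\<close> is a
  bounded continuous test function on the line.\<close>

lemma discrete_weak_limit:
  fixes F :: "nat \<Rightarrow> (real^'n) set" and m :: "nat \<Rightarrow> real^'n \<Rightarrow> real"
  assumes F: "\<And>N. finite (F N)" "\<And>N. F N \<subseteq> E" and E: "bounded E"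
    and m: "\<And>N x. 0 \<le> m N x" "\<And>N. sum (m N) (F N) = 1"
  obtains \<mu> :: "(real^'n) measure" and r where "prob_space \<mu>" "sets \<mu> = sets borel" "strict_mono (r :: nat \<Rightarrow> nat)"
    "\<And>f B. continuous_on UNIV f \<Longrightarrow> (\<And>x. \<bar>f x\<bar> \<le> B) \<Longrightarrow> (\<lambda>N. \<Sum>x\<in>F (r N). m (r N) x * f x) \<longlonglongrightarrow> (\<integral>x. f x \<partial>\<mu>)"
proof -
  obtain g :: "real \<Rightarrow> real^'n" where g: "continuous_on UNIV g" "E \<subseteq> g ` {0..1}"
    using curve_through_bounded[OF E] .
  have gm: "g \<in> borel_measurable borel" by (rule borel_measurable_continuous_onI[OF g(1)])
  have "\<exists>\<rho>. real_distribution \<rho> \<and> measure \<rho> {-1<..1} = 1 \<and>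
    (\<forall>f. f \<in> borel_measurable borel \<longrightarrow> (\<integral>t. f (g t) \<partial>\<rho>) = (\<Sum>x\<in>F N. m N x * f x))" for N
  proof -
    have "F N \<subseteq> g ` {0..1}" using F(2) g(2) by blast
    then show ?thesis
    proof (rule point_measure_curve[OF F(1)[of N] _ m(1)[of N] m(2)[of N]])
      fix \<rho> :: "real measure" assume \<rho>: "real_distribution \<rho>" "measure \<rho> {-1<..1} = 1"
        "\<And>f :: real^'n \<Rightarrow> real. f \<in> borel_measurable borel \<Longrightarrow> g \<in> borel_measurable borel \<Longrightarrow> (\<integral>t. f (g t) \<partial>\<rho>) = (\<Sum>x\<in>F N. m N x * f x)"
      then show ?thesis using gm by (intro exI[of _ \<rho>] conjI allI impI) auto
    qed
  qed
  then obtain \<rho> where \<rho>: "\<And>N. real_distribution (\<rho> N)" "\<And>N. measure (\<rho> N) {-1<..1} = 1"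
    "\<And>N f. f \<in> borel_measurable borel \<Longrightarrow> (\<integral>t. f (g t) \<partial>\<rho> N) = (\<Sum>x\<in>F N. m N x * f x)"
    by metis
  have "tight \<rho>" unfolding tight_def
  proof (intro conjI allI impI)
    fix \<epsilon> :: real assume "0 < \<epsilon>"
    then show "\<exists>a b. a < b \<and> (\<forall>n. 1 - \<epsilon> < measure (\<rho> n) {a<..b})"
      by (intro exI[of _ "-1"] exI[of _ 1]) (simp add: \<rho>(2))
  qed (rule \<rho>(1))
  from tight_imp_convergent_subsubsequence[OF this strict_mono_id]
  obtain r M where r: "strict_mono (r :: nat \<Rightarrow> nat)" "real_distribution M" "weak_conv_m (\<rho> \<circ> id \<circ> r) M"
    by blast
  interpret M: real_distribution M by fact
  have gM: "g \<in> measurable M borel" using gm M.events_eq_borel by (simp cong: measurable_cong_sets)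
  define \<mu> where "\<mu> = distr M borel g"
  show thesis
  proof (rule that[of \<mu> r])
    show "prob_space \<mu>" unfolding \<mu>_def by (rule M.prob_space_distr[OF gM])
    show "sets \<mu> = sets borel" by (simp add: \<mu>_def)
    show "strict_mono r" by fact
    fix f :: "real^'n \<Rightarrow> real" and B assume f: "continuous_on UNIV f" "\<And>x. \<bar>f x\<bar> \<le> B"
    have fm: "f \<in> borel_measurable borel" by (rule borel_measurable_continuous_onI[OF f(1)])
    have fg: "continuous_on UNIV (\<lambda>t. f (g t))"
      using continuous_on_compose2[OF f(1) g(1)] by simp
    have "(\<lambda>N. integral\<^sup>L ((\<rho> \<circ> id \<circ> r) N) (\<lambda>t. f (g t))) \<longlonglongrightarrow> integral\<^sup>L M (\<lambda>t. f (g t))"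
      using r \<rho>(1) fg f(2)
      by (intro weak_conv_imp_integral_bdd_continuous_conv) (auto simp: continuous_on_eq_continuous_at comp_def)
    moreover have "integral\<^sup>L M (\<lambda>t. f (g t)) = (\<integral>x. f x \<partial>\<mu>)"
      unfolding \<mu>_def using gM fm by (rule integral_distr[symmetric])
    ultimately show "(\<lambda>N. \<Sum>x\<in>F (r N). m (r N) x * f x) \<longlonglongrightarrow> (\<integral>x. f x \<partial>\<mu>)"
      by (simp add: \<rho>(3)[OF fm])
  qed
qed

section \<open>Frostman's theorem for Borel sets\<close>

lemma dcont_pos_if_hausdorff_measure_pos:
  fixes A :: "(real^'n) set"
  assumes s: "0 < s" and H: "0 < hausdorff_measure s A"
  shows "0 < dcont s A"
proof (rule ccontr)
  assume "\<not> 0 < dcont s A"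
  then have D0: "dcont s A = 0" by simp
  define n where "n = real CARD('n)"
  have n: "n \<ge> 1" by (simp add: n_def Suc_leI)
  have dist_le: "norm (x - y) \<le> n * 2 powr - real k" if "x \<in> dcube (k, z)" "y \<in> dcube (k, z)" for x y :: "real^'n" and k z
  proof -
    have "\<bar>(x - y) $ i\<bar> \<le> 2 powr - real k" for i
    proof -
      have "\<lfloor>2 ^ k * x $ i\<rfloor> = \<lfloor>2 ^ k * y $ i\<rfloor>"
        using that by (auto simp: dcube_def lev_def fun_eq_iff)
      then have "\<bar>2 ^ k * x $ i - 2 ^ k * y $ i\<bar> \<le> 1" by linarith
      then have "2 ^ k * \<bar>x $ i - y $ i\<bar> \<le> 1" by (simp add: abs_mult flip: right_diff_distrib)
      then show ?thesis by (simp add: powr_minus powr_realpow field_simps)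
    qed
    then have "(\<Sum>i\<in>UNIV. \<bar>(x - y) $ i\<bar>) \<le> n * 2 powr - real k"
      unfolding n_def using sum_bounded_above[of UNIV "\<lambda>i. \<bar>(x - y) $ i\<bar>"] by auto
    then show ?thesis using norm_le_l1_cart[of "x - y"] by linarith
  qed
  have "hausdorff_pre s \<delta> A \<le> 0 + ennreal e" if \<delta>: "\<delta> > 0" and e: "e > 0" for \<delta> e
  proof -
    \<comment> \<open>Content sets no limit on the size of cubes, but a cheap cover consists of
      small ones: the first bound on \<open>\<epsilon>\<close> forces diameters at most
      \<open>\<delta>\<close>, and the second absorbs the factor \<open>n powr s\<close> between
      powers of diameters and weights.\<close>
    define \<epsilon> where "\<epsilon> = min ((\<delta> / n) powr s) (e / n powr s)"
    have \<epsilon>: "\<epsilon> > 0" "\<epsilon> \<le> (\<delta> / n) powr s" "\<epsilon> \<le> e / n powr s" using \<delta> e n by (auto simp: \<epsilon>_def)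
    have "dcont s A < ennreal \<epsilon>" using D0 \<epsilon> by simp
    then obtain \<C> where C: "A \<subseteq> \<Union>(dcube ` \<C>)" "cost s \<C> < ennreal \<epsilon>" by (rule dcont_lessE)
    define E where "E i = {c \<in> \<C>. to_nat c = i}" for i
    define D where "D i = (\<Union>c\<in>E i. dcube c)" for i
    have E: "E i = {} \<or> (\<exists>c\<in>\<C>. E i = {c})" for i
    proof (cases "\<exists>c\<in>\<C>. to_nat c = i")
      case True
      then obtain c where c: "c \<in> \<C>" "to_nat c = i" by auto
      then have "E i = {c}" by (auto simp: E_def)
      then show ?thesis using c by auto
    next
      case False
      then have "E i = {}" by (auto simp: E_def)
      then show ?thesis by simp
    qed
    have AD: "A \<subseteq> (\<Union>i. D i)" using C(1) by (fastforce simp: D_def E_def)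
    have D: "bounded (D i) \<and> diameter (D i) \<le> \<delta> \<and> ennreal (diameter (D i) powr s) \<le> ennreal (n powr s) * cost s (E i)" for i
    proof (cases "E i = {}")
      case True
      then show ?thesis using \<delta> by (simp add: D_def)
    next
      case False
      then obtain k z where c: "(k, z) \<in> \<C>" "E i = {(k, z)}" using E[of i] by auto
      have Di: "D i = dcube (k, z)" by (simp add: D_def c)
      have b: "bounded (D i)"
        unfolding Di bounded_two_points using dist_le[of _ k z] by (auto simp: dist_norm)
      have d: "diameter (D i) \<le> n * 2 powr - real k"
        unfolding Di using dist_le n by (intro diameter_le) auto
      have "ennreal (wt s k) \<le> cost s \<C>" using cost_mono[of "{(k, z)}" \<C> s] c by simp
      then have "ennreal (wt s k) < ennreal \<epsilon>" using C(2) by (rule le_less_trans)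
      then have "wt s k < \<epsilon>" by (simp add: ennreal_less_iff less_imp_le)
      then have w: "wt s k \<le> (\<delta> / n) powr s" using \<epsilon> by linarith
      have wk: "wt s k = (2 powr - real k) powr s" by (simp add: wt_def powr_powr mult.commute)
      have "2 powr - real k \<le> \<delta> / n"
      proof (rule ccontr)
        assume "\<not> ?thesis"
        then have "(\<delta> / n) powr s < (2 powr - real k) powr s" using \<delta> n s by (intro powr_less_mono2) auto
        then show False using w by (simp add: wk)
      qed
      then have "n * 2 powr - real k \<le> \<delta>" using n by (simp add: field_simps)
      moreover have "diameter (D i) powr s \<le> (n * 2 powr - real k) powr s"
        using d s b by (intro powr_mono2) (auto intro: diameter_ge_0)
      moreover have "(n * 2 powr - real k) powr s = n powr s * wt s k"
        using n by (simp add: powr_mult wk)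
      ultimately show ?thesis using b d by (auto simp: c ennreal_mult[symmetric] less_imp_le intro!: ennreal_leI)
    qed
    have "hausdorff_pre s \<delta> A \<le> (\<Sum>i. ennreal (diameter (D i) powr s))"
      unfolding hausdorff_pre_def by (rule INF_lower) (use AD D in auto)
    also have "\<dots> \<le> (\<Sum>i. ennreal (n powr s) * cost s (E i))"
      using D by (intro suminf_le) auto
    also have "\<dots> = ennreal (n powr s) * (\<Sum>i. cost s (E i))" by simp
    also have "(\<Sum>i. cost s (E i)) = cost s (\<Union>i. E i)"
      unfolding cost_def
      by (rule suminf_emeasure) (auto simp: sets_point_measure disjoint_family_on_def E_def)
    also have "(\<Union>i. E i) = \<C>" by (auto simp: E_def)
    also have "ennreal (n powr s) * cost s \<C> \<le> ennreal (n powr s) * ennreal \<epsilon>"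
      using C(2) by (intro mult_left_mono) auto
    also have "\<dots> = ennreal (n powr s * \<epsilon>)" using \<epsilon> by (simp add: ennreal_mult)
    also have "\<dots> \<le> ennreal e" using \<epsilon>(3) n by (intro ennreal_leI) (simp add: field_simps)
    finally show ?thesis by simp
  qed
  then have "hausdorff_pre s \<delta> A \<le> 0" if "\<delta> > 0" for \<delta>
    using that by (intro ennreal_le_epsilon[of 0 "hausdorff_pre s \<delta> A"])
  then have "hausdorff_measure s A \<le> 0"
    unfolding hausdorff_measure_def by (intro SUP_least) auto
  then show False using H by simp
qed

definition growth :: "real \<Rightarrow> (real^'n) measure \<Rightarrow> bool" where
  "growth s \<mu> \<longleftrightarrow> (\<exists>C>0. \<forall>x r. 0 < r \<longrightarrow> measure \<mu> (cball x r) \<le> C * r powr s)"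

text \<open>The measures chosen on the sets \<open>E N\<close> obey the cube bounds up to generation
  \<open>N\<close> and have mass above \<open>c\<close>. After normalisation a weak limit obeys the
  ball bound at every scale, and it lives on each \<open>K k\<close> because all but finitely many
  of the measures do.\<close>

theorem frostman:
  fixes A :: "(real^'n) set"
  assumes A: "A \<in> sets borel" and s: "0 < s" and H: "0 < hausdorff_measure s A"
  obtains K \<mu> where "compact K" "K \<subseteq> A" "prob_space \<mu>" "sets \<mu> = sets borel" "AE x in \<mu>. x \<in> K" "growth s \<mu>"
proof -
  have D: "0 < dcont s A" by (rule dcont_pos_if_hausdorff_measure_pos[OF s H])
  have "A = (\<Union>n::nat. A \<inter> cball 0 (real n))" by (auto simp: real_arch_simple)
  moreover have "incseq (\<lambda>n::nat. A \<inter> cball 0 (real n))" by (auto simp: incseq_def)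
  ultimately have "0 < (SUP n::nat. dcont s (A \<inter> cball 0 (real n)))"
    using dcont_incseq[of s "\<lambda>n. A \<inter> cball 0 (real n)"] s D by simp
  then obtain R :: nat where R: "0 < dcont s (A \<inter> cball 0 (real R))" by (auto simp: less_SUP_iff)
  obtain c where c: "c > 0" "ennreal c < dcont s (A \<inter> cball 0 (real R))"
  proof -
    obtain y where y: "0 < y" "y < dcont s (A \<inter> cball 0 (real R))" using dense[OF R] by blast
    then obtain c where "y = ennreal c" "c \<ge> 0" by (cases y) auto
    then show thesis using that[of c] y by (auto simp: ennreal_less_zero_iff)
  qed
  have "captured (A \<inter> cball 0 (real R))" using A by (intro borel_captured) auto
  then obtain E K where EK: "\<And>k. compact (K k)" "\<And>k. E k \<subseteq> K k" "\<And>k. K (Suc k) \<subseteq> K k"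
     "\<And>k. ennreal c < dcont s (E k)" "(\<Inter>k. K k) \<subseteq> A \<inter> cball 0 (real R)"
    using captured_compact_sequence[OF _ _ c(2)] s by (metis bounded_Int bounded_cball less_imp_le)
  have Kdec: "K l \<subseteq> K k" if "k \<le> l" for k l
    using EK(3) that by (rule lift_Suc_antimono_le)
  have "\<exists>F m. finite F \<and> F \<subseteq> E N \<and> (\<forall>x. 0 \<le> m x) \<and> (\<forall>k\<le>N. \<forall>x. sum m (F \<inter> dcube (k, lev k x)) \<le> wt s k) \<and>
     dcont s (E N) \<le> ennreal (sum m F)" for N
  proof -
    have "bounded (E N)" using EK(1,2) compact_imp_bounded bounded_subset by metis
    from discrete_frostman[OF this] show ?thesis by metis
  qed
  then obtain F m0 where F: "\<And>N. finite (F N)" "\<And>N. F N \<subseteq> E N" "\<And>N x. 0 \<le> m0 N x"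
     "\<And>N k x. k \<le> N \<Longrightarrow> sum (m0 N) (F N \<inter> dcube (k, lev k x)) \<le> wt s k"
     "\<And>N. dcont s (E N) \<le> ennreal (sum (m0 N) (F N))"
    by metis
  define tot where "tot N = sum (m0 N) (F N)" for N
  have tot: "c < tot N" for N
  proof -
    have "ennreal c < ennreal (tot N)" using EK(4)[of N] F(5)[of N] by (simp add: tot_def)
    then show ?thesis using c by (simp add: ennreal_less_iff)
  qed
  define m where "m N x = m0 N x / tot N" for N x
  have m: "0 \<le> m N x" "sum (m N) (F N) = 1" for N x
    using F(3)[of N x] tot[of N] c by (auto simp: m_def simp flip: sum_divide_distrib tot_def)
  \<comment> \<open>Totals above \<open>c\<close> keep the cube bounds within the fixed factor
    \<open>1 / c\<close> after normalisation.\<close>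
  have mle: "m N x \<le> m0 N x / c" for N x
    unfolding m_def using F(3)[of N x] tot[of N] c by (intro divide_left_mono) auto
  have FK: "F N \<subseteq> K k" if "k \<le> N" for N k using F(2) EK(2) Kdec[OF that] by blast
  obtain \<mu> r where \<mu>: "prob_space \<mu>" "sets \<mu> = sets borel" and r: "strict_mono (r :: nat \<Rightarrow> nat)"
    and lim: "\<And>f B. continuous_on UNIV f \<Longrightarrow> (\<And>x. \<bar>f x\<bar> \<le> B) \<Longrightarrow> (\<lambda>N. \<Sum>x\<in>F (r N). m (r N) x * f x) \<longlonglongrightarrow> (\<integral>x. f x \<partial>\<mu>)"
  proof (rule discrete_weak_limit[of F "K 0" m])
    show "F N \<subseteq> K 0" for N by (rule FK) simp
    show "bounded (K 0)" by (rule compact_imp_bounded[OF EK(1)])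
  qed (use F m in auto)
  interpret \<mu>: prob_space \<mu> by fact
  have spm: "space \<mu> = UNIV" using sets_eq_imp_space_eq[OF \<mu>(2)] by simp
  have rge: "N \<le> r N" for N by (rule seq_suble[OF r])
  have "AE x in \<mu>. x \<in> K k" for k
  proof -
    have Kne: "K k \<noteq> {}"
    proof
      assume "K k = {}"
      then have "F k = {}" using FK[of k k] by auto
      then show False using m(2)[of k] by simp
    qed
    \<comment> \<open>A continuous function vanishing exactly on \<open>K k\<close>: its integrals
      are eventually zero along the subsequence, so it vanishes almost everywhere for the
      limit.\<close>
    define f where "f x = min 1 (infdist x (K k))" for x
    have fc: "continuous_on UNIV f" unfolding f_def by (intro continuous_intros)
    have fb: "\<bar>f x\<bar> \<le> 1" for x using infdist_nonneg[of x "K k"] by (simp add: f_def)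
    have "(\<lambda>N. \<Sum>x\<in>F (r N). m (r N) x * f x) \<longlonglongrightarrow> (\<integral>x. f x \<partial>\<mu>)" using fc fb by (rule lim)
    moreover have "eventually (\<lambda>N. (\<Sum>x\<in>F (r N). m (r N) x * f x) = 0) sequentially"
      unfolding eventually_sequentially
    proof (intro exI[of _ k] allI impI)
      fix N assume "k \<le> N"
      then have "F (r N) \<subseteq> K k" using FK[of k "r N"] rge[of N] by auto
      then show "(\<Sum>x\<in>F (r N). m (r N) x * f x) = 0"
        by (intro sum.neutral) (auto simp: f_def)
    qed
    ultimately have "(\<integral>x. f x \<partial>\<mu>) = 0"
      by (intro LIMSEQ_unique[OF _ tendsto_eventually])
    moreover have fm: "f \<in> borel_measurable \<mu>"
      using borel_measurable_continuous_onI[OF fc] \<mu>(2) by (simp cong: measurable_cong_sets)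
    then have "integrable \<mu> f" by (rule \<mu>.integrable_const_bound[of _ 1, rotated]) (use fb in auto)
    moreover have "\<And>x. 0 \<le> f x" by (simp add: f_def infdist_nonneg)
    ultimately have "AE x in \<mu>. f x = 0" by (simp add: integral_nonneg_eq_0_iff_AE)
    then show ?thesis
    proof (rule AE_mp, intro AE_I2 impI)
      fix x assume "f x = 0"
      then have "infdist x (K k) = 0" by (simp add: f_def min_def split: if_splits)
      then show "x \<in> K k" using in_closed_iff_infdist_zero[of "K k" x] Kne compact_imp_closed[OF EK(1)] by auto
    qed
  qed
  then have AEK: "AE x in \<mu>. x \<in> (\<Inter>k. K k)" by (simp add: AE_all_countable)
  have bound: "measure \<mu> (cball x \<rho>) \<le> (3 ^ CARD('n) * 4 powr s / c + 2 powr s) * \<rho> powr s" if \<rho>: "0 < \<rho>" for x \<rho>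
  proof (cases "2 * \<rho> \<le> 1")
    case False
    then have "1 \<le> (2 * \<rho>) powr s" using s by (intro ge_one_powr_ge_zero) auto
    then have "1 \<le> 2 powr s * \<rho> powr s" using \<rho> by (simp add: powr_mult)
    moreover have "0 \<le> 3 ^ CARD('n) * 4 powr s / c * \<rho> powr s" using c by simp
    moreover have "measure \<mu> (cball x \<rho>) \<le> 1" by (rule \<mu>.prob_le_1)
    ultimately have "measure \<mu> (cball x \<rho>) \<le> 3 ^ CARD('n) * 4 powr s / c * \<rho> powr s + 2 powr s * \<rho> powr s"
      by linarith
    then show ?thesis by (simp add: distrib_right)
  next
    case True
    \<comment> \<open>The generation is chosen for the doubled radius, since the cut-off
      \<open>f\<close> below reaches to \<open>2 * \<rho>\<close>; the second inequality gives a
      side length of at most \<open>4 * \<rho>\<close>, whence the factor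
      \<open>4 powr s\<close>.\<close>
    obtain k where k: "2 ^ k * (2 * \<rho>) \<le> 1" "1 < 2 ^ Suc k * (2 * \<rho>)"
    proof -
      have "1 / (2 * \<rho>) \<ge> 1" using True \<rho> by simp
      then have "0 \<le> log 2 (1 / (2 * \<rho>))" using \<rho> by (subst zero_le_log_cancel_iff) auto
      define k where "k = nat \<lfloor>log 2 (1 / (2 * \<rho>))\<rfloor>"
      have riesz_kernel: "real k \<le> log 2 (1 / (2 * \<rho>))" "log 2 (1 / (2 * \<rho>)) < real (Suc k)"
        using \<open>0 \<le> log 2 (1 / (2 * \<rho>))\<close> by (auto simp: k_def) linarith+
      have "2 powr real k \<le> 1 / (2 * \<rho>)" using riesz_kernel(1) \<rho> by (subst (asm) le_log_iff) auto
      then have 1: "2 ^ k * (2 * \<rho>) \<le> 1" using \<rho> by (simp add: powr_realpow field_simps)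
      have "1 / (2 * \<rho>) < 2 powr real (Suc k)" using riesz_kernel(2) \<rho> by (subst (asm) log_less_iff) auto
      then have "1 < 2 ^ Suc k * (2 * \<rho>)" using \<rho> by (simp add: powr_realpow field_simps del: of_nat_Suc power_Suc)
      then show thesis using that 1 by blast
    qed
    define f where "f y = max 0 (min 1 (2 - dist x y / \<rho>))" for y
    have fc: "continuous_on UNIV f" unfolding f_def by (intro continuous_intros) (use \<rho> in auto)
    have fb: "\<bar>f y\<bar> \<le> 1" for y by (simp add: f_def)
    have fm: "f \<in> borel_measurable \<mu>"
      using borel_measurable_continuous_onI[OF fc] \<mu>(2) by (simp cong: measurable_cong_sets)
    have fi: "integrable \<mu> f" using fm by (rule \<mu>.integrable_const_bound[of _ 1, rotated]) (use fb in auto)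
    have L: "(\<lambda>N. \<Sum>y\<in>F (r N). m (r N) y * f y) \<longlonglongrightarrow> (\<integral>y. f y \<partial>\<mu>)" using fc fb by (rule lim)
    have cb: "cball x \<rho> \<in> sets \<mu>" using \<mu>(2) by simp
    have "measure \<mu> (cball x \<rho>) = (\<integral>y. indicator (cball x \<rho>) y \<partial>\<mu>)" using cb by (simp add: spm)
    also have "\<dots> \<le> (\<integral>y. f y \<partial>\<mu>)"
    proof (rule integral_mono)
      show "integrable \<mu> (indicator (cball x \<rho>) :: _ \<Rightarrow> real)" using cb by (intro integrable_real_indicator) (auto simp: \<mu>.emeasure_eq_measure)
      show "indicator (cball x \<rho>) y \<le> f y" for y
        using \<rho> by (auto simp: indicator_def f_def field_simps)
    qed (rule fi)
    also have "\<dots> \<le> 3 ^ CARD('n) * wt s k / c"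
    proof (rule LIMSEQ_le_const2[OF L], intro exI[of _ k] allI impI)
      fix N assume "k \<le> N"
      then have kN: "k \<le> r N" using rge[of N] by auto
      have "(\<Sum>y\<in>F (r N). m (r N) y * f y) \<le> (\<Sum>y\<in>F (r N). if y \<in> cball x (2 * \<rho>) then m0 (r N) y / c else 0)"
      proof (rule sum_mono)
        fix y
        show "m (r N) y * f y \<le> (if y \<in> cball x (2 * \<rho>) then m0 (r N) y / c else 0)"
        proof (cases "y \<in> cball x (2 * \<rho>)")
          case True
          have "m (r N) y * f y \<le> m (r N) y * 1" using m(1) fb[of y] by (intro mult_left_mono) auto
          then show ?thesis using True mle[of "r N" y] by simp
        next
          case False
          then have "f y = 0" using \<rho> by (auto simp: f_def field_simps)
          then show ?thesis using False by simp
        qed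
      qed
      also have "\<dots> = sum (m0 (r N)) (F (r N) \<inter> cball x (2 * \<rho>)) / c"
        using F(1) by (simp only: sum.inter_restrict[symmetric] sum_divide_distrib)
      also have "\<dots> \<le> 3 ^ CARD('n) * wt s k / c"
        using c by (intro divide_right_mono cball_cubes F kN k(1)) auto
      finally show "(\<Sum>y\<in>F (r N). m (r N) y * f y) \<le> 3 ^ CARD('n) * wt s k / c" .
    qed
    also have "\<dots> \<le> 3 ^ CARD('n) * (4 powr s * \<rho> powr s) / c"
    proof -
      have "2 powr - real k \<le> 4 * \<rho>" using k(2) by (simp add: powr_minus powr_realpow field_simps)
      then have "(2 powr - real k) powr s \<le> (4 * \<rho>) powr s" using s by (intro powr_mono2) auto
      then have "wt s k \<le> 4 powr s * \<rho> powr s" using \<rho> by (simp add: wt_def powr_powr powr_mult mult.commute)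
      then show ?thesis using c by (intro divide_right_mono mult_left_mono) auto
    qed
    also have "\<dots> \<le> (3 ^ CARD('n) * 4 powr s / c + 2 powr s) * \<rho> powr s"
    proof -
      have "0 \<le> 2 powr s * \<rho> powr s" by simp
      then show ?thesis by (simp add: distrib_right mult.assoc)
    qed
    finally show ?thesis .
  qed
  show thesis
  proof (rule that[of "\<Inter>k. K k" \<mu>])
    show "compact (\<Inter>k. K k)" by (rule compact_Inter) (use EK(1) in auto)
    show "growth s \<mu>" unfolding growth_def
      using bound c by (intro exI[of _ "3 ^ CARD('n) * 4 powr s / c + 2 powr s"]) (auto intro: add_nonneg_pos)
  qed (use EK(5) \<mu> AEK in auto)
qed

section \<open>Orthogonal projections and Gaussian integrals\<close>

lemma orth_proj_works:
  fixes V :: "'a::euclidean_space set"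
  assumes V: "subspace V"
  shows "orth_proj V x \<in> V" "v \<in> V \<Longrightarrow> (x - orth_proj V x) \<bullet> v = 0"
proof -
  obtain y z where "y \<in> span V" "\<And>w. w \<in> span V \<Longrightarrow> orthogonal z w" "x = y + z"
    using orthogonal_subspace_decomp_exists by metis
  then have "\<exists>y. y \<in> V \<and> (\<forall>v\<in>V. (x - y) \<bullet> v = 0)"
    using V by (intro exI[of _ y]) (auto simp: orthogonal_def span_eq_iff[THEN iffD2, OF V])
  from someI_ex[OF this, folded orth_proj_def]
  show "orth_proj V x \<in> V" "v \<in> V \<Longrightarrow> (x - orth_proj V x) \<bullet> v = 0" by auto
qed

lemma orth_proj_unique:
  fixes V :: "'a::euclidean_space set"
  assumes V: "subspace V" and y: "y \<in> V" "\<And>v. v \<in> V \<Longrightarrow> (x - y) \<bullet> v = 0"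
  shows "orth_proj V x = y"
proof -
  let ?d = "orth_proj V x - y"
  have d: "?d \<in> V" using V y orth_proj_works[OF V] by (simp add: subspace_diff)
  have "?d \<bullet> ?d = (x - y) \<bullet> ?d - (x - orth_proj V x) \<bullet> ?d"
    by (simp add: inner_diff_left)
  also have "\<dots> = 0" using y(2)[OF d] orth_proj_works(2)[OF V d, of x] by simp
  finally show ?thesis by simp
qed

lemma linear_orth_proj:
  fixes V :: "'a::euclidean_space set"
  assumes V: "subspace V"
  shows "linear (orth_proj V)"
proof (rule linearI)
  note w = orth_proj_works[OF V]
  show "orth_proj V (x + y) = orth_proj V x + orth_proj V y" for x y
  proof (rule orth_proj_unique[OF V])
    show "orth_proj V x + orth_proj V y \<in> V" using V w by (simp add: subspace_add)
    fix v assume "v \<in> V"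
    then show "(x + y - (orth_proj V x + orth_proj V y)) \<bullet> v = 0"
      using w(2)[of v x] w(2)[of v y] by (simp add: inner_diff_left inner_add_left)
  qed
  show "orth_proj V (c *\<^sub>R x) = c *\<^sub>R orth_proj V x" for c x
  proof (rule orth_proj_unique[OF V])
    show "c *\<^sub>R orth_proj V x \<in> V" using V w by (simp add: subspace_scale)
    fix v assume "v \<in> V"
    then show "(c *\<^sub>R x - c *\<^sub>R orth_proj V x) \<bullet> v = 0"
      using w(2)[of v x] by (simp flip: scaleR_diff_right)
  qed
qed

lemma orth_proj_inner:
  fixes V :: "'a::euclidean_space set"
  assumes V: "subspace V"
  shows "orth_proj V x \<bullet> y = x \<bullet> orth_proj V y"
proof -
  have "(x - orth_proj V x) \<bullet> orth_proj V y = 0" "(y - orth_proj V y) \<bullet> orth_proj V x = 0"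
    using orth_proj_works[OF V] by auto
  then have "x \<bullet> orth_proj V y = orth_proj V x \<bullet> orth_proj V y" "y \<bullet> orth_proj V x = orth_proj V y \<bullet> orth_proj V x"
    by (simp_all add: inner_diff_left)
  then show ?thesis by (metis inner_commute)
qed

lemma orth_proj_id: "subspace V \<Longrightarrow> x \<in> V \<Longrightarrow> orth_proj V x = (x :: 'a::euclidean_space)"
  by (rule orth_proj_unique) auto

lemma orth_proj_idem [simp]: "subspace V \<Longrightarrow> orth_proj V (orth_proj V x) = orth_proj V (x :: 'a::euclidean_space)"
  by (simp add: orth_proj_id orth_proj_works)

lemma norm_orth_proj_Pythagoras:
  fixes V :: "'a::euclidean_space set"
  assumes V: "subspace V"
  shows "(norm x)\<^sup>2 = (norm (orth_proj V x))\<^sup>2 + (norm (x - orth_proj V x))\<^sup>2"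
proof -
  have "(norm (orth_proj V x + (x - orth_proj V x)))\<^sup>2 = (norm (orth_proj V x))\<^sup>2 + (norm (x - orth_proj V x))\<^sup>2"
    using orth_proj_works[OF V] by (intro norm_add_Pythagorean) (auto simp: orthogonal_def inner_commute)
  then show ?thesis by simp
qed

lemma orth_proj_orthogonal_image:
  fixes V :: "'a::euclidean_space set" and f :: "'a \<Rightarrow> 'a"
  assumes V: "subspace V" and f: "orthogonal_transformation f"
  shows "orth_proj (f ` V) (f x) = f (orth_proj V x)"
proof (rule orth_proj_unique)
  have lf: "linear f" using f by (rule orthogonal_transformation_linear)
  show "subspace (f ` V)" using lf V by (rule linear_subspace_image)
  show "f (orth_proj V x) \<in> f ` V" using orth_proj_works[OF V] by auto
  fix v assume "v \<in> f ` V"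
  then obtain u where u: "u \<in> V" "v = f u" by auto
  have "(f x - f (orth_proj V x)) \<bullet> v = f (x - orth_proj V x) \<bullet> f u"
    using lf u by (simp add: linear_diff)
  also have "\<dots> = (x - orth_proj V x) \<bullet> u" using f by (simp add: orthogonal_transformation_def)
  finally show "(f x - f (orth_proj V x)) \<bullet> v = 0" using orth_proj_works[OF V] u by simp
qed

lemma grassmannian_subspace: "V \<in> grassmannian m \<Longrightarrow> subspace V"
  by (simp add: grassmannian_def)

lemma continuous_orth_proj: "subspace V \<Longrightarrow> continuous_on S (orth_proj (V :: 'a::euclidean_space set))"
  by (intro linear_continuous_on linear_conv_bounded_linear[THEN iffD1] linear_orth_proj)

lemma borel_measurable_orth_proj:
  "subspace V \<Longrightarrow> orth_proj (V :: 'a::euclidean_space set) \<in> borel_measurable borel"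
  by (intro borel_measurable_continuous_onI continuous_orth_proj)

text \<open>The library version needs an index type of class \<open>wellorder\<close>.\<close>

lemma lborel_orthogonal_invariant:
  fixes f :: "'a::euclidean_space \<Rightarrow> 'a"
  assumes f: "orthogonal_transformation f"
  shows "distr lborel borel f = lborel"
proof (rule measure_eqI)
  show "sets (distr lborel borel f) = sets lborel" by simp
  fix A assume "A \<in> sets (distr lborel borel f)"
  then have A [measurable]: "A \<in> sets borel" by simp
  let ?B = "ball 0 1 :: 'a set"
  have [measurable]: "?B \<in> sets borel" by simp
  have lf: "linear f" using f by (rule orthogonal_transformation_linear)
  have lg: "linear (inv f)" using f by (intro orthogonal_transformation_linear orthogonal_transformation_inv)
  have ng: "norm (inv f x) = norm x" for x
    using f by (intro orthogonal_transformation_norm orthogonal_transformation_inv)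
  have fi: "f (inv f x) = x" for x using orthogonal_transformation_surj[OF f] by (simp add: surj_f_inv_f)
  have if': "inv f (f x) = x" for x using orthogonal_transformation_inj[OF f] by simp
  have [measurable]: "f \<in> borel_measurable borel"
    by (intro borel_measurable_continuous_onI linear_continuous_on linear_conv_bounded_linear[THEN iffD1] lf)
  let ?i = "indicator :: 'a set \<Rightarrow> 'a \<Rightarrow> ennreal"
  have shift: "(\<integral>\<^sup>+x. h (c + x) \<partial>lborel) = (\<integral>\<^sup>+x. h x \<partial>lborel)" if [measurable]: "h \<in> borel_measurable borel" for h and c :: 'a
  proof -
    have "(\<integral>\<^sup>+x. h x \<partial>lborel) = (\<integral>\<^sup>+x. h x \<partial>distr lborel borel ((+) c))" by (simp add: lborel_distr_plus)
    also have "\<dots> = (\<integral>\<^sup>+x. h (c + x) \<partial>lborel)" by (subst nn_integral_distr) auto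
    finally show ?thesis by simp
  qed
  have eq1: "(\<integral>\<^sup>+x. ?i A (f x) \<partial>lborel) = (\<integral>\<^sup>+x. ?i A (y + f x) \<partial>lborel)" for y
  proof -
    have "(\<integral>\<^sup>+x. ?i A (f x) \<partial>lborel) = (\<integral>\<^sup>+x. ?i A (f (inv f y + x)) \<partial>lborel)"
      by (rule shift[symmetric]) measurable
    then show ?thesis by (simp add: linear_add[OF lf] fi)
  qed
  have "emeasure (distr lborel borel f) A = (\<integral>\<^sup>+x. ?i A (f x) \<partial>lborel)"
    by (simp add: nn_integral_distr flip: nn_integral_indicator)
  \<comment> \<open>The two measures are compared after multiplication with the mass of the unit
    ball: the integral of \<open>?i A (y + f x) * ?i ?B y\<close> over \<open>x\<close> and
    \<open>y\<close> is reduced by translations in either order, and the ball is unchanged by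
    \<open>f\<close>.\<close>
  then have "emeasure (distr lborel borel f) A * emeasure lborel ?B = (\<integral>\<^sup>+x. ?i A (f x) \<partial>lborel) * (\<integral>\<^sup>+y. ?i ?B y \<partial>lborel)"
    by simp
  also have "\<dots> = (\<integral>\<^sup>+y. (\<integral>\<^sup>+x. ?i A (f x) \<partial>lborel) * ?i ?B y \<partial>lborel)"
    by (subst nn_integral_cmult) (auto intro!: borel_measurable_indicator)
  also have "\<dots> = (\<integral>\<^sup>+y. (\<integral>\<^sup>+x. ?i A (y + f x) * ?i ?B y \<partial>lborel) \<partial>lborel)"
  proof (rule nn_integral_cong)
    fix y
    show "(\<integral>\<^sup>+x. ?i A (f x) \<partial>lborel) * ?i ?B y = (\<integral>\<^sup>+x. ?i A (y + f x) * ?i ?B y \<partial>lborel)"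
      unfolding eq1[of y] by (rule nn_integral_multc[symmetric]) measurable
  qed
  also have "\<dots> = (\<integral>\<^sup>+x. (\<integral>\<^sup>+y. ?i A (y + f x) * ?i ?B y \<partial>lborel) \<partial>lborel)"
    by (rule lborel_pair.Fubini') measurable
  also have "\<dots> = (\<integral>\<^sup>+x. (\<integral>\<^sup>+y. ?i A y * ?i ?B (y - f x) \<partial>lborel) \<partial>lborel)"
  proof (rule nn_integral_cong)
    fix x
    have "(\<integral>\<^sup>+y. ?i A y * ?i ?B (y - f x) \<partial>lborel) = (\<integral>\<^sup>+y. ?i A (f x + y) * ?i ?B ((f x + y) - f x) \<partial>lborel)"
      by (rule shift[symmetric]) measurable
    then show "(\<integral>\<^sup>+y. ?i A (y + f x) * ?i ?B y \<partial>lborel) = (\<integral>\<^sup>+y. ?i A y * ?i ?B (y - f x) \<partial>lborel)"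
      by (simp add: add.commute)
  qed
  also have "\<dots> = (\<integral>\<^sup>+y. (\<integral>\<^sup>+x. ?i A y * ?i ?B (y - f x) \<partial>lborel) \<partial>lborel)"
    by (rule lborel_pair.Fubini') measurable
  also have "\<dots> = (\<integral>\<^sup>+y. ?i A y * emeasure lborel ?B \<partial>lborel)"
  proof (rule nn_integral_cong)
    fix y
    have "?i ?B (y - f x) = ?i ?B (- inv f y + x)" for x
    proof -
      have "norm (y - f x) = norm (inv f (y - f x))" by (simp add: ng)
      also have "inv f (y - f x) = inv f y - x" using lg by (simp add: linear_diff if')
      finally show ?thesis by (simp add: indicator_def norm_minus_commute)
    qed
    then have "(\<integral>\<^sup>+x. ?i ?B (y - f x) \<partial>lborel) = (\<integral>\<^sup>+x. ?i ?B (- inv f y + x) \<partial>lborel)" by simp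
    also have "\<dots> = (\<integral>\<^sup>+x. ?i ?B x \<partial>lborel)" by (rule shift) measurable
    finally show "(\<integral>\<^sup>+x. ?i A y * ?i ?B (y - f x) \<partial>lborel) = ?i A y * emeasure lborel ?B"
      by (subst nn_integral_cmult) auto
  qed
  also have "\<dots> = emeasure lborel A * emeasure lborel ?B"
    by (simp add: nn_integral_multc)
  finally have eq: "emeasure (distr lborel borel f) A * emeasure lborel ?B = emeasure lborel A * emeasure lborel ?B" .
  have "emeasure lborel ?B \<noteq> 0"
    using emeasure_lborel_ball_finite[of "0::'a" 1] content_ball_pos[of 1 "0::'a"]
    by (auto simp: measure_def)
  moreover have "emeasure lborel ?B \<noteq> \<infinity>"
    using emeasure_lborel_ball_finite[of "0::'a" 1] by simp
  ultimately show "emeasure (distr lborel borel f) A = emeasure lborel A"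
    using eq by (simp add: mult.commute[of _ "emeasure lborel ?B"] ennreal_mult_cancel_left)
qed

section \<open>Gaussian integrals adapted to a plane\<close>

lemma integrable_gauss:
  assumes "0 < a"
  shows "integrable lborel (\<lambda>t::real. exp (- (a * t\<^sup>2) / 2))"
proof -
  have "integrable lborel (\<lambda>t. sqrt (2 * pi / a) * normal_density 0 (1 / sqrt a) t)"
    using assms by (intro integrable_mult_right) auto
  moreover have "sqrt (2 * pi / a) * normal_density 0 (1 / sqrt a) t = exp (- (a * t\<^sup>2) / 2)" for t
  proof -
    have "sqrt (2 * pi / a) / sqrt (2 * pi / a) = 1" using assms by simp
    then show ?thesis using assms by (simp add: normal_density_def power_divide field_simps)
  qed
  ultimately show ?thesis by simp
qed

text \<open>The substitution \<open>t = x / sqrt a\<close> turns the integral into the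
  characteristic function of the standard normal distribution at \<open>w / sqrt a\<close>.\<close>

lemma gauss_cis_1d:
  assumes a: "0 < a"
  shows "(LINT t|lborel. exp (- (a * t\<^sup>2) / 2) *\<^sub>R cis (w * t)) = of_real (sqrt (2 * pi / a) * exp (- (w\<^sup>2) / (2 * a)))"
    and "integrable lborel (\<lambda>t. exp (- (a * t\<^sup>2) / 2) *\<^sub>R cis (w * t))"
proof -
  show "integrable lborel (\<lambda>t. exp (- (a * t\<^sup>2) / 2) *\<^sub>R cis (w * t))"
    by (rule Bochner_Integration.integrable_bound[OF integrable_gauss[OF a]])
      (auto simp: cis_conv_exp)
  define v where "v = w / sqrt a"
  have "(LINT t|lborel. exp (- (a * t\<^sup>2) / 2) *\<^sub>R cis (w * t)) =
     \<bar>1 / sqrt a\<bar> *\<^sub>R (LINT x|lborel. exp (- (a * (0 + 1 / sqrt a * x)\<^sup>2) / 2) *\<^sub>R cis (w * (0 + 1 / sqrt a * x)))"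
    by (rule lborel_integral_real_affine) (use a in auto)
  also have "(LINT x|lborel. exp (- (a * (0 + 1 / sqrt a * x)\<^sup>2) / 2) *\<^sub>R cis (w * (0 + 1 / sqrt a * x)))
     = (LINT x|lborel. sqrt (2 * pi) *\<^sub>R (std_normal_density x *\<^sub>R iexp (v * x)))"
    by (rule Bochner_Integration.integral_cong)
       (use a in \<open>auto simp: std_normal_density_def v_def power_divide cis_conv_exp field_simps\<close>)
  also have "\<dots> = sqrt (2 * pi) *\<^sub>R (LINT x|lborel. std_normal_density x *\<^sub>R iexp (v * x))"
    by (rule integral_scaleR_right)
  also have "(LINT x|lborel. std_normal_density x *\<^sub>R iexp (v * x)) = char std_normal_distribution v"
    unfolding char_def by (rule integral_density[symmetric]) (auto simp: normal_density_nonneg)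
  also have "\<dots> = of_real (exp (- (v\<^sup>2) / 2))" by (simp add: char_std_normal_distribution)
  also have "\<bar>1 / sqrt a\<bar> *\<^sub>R (sqrt (2 * pi) *\<^sub>R complex_of_real (exp (- (v\<^sup>2) / 2))) =
      of_real (sqrt (2 * pi / a) * exp (- (w\<^sup>2) / (2 * a)))"
    using a by (simp add: v_def power_divide real_sqrt_divide scaleR_conv_of_real mult.commute)
  finally show "(LINT t|lborel. exp (- (a * t\<^sup>2) / 2) *\<^sub>R cis (w * t)) = of_real (sqrt (2 * pi / a) * exp (- (w\<^sup>2) / (2 * a)))" .
qed

text \<open>\<open>lborel\<close> is a product measure indexed by the basis vectors;
  \<open>?ix\<close> translates a basis vector \<open>axis i 1\<close> back to the index
  \<open>i\<close>.\<close>

lemma lborel_cart_prod: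
  fixes h :: "'n::finite \<Rightarrow> real \<Rightarrow> complex"
  assumes h: "\<And>i. integrable lborel (h i)"
  shows "(LINT x|lborel. (\<Prod>i\<in>UNIV. h i (x $ i))) = (\<Prod>i\<in>UNIV. LINT t|lborel. h i t)"
    and "integrable lborel (\<lambda>x :: real^'n. \<Prod>i\<in>UNIV. h i (x $ i))"
proof -
  interpret product_sigma_finite "\<lambda>_::real^'n. lborel :: real measure"
    by standard
  let ?ix = "\<lambda>b::real^'n. THE i. b = axis i 1"
  have ix: "?ix (axis i 1) = i" for i by (auto simp: axis_eq_axis)
  have B: "Basis = (\<lambda>i. axis i (1::real) :: real^'n) ` UNIV" by (auto simp: Basis_vec_def)
  have injax: "inj (\<lambda>i. axis i (1::real) :: real^'n)" by (auto simp: inj_on_def axis_eq_axis)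
  let ?T = "\<lambda>f. \<Sum>b\<in>Basis. f b *\<^sub>R b :: real^'n"
  have comp: "?T f $ i = f (axis i 1)" for f i
    by (simp add: cart_eq_inner_axis inner_sum_left inner_Basis if_distrib B sum.reindex[OF injax] axis_eq_axis inner_axis_axis cong: if_cong)
  have prodB: "(\<Prod>i\<in>UNIV. g (axis i 1) i) = (\<Prod>b\<in>Basis. g b (?ix b))" for g :: "real^'n \<Rightarrow> 'n \<Rightarrow> complex"
    by (simp add: B prod.reindex[OF injax] ix)
  have [measurable]: "h i \<in> borel_measurable borel" for i using borel_measurable_integrable[OF h[of i]] by simp
  have m: "(\<lambda>x :: real^'n. \<Prod>i\<in>UNIV. h i (x $ i)) \<in> borel_measurable borel"
    by measurable
  have [measurable]: "?T \<in> borel_measurable (\<Pi>\<^sub>M b\<in>Basis. lborel)" by measurable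
  have int: "integrable (\<Pi>\<^sub>M b\<in>Basis. lborel) (\<lambda>f. \<Prod>b\<in>Basis. h (?ix b) (f b))"
    using h by (intro product_integrable_prod) auto
  have eqf: "(\<Prod>i\<in>UNIV. h i (?T f $ i)) = (\<Prod>b\<in>Basis. h (?ix b) (f b))" for f
    unfolding comp by (rule prodB[of "\<lambda>b i. h i (f b)"])
  show "integrable lborel (\<lambda>x :: real^'n. \<Prod>i\<in>UNIV. h i (x $ i))"
    by (subst lborel_eq, subst integrable_distr_eq) (use m int in \<open>auto simp only: eqf, auto\<close>)
  have "(LINT x|lborel. (\<Prod>i\<in>UNIV. h i (x $ i))) = (LINT f|(\<Pi>\<^sub>M b\<in>Basis. lborel). (\<Prod>i\<in>UNIV. h i (?T f $ i)))"
    by (subst lborel_eq, rule integral_distr) (use m in auto)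
  also have "\<dots> = (LINT f|(\<Pi>\<^sub>M b\<in>Basis. lborel). (\<Prod>b\<in>Basis. h (?ix b) (f b)))"
    by (simp only: eqf)
  also have "\<dots> = (\<Prod>b\<in>Basis. LINT t|lborel. h (?ix b) t)"
    using h by (intro product_integral_prod) auto
  also have "\<dots> = (\<Prod>i\<in>UNIV. LINT t|lborel. h i t)"
    by (rule prodB[of "\<lambda>b i. LINT t|lborel. h i t", symmetric])
  finally show "(LINT x|lborel. (\<Prod>i\<in>UNIV. h i (x $ i))) = (\<Prod>i\<in>UNIV. LINT t|lborel. h i t)" .
qed

text \<open>Orthonormal bases of \<open>V\<close> and of its orthogonal complement together form the
  image of the coordinate basis under an orthogonal map \<open>f\<close>; \<open>I\<close> collects
  the indices that land in \<open>V\<close>. This reduces every plane to a coordinate plane.\<close>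

lemma grassmannian_rotate:
  fixes V :: "(real^'n) set"
  assumes V: "V \<in> grassmannian m"
  obtains f :: "real^'n \<Rightarrow> real^'n" and I :: "'n set" where "orthogonal_transformation f" "card I = m"
    "\<And>x. orth_proj V (f x) = f (\<chi> i. if i \<in> I then x $ i else 0)"
proof -
  have sV: "subspace V" and dV: "dim V = m" using V by (auto simp: grassmannian_def)
  obtain B where B: "B \<subseteq> V" "pairwise orthogonal B" "\<And>x. x \<in> B \<Longrightarrow> norm x = 1" "independent B" "card B = dim V" "span B = V"
    using orthonormal_basis_subspace[OF sV] by metis
  define W where "W = {y. \<forall>x\<in>V. orthogonal x y}"
  have sW: "subspace W" unfolding W_def by (rule subspace_orthogonal_to_vectors)
  have "dim W + dim V = DIM(real^'n)"
    using dim_subspace_orthogonal_to_vectors[OF sV subspace_UNIV] by (simp add: W_def)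
  then have dW: "dim V + dim W = CARD('n)" by simp
  obtain C where C: "C \<subseteq> W" "pairwise orthogonal C" "\<And>x. x \<in> C \<Longrightarrow> norm x = 1" "independent C" "card C = dim W" "span C = W"
    using orthonormal_basis_subspace[OF sW] by metis
  have fin: "finite B" "finite C" using B C independent_imp_finite by auto
  have orthBC: "x \<bullet> y = 0" if "x \<in> B" "y \<in> C" for x y
    using that B C by (auto simp: W_def orthogonal_def)
  have disj: "B \<inter> C = {}"
  proof (rule ccontr)
    assume "B \<inter> C \<noteq> {}"
    then obtain x where "x \<in> B" "x \<in> C" by auto
    then show False using orthBC[of x x] B(3)[of x] by auto
  qed
  have cBC: "card (B \<union> C) = CARD('n)" using dW disj fin B C by (simp add: card_Un_disjoint)
  obtain b :: "'n \<Rightarrow> real^'n" where b: "bij_betw b UNIV (B \<union> C)"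
    using finite_same_card_bij[of "UNIV :: 'n set" "B \<union> C"] fin cBC by auto
  have orth: "b i \<bullet> b j = (if i = j then 1 else 0)" for i j
  proof -
    have bi: "b i \<in> B \<union> C" "b j \<in> B \<union> C" using b by (auto simp: bij_betw_def)
    have "b i \<bullet> b i = 1" using bi B(3) C(3) by (auto simp: norm_eq_1)
    moreover have "b i \<bullet> b j = 0" if "i \<noteq> j"
    proof -
      have ne: "b i \<noteq> b j" using b that by (auto simp: bij_betw_def inj_on_def)
      show ?thesis
        using bi ne B(2) C(2) orthBC[of "b i" "b j"] orthBC[of "b j" "b i"]
        by (auto simp: pairwise_def orthogonal_def inner_commute)
    qed
    ultimately show ?thesis by auto
  qed
  define f where "f x = (\<Sum>i\<in>UNIV. (x $ i) *\<^sub>R b i)" for x :: "real^'n"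
  have lf: "linear f"
    unfolding f_def by (intro linearI) (simp_all add: scaleR_add_left sum.distrib scaleR_sum_right)
  have ff: "f x \<bullet> f y = x \<bullet> y" for x y
  proof -
    have "f x \<bullet> f y = (\<Sum>i\<in>UNIV. \<Sum>j\<in>UNIV. x $ i * (y $ j * (b i \<bullet> b j)))"
      by (simp add: f_def inner_sum_left inner_sum_right sum_distrib_left mult.left_commute) (rule sum.swap)
    also have "\<dots> = (\<Sum>i\<in>UNIV. x $ i * y $ i)"
      by (simp add: orth if_distrib[of "\<lambda>t. _ * t"] cong: if_cong)
    finally show ?thesis by (simp add: inner_vec_def)
  qed
  have ot: "orthogonal_transformation f" using lf ff by (simp add: orthogonal_transformation_def)
  define I where "I = b -` B"
  have bI: "b ` I = B" using b by (auto simp: I_def bij_betw_def)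
  have inj: "inj_on b I" using b by (auto simp: bij_betw_def inj_on_def)
  have cI: "card I = m" using card_image[OF inj] bI B(5) dV by simp
  have "orth_proj V (f x) = f (\<chi> i. if i \<in> I then x $ i else 0)" for x
  proof (rule orth_proj_unique[OF sV])
    let ?y = "\<chi> i. if i \<in> I then x $ i else 0"
    have "f ?y = (\<Sum>i\<in>I. (x $ i) *\<^sub>R b i)"
      unfolding f_def by (simp add: if_distrib[of "\<lambda>c. c *\<^sub>R _"] sum.If_cases cong: if_cong)
    also have "\<dots> \<in> V"
      by (intro subspace_sum[OF sV] subspace_scale[OF sV]) (use B(1) in \<open>auto simp: I_def\<close>)
    finally show "f ?y \<in> V" .
    fix v assume "v \<in> V"
    then have "v \<in> span B" using B by simp
    then show "(f x - f ?y) \<bullet> v = 0"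
    proof (induction rule: span_induct)
      case base
      show ?case by (auto simp: subspace_def inner_add_right)
    next
      case (step u)
      then obtain j where j: "j \<in> I" "u = b j" using bI by auto
      have "b j = f (axis j 1)"
        unfolding f_def by (simp add: axis_def if_distrib[of "\<lambda>c. c *\<^sub>R _"] cong: if_cong)
      then have "(f x - f ?y) \<bullet> u = f (x - ?y) \<bullet> f (axis j 1)"
        using j lf by (simp add: linear_diff)
      also have "\<dots> = (x - ?y) $ j" by (simp add: ff cart_eq_inner_axis)
      finally show ?case using j by simp
    qed
  qed
  then show thesis using that ot cI by blast
qed

text \<open>After passing to a coordinate plane the integrand is a product over the coordinates,
  with weight \<open>a\<close> on \<open>I\<close> and \<open>b\<close> off it. Keeping both free
  serves integrals over \<open>V\<close> (weight 1 across it) as well as integrals over the whole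
  space (\<open>a = b\<close>).\<close>

lemma gauss_grassmannian:
  fixes V :: "(real^'n) set"
  assumes V: "V \<in> grassmannian m" and ab: "0 < a" "0 < b"
  shows "(LINT \<xi>|lborel. exp (- (a * (norm (orth_proj V \<xi>))\<^sup>2 + b * (norm (\<xi> - orth_proj V \<xi>))\<^sup>2) / 2) *\<^sub>R cis (\<xi> \<bullet> z))
     = of_real ((2 * pi) powr (CARD('n) / 2) * a powr (- real m / 2) * b powr (- real (CARD('n) - m) / 2) *
         exp (- ((norm (orth_proj V z))\<^sup>2 / (2 * a)) - (norm (z - orth_proj V z))\<^sup>2 / (2 * b)))" (is ?th1)
    and "integrable lborel (\<lambda>\<xi>. exp (- (a * (norm (orth_proj V \<xi>))\<^sup>2 + b * (norm (\<xi> - orth_proj V \<xi>))\<^sup>2) / 2) *\<^sub>R cis (\<xi> \<bullet> z))" (is ?th2)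
proof -
  obtain f :: "real^'n \<Rightarrow> real^'n" and I :: "'n set" where f: "orthogonal_transformation f" and cI: "card I = m"
    and P: "\<And>x. orth_proj V (f x) = f (\<chi> i. if i \<in> I then x $ i else 0)"
    using grassmannian_rotate[OF V] by metis
  have sV: "subspace V" using V by (rule grassmannian_subspace)
  have lf: "linear f" using f by (rule orthogonal_transformation_linear)
  have nf: "norm (f x) = norm x" for x by (rule orthogonal_transformation_norm[OF f])
  have n2: "(norm x)\<^sup>2 = (\<Sum>i\<in>UNIV. (x $ i)\<^sup>2)" for x :: "real^'n"
    unfolding power2_norm_eq_inner inner_vec_def inner_real_def by (simp only: power2_eq_square)
  have P1: "(norm (orth_proj V (f x)))\<^sup>2 = (\<Sum>i\<in>UNIV. if i \<in> I then (x $ i)\<^sup>2 else 0)" for x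
    by (simp add: P nf n2 if_distrib[of "\<lambda>t. t\<^sup>2"] cong: if_cong)
  have P2: "(norm (f x - orth_proj V (f x)))\<^sup>2 = (\<Sum>i\<in>UNIV. if i \<in> I then 0 else (x $ i)\<^sup>2)" for x
    by (simp add: P nf n2 if_distrib[of "\<lambda>t. (_ - t)\<^sup>2"] cong: if_cong flip: linear_diff[OF lf])
  define w where "w = inv f z"
  have z: "z = f w" using orthogonal_transformation_surj[OF f] by (simp add: w_def surj_f_inv_f)
  define c where "c i = (if i \<in> I then a else b)" for i
  have c: "c i > 0" for i using ab by (simp add: c_def)
  define h where "h i t = exp (- (c i * t\<^sup>2) / 2) *\<^sub>R cis (w $ i * t)" for i t
  let ?G = "\<lambda>\<xi>. exp (- (a * (norm (orth_proj V \<xi>))\<^sup>2 + b * (norm (\<xi> - orth_proj V \<xi>))\<^sup>2) / 2) *\<^sub>R cis (\<xi> \<bullet> z)"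
  have cisp: "(\<Prod>i\<in>A. cis (g i)) = cis (\<Sum>i\<in>A. g i)" for g :: "'n \<Rightarrow> real" and A
    by (induction A rule: infinite_finite_induct) (auto simp: cis_mult)
  have G: "?G (f x) = (\<Prod>i\<in>UNIV. h i (x $ i))" for x
  proof -
    have 1: "- (a * (norm (orth_proj V (f x)))\<^sup>2 + b * (norm (f x - orth_proj V (f x)))\<^sup>2) / 2 = (\<Sum>i\<in>UNIV. - (c i * (x $ i)\<^sup>2) / 2)"
      unfolding P1 P2 sum_distrib_left sum.distrib[symmetric] sum_negf[symmetric] sum_divide_distrib
      by (rule sum.cong) (auto simp: c_def)
    have 2: "f x \<bullet> z = (\<Sum>i\<in>UNIV. w $ i * x $ i)"
      using f by (simp add: z orthogonal_transformation_def inner_vec_def mult.commute)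
    show ?thesis
      unfolding 1 2 h_def by (simp add: exp_sum cisp scaleR_conv_of_real prod.distrib)
  qed
  have hi: "integrable lborel (h i)" for i unfolding h_def by (rule gauss_cis_1d(2)[OF c])
  have hv: "(LINT t|lborel. h i t) = of_real (sqrt (2 * pi / c i) * exp (- ((w $ i)\<^sup>2) / (2 * c i)))" for i
    unfolding h_def by (rule gauss_cis_1d(1)[OF c])
  have mP: "orth_proj V \<in> borel_measurable borel" by (rule borel_measurable_orth_proj[OF sV])
  note [measurable] = mP
  have mf [measurable]: "f \<in> borel_measurable borel"
    by (intro borel_measurable_continuous_onI linear_continuous_on linear_conv_bounded_linear[THEN iffD1] lf)
  have mG: "?G \<in> borel_measurable borel"
    unfolding cis_conv_exp by measurable
  have "integrable (distr lborel borel f) ?G"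
  proof (subst integrable_distr_eq)
    show "integrable lborel (\<lambda>x. ?G (f x))" unfolding G by (rule lborel_cart_prod(2)[OF hi])
  qed (use mG in auto)
  then show ?th2 by (simp add: lborel_orthogonal_invariant[OF f])
  have "(LINT \<xi>|lborel. ?G \<xi>) = (LINT \<xi>|distr lborel borel f. ?G \<xi>)" by (simp add: lborel_orthogonal_invariant[OF f])
  also have "\<dots> = (LINT x|lborel. ?G (f x))" by (rule integral_distr) (use mG in auto)
  also have "\<dots> = (LINT x|lborel. (\<Prod>i\<in>UNIV. h i (x $ i)))" by (simp only: G)
  also have "\<dots> = (\<Prod>i\<in>UNIV. of_real (sqrt (2 * pi / c i) * exp (- ((w $ i)\<^sup>2) / (2 * c i))))"
    by (simp only: lborel_cart_prod(1)[OF hi] hv)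
  also have "\<dots> = of_real ((\<Prod>i\<in>UNIV. sqrt (2 * pi / c i)) * (\<Prod>i\<in>UNIV. exp (- ((w $ i)\<^sup>2) / (2 * c i))))"
    by (simp only: of_real_prod prod.distrib of_real_mult)
  also have "(\<Prod>i\<in>UNIV. exp (- ((w $ i)\<^sup>2) / (2 * c i))) = exp (- ((norm (orth_proj V z))\<^sup>2 / (2 * a)) - (norm (z - orth_proj V z))\<^sup>2 / (2 * b))"
  proof -
    have "(\<Sum>i\<in>UNIV. - ((w $ i)\<^sup>2) / (2 * c i)) = - ((norm (orth_proj V z))\<^sup>2 / (2 * a)) - (norm (z - orth_proj V z))\<^sup>2 / (2 * b)"
      unfolding z P1 P2 sum_divide_distrib sum_negf[symmetric] sum_subtractf[symmetric]
      by (rule sum.cong) (auto simp: c_def)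
    then show ?thesis by (simp flip: exp_sum)
  qed
  also have "(\<Prod>i\<in>UNIV. sqrt (2 * pi / c i)) = (2 * pi) powr (CARD('n) / 2) * a powr (- real m / 2) * b powr (- real (CARD('n) - m) / 2)"
  proof -
    have "sqrt (2 * pi / c i) = (2 * pi) powr (1/2) * c i powr (- (1/2))" for i
      using c[of i] by (simp add: powr_half_sqrt[symmetric] powr_divide powr_minus_divide)
    then have "(\<Prod>i\<in>UNIV. sqrt (2 * pi / c i)) = ((2 * pi) powr (1/2)) ^ CARD('n) * (\<Prod>i\<in>UNIV. c i powr (- (1/2)))"
      by (simp add: prod.distrib)
    also have "((2 * pi) powr (1/2)) ^ CARD('n) = (2 * pi) powr (CARD('n) / 2)"
      by (simp add: powr_realpow[symmetric] powr_powr)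
    also have "(\<Prod>i\<in>UNIV. c i powr (- (1/2))) = (\<Prod>i\<in>I. a powr (- (1/2))) * (\<Prod>i\<in>-I. b powr (- (1/2)))"
      by (simp add: c_def if_distrib[of "\<lambda>t. t powr _"] prod.If_cases Compl_eq cong: if_cong)
    also have "(\<Prod>i\<in>I. a powr (- (1/2))) = a powr (- real m / 2)"
      using ab by (simp add: cI powr_realpow[symmetric] powr_powr)
    also have "(\<Prod>i\<in>-I. b powr (- (1/2))) = b powr (- real (CARD('n) - m) / 2)"
      using ab by (simp add: cI Compl_eq_Diff_UNIV card_Diff_subset powr_realpow[symmetric] powr_powr)
    finally show ?thesis by (simp only: mult.assoc)
  qed
  finally show ?th1 .
qed

lemma nn_gauss_grassmannian:
  fixes V :: "(real^'n) set"
  assumes V: "V \<in> grassmannian m" and ab: "0 < a" "0 < b"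
  shows "(\<integral>\<^sup>+\<xi>. ennreal (exp (- (a * (norm (orth_proj V \<xi>))\<^sup>2 + b * (norm (\<xi> - orth_proj V \<xi>))\<^sup>2) / 2)) \<partial>lborel)
     = ennreal ((2 * pi) powr (CARD('n) / 2) * a powr (- real m / 2) * b powr (- real (CARD('n) - m) / 2))"
proof -
  let ?g = "\<lambda>\<xi>. exp (- (a * (norm (orth_proj V \<xi>))\<^sup>2 + b * (norm (\<xi> - orth_proj V \<xi>))\<^sup>2) / 2)"
  let ?c = "(2 * pi) powr (CARD('n) / 2) * a powr (- real m / 2) * b powr (- real (CARD('n) - m) / 2)"
  have sV: "subspace V" using V by (rule grassmannian_subspace)
  have P0: "orth_proj V 0 = 0" using linear_orth_proj[OF sV] by (rule linear_0)
  have i: "integrable lborel (\<lambda>\<xi>. ?g \<xi> *\<^sub>R (1::complex))"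
    using gauss_grassmannian(2)[OF V ab, of 0] by simp
  have v: "(LINT \<xi>|lborel. ?g \<xi> *\<^sub>R (1::complex)) = of_real ?c"
    using gauss_grassmannian(1)[OF V ab, of 0] by (simp add: P0)
  have ir: "integrable lborel ?g"
    using integrable_Re[OF i] by simp
  have "(LINT \<xi>|lborel. ?g \<xi>) = ?c"
    using integral_Re[OF i] unfolding v by simp
  then show ?thesis using nn_integral_eq_integral[OF ir] by simp
qed

lemma powr_le_exp:
  assumes "0 \<le> b" "0 < (\<kappa>::real)"
  obtains C where "0 < C" "\<And>y. 0 \<le> y \<Longrightarrow> (1 + y) powr b \<le> C * exp (\<kappa> * y)"
proof (cases "b = 0")
  case True
  have "(1 + y) powr b \<le> 1 * exp (\<kappa> * y)" if "0 \<le> y" for y using True that assms by simp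
  then show thesis using that[of 1] by simp
next
  case False
  then have b: "0 < b" using assms by simp
  \<comment> \<open>The maximum of \<open>(1 + y) powr b * exp (- \<kappa> * y)\<close> over
    \<open>y > -1\<close>, attained at \<open>1 + y = b / \<kappa>\<close>; it comes from
    \<open>ln x \<le> x - 1\<close> at \<open>x = (1 + y) * \<kappa> / b\<close>.\<close>
  define C where "C = exp (b * ln (b / \<kappa>) + \<kappa> - b)"
  have "(1 + y) powr b \<le> C * exp (\<kappa> * y)" if y: "0 \<le> y" for y
  proof -
    have "ln ((1 + y) * (\<kappa> / b)) \<le> (1 + y) * (\<kappa> / b) - 1" using b y assms by (intro ln_le_minus_one) auto
    then have "b * ln (1 + y) \<le> b * (ln (b / \<kappa>) + (1 + y) * (\<kappa> / b) - 1)"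
      using b y assms by (intro mult_left_mono) (auto simp: ln_mult ln_div)
    also have "\<dots> = b * ln (b / \<kappa>) + \<kappa> - b + \<kappa> * y" using b by (simp add: field_simps)
    finally have "exp (b * ln (1 + y)) \<le> C * exp (\<kappa> * y)"
      by (simp add: C_def flip: exp_add)
    then show ?thesis using y by (simp add: powr_def)
  qed
  moreover have "0 < C" by (simp add: C_def)
  ultimately show thesis using that by blast
qed

text \<open>Split dyadically into balls of radius \<open>2 ^ j * sqrt \<tau>\<close>: the kernel is
  about \<open>2 powr (- j * b)\<close> at that distance, the growth allows mass of order
  \<open>2 powr (j * t) * \<tau> powr (t / 2)\<close>, and the sum is geometric with ratio
  \<open>q < 1\<close> because \<open>t < b\<close>.\<close>

lemma growth_integral:
  fixes \<nu> :: "(real^'n) measure"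
  assumes \<nu>: "finite_measure \<nu>" "sets \<nu> = sets borel" and g: "growth t \<nu>" and tb: "t < b" "0 < b"
  obtains C where "0 < C" "\<And>x \<tau>. 0 < \<tau> \<Longrightarrow>
    (\<integral>\<^sup>+y. ennreal ((1 + (norm (x - y))\<^sup>2 / \<tau>) powr (- b / 2)) \<partial>\<nu>) \<le> ennreal (C * \<tau> powr (t / 2))"
proof -
  interpret finite_measure \<nu> by fact
  obtain C where C: "0 < C" "\<And>x r. 0 < r \<Longrightarrow> measure \<nu> (cball x r) \<le> C * r powr t"
    using g by (auto simp: growth_def)
  define q where "q = 2 powr (t - b)"
  have q: "0 < q" "q < 1" using tb by (auto simp: q_def powr_less_one)
  define D where "D = 2 powr b * C * (1 / (1 - q))"
  have "(\<integral>\<^sup>+y. ennreal ((1 + (norm (x - y))\<^sup>2 / \<tau>) powr (- b / 2)) \<partial>\<nu>) \<le> ennreal (D * \<tau> powr (t / 2))"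
    if \<tau>: "0 < \<tau>" for x \<tau>
  proof -
    have "ennreal ((1 + (norm (x - y))\<^sup>2 / \<tau>) powr (- b / 2)) \<le>
       (\<Sum>j. ennreal (2 powr (b - real j * b)) * indicator (cball x (2 ^ j * sqrt \<tau>)) y)" for y
    proof -
      define \<rho> where "\<rho> = norm (x - y) / sqrt \<tau>"
      have \<rho>: "\<rho> \<ge> 0" "(norm (x - y))\<^sup>2 / \<tau> = \<rho>\<^sup>2" using \<tau> by (auto simp: \<rho>_def power_divide)
      obtain j0 where "\<rho> < 2 ^ j0" using real_arch_pow[of 2 \<rho>] by auto
      then have ex: "\<exists>j. \<rho> \<le> 2 ^ j" by (auto intro: less_imp_le)
      define j where "j = (LEAST j. \<rho> \<le> 2 ^ j)"
      have j: "\<rho> \<le> 2 ^ j" unfolding j_def using ex by (rule LeastI_ex)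
      have "(1 + \<rho>\<^sup>2) powr (- b / 2) \<le> 2 powr (b - real j * b)"
      proof (cases j)
        case 0
        have "(1 + \<rho>\<^sup>2) powr (- b / 2) \<le> 1" using tb ge_one_powr_ge_zero[of "1 + \<rho>\<^sup>2" "b / 2"] by (simp add: powr_minus_divide divide_le_eq)
        also have "1 \<le> 2 powr b" using tb by (simp add: ge_one_powr_ge_zero)
        finally show ?thesis using 0 by simp
      next
        case (Suc i)
        then have "\<not> \<rho> \<le> 2 ^ i" using not_less_Least[of i "\<lambda>j. \<rho> \<le> 2 ^ j"] by (simp add: j_def)
        then have i: "2 powr real i < \<rho>" by (simp add: powr_realpow)
        then have r0: "\<rho> > 0" by (smt (verit) powr_gt_zero)
        have "(1 + \<rho>\<^sup>2) powr (- b / 2) \<le> (\<rho> powr 2) powr (- b / 2)"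
          using r0 tb by (intro powr_mono2') (auto simp: powr_numeral)
        also have "\<dots> = \<rho> powr (- b)" by (simp add: powr_powr)
        also have "\<dots> \<le> (2 powr real i) powr (- b)" using i tb by (intro powr_mono2') auto
        also have "\<dots> = 2 powr (b - real j * b)" by (simp add: powr_powr Suc algebra_simps)
        finally show ?thesis .
      qed
      moreover have "y \<in> cball x (2 ^ j * sqrt \<tau>)"
        using j \<tau> by (simp add: \<rho>_def dist_norm pos_divide_le_eq)
      ultimately have "ennreal ((1 + (norm (x - y))\<^sup>2 / \<tau>) powr (- b / 2)) \<le>
         (\<Sum>j\<in>{j}. ennreal (2 powr (b - real j * b)) * indicator (cball x (2 ^ j * sqrt \<tau>)) y)"
        using \<rho>(2) by (simp add: ennreal_leI)
      also have "\<dots> \<le> (\<Sum>j. ennreal (2 powr (b - real j * b)) * indicator (cball x (2 ^ j * sqrt \<tau>)) y)"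
        by (intro sum_le_suminf) auto
      finally show ?thesis .
    qed
    then have "(\<integral>\<^sup>+y. ennreal ((1 + (norm (x - y))\<^sup>2 / \<tau>) powr (- b / 2)) \<partial>\<nu>) \<le>
       (\<integral>\<^sup>+y. (\<Sum>j. ennreal (2 powr (b - real j * b)) * indicator (cball x (2 ^ j * sqrt \<tau>)) y) \<partial>\<nu>)"
      by (rule nn_integral_mono)
    also have "\<dots> = (\<Sum>j. \<integral>\<^sup>+y. ennreal (2 powr (b - real j * b)) * indicator (cball x (2 ^ j * sqrt \<tau>)) y \<partial>\<nu>)"
    proof (rule nn_integral_suminf)
      fix j
      show "(\<lambda>y. ennreal (2 powr (b - real j * b)) * indicator (cball x (2 ^ j * sqrt \<tau>)) y) \<in> borel_measurable \<nu>"
        by (intro borel_measurable_times_ennreal borel_measurable_const borel_measurable_indicator) (simp add: \<nu>(2))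
    qed
    also have "\<dots> = (\<Sum>j. ennreal (2 powr (b - real j * b)) * emeasure \<nu> (cball x (2 ^ j * sqrt \<tau>)))"
      by (subst nn_integral_cmult_indicator) (simp_all add: \<nu>(2))
    also have "\<dots> \<le> (\<Sum>j. ennreal (2 powr b * C * \<tau> powr (t / 2) * q ^ j))"
    proof (intro suminf_le)
      fix j
      have "measure \<nu> (cball x (2 ^ j * sqrt \<tau>)) \<le> C * (2 ^ j * sqrt \<tau>) powr t"
        using \<tau> by (intro C) auto
      also have "(2 ^ j * sqrt \<tau>) powr t = 2 powr (real j * t) * \<tau> powr (t / 2)"
        using \<tau> by (simp add: powr_mult powr_half_sqrt[symmetric] powr_powr powr_realpow[symmetric])
      finally have "2 powr (b - real j * b) * measure \<nu> (cball x (2 ^ j * sqrt \<tau>)) \<le>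
          2 powr (b - real j * b) * (C * (2 powr (real j * t) * \<tau> powr (t / 2)))"
        by (intro mult_left_mono) auto
      also have "\<dots> = 2 powr b * C * \<tau> powr (t / 2) * q ^ j"
      proof -
        have "2 powr (b - real j * b) * 2 powr (real j * t) = 2 powr b * 2 powr (real j * (t - b))"
          by (simp add: algebra_simps flip: powr_add)
        also have "2 powr (real j * (t - b)) = q ^ j"
          by (simp add: q_def powr_realpow[symmetric] powr_powr mult.commute)
        finally show ?thesis by (simp add: mult_ac)
      qed
      finally show "ennreal (2 powr (b - real j * b)) * emeasure \<nu> (cball x (2 ^ j * sqrt \<tau>)) \<le>
        ennreal (2 powr b * C * \<tau> powr (t / 2) * q ^ j)"
        by (simp add: emeasure_eq_measure ennreal_leI flip: ennreal_mult)
    qed auto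
    also have "\<dots> = ennreal (2 powr b * C * \<tau> powr (t / 2) * (1 / (1 - q)))"
    proof (rule suminf_ennreal_eq)
      show "(\<lambda>j. 2 powr b * C * \<tau> powr (t / 2) * q ^ j) sums (2 powr b * C * \<tau> powr (t / 2) * (1 / (1 - q)))"
        using q by (intro sums_mult geometric_sums) auto
    qed (use q C in auto)
    finally show ?thesis by (simp add: D_def mult_ac)
  qed
  moreover have "0 < D" using q C by (simp add: D_def)
  ultimately show thesis using that by blast
qed

section \<open>Averages over the Grassmannian\<close>

locale haar_grassmannian =
  fixes m :: nat and \<gamma> :: "(real^'n) set measure"
  assumes haar: "grassmann_haar m \<gamma>" and m1: "1 \<le> m" and mn: "m < CARD('n)"
begin

lemma sets_\<gamma>: "sets \<gamma> = sets (grassmannian_borel m)"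
  and prob_\<gamma>: "prob_space \<gamma>"
  using haar by (auto simp: grassmann_haar_def)

sublocale \<gamma>: prob_space \<gamma> by (rule prob_\<gamma>)

lemma space_\<gamma> [simp]: "space \<gamma> = grassmannian m"
  using sets_eq_imp_space_eq[OF sets_\<gamma>] by (simp add: grassmannian_borel_def)

text \<open>The sigma-algebra of the Grassmannian is pulled back along the matrix of the projection,
  so joint measurability follows from continuity of the product of a matrix and a vector.\<close>

lemma measurable_orth_proj [measurable]:
  assumes f [measurable]: "f \<in> measurable M \<gamma>" and g [measurable]: "g \<in> borel_measurable M"
  shows "(\<lambda>x. orth_proj (f x) (g x)) \<in> borel_measurable M"
proof -
  have "(\<lambda>V. matrix (orth_proj V)) \<in> measurable (grassmannian_borel m) (borel :: (real^'n^'n) measure)"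
    unfolding grassmannian_borel_def by (rule measurable_vimage_algebra1) auto
  then have [measurable]: "(\<lambda>V. matrix (orth_proj V)) \<in> measurable \<gamma> (borel :: (real^'n^'n) measure)"
    by (simp cong: measurable_cong_sets add: sets_\<gamma>)
  have "(\<lambda>x. matrix (orth_proj (f x)) *v g x) \<in> borel_measurable M"
  proof (rule borel_measurable_continuous_Pair[where H = "\<lambda>A x. A *v x"])
    show "continuous_on UNIV (\<lambda>x :: (real^'n^'n) \<times> (real^'n). fst x *v snd x)"
      unfolding matrix_vector_mult_def by (intro continuous_intros)
  qed measurable
  moreover have "matrix (orth_proj (f x)) *v g x = orth_proj (f x) (g x)" if "x \<in> space M" for x
  proof -
    have "f x \<in> grassmannian m" using measurable_space[OF f that] by simp
    then show ?thesis by (simp add: matrix_works linear_orth_proj grassmannian_subspace)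
  qed
  ultimately show ?thesis by (subst measurable_cong[where g = "\<lambda>x. matrix (orth_proj (f x)) *v g x"]) auto
qed

lemma grassmannian_image:
  assumes f: "orthogonal_transformation f" and V: "V \<in> grassmannian m"
  shows "f ` V \<in> (grassmannian m :: (real^'n) set set)"
proof -
  have lf: "linear f" using f by (rule orthogonal_transformation_linear)
  have "inj_on f (span V)" using orthogonal_transformation_inj[OF f] by (rule inj_on_subset) simp
  then have "dim (f ` V) = dim V" by (rule dim_image_eq[OF lf])
  moreover have "subspace (f ` V)" using lf V by (intro linear_subspace_image) (auto simp: grassmannian_def)
  ultimately show ?thesis using V by (simp add: grassmannian_def)
qed

text \<open>Invariance is given for images of measurable sets; the preimage under \<open>f\<close>
  is the image under \<open>inv f\<close>, which turns it into invariance of the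
  push-forward.\<close>

lemma distr_image:
  assumes f: "orthogonal_transformation f"
  shows "(`) f \<in> measurable \<gamma> \<gamma>" "distr \<gamma> \<gamma> ((`) f) = \<gamma>"
proof -
  have g: "orthogonal_transformation (inv f)" using f by (rule orthogonal_transformation_inv)
  have bf: "bij f" using f by (rule orthogonal_transformation_bij)
  have fi: "f ` inv f ` V = V" "inv f ` f ` V = V" for V
    using bf by (auto simp: image_f_inv_f image_inv_f_f bij_is_surj bij_is_inj)
  have vim: "(`) f -` S \<inter> space \<gamma> = (`) (inv f) ` S" if S: "S \<in> sets \<gamma>" for S
  proof
    show "(`) f -` S \<inter> space \<gamma> \<subseteq> (`) (inv f) ` S"
    proof
      fix V assume V: "V \<in> (`) f -` S \<inter> space \<gamma>"
      have "V = inv f ` (f ` V)" using fi by simp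
      moreover have "f ` V \<in> S" using V by simp
      ultimately show "V \<in> (`) (inv f) ` S" by (rule image_eqI)
    qed
    show "(`) (inv f) ` S \<subseteq> (`) f -` S \<inter> space \<gamma>"
      using fi sets.sets_into_space[OF S] grassmannian_image[OF g] by auto
  qed
  show meas: "(`) f \<in> measurable \<gamma> \<gamma>"
  proof (rule measurableI)
    show "f ` V \<in> space \<gamma>" if "V \<in> space \<gamma>" for V using grassmannian_image[OF f] that by simp
    show "(`) f -` S \<inter> space \<gamma> \<in> sets \<gamma>" if "S \<in> sets \<gamma>" for S
      unfolding vim[OF that] using haar g that by (auto simp: grassmann_haar_def)
  qed
  show "distr \<gamma> \<gamma> ((`) f) = \<gamma>"
  proof (rule measure_eqI)
    fix S assume "S \<in> sets (distr \<gamma> \<gamma> ((`) f))"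
    then have S: "S \<in> sets \<gamma>" by simp
    show "emeasure (distr \<gamma> \<gamma> ((`) f)) S = emeasure \<gamma> S"
    proof -
      have "emeasure \<gamma> ((`) (inv f) ` S) = emeasure \<gamma> S"
        using haar g S unfolding grassmann_haar_def by blast
      then show ?thesis by (simp only: emeasure_distr[OF meas S] vim[OF S])
    qed
  qed simp
qed

end

text \<open>A quadratic form \<open>q V\<close> of rank \<open>j\<close>, depending equivariantly on \<open>V\<close>; it is used for the squared
  lengths of the projections to \<open>V\<close> (\<open>j = m\<close>) and to its orthogonal complement (\<open>j = n - m\<close>).\<close>

locale haar_form = haar_grassmannian m \<gamma> for m and \<gamma> :: "(real^'n) set measure" +
  fixes q :: "(real^'n) set \<Rightarrow> real^'n \<Rightarrow> real" and j :: nat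
  assumes q_meas: "(\<lambda>(V, z). q V z) \<in> borel_measurable (\<gamma> \<Otimes>\<^sub>M borel)"
    and q_nonneg: "\<And>V z. 0 \<le> q V z"
    and q_image: "\<And>f V z. orthogonal_transformation f \<Longrightarrow> V \<in> grassmannian m \<Longrightarrow> q (f ` V) (f z) = q V z"
    and q_scale: "\<And>V c z. V \<in> grassmannian m \<Longrightarrow> q V (c *\<^sub>R z) = c\<^sup>2 * q V z"
    and q_gauss: "\<And>V a b. V \<in> grassmannian m \<Longrightarrow> 0 < b \<Longrightarrow> 0 \<le> a \<Longrightarrow>
      (\<integral>\<^sup>+z. ennreal (exp (- (a * q V z + b * (norm z)\<^sup>2) / 2)) \<partial>lborel) =
      ennreal ((2 * pi) powr (CARD('n) / 2) * (a + b) powr (- real j / 2) * b powr (- real (CARD('n) - j) / 2))"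
begin

text \<open>Rotation invariance makes this a function of \<open>norm z\<close> alone. The estimates
  below, of decay like \<open>norm z powr (- j)\<close>, carry the quantitative information about
  the Haar measure.\<close>

definition \<psi> :: "real^'n \<Rightarrow> ennreal" where
  "\<psi> z = (\<integral>\<^sup>+V. ennreal (exp (- q V z / 2)) \<partial>\<gamma>)"

lemma q_measurable [measurable]:
  assumes [measurable]: "f \<in> measurable M \<gamma>" "g \<in> borel_measurable M"
  shows "(\<lambda>x. q (f x) (g x)) \<in> borel_measurable M"
proof -
  have "(\<lambda>x. (f x, g x)) \<in> measurable M (\<gamma> \<Otimes>\<^sub>M borel)" by measurable
  from measurable_compose[OF this q_meas] show ?thesis by simp
qed

lemma \<psi>_radial:
  assumes "norm z = norm w"
  shows "\<psi> z = \<psi> w"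
proof -
  obtain f where f: "orthogonal_transformation f" "f z = w"
    using orthogonal_transformation_exists[OF assms] by metis
  have "\<psi> w = (\<integral>\<^sup>+V. ennreal (exp (- q V w / 2)) \<partial>distr \<gamma> \<gamma> ((`) f))"
    by (simp add: \<psi>_def distr_image[OF f(1)])
  also have "\<dots> = (\<integral>\<^sup>+V. ennreal (exp (- q (f ` V) w / 2)) \<partial>\<gamma>)"
    by (rule nn_integral_distr[OF distr_image(1)[OF f(1)]]) measurable
  also have "\<dots> = \<psi> z"
    unfolding \<psi>_def by (rule nn_integral_cong) (simp add: q_image f flip: f(2))
  finally show ?thesis by simp
qed

lemma \<psi>_antimono:
  assumes "norm z \<le> norm w"
  shows "\<psi> w \<le> \<psi> z"
proof (cases "w = 0")
  case False
  define c where "c = norm z / norm w"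
  have c: "0 \<le> c" "c \<le> 1" using assms False by (auto simp: c_def)
  have "\<psi> z = \<psi> (c *\<^sub>R w)" using False by (intro \<psi>_radial) (simp add: c_def)
  also have "\<dots> \<ge> \<psi> w"
    unfolding \<psi>_def
  proof (intro nn_integral_mono ennreal_leI)
    fix V assume V: "V \<in> space \<gamma>"
    have "c\<^sup>2 * q V w \<le> 1 * q V w"
      using c by (intro mult_right_mono q_nonneg) (simp add: power_le_one)
    then show "exp (- q V w / 2) \<le> exp (- q V (c *\<^sub>R w) / 2)" using V by (simp add: q_scale)
  qed
  finally show ?thesis .
qed (use assms in auto)

lemma \<psi>_measurable [measurable]: "\<psi> \<in> borel_measurable borel"
  unfolding \<psi>_def by measurable

text \<open>After exchanging the integrals the inner one has the same value for every plane, so its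
  average is known exactly. Combined with radial monotonicity this controls the decay of
  \<open>\<psi>\<close>.\<close>

lemma \<psi>_gauss:
  assumes b: "0 < b"
  shows "(\<integral>\<^sup>+z. \<psi> (r *\<^sub>R z) * ennreal (exp (- (b * (norm z)\<^sup>2) / 2)) \<partial>lborel) =
    ennreal ((2 * pi) powr (CARD('n) / 2) * (r\<^sup>2 + b) powr (- real j / 2) * b powr (- real (CARD('n) - j) / 2))"
    (is "?L = ennreal ?c")
proof -
  interpret L: pair_sigma_finite \<gamma> "lborel :: (real^'n) measure" ..
  have "?L = (\<integral>\<^sup>+z. (\<integral>\<^sup>+V. ennreal (exp (- q V (r *\<^sub>R z) / 2)) * ennreal (exp (- (b * (norm z)\<^sup>2) / 2)) \<partial>\<gamma>) \<partial>lborel)"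
    unfolding \<psi>_def by (intro nn_integral_cong nn_integral_multc[symmetric]) measurable
  also have "\<dots> = (\<integral>\<^sup>+V. (\<integral>\<^sup>+z. ennreal (exp (- q V (r *\<^sub>R z) / 2)) * ennreal (exp (- (b * (norm z)\<^sup>2) / 2)) \<partial>lborel) \<partial>\<gamma>)"
    by (rule L.Fubini') measurable
  also have "\<dots> = (\<integral>\<^sup>+V. ennreal ?c \<partial>\<gamma>)"
  proof (rule nn_integral_cong)
    fix V assume V: "V \<in> space \<gamma>"
    have "(\<integral>\<^sup>+z. ennreal (exp (- q V (r *\<^sub>R z) / 2)) * ennreal (exp (- (b * (norm z)\<^sup>2) / 2)) \<partial>lborel) =
      (\<integral>\<^sup>+z. ennreal (exp (- (r\<^sup>2 * q V z + b * (norm z)\<^sup>2) / 2)) \<partial>lborel)"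
    proof (rule nn_integral_cong)
      fix z :: "real^'n"
      have "- q V (r *\<^sub>R z) / 2 + - (b * (norm z)\<^sup>2) / 2 = - (r\<^sup>2 * q V z + b * (norm z)\<^sup>2) / 2"
        using V by (simp add: q_scale field_simps)
      then show "ennreal (exp (- q V (r *\<^sub>R z) / 2)) * ennreal (exp (- (b * (norm z)\<^sup>2) / 2)) = ennreal (exp (- (r\<^sup>2 * q V z + b * (norm z)\<^sup>2) / 2))"
        by (simp only: ennreal_mult[symmetric] exp_ge_zero exp_add[symmetric])
    qed
    also have "\<dots> = ennreal ?c" using V b by (intro q_gauss) auto
    finally show "(\<integral>\<^sup>+z. ennreal (exp (- q V (r *\<^sub>R z) / 2)) * ennreal (exp (- (b * (norm z)\<^sup>2) / 2)) \<partial>lborel) = ennreal ?c" .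
  qed
  also have "\<dots> = ennreal ?c" using \<gamma>.emeasure_space_1 by simp
  finally show ?thesis .
qed

text \<open>With \<open>r = norm w\<close>, monotonicity makes \<open>\<psi> (r *\<^sub>R z)\<close>
  at least \<open>\<psi> w\<close> for \<open>z\<close> in the unit ball, so \<open>\<psi> w\<close>
  is at most a constant times the Gaussian average at scale \<open>r\<close>.\<close>

lemma \<psi>_upper:
  obtains C where "0 < C" "\<And>w. \<psi> w \<le> ennreal (C * (1 + (norm w)\<^sup>2) powr (- real j / 2))"
proof -
  let ?B = "cball 0 1 :: (real^'n) set"
  define c0 where "c0 = exp (- 1/2) * measure lborel ?B"
  have c0: "0 < c0" using content_cball_pos[of 1 "0 :: real^'n"] by (simp add: c0_def)
  have eB: "emeasure lborel ?B = ennreal (measure lborel ?B)"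
    using emeasure_lborel_cball_finite[of "0 :: real^'n" 1] by (intro emeasure_eq_ennreal_measure) auto
  define C where "C = (2 * pi) powr (CARD('n) / 2) / c0"
  have "\<psi> w \<le> ennreal (C * (1 + (norm w)\<^sup>2) powr (- real j / 2))" for w
  proof -
    define r where "r = norm w"
    have "\<psi> w * ennreal c0 = (\<integral>\<^sup>+z. \<psi> w * ennreal (exp (- 1/2)) * indicator ?B z \<partial>lborel)"
      by (subst nn_integral_cmult_indicator) (simp_all add: eB c0_def ennreal_mult mult.assoc)
    also have "\<dots> \<le> (\<integral>\<^sup>+z. \<psi> (r *\<^sub>R z) * ennreal (exp (- (1 * (norm z)\<^sup>2) / 2)) \<partial>lborel)"
    proof (rule nn_integral_mono)
      fix z :: "real^'n"
      show "\<psi> w * ennreal (exp (- 1/2)) * indicator ?B z \<le> \<psi> (r *\<^sub>R z) * ennreal (exp (- (1 * (norm z)\<^sup>2) / 2))"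
      proof (cases "z \<in> ?B")
        case True
        then have z: "norm z \<le> 1" by simp
        then have "(norm z)\<^sup>2 \<le> 1" by (simp add: power_le_one)
        moreover have "\<psi> w \<le> \<psi> (r *\<^sub>R z)"
          using z by (intro \<psi>_antimono) (simp add: r_def mult_left_le)
        ultimately show ?thesis using True by (auto intro!: mult_mono ennreal_leI)
      qed simp
    qed
    also have "\<dots> = ennreal ((2 * pi) powr (CARD('n) / 2) * (r\<^sup>2 + 1) powr (- real j / 2))"
      by (subst \<psi>_gauss) auto
    finally have "\<psi> w * ennreal c0 * ennreal (1 / c0) \<le>
        ennreal ((2 * pi) powr (CARD('n) / 2) * (r\<^sup>2 + 1) powr (- real j / 2)) * ennreal (1 / c0)"
      by (rule mult_right_mono) simp
    moreover have "\<psi> w * ennreal c0 * ennreal (1 / c0) = \<psi> w"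
      using c0 by (simp add: mult.assoc flip: ennreal_mult)
    ultimately show ?thesis
      using c0 by (simp add: C_def r_def add.commute mult_ac flip: ennreal_mult)
  qed
  moreover have "0 < C" using c0 by (simp add: C_def)
  ultimately show thesis using that by blast
qed

text \<open>The Gaussian average of \<open>\<psi> (r z)\<close> is known; the part of it coming from small \<open>z\<close> is dominated by the
  average against a narrower Gaussian and hence negligible because \<open>j < n\<close>.\<close>

lemma \<psi>_lower:
  assumes j: "j < CARD('n)"
  obtains c R where "0 < c" "0 < R" "\<And>w. R \<le> norm w \<Longrightarrow> ennreal (c * norm w powr (- real j)) \<le> \<psi> w"
proof -
  \<comment> \<open>\<open>c1\<close> is half of the constant that the Gaussian average guarantees
    for \<open>r \<ge> 1\<close>, so that half survives the subtraction. \<open>b\<close> is so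
    large that \<open>exp (1/2) * b powr (- (n - j) / 2)\<close> is at most \<open>c1\<close>, which
    uses \<open>n - j \<ge> 1\<close>.\<close>
  define c1 where "c1 = 2 powr (- real j / 2) / 2"
  define b where "b = (exp (1/2) / c1)\<^sup>2"
  have "1 \<le> 2 powr (real j / 2)" by (simp add: ge_one_powr_ge_zero)
  then have "1 \<le> 2 powr (real j / 2) * 2" by linarith
  then have c1: "0 < c1" "c1 \<le> 1" by (auto simp: c1_def powr_minus_divide divide_le_eq)
  have e1: "1 \<le> exp (1/2::real)" by simp
  have "c1 \<le> exp (1/2)" using c1 e1 by linarith
  then have "1 \<le> exp (1/2) / c1" using c1 by simp
  then have b1: "1 \<le> b" by (simp add: b_def one_le_power)
  have bsmall: "exp (1/2) * b powr (- real (CARD('n) - j) / 2) \<le> c1"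
  proof -
    have "b powr (- real (CARD('n) - j) / 2) \<le> b powr (- (1/2))"
      using b1 j by (intro powr_mono) auto
    also have "\<dots> = c1 / exp (1/2)"
      using c1 by (simp add: b_def powr_minus_divide powr_half_sqrt)
    finally have "exp (1/2) * b powr (- real (CARD('n) - j) / 2) \<le> exp (1/2) * (c1 / exp (1/2))"
      by (intro mult_left_mono) auto
    then show ?thesis by simp
  qed
  define a where "a = 1 / sqrt b"
  have a: "0 < a" using b1 by (simp add: a_def)
  let ?p = "(2 * pi) powr (CARD('n) / 2)"
  have p: "?p > 0" by simp
  have "ennreal (c1 * a powr real j * norm w powr (- real j)) \<le> \<psi> w" if w: "a \<le> norm w" for w
  proof -
    \<comment> \<open>At this scale \<open>norm z \<ge> a\<close> implies
      \<open>norm (r *\<^sub>R z) \<ge> norm w\<close>, where \<open>\<psi>\<close> is at most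
      \<open>\<psi> w\<close>; for smaller \<open>z\<close> one has
      \<open>b * (norm z)\<^sup>2 \<le> 1\<close>, and the narrower Gaussian takes over at the price
      of \<open>exp (1/2)\<close>.\<close>
    define r where "r = norm w / a"
    have r: "1 \<le> r" using w a by (simp add: r_def)
    have "ennreal (?p * (r\<^sup>2 + 1) powr (- real j / 2)) = (\<integral>\<^sup>+z. \<psi> (r *\<^sub>R z) * ennreal (exp (- (1 * (norm z)\<^sup>2) / 2)) \<partial>lborel)"
      by (subst \<psi>_gauss) auto
    also have "\<dots> \<le> (\<integral>\<^sup>+z. ennreal (exp (1/2)) * (\<psi> (r *\<^sub>R z) * ennreal (exp (- (b * (norm z)\<^sup>2) / 2))) +
        \<psi> w * (\<psi> (0 *\<^sub>R z) * ennreal (exp (- (1 * (norm z)\<^sup>2) / 2))) \<partial>lborel)"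
    proof (rule nn_integral_mono)
      fix z :: "real^'n"
      \<comment> \<open>The factor \<open>\<psi> 0 = 1\<close> is inserted so that
        \<open>\<psi>_gauss\<close> with scale 0 evaluates the plain Gaussian integral.\<close>
      have \<psi>0: "\<psi> (0 *\<^sub>R z) = 1"
      proof -
        have "\<psi> 0 = (\<integral>\<^sup>+V. 1 \<partial>\<gamma>)" unfolding \<psi>_def
        proof (rule nn_integral_cong)
          fix V assume "V \<in> space \<gamma>"
          then have "q V 0 = 0" using q_scale[of V 0 0] by simp
          then show "ennreal (exp (- q V 0 / 2)) = 1" by simp
        qed
        then show ?thesis using \<gamma>.emeasure_space_1 by simp
      qed
      show "\<psi> (r *\<^sub>R z) * ennreal (exp (- (1 * (norm z)\<^sup>2) / 2)) \<le>
        ennreal (exp (1/2)) * (\<psi> (r *\<^sub>R z) * ennreal (exp (- (b * (norm z)\<^sup>2) / 2))) +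
        \<psi> w * (\<psi> (0 *\<^sub>R z) * ennreal (exp (- (1 * (norm z)\<^sup>2) / 2)))"
      proof (cases "a \<le> norm z")
        case True
        then have "a * norm w \<le> norm z * norm w" by (intro mult_right_mono) auto
        then have "norm w \<le> norm (r *\<^sub>R z)" using w a by (simp add: r_def field_simps)
        then have "\<psi> (r *\<^sub>R z) \<le> \<psi> w" by (rule \<psi>_antimono)
        then have "\<psi> (r *\<^sub>R z) * ennreal (exp (- (1 * (norm z)\<^sup>2) / 2)) \<le> \<psi> w * ennreal (exp (- (1 * (norm z)\<^sup>2) / 2))"
          by (intro mult_right_mono) auto
        then show ?thesis unfolding \<psi>0 mult_1 by (rule order_trans) (rule le_iff_add[THEN iffD2], metis add.commute)
      next
        case False
        then have "(norm z)\<^sup>2 \<le> a\<^sup>2" by (intro power_mono) auto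
        then have "b * (norm z)\<^sup>2 \<le> b * a\<^sup>2" using b1 by (intro mult_left_mono) auto
        also have "\<dots> = 1" using b1 by (simp add: a_def power_divide)
        finally have "b * (norm z)\<^sup>2 \<le> 1" .
        then have "- (1 * (norm z)\<^sup>2) / 2 \<le> 1/2 + - (b * (norm z)\<^sup>2) / 2"
          using zero_le_power2[of "norm z"] by linarith
        then have "exp (- (1 * (norm z)\<^sup>2) / 2) \<le> exp (1/2) * exp (- (b * (norm z)\<^sup>2) / 2)"
          by (simp only: exp_add[symmetric] exp_le_cancel_iff)
        then have "\<psi> (r *\<^sub>R z) * ennreal (exp (- (1 * (norm z)\<^sup>2) / 2)) \<le> \<psi> (r *\<^sub>R z) * (ennreal (exp (1/2)) * ennreal (exp (- (b * (norm z)\<^sup>2) / 2)))"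
          by (intro mult_left_mono) (auto simp flip: ennreal_mult intro: ennreal_leI)
        also have "\<dots> = ennreal (exp (1/2)) * (\<psi> (r *\<^sub>R z) * ennreal (exp (- (b * (norm z)\<^sup>2) / 2)))"
          by (simp only: ac_simps)
        finally show ?thesis by (rule order_trans) (rule le_iff_add[THEN iffD2], blast)
      qed
    qed
    also have "\<dots> = ennreal (exp (1/2)) * (\<integral>\<^sup>+z. \<psi> (r *\<^sub>R z) * ennreal (exp (- (b * (norm z)\<^sup>2) / 2)) \<partial>lborel) +
        \<psi> w * (\<integral>\<^sup>+z. \<psi> (0 *\<^sub>R z) * ennreal (exp (- (1 * (norm z)\<^sup>2) / 2)) \<partial>lborel)"
      by (subst nn_integral_add) (auto simp: nn_integral_cmult)
    also have "\<dots> = ennreal (exp (1/2) * (?p * (r\<^sup>2 + b) powr (- real j / 2) * b powr (- real (CARD('n) - j) / 2))) + \<psi> w * ennreal ?p"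
      using b1 by (subst (1 2) \<psi>_gauss) (auto simp: ennreal_mult)
    also have "\<dots> \<le> ennreal (?p * (c1 * r powr (- real j))) + \<psi> w * ennreal ?p"
    proof (intro add_right_mono ennreal_leI)
      have "(r\<^sup>2 + b) powr (- real j / 2) \<le> (r powr 2) powr (- real j / 2)"
        using r b1 by (intro powr_mono2') (auto simp: powr_numeral)
      also have "\<dots> = r powr (- real j)" by (simp add: powr_powr)
      finally have "(r\<^sup>2 + b) powr (- real j / 2) * (exp (1/2) * b powr (- real (CARD('n) - j) / 2)) \<le> r powr (- real j) * c1"
        using bsmall by (intro mult_mono) auto
      then have "?p * ((r\<^sup>2 + b) powr (- real j / 2) * (exp (1/2) * b powr (- real (CARD('n) - j) / 2))) \<le> ?p * (r powr (- real j) * c1)"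
        by (intro mult_left_mono) auto
      then show "exp (1/2) * (?p * (r\<^sup>2 + b) powr (- real j / 2) * b powr (- real (CARD('n) - j) / 2)) \<le> ?p * (c1 * r powr (- real j))"
        by (simp only: mult_ac)
    qed
    finally have main: "ennreal (?p * (r\<^sup>2 + 1) powr (- real j / 2)) \<le> ennreal (?p * (c1 * r powr (- real j))) + \<psi> w * ennreal ?p" .
    have "2 * c1 * r powr (- real j) \<le> (r\<^sup>2 + 1) powr (- real j / 2)"
    proof -
      have "1 \<le> r\<^sup>2" using r by (simp add: one_le_power)
      then have "(2 * r powr 2) powr (- real j / 2) \<le> (r\<^sup>2 + 1) powr (- real j / 2)"
        using r by (intro powr_mono2') (auto simp: powr_numeral add_pos_nonneg)
      moreover have "(2 * r powr 2) powr (- real j / 2) = 2 powr (- real j / 2) * r powr (- real j)"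
        using r by (simp add: powr_mult powr_powr del: powr_numeral)
      ultimately show ?thesis by (simp add: c1_def)
    qed
    then have "?p * (2 * c1 * r powr (- real j)) \<le> ?p * (r\<^sup>2 + 1) powr (- real j / 2)"
      by (intro mult_left_mono) auto
    then have "ennreal (?p * (2 * c1 * r powr (- real j))) \<le> ennreal (?p * (c1 * r powr (- real j))) + \<psi> w * ennreal ?p"
      using main by (meson ennreal_leI order_trans)
    moreover have "ennreal (?p * (2 * c1 * r powr (- real j))) = ennreal (?p * (c1 * r powr (- real j))) + ennreal (?p * (c1 * r powr (- real j)))"
      using c1 by (subst ennreal_plus[symmetric]) auto
    ultimately have "ennreal (?p * (c1 * r powr (- real j))) \<le> \<psi> w * ennreal ?p"
      by (simp add: ennreal_add_left_cancel_le)
    then have "ennreal (?p * (c1 * r powr (- real j))) * ennreal (1 / ?p) \<le> \<psi> w * ennreal ?p * ennreal (1 / ?p)"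
      by (rule mult_right_mono) simp
    moreover have "\<psi> w * ennreal ?p * ennreal (1 / ?p) = \<psi> w"
      using p by (simp add: mult.assoc flip: ennreal_mult)
    moreover have "ennreal (?p * (c1 * r powr (- real j))) * ennreal (1 / ?p) = ennreal (c1 * r powr (- real j))"
      using p c1 by (simp flip: ennreal_mult)
    moreover have "r powr (- real j) = a powr real j * norm w powr (- real j)"
      using a by (simp add: r_def powr_divide powr_minus_divide)
    ultimately show ?thesis by (simp add: mult.assoc)
  qed
  then show thesis using that[of "c1 * a powr real j" a] c1 a by simp
qed

end

context haar_grassmannian
begin

sublocale proj: haar_form m \<gamma> "\<lambda>V z. (norm (orth_proj V z))\<^sup>2" m
proof
  show "(\<lambda>(V, z). (norm (orth_proj V z))\<^sup>2) \<in> borel_measurable (\<gamma> \<Otimes>\<^sub>M borel)" by measurable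
  fix V :: "(real^'n) set" assume V: "V \<in> grassmannian m"
  then have sV: "subspace V" by (rule grassmannian_subspace)
  show "(norm (orth_proj (f ` V) (f z)))\<^sup>2 = (norm (orth_proj V z))\<^sup>2" if "orthogonal_transformation f" for f :: "real^'n \<Rightarrow> real^'n" and z
    using that by (simp add: orth_proj_orthogonal_image[OF sV] orthogonal_transformation_norm)
  show "(norm (orth_proj V (c *\<^sub>R z)))\<^sup>2 = c\<^sup>2 * (norm (orth_proj V z))\<^sup>2" for c z
    using linear_orth_proj[OF sV] by (simp add: linear_scale power_mult_distrib)
  show "(\<integral>\<^sup>+z. ennreal (exp (- (a * (norm (orth_proj V z))\<^sup>2 + b * (norm z)\<^sup>2) / 2)) \<partial>lborel) =
      ennreal ((2 * pi) powr (CARD('n) / 2) * (a + b) powr (- real m / 2) * b powr (- real (CARD('n) - m) / 2))"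
    if "0 < b" "0 \<le> a" for a b
  proof -
    \<comment> \<open>Pythagoras turns weight \<open>b\<close> on the whole vector plus weight
      \<open>a\<close> on its projection into \<open>a + b\<close> on \<open>V\<close> and
      \<open>b\<close> across it.\<close>
    have "a * (norm (orth_proj V z))\<^sup>2 + b * (norm z)\<^sup>2 = (a + b) * (norm (orth_proj V z))\<^sup>2 + b * (norm (z - orth_proj V z))\<^sup>2" for z
      by (subst norm_orth_proj_Pythagoras[OF sV, of z]) (simp add: algebra_simps)
    then show ?thesis using nn_gauss_grassmannian[OF V, of "a + b" b] that by simp
  qed
qed simp

sublocale coproj: haar_form m \<gamma> "\<lambda>V z. (norm (z - orth_proj V z))\<^sup>2" "CARD('n) - m"
proof
  show "(\<lambda>(V, z). (norm (z - orth_proj V z))\<^sup>2) \<in> borel_measurable (\<gamma> \<Otimes>\<^sub>M borel)" by measurable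
  fix V :: "(real^'n) set" assume V: "V \<in> grassmannian m"
  then have sV: "subspace V" by (rule grassmannian_subspace)
  show "(norm (f z - orth_proj (f ` V) (f z)))\<^sup>2 = (norm (z - orth_proj V z))\<^sup>2" if f: "orthogonal_transformation f" for f :: "real^'n \<Rightarrow> real^'n" and z
  proof -
    have "f z - orth_proj (f ` V) (f z) = f (z - orth_proj V z)"
      using f by (simp add: orth_proj_orthogonal_image[OF sV] linear_diff orthogonal_transformation_linear)
    then show ?thesis using f by (simp add: orthogonal_transformation_norm)
  qed
  show "(norm (c *\<^sub>R z - orth_proj V (c *\<^sub>R z)))\<^sup>2 = c\<^sup>2 * (norm (z - orth_proj V z))\<^sup>2" for c z
    using linear_orth_proj[OF sV] by (simp add: linear_scale power_mult_distrib flip: scaleR_diff_right)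
  show "(\<integral>\<^sup>+z. ennreal (exp (- (a * (norm (z - orth_proj V z))\<^sup>2 + b * (norm z)\<^sup>2) / 2)) \<partial>lborel) =
      ennreal ((2 * pi) powr (CARD('n) / 2) * (a + b) powr (- real (CARD('n) - m) / 2) * b powr (- real (CARD('n) - (CARD('n) - m)) / 2))"
    if "0 < b" "0 \<le> a" for a b
  proof -
    have "a * (norm (z - orth_proj V z))\<^sup>2 + b * (norm z)\<^sup>2 = b * (norm (orth_proj V z))\<^sup>2 + (a + b) * (norm (z - orth_proj V z))\<^sup>2" for z
      by (subst norm_orth_proj_Pythagoras[OF sV, of z]) (simp add: algebra_simps)
    then show ?thesis using nn_gauss_grassmannian[OF V, of b "a + b"] that mn by (simp add: mult_ac)
  qed
qed simp

end

section \<open>Fourier transforms and projected measures\<close>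

definition fhat :: "(real^'n) measure \<Rightarrow> real^'n \<Rightarrow> complex" where
  "fhat \<mu> \<xi> = (CLINT x|\<mu>. cis (\<xi> \<bullet> x))"

lemma cis_measurable [measurable]:
  "f \<in> borel_measurable M \<Longrightarrow> (\<lambda>x. cis (f x)) \<in> borel_measurable M"
  unfolding cis_conv_exp by measurable

locale borel_finite = finite_measure \<mu> for \<mu> :: "(real^'n) measure" +
  assumes sets_eq: "sets \<mu> = sets borel"
begin

lemmas sets_cong [measurable_cong] = sets_eq

lemma space_UNIV [simp]: "space \<mu> = UNIV"
  using sets_eq_imp_space_eq[OF sets_eq] by simp

lemma fhat_measurable [measurable]: "fhat \<mu> \<in> borel_measurable borel"
  unfolding fhat_def by measurable

lemma fhat_bound: "norm (fhat \<mu> \<xi>) \<le> measure \<mu> UNIV"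
proof -
  have "norm (fhat \<mu> \<xi>) \<le> (\<integral>x. norm (cis (\<xi> \<bullet> x)) \<partial>\<mu>)"
    unfolding fhat_def by (rule integral_norm_bound)
  then show ?thesis by simp
qed

end

lemma pair_borel_finite:
  assumes "borel_finite \<mu>" "borel_finite \<nu>"
  shows "pair_sigma_finite \<mu> \<nu>" "finite_measure (\<mu> \<Otimes>\<^sub>M \<nu>)" "space (\<mu> \<Otimes>\<^sub>M \<nu>) = UNIV"
    "measure (\<mu> \<Otimes>\<^sub>M \<nu>) UNIV = measure \<mu> UNIV * measure \<nu> UNIV"
    "sets (\<mu> \<Otimes>\<^sub>M \<nu>) = sets (borel \<Otimes>\<^sub>M borel)"
proof -
  interpret A: borel_finite \<mu> by fact
  interpret B: borel_finite \<nu> by fact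
  show "pair_sigma_finite \<mu> \<nu>" ..
  then interpret P: pair_sigma_finite \<mu> \<nu> .
  show sp: "space (\<mu> \<Otimes>\<^sub>M \<nu>) = UNIV" by (simp add: space_pair_measure)
  have e: "emeasure (\<mu> \<Otimes>\<^sub>M \<nu>) (UNIV \<times> UNIV) = emeasure \<mu> UNIV * emeasure \<nu> UNIV"
    by (rule B.emeasure_pair_measure_Times) (auto simp: A.sets_eq B.sets_eq)
  then have e': "emeasure (\<mu> \<Otimes>\<^sub>M \<nu>) UNIV = ennreal (measure \<mu> UNIV * measure \<nu> UNIV)"
    by (simp add: A.emeasure_eq_measure B.emeasure_eq_measure ennreal_mult)
  show "finite_measure (\<mu> \<Otimes>\<^sub>M \<nu>)"
    by (rule finite_measureI) (simp add: sp e')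
  show "measure (\<mu> \<Otimes>\<^sub>M \<nu>) UNIV = measure \<mu> UNIV * measure \<nu> UNIV"
    using e' by (simp add: measure_def)
  show "sets (\<mu> \<Otimes>\<^sub>M \<nu>) = sets (borel \<Otimes>\<^sub>M borel)"
    by (rule sets_pair_measure_cong) (auto simp: A.sets_eq B.sets_eq)
qed

lemma fhat_mult_cnj:
  assumes \<mu>: "borel_finite \<mu>" and \<nu>: "borel_finite \<nu>"
  shows "fhat \<mu> \<eta> * cnj (fhat \<nu> \<eta>) = (CLINT p|(\<mu> \<Otimes>\<^sub>M \<nu>). cis (\<eta> \<bullet> (fst p - snd p)))"
proof -
  interpret A: borel_finite \<mu> by fact
  interpret B: borel_finite \<nu> by fact
  interpret P: pair_sigma_finite \<mu> \<nu> using pair_borel_finite[OF \<mu> \<nu>] by simp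
  interpret F: finite_measure "\<mu> \<Otimes>\<^sub>M \<nu>" using pair_borel_finite[OF \<mu> \<nu>] by simp
  note [measurable_cong] = A.sets_eq B.sets_eq
  have i: "integrable (\<mu> \<Otimes>\<^sub>M \<nu>) (\<lambda>(x, y). cis (\<eta> \<bullet> (x - y)))"
    by (rule F.integrable_const_bound[of _ 1]) (auto simp: split_beta)
  have "cnj (fhat \<nu> \<eta>) = (CLINT y|\<nu>. cis (- (\<eta> \<bullet> y)))"
    using Bochner_Integration.integral_cnj[of \<nu> "\<lambda>y. cis (\<eta> \<bullet> y)"] by (simp add: fhat_def cis_cnj)
  then have "fhat \<mu> \<eta> * cnj (fhat \<nu> \<eta>) = (CLINT x|\<mu>. cis (\<eta> \<bullet> x) * (CLINT y|\<nu>. cis (- (\<eta> \<bullet> y))))"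
    by (simp add: fhat_def)
  also have "\<dots> = (CLINT x|\<mu>. CLINT y|\<nu>. cis (\<eta> \<bullet> (x - y)))"
    by (simp add: cis_mult inner_diff_right flip: integral_mult_right_zero)
  also have "\<dots> = (CLINT p|(\<mu> \<Otimes>\<^sub>M \<nu>). (\<lambda>(x, y). cis (\<eta> \<bullet> (x - y))) p)"
    using P.integral_fst[OF i] by simp
  finally show ?thesis by (simp add: split_beta)
qed

text \<open>\<open>T\<close> will be the projection to a plane or the identity; as
  \<open>cis\<close> is bounded and both measures are finite, integrability of \<open>g\<close> is
  enough for the exchange.\<close>

lemma fhat_Fubini:
  fixes T :: "real^'n \<Rightarrow> real^'n" and g :: "real^'n \<Rightarrow> real"
  assumes \<mu>: "borel_finite \<mu>" and \<nu>: "borel_finite \<nu>" and T [measurable]: "T \<in> borel_measurable borel"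
    and g: "integrable lborel g"
  shows "(CLINT \<xi>|lborel. g \<xi> *\<^sub>R (fhat \<mu> (T \<xi>) * cnj (fhat \<nu> (T \<xi>)))) =
    (CLINT p|(\<mu> \<Otimes>\<^sub>M \<nu>). CLINT \<xi>|lborel. g \<xi> *\<^sub>R cis (T \<xi> \<bullet> (fst p - snd p)))"
proof -
  interpret A: borel_finite \<mu> by fact
  interpret B: borel_finite \<nu> by fact
  interpret F: finite_measure "\<mu> \<Otimes>\<^sub>M \<nu>" using pair_borel_finite[OF \<mu> \<nu>] by simp
  note [measurable_cong] = A.sets_eq B.sets_eq
  interpret P: pair_sigma_finite "lborel :: (real^'n) measure" "\<mu> \<Otimes>\<^sub>M \<nu>" ..
  have [measurable]: "g \<in> borel_measurable borel" using g by simp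
  have i: "integrable (lborel \<Otimes>\<^sub>M (\<mu> \<Otimes>\<^sub>M \<nu>)) (\<lambda>(\<xi>, p). g \<xi> *\<^sub>R cis (T \<xi> \<bullet> (fst p - snd p)))"
  proof (rule P.Fubini_integrable)
    show "(\<lambda>(\<xi>, p). g \<xi> *\<^sub>R cis (T \<xi> \<bullet> (fst p - snd p))) \<in> borel_measurable (lborel \<Otimes>\<^sub>M (\<mu> \<Otimes>\<^sub>M \<nu>))"
      by measurable
    show "integrable lborel (\<lambda>\<xi>. \<integral>p. norm (case (\<xi>, p) of (\<xi>, p) \<Rightarrow> g \<xi> *\<^sub>R cis (T \<xi> \<bullet> (fst p - snd p))) \<partial>(\<mu> \<Otimes>\<^sub>M \<nu>))"
      using g by simp
    show "AE \<xi> in lborel. integrable (\<mu> \<Otimes>\<^sub>M \<nu>) (\<lambda>p. case (\<xi>, p) of (\<xi>, p) \<Rightarrow> g \<xi> *\<^sub>R cis (T \<xi> \<bullet> (fst p - snd p)))"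
    proof (rule AE_I2)
      fix \<xi>
      show "integrable (\<mu> \<Otimes>\<^sub>M \<nu>) (\<lambda>p. case (\<xi>, p) of (\<xi>, p) \<Rightarrow> g \<xi> *\<^sub>R cis (T \<xi> \<bullet> (fst p - snd p)))"
        by (rule F.integrable_const_bound[of _ "\<bar>g \<xi>\<bar>"]) auto
    qed
  qed
  have "(CLINT \<xi>|lborel. g \<xi> *\<^sub>R (fhat \<mu> (T \<xi>) * cnj (fhat \<nu> (T \<xi>)))) =
     (CLINT \<xi>|lborel. CLINT p|(\<mu> \<Otimes>\<^sub>M \<nu>). g \<xi> *\<^sub>R cis (T \<xi> \<bullet> (fst p - snd p)))"
    unfolding fhat_mult_cnj[OF \<mu> \<nu>] by simp
  also have "\<dots> = (CLINT p|(\<mu> \<Otimes>\<^sub>M \<nu>). CLINT \<xi>|lborel. g \<xi> *\<^sub>R cis (T \<xi> \<bullet> (fst p - snd p)))"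
    using P.Fubini_integral[OF i] by simp
  finally show ?thesis .
qed

text \<open>Up to the factor \<open>\<tau> powr (- m / 2)\<close> this is the mass near the diagonal of the pair of projected measures.\<close>

definition overlap :: "(real^'n) set \<Rightarrow> real \<Rightarrow> (real^'n) measure \<Rightarrow> (real^'n) measure \<Rightarrow> real" where
  "overlap V \<tau> \<mu> \<nu> = (\<integral>p. exp (- (norm (orth_proj V (fst p - snd p)))\<^sup>2 / (2 * \<tau>)) \<partial>(\<mu> \<Otimes>\<^sub>M \<nu>))"

text \<open>Functions of \<open>orth_proj V \<xi>\<close> are integrated over \<open>V\<close> by means of \<open>lborel\<close> on the whole space, with this
  Gaussian weight in the directions orthogonal to \<open>V\<close>; no measure on \<open>V\<close> itself is needed.\<close>

abbreviation tgauss :: "(real^'n) set \<Rightarrow> real^'n \<Rightarrow> real" where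
  "tgauss V \<xi> \<equiv> exp (- (norm (\<xi> - orth_proj V \<xi>))\<^sup>2 / 2)"

text \<open>The projection is self-adjoint, so the phase
  \<open>orth_proj V \<xi> \<bullet> (x - y)\<close> can be read as \<open>\<xi>\<close> paired with
  the projection of \<open>x - y\<close>. The Gaussian formula then applies with weights
  \<open>\<tau>\<close> on \<open>V\<close> and 1 across it, and the transverse part of that
  projection is zero.\<close>

lemma overlap_fhat:
  fixes V :: "(real^'n) set"
  assumes \<mu>: "borel_finite \<mu>" and \<nu>: "borel_finite \<nu>" and V: "V \<in> grassmannian m" and \<tau>: "0 < \<tau>"
  shows "(CLINT \<xi>|lborel. (exp (- (\<tau> * (norm (orth_proj V \<xi>))\<^sup>2) / 2) * tgauss V \<xi>) *\<^sub>R
      (fhat \<mu> (orth_proj V \<xi>) * cnj (fhat \<nu> (orth_proj V \<xi>)))) =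
    of_real ((2 * pi) powr (CARD('n) / 2) * \<tau> powr (- real m / 2) * overlap V \<tau> \<mu> \<nu>)"
proof -
  have sV: "subspace V" using V by (rule grassmannian_subspace)
  let ?g = "\<lambda>\<xi>. exp (- (\<tau> * (norm (orth_proj V \<xi>))\<^sup>2 + 1 * (norm (\<xi> - orth_proj V \<xi>))\<^sup>2) / 2)"
  have g_eq: "exp (- (\<tau> * (norm (orth_proj V \<xi>))\<^sup>2) / 2) * tgauss V \<xi> = ?g \<xi>" for \<xi>
    by (simp add: add_divide_distrib flip: exp_add)
  have gi: "integrable lborel ?g"
    using integrable_norm[OF gauss_grassmannian(2)[OF V \<tau>, of 1 0]] by simp
  have "(CLINT \<xi>|lborel. ?g \<xi> *\<^sub>R (fhat \<mu> (orth_proj V \<xi>) * cnj (fhat \<nu> (orth_proj V \<xi>)))) =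
    (CLINT p|(\<mu> \<Otimes>\<^sub>M \<nu>). CLINT \<xi>|lborel. ?g \<xi> *\<^sub>R cis (orth_proj V \<xi> \<bullet> (fst p - snd p)))"
    by (rule fhat_Fubini[OF \<mu> \<nu> borel_measurable_orth_proj[OF sV] gi])
  also have "\<dots> = (CLINT p|(\<mu> \<Otimes>\<^sub>M \<nu>). of_real ((2 * pi) powr (CARD('n) / 2) * \<tau> powr (- real m / 2) *
      exp (- (norm (orth_proj V (fst p - snd p)))\<^sup>2 / (2 * \<tau>))))"
  proof (rule Bochner_Integration.integral_cong)
    fix p :: "(real^'n) \<times> (real^'n)"
    let ?z = "orth_proj V (fst p - snd p)"
    have "(CLINT \<xi>|lborel. ?g \<xi> *\<^sub>R cis (orth_proj V \<xi> \<bullet> (fst p - snd p))) = (CLINT \<xi>|lborel. ?g \<xi> *\<^sub>R cis (\<xi> \<bullet> ?z))"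
      by (simp only: orth_proj_inner[OF sV])
    also have "\<dots> = of_real ((2 * pi) powr (CARD('n) / 2) * \<tau> powr (- real m / 2) * exp (- (norm ?z)\<^sup>2 / (2 * \<tau>)))"
      by (subst gauss_grassmannian(1)[OF V \<tau>]) (simp_all add: sV)
    finally show "(CLINT \<xi>|lborel. ?g \<xi> *\<^sub>R cis (orth_proj V \<xi> \<bullet> (fst p - snd p))) =
      of_real ((2 * pi) powr (CARD('n) / 2) * \<tau> powr (- real m / 2) * exp (- (norm ?z)\<^sup>2 / (2 * \<tau>)))" .
  qed simp
  also have "\<dots> = of_real ((2 * pi) powr (CARD('n) / 2) * \<tau> powr (- real m / 2) * overlap V \<tau> \<mu> \<nu>)"
    unfolding overlap_def by simp
  finally show ?thesis by (simp only: g_eq)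
qed

lemma nn_overlap_fhat:
  fixes V :: "(real^'n) set"
  assumes \<mu>: "borel_finite \<mu>" and V: "V \<in> grassmannian m" and \<tau>: "0 < \<tau>"
  shows "(\<integral>\<^sup>+\<xi>. ennreal (exp (- (\<tau> * (norm (orth_proj V \<xi>))\<^sup>2) / 2) * tgauss V \<xi> * (norm (fhat \<mu> (orth_proj V \<xi>)))\<^sup>2) \<partial>lborel) =
    ennreal ((2 * pi) powr (CARD('n) / 2) * \<tau> powr (- real m / 2) * overlap V \<tau> \<mu> \<mu>)"
proof -
  interpret A: borel_finite \<mu> by fact
  have sV: "subspace V" using V by (rule grassmannian_subspace)
  note [measurable] = borel_measurable_orth_proj[OF sV]
  let ?h = "\<lambda>\<xi>. exp (- (\<tau> * (norm (orth_proj V \<xi>))\<^sup>2) / 2) * tgauss V \<xi> * (norm (fhat \<mu> (orth_proj V \<xi>)))\<^sup>2"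
  let ?g = "\<lambda>\<xi>. exp (- (\<tau> * (norm (orth_proj V \<xi>))\<^sup>2 + 1 * (norm (\<xi> - orth_proj V \<xi>))\<^sup>2) / 2)"
  have g_eq: "exp (- (\<tau> * (norm (orth_proj V \<xi>))\<^sup>2) / 2) * tgauss V \<xi> = ?g \<xi>" for \<xi>
    by (simp add: add_divide_distrib flip: exp_add)
  have gi: "integrable lborel ?g"
    using integrable_norm[OF gauss_grassmannian(2)[OF V \<tau>, of 1 0]] by simp
  have hi: "integrable lborel ?h"
  proof (rule Bochner_Integration.integrable_bound)
    show "integrable lborel (\<lambda>\<xi>. (measure \<mu> UNIV)\<^sup>2 * ?g \<xi>)" using gi by simp
    show "?h \<in> borel_measurable lborel" by measurable
    show "AE \<xi> in lborel. norm (?h \<xi>) \<le> norm ((measure \<mu> UNIV)\<^sup>2 * ?g \<xi>)"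
    proof (rule AE_I2)
      fix \<xi>
      have "?h \<xi> = ?g \<xi> * (norm (fhat \<mu> (orth_proj V \<xi>)))\<^sup>2" by (simp only: g_eq)
      also have "\<dots> \<le> ?g \<xi> * (measure \<mu> UNIV)\<^sup>2"
        by (intro mult_left_mono power_mono A.fhat_bound) auto
      finally show "norm (?h \<xi>) \<le> norm ((measure \<mu> UNIV)\<^sup>2 * ?g \<xi>)" by (simp add: mult.commute)
    qed
  qed
  have "complex_of_real (LINT \<xi>|lborel. ?h \<xi>) = (CLINT \<xi>|lborel. of_real (?h \<xi>))"
    by (rule integral_complex_of_real[symmetric])
  also have "\<dots> = (CLINT \<xi>|lborel. (exp (- (\<tau> * (norm (orth_proj V \<xi>))\<^sup>2) / 2) * tgauss V \<xi>) *\<^sub>R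
      (fhat \<mu> (orth_proj V \<xi>) * cnj (fhat \<mu> (orth_proj V \<xi>))))"
    by (rule Bochner_Integration.integral_cong) (simp_all add: scaleR_conv_of_real flip: complex_norm_square)
  also have "\<dots> = of_real ((2 * pi) powr (CARD('n) / 2) * \<tau> powr (- real m / 2) * overlap V \<tau> \<mu> \<mu>)"
    by (rule overlap_fhat[OF \<mu> \<mu> V \<tau>])
  finally have "(LINT \<xi>|lborel. ?h \<xi>) = (2 * pi) powr (CARD('n) / 2) * \<tau> powr (- real m / 2) * overlap V \<tau> \<mu> \<mu>"
    by (simp only: of_real_eq_iff)
  then show ?thesis using nn_integral_eq_integral[OF hi] by simp
qed

lemma nn_overlap:
  assumes \<mu>: "borel_finite \<mu>" and \<nu>: "borel_finite \<nu>" and V: "subspace V" and \<tau>: "0 < \<tau>"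
  shows "ennreal (overlap V \<tau> \<mu> \<nu>) = (\<integral>\<^sup>+p. ennreal (exp (- (norm (orth_proj V (fst p - snd p)))\<^sup>2 / (2 * \<tau>))) \<partial>(\<mu> \<Otimes>\<^sub>M \<nu>))"
    and "0 \<le> overlap V \<tau> \<mu> \<nu>"
proof -
  interpret A: borel_finite \<mu> by fact
  interpret B: borel_finite \<nu> by fact
  interpret F: finite_measure "\<mu> \<Otimes>\<^sub>M \<nu>" using pair_borel_finite[OF \<mu> \<nu>] by simp
  note [measurable_cong] = A.sets_eq B.sets_eq
  note [measurable] = borel_measurable_orth_proj[OF V]
  have i: "integrable (\<mu> \<Otimes>\<^sub>M \<nu>) (\<lambda>p. exp (- (norm (orth_proj V (fst p - snd p)))\<^sup>2 / (2 * \<tau>)))"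
    by (rule F.integrable_const_bound[of _ 1]) (use \<tau> in auto)
  show "ennreal (overlap V \<tau> \<mu> \<nu>) = (\<integral>\<^sup>+p. ennreal (exp (- (norm (orth_proj V (fst p - snd p)))\<^sup>2 / (2 * \<tau>))) \<partial>(\<mu> \<Otimes>\<^sub>M \<nu>))"
    unfolding overlap_def using nn_integral_eq_integral[OF i] by simp
  show "0 \<le> overlap V \<tau> \<mu> \<nu>" unfolding overlap_def by simp
qed

text \<open>The full space is covered by taking equal weights on \<open>V\<close> and its complement.\<close>

lemma nn_fhat_space:
  fixes V :: "(real^'n) set" and \<mu> :: "(real^'n) measure"
  assumes \<mu>: "borel_finite \<mu>" and V: "V \<in> grassmannian m" and m: "m \<le> CARD('n)" and \<tau>: "0 < \<tau>"
  shows "(\<integral>\<^sup>+\<eta>. ennreal (exp (- (\<tau> * (norm \<eta>)\<^sup>2) / 2) * (norm (fhat \<mu> \<eta>))\<^sup>2) \<partial>lborel) =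
    ennreal ((2 * pi) powr (CARD('n) / 2) * \<tau> powr (- real (CARD('n)) / 2)) *
      (\<integral>\<^sup>+p. ennreal (exp (- (norm (fst p - snd p))\<^sup>2 / (2 * \<tau>))) \<partial>(\<mu> \<Otimes>\<^sub>M \<mu>))"
proof -
  interpret A: borel_finite \<mu> by fact
  interpret F: finite_measure "\<mu> \<Otimes>\<^sub>M \<mu>" using pair_borel_finite[OF \<mu> \<mu>] by simp
  note [measurable_cong] = A.sets_eq
  have sV: "subspace V" using V by (rule grassmannian_subspace)
  let ?c = "(2 * pi) powr (CARD('n) / 2) * \<tau> powr (- real (CARD('n)) / 2)"
  let ?g = "\<lambda>\<eta>::real^'n. exp (- (\<tau> * (norm \<eta>)\<^sup>2) / 2)"
  have g_eq: "exp (- (\<tau> * (norm (orth_proj V \<xi>))\<^sup>2 + \<tau> * (norm (\<xi> - orth_proj V \<xi>))\<^sup>2) / 2) = ?g \<xi>" for \<xi>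
    using norm_orth_proj_Pythagoras[OF sV, of \<xi>] by (simp flip: distrib_left)
  have e_eq: "- ((norm (orth_proj V z))\<^sup>2 / (2 * \<tau>)) - (norm (z - orth_proj V z))\<^sup>2 / (2 * \<tau>) = - (norm z)\<^sup>2 / (2 * \<tau>)" for z
    using norm_orth_proj_Pythagoras[OF sV, of z] by (simp add: add_divide_distrib diff_divide_distrib)
  have p_eq: "\<tau> powr (- real m / 2) * \<tau> powr (- real (CARD('n) - m) / 2) = \<tau> powr (- real (CARD('n)) / 2)"
    using m \<tau> by (simp add: of_nat_diff field_simps flip: powr_add)
  have G1: "(CLINT \<xi>|lborel. ?g \<xi> *\<^sub>R cis (\<xi> \<bullet> z)) = of_real (?c * exp (- (norm z)\<^sup>2 / (2 * \<tau>)))" for z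
    using gauss_grassmannian(1)[OF V \<tau> \<tau>, of z] unfolding g_eq e_eq mult.assoc[of "(2 * pi) powr _"] p_eq .
  have G2: "integrable lborel ?g"
    using integrable_norm[OF gauss_grassmannian(2)[OF V \<tau> \<tau>, of 0]] unfolding g_eq by simp
  have hi: "integrable lborel (\<lambda>\<eta>. ?g \<eta> * (norm (fhat \<mu> \<eta>))\<^sup>2)"
  proof (rule Bochner_Integration.integrable_bound)
    show "integrable lborel (\<lambda>\<xi>. (measure \<mu> UNIV)\<^sup>2 * ?g \<xi>)" using G2 by simp
    show "AE \<xi> in lborel. norm (?g \<xi> * (norm (fhat \<mu> \<xi>))\<^sup>2) \<le> norm ((measure \<mu> UNIV)\<^sup>2 * ?g \<xi>)"
    proof (rule AE_I2)
      fix \<xi> :: "real^'n"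
      have "?g \<xi> * (norm (fhat \<mu> \<xi>))\<^sup>2 \<le> ?g \<xi> * (measure \<mu> UNIV)\<^sup>2"
        by (intro mult_left_mono power_mono A.fhat_bound) auto
      then show "norm (?g \<xi> * (norm (fhat \<mu> \<xi>))\<^sup>2) \<le> norm ((measure \<mu> UNIV)\<^sup>2 * ?g \<xi>)" by (simp add: mult.commute)
    qed
  qed measurable
  have ei: "integrable (\<mu> \<Otimes>\<^sub>M \<mu>) (\<lambda>p. exp (- (norm (fst p - snd p))\<^sup>2 / (2 * \<tau>)))"
    by (rule F.integrable_const_bound[of _ 1]) (use \<tau> in auto)
  have "complex_of_real (LINT \<xi>|lborel. ?g \<xi> * (norm (fhat \<mu> \<xi>))\<^sup>2) = (CLINT \<xi>|lborel. of_real (?g \<xi> * (norm (fhat \<mu> \<xi>))\<^sup>2))"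
    by (rule integral_complex_of_real[symmetric])
  also have "\<dots> = (CLINT \<xi>|lborel. ?g \<xi> *\<^sub>R (fhat \<mu> \<xi> * cnj (fhat \<mu> \<xi>)))"
    by (rule Bochner_Integration.integral_cong) (simp_all add: scaleR_conv_of_real flip: complex_norm_square)
  also have "\<dots> = (CLINT p|(\<mu> \<Otimes>\<^sub>M \<mu>). CLINT \<xi>|lborel. ?g \<xi> *\<^sub>R cis (\<xi> \<bullet> (fst p - snd p)))"
    by (rule fhat_Fubini[OF \<mu> \<mu> _ G2]) simp
  also have "\<dots> = of_real (?c * (LINT p|(\<mu> \<Otimes>\<^sub>M \<mu>). exp (- (norm (fst p - snd p))\<^sup>2 / (2 * \<tau>))))"
    unfolding G1 by simp
  finally have "(LINT \<xi>|lborel. ?g \<xi> * (norm (fhat \<mu> \<xi>))\<^sup>2) = ?c * (LINT p|(\<mu> \<Otimes>\<^sub>M \<mu>). exp (- (norm (fst p - snd p))\<^sup>2 / (2 * \<tau>)))"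
    by (simp only: of_real_eq_iff)
  then show ?thesis
    using nn_integral_eq_integral[OF hi] nn_integral_eq_integral[OF ei] by (simp add: ennreal_mult)
qed

definition damp :: "(real^'n) measure \<Rightarrow> (real^'n) measure" where
  "damp \<mu> = density \<mu> (\<lambda>x. ennreal (exp (- (norm x)\<^sup>2 / 2)))"

lemma damp_borel_finite:
  assumes "borel_finite \<mu>"
  shows "borel_finite (damp \<mu>)"
proof -
  interpret A: borel_finite \<mu> by fact
  have "emeasure (damp \<mu>) UNIV = (\<integral>\<^sup>+x. ennreal (exp (- (norm x)\<^sup>2 / 2)) * indicator UNIV x \<partial>\<mu>)"
    unfolding damp_def by (rule emeasure_density) (auto simp: A.sets_eq)
  also have "\<dots> \<le> (\<integral>\<^sup>+x. 1 \<partial>\<mu>)" by (intro nn_integral_mono) auto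
  also have "\<dots> < \<infinity>" by (simp add: A.emeasure_eq_measure)
  finally have "emeasure (damp \<mu>) (space (damp \<mu>)) \<noteq> \<infinity>" by (simp add: damp_def)
  then have "finite_measure (damp \<mu>)" by (rule finite_measureI)
  then show ?thesis
    by (simp add: borel_finite_def borel_finite_axioms_def damp_def A.sets_eq)
qed

text \<open>Multiplying \<open>\<mu>\<close> by a Gaussian convolves its Fourier transform with a Gaussian, so that the values
  of the transform on a plane are controlled by its values on a neighbourhood of the plane.\<close>

lemma fhat_damp_le:
  fixes \<mu> :: "(real^'n) measure" and V :: "(real^'n) set"
  assumes \<mu>: "borel_finite \<mu>" and V: "V \<in> grassmannian m"
  shows "ennreal ((norm (fhat (damp \<mu>) \<xi>))\<^sup>2) \<le> ennreal ((2 * pi) powr (- (CARD('n) / 2))) *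
    (\<integral>\<^sup>+\<eta>. ennreal (exp (- (norm (\<eta> - \<xi>))\<^sup>2 / 2) * (norm (fhat \<mu> \<eta>))\<^sup>2) \<partial>lborel)"
proof -
  interpret A: borel_finite \<mu> by fact
  note [measurable_cong] = A.sets_eq
  have sV: "subspace V" using V by (rule grassmannian_subspace)
  interpret P: pair_sigma_finite "lborel :: (real^'n) measure" \<mu> ..
  let ?p = "(2 * pi) powr (CARD('n) / 2)"
  let ?q = "(2 * pi) powr (- (CARD('n) / 2))"
  have qp: "?q * ?p = 1" by (simp flip: powr_add)
  define G where "G \<zeta> = ?q * exp (- (norm \<zeta>)\<^sup>2 / 2)" for \<zeta> :: "real^'n"
  have Gpos: "0 \<le> G \<zeta>" for \<zeta> by (simp add: G_def)
  have Gm [measurable]: "G \<in> borel_measurable borel" unfolding G_def by measurable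
  have g_eq: "exp (- (1 * (norm (orth_proj V \<xi>))\<^sup>2 + 1 * (norm (\<xi> - orth_proj V \<xi>))\<^sup>2) / 2) = exp (- (norm \<xi>)\<^sup>2 / 2)" for \<xi>
    using norm_orth_proj_Pythagoras[OF sV, of \<xi>] by simp
  have e_eq: "- ((norm (orth_proj V z))\<^sup>2 / (2 * 1)) - (norm (z - orth_proj V z))\<^sup>2 / (2 * 1) = - (norm z)\<^sup>2 / 2" for z
    using norm_orth_proj_Pythagoras[OF sV, of z] by (simp add: add_divide_distrib diff_divide_distrib)
  have Gft: "(CLINT \<zeta>|lborel. G \<zeta> *\<^sub>R cis (\<zeta> \<bullet> z)) = of_real (exp (- (norm z)\<^sup>2 / 2))" for z
  proof -
    have "(CLINT \<zeta>|lborel. G \<zeta> *\<^sub>R cis (\<zeta> \<bullet> z)) = ?q *\<^sub>R (CLINT \<zeta>|lborel. exp (- (norm \<zeta>)\<^sup>2 / 2) *\<^sub>R cis (\<zeta> \<bullet> z))"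
      by (simp add: G_def flip: scaleR_scaleR)
    also have "\<dots> = ?q *\<^sub>R of_real (?p * exp (- (norm z)\<^sup>2 / 2))"
      using gauss_grassmannian(1)[OF V zero_less_one zero_less_one, of z] unfolding g_eq e_eq by simp
    also have "\<dots> = of_real ((?q * ?p) * exp (- (norm z)\<^sup>2 / 2))" by (simp add: scaleR_conv_of_real)
    finally show ?thesis by (simp only: qp mult_1)
  qed
  have Gi: "integrable lborel G"
    unfolding G_def using integrable_norm[OF gauss_grassmannian(2)[OF V zero_less_one zero_less_one, of 0]] unfolding g_eq by simp
  have G1: "(LINT \<zeta>|lborel. G \<zeta>) = 1"
  proof -
    have "complex_of_real (LINT \<zeta>|lborel. G \<zeta>) = (CLINT \<zeta>|lborel. G \<zeta> *\<^sub>R cis (\<zeta> \<bullet> 0))"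
      by (simp add: scaleR_conv_of_real flip: integral_complex_of_real)
    also have "\<dots> = 1" unfolding Gft by simp
    finally show ?thesis by simp
  qed
  have rep: "fhat (damp \<mu>) \<xi> = (CLINT \<zeta>|lborel. G \<zeta> *\<^sub>R fhat \<mu> (\<xi> + \<zeta>))"
  proof -
    have "fhat (damp \<mu>) \<xi> = (CLINT x|\<mu>. exp (- (norm x)\<^sup>2 / 2) *\<^sub>R cis (\<xi> \<bullet> x))"
      unfolding fhat_def damp_def by (rule integral_density) auto
    also have "\<dots> = (CLINT x|\<mu>. CLINT \<zeta>|lborel. G \<zeta> *\<^sub>R cis ((\<xi> + \<zeta>) \<bullet> x))"
    proof (rule Bochner_Integration.integral_cong)
      fix x
      have "exp (- (norm x)\<^sup>2 / 2) *\<^sub>R cis (\<xi> \<bullet> x) = (CLINT \<zeta>|lborel. G \<zeta> *\<^sub>R cis (\<zeta> \<bullet> x)) * cis (\<xi> \<bullet> x)"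
        unfolding Gft by (simp add: scaleR_conv_of_real)
      also have "\<dots> = (CLINT \<zeta>|lborel. G \<zeta> *\<^sub>R cis ((\<xi> + \<zeta>) \<bullet> x))"
        by (subst integral_mult_left_zero[symmetric]) (simp add: inner_add_left cis_mult add.commute)
      finally show "exp (- (norm x)\<^sup>2 / 2) *\<^sub>R cis (\<xi> \<bullet> x) = (CLINT \<zeta>|lborel. G \<zeta> *\<^sub>R cis ((\<xi> + \<zeta>) \<bullet> x))" .
    qed simp
    also have "\<dots> = (CLINT \<zeta>|lborel. CLINT x|\<mu>. G \<zeta> *\<^sub>R cis ((\<xi> + \<zeta>) \<bullet> x))"
    proof (rule P.Fubini_integral)
      show "integrable (lborel \<Otimes>\<^sub>M \<mu>) (\<lambda>(\<zeta>, x). G \<zeta> *\<^sub>R cis ((\<xi> + \<zeta>) \<bullet> x))"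
      proof (rule P.Fubini_integrable)
        show "integrable lborel (\<lambda>\<zeta>. \<integral>x. norm (case (\<zeta>, x) of (\<zeta>, x) \<Rightarrow> G \<zeta> *\<^sub>R cis ((\<xi> + \<zeta>) \<bullet> x)) \<partial>\<mu>)"
          using Gi by simp
        show "AE \<zeta> in lborel. integrable \<mu> (\<lambda>x. case (\<zeta>, x) of (\<zeta>, x) \<Rightarrow> G \<zeta> *\<^sub>R cis ((\<xi> + \<zeta>) \<bullet> x))"
        proof (rule AE_I2)
          fix \<zeta>
          show "integrable \<mu> (\<lambda>x. case (\<zeta>, x) of (\<zeta>, x) \<Rightarrow> G \<zeta> *\<^sub>R cis ((\<xi> + \<zeta>) \<bullet> x))"
            by (rule A.integrable_const_bound[of _ "\<bar>G \<zeta>\<bar>"]) auto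
        qed
      qed measurable
    qed
    also have "\<dots> = (CLINT \<zeta>|lborel. G \<zeta> *\<^sub>R fhat \<mu> (\<xi> + \<zeta>))"
      by (simp add: fhat_def)
    finally show ?thesis .
  qed
  let ?M = "measure \<mu> UNIV"
  let ?f = "\<lambda>\<zeta>. norm (fhat \<mu> (\<xi> + \<zeta>))"
  have i1: "integrable lborel (\<lambda>\<zeta>. G \<zeta> * ?f \<zeta>)"
  proof (rule Bochner_Integration.integrable_bound)
    show "integrable lborel (\<lambda>\<zeta>. ?M * G \<zeta>)" using Gi by simp
    show "AE \<zeta> in lborel. norm (G \<zeta> * ?f \<zeta>) \<le> norm (?M * G \<zeta>)"
      using Gpos A.fhat_bound by (auto intro!: AE_I2 mult_left_mono simp: abs_mult mult.commute)
  qed measurable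
  have i2: "integrable lborel (\<lambda>\<zeta>. G \<zeta> * (?f \<zeta>)\<^sup>2)"
  proof (rule Bochner_Integration.integrable_bound)
    show "integrable lborel (\<lambda>\<zeta>. ?M\<^sup>2 * G \<zeta>)" using Gi by simp
    show "AE \<zeta> in lborel. norm (G \<zeta> * (?f \<zeta>)\<^sup>2) \<le> norm (?M\<^sup>2 * G \<zeta>)"
      using Gpos A.fhat_bound by (auto intro!: AE_I2 mult_left_mono power_mono simp: abs_mult mult.commute)
  qed measurable
  define c where "c = (LINT \<zeta>|lborel. G \<zeta> * ?f \<zeta>)"
  have nc: "norm (fhat (damp \<mu>) \<xi>) \<le> c"
    unfolding rep c_def using integral_norm_bound[of lborel "\<lambda>\<zeta>. G \<zeta> *\<^sub>R fhat \<mu> (\<xi> + \<zeta>)"] Gpos by simp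
  \<comment> \<open>Jensen's inequality for the probability density \<open>G\<close>, by expanding
    the integral of \<open>G\<close> times the squared deviation from the mean
    \<open>c\<close>.\<close>
  have "0 \<le> (LINT \<zeta>|lborel. G \<zeta> * (?f \<zeta> - c)\<^sup>2)" using Gpos by (intro integral_nonneg_AE) auto
  also have "\<dots> = (LINT \<zeta>|lborel. G \<zeta> * (?f \<zeta>)\<^sup>2 - 2 * c * (G \<zeta> * ?f \<zeta>) + c\<^sup>2 * G \<zeta>)"
    by (rule Bochner_Integration.integral_cong) (simp_all add: power2_diff algebra_simps)
  also have "\<dots> = (LINT \<zeta>|lborel. G \<zeta> * (?f \<zeta>)\<^sup>2) - 2 * c * c + c\<^sup>2 * 1"
    using i1 i2 Gi by (simp add: G1 c_def)
  finally have c2: "c\<^sup>2 \<le> (LINT \<zeta>|lborel. G \<zeta> * (?f \<zeta>)\<^sup>2)" by (simp add: power2_eq_square)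
  have "(norm (fhat (damp \<mu>) \<xi>))\<^sup>2 \<le> c\<^sup>2" using nc by (intro power_mono) auto
  then have "ennreal ((norm (fhat (damp \<mu>) \<xi>))\<^sup>2) \<le> ennreal (LINT \<zeta>|lborel. G \<zeta> * (?f \<zeta>)\<^sup>2)"
    using c2 by (intro ennreal_leI) simp
  also have "\<dots> = (\<integral>\<^sup>+\<zeta>. ennreal (G \<zeta> * (?f \<zeta>)\<^sup>2) \<partial>lborel)"
    using i2 Gpos by (intro nn_integral_eq_integral[symmetric]) auto
  also have "\<dots> = (\<integral>\<^sup>+\<zeta>. ennreal ?q * ennreal (exp (- (norm ((\<xi> + \<zeta>) - \<xi>))\<^sup>2 / 2) * (norm (fhat \<mu> (\<xi> + \<zeta>)))\<^sup>2) \<partial>lborel)"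
    by (intro nn_integral_cong) (simp add: G_def mult.assoc flip: ennreal_mult)
  also have "\<dots> = ennreal ?q * (\<integral>\<^sup>+\<zeta>. ennreal (exp (- (norm ((\<xi> + \<zeta>) - \<xi>))\<^sup>2 / 2) * (norm (fhat \<mu> (\<xi> + \<zeta>)))\<^sup>2) \<partial>lborel)"
    by (rule nn_integral_cmult) measurable
  also have "(\<integral>\<^sup>+\<zeta>. ennreal (exp (- (norm ((\<xi> + \<zeta>) - \<xi>))\<^sup>2 / 2) * (norm (fhat \<mu> (\<xi> + \<zeta>)))\<^sup>2) \<partial>lborel) =
    (\<integral>\<^sup>+\<eta>. ennreal (exp (- (norm (\<eta> - \<xi>))\<^sup>2 / 2) * (norm (fhat \<mu> \<eta>))\<^sup>2) \<partial>distr lborel borel ((+) \<xi>))"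
    by (subst nn_integral_distr) auto
  finally show ?thesis by (simp add: lborel_distr_plus)
qed

text \<open>Writes a negative power as a superposition of exponentials. With \<open>A\<close> a
  quadratic expression in the frequency this exchanges polynomial weights for Gaussian ones, for
  which exact formulas exist.\<close>

lemma nn_integral_Gamma:
  assumes "0 < \<beta>" "0 < A"
  shows "(\<integral>\<^sup>+\<tau>. ennreal (indicator {0<..} \<tau> * (\<tau> powr (\<beta> - 1) * exp (- (\<tau> * A)))) \<partial>lborel) = ennreal (Gamma \<beta> * A powr (- \<beta>))"
proof -
  let ?L = "\<integral>\<^sup>+\<tau>. ennreal (indicator {0<..} \<tau> * (\<tau> powr (\<beta> - 1) * exp (- (\<tau> * A)))) \<partial>lborel"
  have "ennreal (Gamma \<beta>) = (\<integral>\<^sup>+t. ennreal (indicator {0..} t * t powr (\<beta> - 1) / exp t) \<partial>lborel)"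
    by (rule Gamma_conv_nn_integral_real[OF assms(1)])
  also have "\<dots> = \<bar>A\<bar> * (\<integral>\<^sup>+t. ennreal (indicator {0..} (0 + A * t) * (0 + A * t) powr (\<beta> - 1) / exp (0 + A * t)) \<partial>lborel)"
    by (rule nn_integral_real_affine) (use assms in auto)
  also have "(\<integral>\<^sup>+t. ennreal (indicator {0..} (0 + A * t) * (0 + A * t) powr (\<beta> - 1) / exp (0 + A * t)) \<partial>lborel) =
     (\<integral>\<^sup>+t. ennreal (A powr (\<beta> - 1)) * ennreal (indicator {0<..} t * (t powr (\<beta> - 1) * exp (- (t * A)))) \<partial>lborel)"
  proof (rule nn_integral_cong)
    fix t :: real
    have "indicator {0..} (0 + A * t) * (0 + A * t) powr (\<beta> - 1) / exp (0 + A * t) =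
      A powr (\<beta> - 1) * (indicator {0<..} t * (t powr (\<beta> - 1) * exp (- (t * A))))"
      using assms by (cases "t > 0"; cases "t = 0")
        (auto simp: indicator_def powr_mult exp_minus field_simps mult_less_0_iff zero_le_mult_iff)
    then show "ennreal (indicator {0..} (0 + A * t) * (0 + A * t) powr (\<beta> - 1) / exp (0 + A * t)) =
       ennreal (A powr (\<beta> - 1)) * ennreal (indicator {0<..} t * (t powr (\<beta> - 1) * exp (- (t * A))))"
      by (simp flip: ennreal_mult)
  qed
  also have "\<dots> = ennreal (A powr (\<beta> - 1)) * ?L"
    by (rule nn_integral_cmult) measurable
  finally have "ennreal (Gamma \<beta>) = ennreal (A * A powr (\<beta> - 1)) * ?L"
    using assms by (simp add: ennreal_mult mult.assoc)
  moreover have "A * A powr (\<beta> - 1) = A powr \<beta>"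
    using assms by (simp add: powr_diff)
  ultimately have "ennreal (A powr (- \<beta>)) * ennreal (Gamma \<beta>) = ennreal (A powr (- \<beta>) * A powr \<beta>) * ?L"
    by (simp add: ennreal_mult mult.assoc)
  then show ?thesis using assms Gamma_real_pos[of \<beta>]
    by (simp add: mult.commute flip: ennreal_mult powr_add)
qed

lemma (in borel_finite) nn_integral_pair:
  assumes "borel_finite \<nu>" "f \<in> borel_measurable (borel \<Otimes>\<^sub>M borel)"
  shows "(\<integral>\<^sup>+p. f p \<partial>(\<nu> \<Otimes>\<^sub>M \<mu>)) = (\<integral>\<^sup>+x. \<integral>\<^sup>+y. f (x, y) \<partial>\<mu> \<partial>\<nu>)"
proof -
  have "f \<in> borel_measurable (\<nu> \<Otimes>\<^sub>M \<mu>)"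
    using assms(2) pair_borel_finite(5)[OF assms(1), of \<mu>] borel_finite_axioms by (simp cong: measurable_cong_sets)
  from nn_integral_fst[OF this] show ?thesis by simp
qed

lemma growth_pair_integral:
  fixes \<nu> :: "(real^'n) measure"
  assumes \<nu>: "borel_finite \<nu>" and g: "growth t \<nu>" and b: "t < b" "0 < b"
  obtains C where "0 < C" "\<And>\<tau>. 0 < \<tau> \<Longrightarrow>
    (\<integral>\<^sup>+p. ennreal ((1 + (norm (fst p - snd p))\<^sup>2 / \<tau>) powr (- b / 2)) \<partial>(\<nu> \<Otimes>\<^sub>M \<nu>)) \<le> ennreal (C * \<tau> powr (t / 2))"
proof -
  interpret A: borel_finite \<nu> by fact
  obtain C where C: "0 < C" "\<And>x \<tau>. 0 < \<tau> \<Longrightarrow>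
    (\<integral>\<^sup>+y. ennreal ((1 + (norm (x - y))\<^sup>2 / \<tau>) powr (- b / 2)) \<partial>\<nu>) \<le> ennreal (C * \<tau> powr (t / 2))"
    by (rule growth_integral[OF A.finite_measure_axioms A.sets_eq g b]) (rule that)
  have "(\<integral>\<^sup>+p. ennreal ((1 + (norm (fst p - snd p))\<^sup>2 / \<tau>) powr (- b / 2)) \<partial>(\<nu> \<Otimes>\<^sub>M \<nu>)) \<le> ennreal ((C * (measure \<nu> UNIV + 1)) * \<tau> powr (t / 2))"
    if \<tau>: "0 < \<tau>" for \<tau>
  proof -
    have "(\<integral>\<^sup>+p. ennreal ((1 + (norm (fst p - snd p))\<^sup>2 / \<tau>) powr (- b / 2)) \<partial>(\<nu> \<Otimes>\<^sub>M \<nu>)) =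
      (\<integral>\<^sup>+x. \<integral>\<^sup>+y. ennreal ((1 + (norm (fst (x, y) - snd (x, y)))\<^sup>2 / \<tau>) powr (- b / 2)) \<partial>\<nu> \<partial>\<nu>)"
      by (rule A.nn_integral_pair[OF \<nu>]) measurable
    also have "\<dots> \<le> (\<integral>\<^sup>+x. ennreal (C * \<tau> powr (t / 2)) \<partial>\<nu>)"
      by (intro nn_integral_mono) (use C(2)[OF \<tau>] in simp)
    also have "\<dots> = ennreal (C * \<tau> powr (t / 2) * measure \<nu> UNIV)"
      using C by (simp add: A.emeasure_eq_measure flip: ennreal_mult)
    also have "\<dots> \<le> ennreal ((C * (measure \<nu> UNIV + 1)) * \<tau> powr (t / 2))"
      using C by (intro ennreal_leI) (simp add: algebra_simps)
    finally show ?thesis .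
  qed
  moreover have "0 < C * (measure \<nu> UNIV + 1)" using C by (simp add: add_nonneg_pos)
  ultimately show thesis using that by blast
qed

text \<open>A Gaussian lies below a multiple of the polynomial kernel of exponent
  \<open>t + 1\<close>, and any exponent above \<open>t\<close> makes
  \<open>growth_pair_integral\<close> applicable.\<close>

lemma gaussian_pair_integral:
  fixes \<nu> :: "(real^'n) measure"
  assumes \<nu>: "borel_finite \<nu>" and g: "growth t \<nu>" and t: "0 < t"
  obtains C where "0 < C" "\<And>\<tau>. 0 < \<tau> \<Longrightarrow>
    (\<integral>\<^sup>+p. ennreal (exp (- (norm (fst p - snd p))\<^sup>2 / (2 * \<tau>))) \<partial>(\<nu> \<Otimes>\<^sub>M \<nu>)) \<le> ennreal (C * \<tau> powr (t / 2))"
proof -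
  interpret A: borel_finite \<nu> by fact
  note [measurable_cong] = A.sets_eq
  obtain C where C: "0 < C" "\<And>\<tau>. 0 < \<tau> \<Longrightarrow>
    (\<integral>\<^sup>+p. ennreal ((1 + (norm (fst p - snd p))\<^sup>2 / \<tau>) powr (- (t + 1) / 2)) \<partial>(\<nu> \<Otimes>\<^sub>M \<nu>)) \<le> ennreal (C * \<tau> powr (t / 2))"
  proof (rule growth_pair_integral[OF \<nu> g])
    show "t < t + 1" "0 < t + 1" using t by auto
  qed (rule that)
  obtain D where D: "0 < D" "\<And>y. 0 \<le> y \<Longrightarrow> (1 + y) powr ((t + 1) / 2) \<le> D * exp (1 / 2 * y)"
    using powr_le_exp[of "(t + 1) / 2" "1/2"] t by auto
  have "(\<integral>\<^sup>+p. ennreal (exp (- (norm (fst p - snd p))\<^sup>2 / (2 * \<tau>))) \<partial>(\<nu> \<Otimes>\<^sub>M \<nu>)) \<le> ennreal (D * C * \<tau> powr (t / 2))"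
    if \<tau>: "0 < \<tau>" for \<tau>
  proof -
    have "(\<integral>\<^sup>+p. ennreal (exp (- (norm (fst p - snd p))\<^sup>2 / (2 * \<tau>))) \<partial>(\<nu> \<Otimes>\<^sub>M \<nu>)) \<le>
      (\<integral>\<^sup>+p. ennreal D * ennreal ((1 + (norm (fst p - snd p))\<^sup>2 / \<tau>) powr (- (t + 1) / 2)) \<partial>(\<nu> \<Otimes>\<^sub>M \<nu>))"
    proof (rule nn_integral_mono)
      fix p :: "(real^'n) \<times> (real^'n)"
      define y where "y = (norm (fst p - snd p))\<^sup>2 / \<tau>"
      have y: "0 \<le> y" using \<tau> by (simp add: y_def)
      have pos: "0 < (1 + y) powr ((t + 1) / 2)" using y by simp
      have m: "- (t + 1) / 2 = - ((t + 1) / 2)" by (rule minus_divide_left[symmetric])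
      have "exp (- (1 / 2 * y)) \<le> D * (1 + y) powr (- (t + 1) / 2)"
        using D(2)[OF y] pos unfolding m exp_minus powr_minus by (simp add: field_simps)
      moreover have ey: "- (norm (fst p - snd p))\<^sup>2 / (2 * \<tau>) = - (1 / 2 * y)" by (simp add: y_def)
      ultimately show "ennreal (exp (- (norm (fst p - snd p))\<^sup>2 / (2 * \<tau>))) \<le>
          ennreal D * ennreal ((1 + (norm (fst p - snd p))\<^sup>2 / \<tau>) powr (- (t + 1) / 2))"
        using D(1) unfolding ey y_def[symmetric] by (subst ennreal_mult[symmetric]) (auto intro: ennreal_leI)
    qed
    also have "\<dots> = ennreal D * (\<integral>\<^sup>+p. ennreal ((1 + (norm (fst p - snd p))\<^sup>2 / \<tau>) powr (- (t + 1) / 2)) \<partial>(\<nu> \<Otimes>\<^sub>M \<nu>))"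
      by (rule nn_integral_cmult) measurable
    also have "\<dots> \<le> ennreal D * ennreal (C * \<tau> powr (t / 2))"
      by (intro mult_left_mono C \<tau>) auto
    finally show ?thesis using C D by (simp add: mult.assoc flip: ennreal_mult)
  qed
  moreover have "0 < D * C" using C D by simp
  ultimately show thesis using that by blast
qed

lemma growth_damp:
  assumes "borel_finite \<mu>" "growth t \<mu>"
  shows "growth t (damp \<mu>)"
proof -
  interpret A: borel_finite \<mu> by fact
  interpret D: borel_finite "damp \<mu>" by (rule damp_borel_finite[OF assms(1)])
  have le: "measure (damp \<mu>) (cball x r) \<le> measure \<mu> (cball x r)" for x r
  proof -
    have "emeasure (damp \<mu>) (cball x r) = (\<integral>\<^sup>+y. ennreal (exp (- (norm y)\<^sup>2 / 2)) * indicator (cball x r) y \<partial>\<mu>)"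
      unfolding damp_def by (rule emeasure_density) (auto simp: A.sets_eq)
    also have "\<dots> \<le> (\<integral>\<^sup>+y. indicator (cball x r) y \<partial>\<mu>)"
      by (intro nn_integral_mono) (auto simp: indicator_def)
    also have "\<dots> = emeasure \<mu> (cball x r)" by (simp add: A.sets_eq)
    finally show ?thesis by (simp add: A.emeasure_eq_measure D.emeasure_eq_measure)
  qed
  then show ?thesis using assms(2) unfolding growth_def by (meson order_trans)
qed

section \<open>Sobolev norms and energies of projections\<close>

text \<open>The squared Sobolev norm of order \<open>a / 2\<close> of the projection of \<open>\<mu>\<close> to \<open>V\<close>. The kernel \<open>riesz_kernel r w\<close> is
  comparable to \<open>w powr (- r / 2)\<close> for small \<open>w\<close>, which makes \<open>energy r \<nu> V\<close> the \<open>r\<close>-energy of the projection of \<open>\<nu>\<close>;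
  it is a Gamma integral of Gaussians so that it can be read off on the Fourier side.\<close>

definition sobolev :: "real \<Rightarrow> (real^'n) measure \<Rightarrow> (real^'n) set \<Rightarrow> ennreal" where
  "sobolev a \<mu> V = (\<integral>\<^sup>+\<xi>. ennreal ((1 + (norm (orth_proj V \<xi>))\<^sup>2 / 2) powr (a / 2) * tgauss V \<xi> * (norm (fhat \<mu> (orth_proj V \<xi>)))\<^sup>2) \<partial>lborel)"

definition riesz_kernel :: "real \<Rightarrow> real \<Rightarrow> ennreal" where
  "riesz_kernel r w = (\<integral>\<^sup>+\<tau>. ennreal (indicator {0<..} \<tau> * (\<tau> powr (- r / 2 - 1) * exp (- \<tau>) * exp (- w / (2 * \<tau>)))) \<partial>lborel)"

definition energy :: "real \<Rightarrow> (real^'n) measure \<Rightarrow> (real^'n) set \<Rightarrow> ennreal" where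
  "energy r \<nu> V = (\<integral>\<^sup>+p. riesz_kernel r ((norm (orth_proj V (fst p - snd p)))\<^sup>2) \<partial>(\<nu> \<Otimes>\<^sub>M \<nu>))"

lemma riesz_kernel_measurable [measurable]: "riesz_kernel r \<in> borel_measurable borel"
  unfolding riesz_kernel_def by measurable

text \<open>Translation of \<open>\<xi>\<close> by the projection of \<open>\<eta>\<close> centres
  the Gaussian along \<open>V\<close>, and Pythagoras leaves only the distance from
  \<open>\<eta>\<close> to \<open>V\<close>. The \<open>1/2\<close> in the constant is the weight on
  \<open>V\<close> that belongs to a Gaussian with denominator 4.\<close>

lemma nn_gauss_shifted:
  fixes V :: "(real^'n) set"
  assumes V: "V \<in> grassmannian m"
  shows "(\<integral>\<^sup>+\<xi>. ennreal (exp (- (norm (\<eta> - orth_proj V \<xi>))\<^sup>2 / 4) * tgauss V \<xi>) \<partial>lborel) =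
    ennreal ((2 * pi) powr (CARD('n) / 2) * (1/2) powr (- real m / 2)) * ennreal (exp (- (norm (\<eta> - orth_proj V \<eta>))\<^sup>2 / 4))"
proof -
  have sV: "subspace V" using V by (rule grassmannian_subspace)
  note [measurable] = borel_measurable_orth_proj[OF sV]
  have lin: "linear (orth_proj V)" by (rule linear_orth_proj[OF sV])
  let ?h = "\<lambda>\<xi>. ennreal (exp (- (norm (\<eta> - orth_proj V \<xi>))\<^sup>2 / 4) * tgauss V \<xi>)"
  have "(\<integral>\<^sup>+\<xi>. ?h \<xi> \<partial>lborel) = (\<integral>\<^sup>+\<xi>. ?h \<xi> \<partial>distr lborel borel ((+) (orth_proj V \<eta>)))"
    by (simp add: lborel_distr_plus)
  also have "\<dots> = (\<integral>\<^sup>+\<xi>. ?h (orth_proj V \<eta> + \<xi>) \<partial>lborel)"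
    by (subst nn_integral_distr) auto
  also have "\<dots> = (\<integral>\<^sup>+\<xi>. ennreal (exp (- (1/2 * (norm (orth_proj V \<xi>))\<^sup>2 + 1 * (norm (\<xi> - orth_proj V \<xi>))\<^sup>2) / 2)) *
      ennreal (exp (- (norm (\<eta> - orth_proj V \<eta>))\<^sup>2 / 4)) \<partial>lborel)"
  proof (rule nn_integral_cong)
    fix \<xi>
    let ?P = "orth_proj V"
    have P: "?P (?P \<eta> + \<xi>) = ?P \<eta> + ?P \<xi>" using sV by (simp add: linear_add[OF lin])
    have "?P (\<eta> - ?P (?P \<eta> + \<xi>)) = - ?P \<xi>" using sV by (simp add: P linear_diff[OF lin] linear_add[OF lin])
    then have E1: "(norm (\<eta> - ?P (?P \<eta> + \<xi>)))\<^sup>2 = (norm (?P \<xi>))\<^sup>2 + (norm (\<eta> - ?P \<eta>))\<^sup>2"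
      by (subst norm_orth_proj_Pythagoras[OF sV]) (simp add: P)
    have E2: "(?P \<eta> + \<xi>) - ?P (?P \<eta> + \<xi>) = \<xi> - ?P \<xi>" by (simp add: P)
    show "?h (?P \<eta> + \<xi>) = ennreal (exp (- (1/2 * (norm (?P \<xi>))\<^sup>2 + 1 * (norm (\<xi> - ?P \<xi>))\<^sup>2) / 2)) *
      ennreal (exp (- (norm (\<eta> - ?P \<eta>))\<^sup>2 / 4))"
      unfolding E1 E2 by (simp add: field_simps flip: ennreal_mult exp_add)
  qed
  also have "\<dots> = (\<integral>\<^sup>+\<xi>. ennreal (exp (- (1/2 * (norm (orth_proj V \<xi>))\<^sup>2 + 1 * (norm (\<xi> - orth_proj V \<xi>))\<^sup>2) / 2)) \<partial>lborel) *
      ennreal (exp (- (norm (\<eta> - orth_proj V \<eta>))\<^sup>2 / 4))"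
    by (rule nn_integral_multc) measurable
  also have "\<dots> = ennreal ((2 * pi) powr (CARD('n) / 2) * (1/2) powr (- real m / 2)) * ennreal (exp (- (norm (\<eta> - orth_proj V \<eta>))\<^sup>2 / 4))"
    by (subst nn_gauss_grassmannian[OF V]) auto
  finally show ?thesis .
qed

text \<open>Expand the weight into Gaussians by the Gamma integral. At scale \<open>\<tau>\<close>
  growth bounds the Gaussian integral by a multiple of \<open>\<tau> powr ((s - n) / 2)\<close>, so
  the remaining exponent is \<open>(s - n) / 2 + \<beta> - 1\<close>; the hypothesis on
  \<open>\<beta>\<close> is its integrability at 0, and \<open>exp (- \<tau>)\<close> takes care of
  large \<open>\<tau>\<close>.\<close>

lemma fhat_weighted_finite:
  fixes \<mu> :: "(real^'n) measure" and V :: "(real^'n) set"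
  assumes \<mu>: "borel_finite \<mu>" and V: "V \<in> grassmannian m" and m: "m \<le> CARD('n)" and g: "growth s \<mu>" and s: "0 < s"
    and \<beta>: "0 < \<beta>" "real CARD('n) - 2 * \<beta> < s"
  shows "(\<integral>\<^sup>+\<eta>. ennreal ((1 + (norm \<eta>)\<^sup>2 / 2) powr (- \<beta>) * (norm (fhat \<mu> \<eta>))\<^sup>2) \<partial>lborel) < \<infinity>"
proof -
  interpret A: borel_finite \<mu> by fact
  obtain C where C: "0 < C" "\<And>\<tau>. 0 < \<tau> \<Longrightarrow>
    (\<integral>\<^sup>+p. ennreal (exp (- (norm (fst p - snd p))\<^sup>2 / (2 * \<tau>))) \<partial>(\<mu> \<Otimes>\<^sub>M \<mu>)) \<le> ennreal (C * \<tau> powr (s / 2))"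
    by (rule gaussian_pair_integral[OF \<mu> g s]) (rule that)
  have \<Gamma>: "0 < Gamma \<beta>" by (rule Gamma_real_pos[OF \<beta>(1)])
  let ?p = "(2 * pi) powr (CARD('n) / 2)"
  let ?e = "s / 2 - CARD('n) / 2 + \<beta>"
  have e: "0 < ?e" using \<beta> by simp
  let ?X = "\<integral>\<^sup>+\<eta>. ennreal ((1 + (norm \<eta>)\<^sup>2 / 2) powr (- \<beta>) * (norm (fhat \<mu> \<eta>))\<^sup>2) \<partial>lborel"
  have "ennreal (Gamma \<beta>) * ?X = (\<integral>\<^sup>+\<eta>. ennreal (Gamma \<beta>) * ennreal ((1 + (norm \<eta>)\<^sup>2 / 2) powr (- \<beta>) * (norm (fhat \<mu> \<eta>))\<^sup>2) \<partial>lborel)"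
    by (rule nn_integral_cmult[symmetric]) measurable
  also have "\<dots> = (\<integral>\<^sup>+\<eta>. (\<integral>\<^sup>+\<tau>. ennreal (indicator {0<..} \<tau> * (\<tau> powr (\<beta> - 1) * exp (- \<tau>))) *
       ennreal (exp (- (\<tau> * (norm \<eta>)\<^sup>2) / 2) * (norm (fhat \<mu> \<eta>))\<^sup>2) \<partial>lborel) \<partial>lborel)"
  proof (rule nn_integral_cong)
    fix \<eta> :: "real^'n"
    have A: "0 < 1 + (norm \<eta>)\<^sup>2 / 2" by (simp add: add_pos_nonneg)
    have "ennreal (Gamma \<beta>) * ennreal ((1 + (norm \<eta>)\<^sup>2 / 2) powr (- \<beta>) * (norm (fhat \<mu> \<eta>))\<^sup>2) =
      ennreal (Gamma \<beta> * (1 + (norm \<eta>)\<^sup>2 / 2) powr (- \<beta>)) * ennreal ((norm (fhat \<mu> \<eta>))\<^sup>2)"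
      using \<Gamma> by (simp add: ennreal_mult mult.assoc)
    also have "\<dots> = (\<integral>\<^sup>+\<tau>. ennreal (indicator {0<..} \<tau> * (\<tau> powr (\<beta> - 1) * exp (- (\<tau> * (1 + (norm \<eta>)\<^sup>2 / 2))))) * ennreal ((norm (fhat \<mu> \<eta>))\<^sup>2) \<partial>lborel)"
      unfolding nn_integral_Gamma[OF \<beta>(1) A, symmetric] by (rule nn_integral_multc[symmetric]) measurable
    also have "\<dots> = (\<integral>\<^sup>+\<tau>. ennreal (indicator {0<..} \<tau> * (\<tau> powr (\<beta> - 1) * exp (- \<tau>))) *
       ennreal (exp (- (\<tau> * (norm \<eta>)\<^sup>2) / 2) * (norm (fhat \<mu> \<eta>))\<^sup>2) \<partial>lborel)"
    proof (rule nn_integral_cong)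
      fix \<tau> :: real
      have "exp (- (\<tau> * (1 + (norm \<eta>)\<^sup>2 / 2))) = exp (- \<tau>) * exp (- (\<tau> * (norm \<eta>)\<^sup>2) / 2)"
        by (simp add: algebra_simps flip: exp_add)
      then show "ennreal (indicator {0<..} \<tau> * (\<tau> powr (\<beta> - 1) * exp (- (\<tau> * (1 + (norm \<eta>)\<^sup>2 / 2))))) * ennreal ((norm (fhat \<mu> \<eta>))\<^sup>2) =
        ennreal (indicator {0<..} \<tau> * (\<tau> powr (\<beta> - 1) * exp (- \<tau>))) * ennreal (exp (- (\<tau> * (norm \<eta>)\<^sup>2) / 2) * (norm (fhat \<mu> \<eta>))\<^sup>2)"
        by (simp add: mult.assoc flip: ennreal_mult)
    qed
    finally show "ennreal (Gamma \<beta>) * ennreal ((1 + (norm \<eta>)\<^sup>2 / 2) powr (- \<beta>) * (norm (fhat \<mu> \<eta>))\<^sup>2) =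
      (\<integral>\<^sup>+\<tau>. ennreal (indicator {0<..} \<tau> * (\<tau> powr (\<beta> - 1) * exp (- \<tau>))) *
       ennreal (exp (- (\<tau> * (norm \<eta>)\<^sup>2) / 2) * (norm (fhat \<mu> \<eta>))\<^sup>2) \<partial>lborel)" .
  qed
  also have "\<dots> = (\<integral>\<^sup>+\<tau>. (\<integral>\<^sup>+\<eta>. ennreal (indicator {0<..} \<tau> * (\<tau> powr (\<beta> - 1) * exp (- \<tau>))) *
       ennreal (exp (- (\<tau> * (norm \<eta>)\<^sup>2) / 2) * (norm (fhat \<mu> \<eta>))\<^sup>2) \<partial>lborel) \<partial>lborel)"
    by (rule lborel_pair.Fubini') measurable
  also have "\<dots> = (\<integral>\<^sup>+\<tau>. ennreal (indicator {0<..} \<tau> * (\<tau> powr (\<beta> - 1) * exp (- \<tau>))) *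
       (\<integral>\<^sup>+\<eta>. ennreal (exp (- (\<tau> * (norm \<eta>)\<^sup>2) / 2) * (norm (fhat \<mu> \<eta>))\<^sup>2) \<partial>lborel) \<partial>lborel)"
    by (intro nn_integral_cong nn_integral_cmult) measurable
  also have "\<dots> \<le> (\<integral>\<^sup>+\<tau>. ennreal (?p * C) * ennreal (indicator {0<..} \<tau> * (\<tau> powr (?e - 1) * exp (- (\<tau> * 1)))) \<partial>lborel)"
  proof (rule nn_integral_mono)
    fix \<tau> :: real
    show "ennreal (indicator {0<..} \<tau> * (\<tau> powr (\<beta> - 1) * exp (- \<tau>))) *
       (\<integral>\<^sup>+\<eta>. ennreal (exp (- (\<tau> * (norm \<eta>)\<^sup>2) / 2) * (norm (fhat \<mu> \<eta>))\<^sup>2) \<partial>lborel) \<le>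
       ennreal (?p * C) * ennreal (indicator {0<..} \<tau> * (\<tau> powr (?e - 1) * exp (- (\<tau> * 1))))"
    proof (cases "0 < \<tau>")
      case True
      have "(\<integral>\<^sup>+\<eta>. ennreal (exp (- (\<tau> * (norm \<eta>)\<^sup>2) / 2) * (norm (fhat \<mu> \<eta>))\<^sup>2) \<partial>lborel) \<le>
        ennreal (?p * \<tau> powr (- real (CARD('n)) / 2)) * ennreal (C * \<tau> powr (s / 2))"
        unfolding nn_fhat_space[OF \<mu> V m True] using C(2)[OF True] by (intro mult_left_mono) auto
      then have "ennreal (\<tau> powr (\<beta> - 1) * exp (- \<tau>)) *
         (\<integral>\<^sup>+\<eta>. ennreal (exp (- (\<tau> * (norm \<eta>)\<^sup>2) / 2) * (norm (fhat \<mu> \<eta>))\<^sup>2) \<partial>lborel) \<le>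
        ennreal (\<tau> powr (\<beta> - 1) * exp (- \<tau>)) * (ennreal (?p * \<tau> powr (- real (CARD('n)) / 2)) * ennreal (C * \<tau> powr (s / 2)))"
        by (intro mult_left_mono) auto
      also have "\<dots> = ennreal ((?p * C) * ((\<tau> powr (\<beta> - 1) * \<tau> powr (- real (CARD('n)) / 2) * \<tau> powr (s / 2)) * exp (- \<tau>)))"
        using C by (simp add: mult_ac flip: ennreal_mult)
      also have "\<tau> powr (\<beta> - 1) * \<tau> powr (- real (CARD('n)) / 2) * \<tau> powr (s / 2) = \<tau> powr (?e - 1)"
        by (simp add: algebra_simps flip: powr_add)
      finally show ?thesis using True C by (simp add: ennreal_mult)
    qed simp
  qed
  also have "\<dots> = ennreal (?p * C) * (\<integral>\<^sup>+\<tau>. ennreal (indicator {0<..} \<tau> * (\<tau> powr (?e - 1) * exp (- (\<tau> * 1)))) \<partial>lborel)"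
    by (rule nn_integral_cmult) measurable
  also have "\<dots> < \<infinity>"
    by (subst nn_integral_Gamma[OF e]) (auto simp: ennreal_mult_less_top)
  finally show ?thesis
    using \<Gamma> by (auto simp: ennreal_mult_less_top ennreal_zero_less_mult_iff top.not_eq_extremum)
qed

section \<open>Averages over planes\<close>

context haar_grassmannian
begin

lemma exists_plane: "\<exists>V. V \<in> (grassmannian m :: (real^'n) set set)"
  using \<gamma>.not_empty by auto

lemma sobolev_measurable [measurable]:
  assumes "borel_finite \<mu>"
  shows "sobolev a \<mu> \<in> borel_measurable \<gamma>"
proof -
  interpret A: borel_finite \<mu> by fact
  show ?thesis unfolding sobolev_def by measurable
qed

lemma energy_measurable [measurable]:
  assumes "borel_finite \<mu>"
  shows "energy r \<mu> \<in> borel_measurable \<gamma>"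
proof -
  interpret A: borel_finite \<mu> by fact
  interpret F: finite_measure "\<mu> \<Otimes>\<^sub>M \<mu>" using pair_borel_finite[OF assms assms] by simp
  note [measurable_cong] = A.sets_eq
  show ?thesis unfolding energy_def by measurable
qed

text \<open>Values of the transform on \<open>V\<close> are replaced by Gaussian means over nearby
  frequencies, and the order of integration is exchanged. What remains is an integral over the whole
  space with a weight that decays in the distance from \<open>V\<close>, ready for averaging over
  planes.\<close>

lemma sobolev_le:
  fixes \<mu> :: "(real^'n) measure"
  assumes \<mu>: "borel_finite \<mu>" and a: "0 \<le> a"
  obtains C where "0 < C" "\<And>V. V \<in> grassmannian m \<Longrightarrow>
    sobolev a (damp \<mu>) V \<le> ennreal C * (\<integral>\<^sup>+\<eta>. ennreal ((1 + (norm \<eta>)\<^sup>2 / 2) powr (a / 2) * (norm (fhat \<mu> \<eta>))\<^sup>2) *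
      ennreal (exp (- (norm (\<eta> - orth_proj V \<eta>))\<^sup>2 / 4)) \<partial>lborel)"
proof -
  interpret A: borel_finite \<mu> by fact
  obtain D where D: "0 < D" "\<And>y. 0 \<le> y \<Longrightarrow> (1 + y) powr (a / 2) \<le> D * exp (1 / 2 * y)"
    using powr_le_exp[of "a / 2" "1/2"] a by auto
  let ?q = "(2 * pi) powr (- (CARD('n) / 2))"
  define K1 where "K1 = ?q * (2 powr (a / 2) * D)"
  have K1: "0 < K1" using D by (simp add: K1_def)
  define c1 where "c1 = (2 * pi) powr (CARD('n) / 2) * (1/2) powr (- real m / 2)"
  have c1: "0 < c1" by (simp add: c1_def)
  have main: "sobolev a (damp \<mu>) V \<le> ennreal (K1 * c1) * (\<integral>\<^sup>+\<eta>. ennreal ((1 + (norm \<eta>)\<^sup>2 / 2) powr (a / 2) * (norm (fhat \<mu> \<eta>))\<^sup>2) *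
      ennreal (exp (- (norm (\<eta> - orth_proj V \<eta>))\<^sup>2 / 4)) \<partial>lborel)" if V: "V \<in> grassmannian m" for V
  proof -
    have sV: "subspace V" using V by (rule grassmannian_subspace)
    note [measurable] = borel_measurable_orth_proj[OF sV]
    let ?P = "orth_proj V"
    let ?w = "\<lambda>\<eta>::real^'n. (1 + (norm \<eta>)\<^sup>2 / 2) powr (a / 2)"
    let ?F = "\<lambda>\<eta>. ennreal (K1 * (?w \<eta> * (norm (fhat \<mu> \<eta>))\<^sup>2))"
    \<comment> \<open>Peetre's inequality moves the Sobolev weight from \<open>u\<close> to
      \<open>\<eta>\<close>; the loss, a power of \<open>1 + y\<close>, is absorbed by half of the
      Gaussian exponent.\<close>
    have wt: "?w u * exp (- (norm (\<eta> - u))\<^sup>2 / 2) \<le> 2 powr (a / 2) * D * ?w \<eta> * exp (- (norm (\<eta> - u))\<^sup>2 / 4)" for u \<eta> :: "real^'n"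
    proof -
      define y where "y = (norm (\<eta> - u))\<^sup>2 / 2"
      have y: "0 \<le> y" by (simp add: y_def)
      have "norm u \<le> norm \<eta> + norm (\<eta> - u)" using norm_triangle_sub[of u \<eta>] by (simp add: norm_minus_commute)
      then have "(norm u)\<^sup>2 \<le> (norm \<eta> + norm (\<eta> - u))\<^sup>2" by (intro power_mono) auto
      also have "\<dots> \<le> 2 * (norm \<eta>)\<^sup>2 + 2 * (norm (\<eta> - u))\<^sup>2" using sum_squares_bound[of "norm \<eta>" "norm (\<eta> - u)"] by (simp add: power2_sum)
      finally have "1 + (norm u)\<^sup>2 / 2 \<le> 1 + (norm \<eta>)\<^sup>2 + 2 * y" by (simp add: y_def)
      also have "\<dots> \<le> 2 * ((1 + (norm \<eta>)\<^sup>2 / 2) * (1 + y))"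
      proof -
        have "2 * ((1 + (norm \<eta>)\<^sup>2 / 2) * (1 + y)) = 2 + 2 * y + (norm \<eta>)\<^sup>2 + (norm \<eta>)\<^sup>2 * y" by (simp add: field_simps)
        moreover have "0 \<le> (norm \<eta>)\<^sup>2 * y" using y by simp
        ultimately show ?thesis by linarith
      qed
      finally have "?w u \<le> (2 * ((1 + (norm \<eta>)\<^sup>2 / 2) * (1 + y))) powr (a / 2)"
        using a by (intro powr_mono2) auto
      also have "\<dots> = 2 powr (a / 2) * (?w \<eta> * (1 + y) powr (a / 2))"
        using y by (simp add: powr_mult add_pos_nonneg)
      also have "\<dots> \<le> 2 powr (a / 2) * (?w \<eta> * (D * exp (1 / 2 * y)))"
        by (intro mult_left_mono D y) auto
      finally have "?w u * exp (- y) \<le> 2 powr (a / 2) * (?w \<eta> * (D * exp (1 / 2 * y))) * exp (- y)"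
        by (intro mult_right_mono) auto
      also have "\<dots> = 2 powr (a / 2) * D * ?w \<eta> * (exp (1 / 2 * y) * exp (- y))" by (simp only: mult_ac)
      also have "exp (1 / 2 * y) * exp (- y) = exp (- (norm (\<eta> - u))\<^sup>2 / 4)"
        by (simp add: y_def flip: exp_add)
      finally show ?thesis by (simp add: y_def)
    qed
    have pt: "ennreal (?w (?P \<xi>) * tgauss V \<xi> * (norm (fhat (damp \<mu>) (?P \<xi>)))\<^sup>2) \<le>
      (\<integral>\<^sup>+\<eta>. ?F \<eta> * ennreal (exp (- (norm (\<eta> - ?P \<xi>))\<^sup>2 / 4) * tgauss V \<xi>) \<partial>lborel)" for \<xi>
    proof -
      have "ennreal (?w (?P \<xi>) * tgauss V \<xi> * (norm (fhat (damp \<mu>) (?P \<xi>)))\<^sup>2) =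
         ennreal (?w (?P \<xi>) * tgauss V \<xi>) * ennreal ((norm (fhat (damp \<mu>) (?P \<xi>)))\<^sup>2)"
        by (simp add: ennreal_mult)
      also have "\<dots> \<le> ennreal (?w (?P \<xi>) * tgauss V \<xi>) * (ennreal ?q *
        (\<integral>\<^sup>+\<eta>. ennreal (exp (- (norm (\<eta> - ?P \<xi>))\<^sup>2 / 2) * (norm (fhat \<mu> \<eta>))\<^sup>2) \<partial>lborel))"
        by (intro mult_left_mono fhat_damp_le[OF \<mu> V]) auto
      also have "\<dots> = ennreal (?w (?P \<xi>) * tgauss V \<xi> * ?q) *
        (\<integral>\<^sup>+\<eta>. ennreal (exp (- (norm (\<eta> - ?P \<xi>))\<^sup>2 / 2) * (norm (fhat \<mu> \<eta>))\<^sup>2) \<partial>lborel)"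
        by (simp add: ennreal_mult mult.assoc)
      also have "\<dots> = (\<integral>\<^sup>+\<eta>. ennreal (?w (?P \<xi>) * tgauss V \<xi> * ?q) * ennreal (exp (- (norm (\<eta> - ?P \<xi>))\<^sup>2 / 2) * (norm (fhat \<mu> \<eta>))\<^sup>2) \<partial>lborel)"
        by (rule nn_integral_cmult[symmetric]) measurable
      also have "\<dots> \<le> (\<integral>\<^sup>+\<eta>. ?F \<eta> * ennreal (exp (- (norm (\<eta> - ?P \<xi>))\<^sup>2 / 4) * tgauss V \<xi>) \<partial>lborel)"
      proof (rule nn_integral_mono)
        fix \<eta> :: "real^'n"
        have "(?w (?P \<xi>) * exp (- (norm (\<eta> - ?P \<xi>))\<^sup>2 / 2)) * (tgauss V \<xi> * ?q * (norm (fhat \<mu> \<eta>))\<^sup>2) \<le>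
          (2 powr (a / 2) * D * ?w \<eta> * exp (- (norm (\<eta> - ?P \<xi>))\<^sup>2 / 4)) * (tgauss V \<xi> * ?q * (norm (fhat \<mu> \<eta>))\<^sup>2)"
          by (intro mult_right_mono wt) auto
        then have "?w (?P \<xi>) * tgauss V \<xi> * ?q * (exp (- (norm (\<eta> - ?P \<xi>))\<^sup>2 / 2) * (norm (fhat \<mu> \<eta>))\<^sup>2) \<le>
          K1 * (?w \<eta> * (norm (fhat \<mu> \<eta>))\<^sup>2) * (exp (- (norm (\<eta> - ?P \<xi>))\<^sup>2 / 4) * tgauss V \<xi>)"
          by (simp only: K1_def mult_ac)
        then show "ennreal (?w (?P \<xi>) * tgauss V \<xi> * ?q) * ennreal (exp (- (norm (\<eta> - ?P \<xi>))\<^sup>2 / 2) * (norm (fhat \<mu> \<eta>))\<^sup>2) \<le>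
          ?F \<eta> * ennreal (exp (- (norm (\<eta> - ?P \<xi>))\<^sup>2 / 4) * tgauss V \<xi>)"
          using K1 by (subst (1 2) ennreal_mult[symmetric]) (auto intro: ennreal_leI)
      qed
      finally show ?thesis .
    qed
    have "sobolev a (damp \<mu>) V \<le> (\<integral>\<^sup>+\<xi>. (\<integral>\<^sup>+\<eta>. ?F \<eta> * ennreal (exp (- (norm (\<eta> - ?P \<xi>))\<^sup>2 / 4) * tgauss V \<xi>) \<partial>lborel) \<partial>lborel)"
      unfolding sobolev_def by (intro nn_integral_mono pt)
    also have "\<dots> = (\<integral>\<^sup>+\<eta>. (\<integral>\<^sup>+\<xi>. ?F \<eta> * ennreal (exp (- (norm (\<eta> - ?P \<xi>))\<^sup>2 / 4) * tgauss V \<xi>) \<partial>lborel) \<partial>lborel)"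
      by (rule lborel_pair.Fubini') measurable
    also have "\<dots> = (\<integral>\<^sup>+\<eta>. ?F \<eta> * (\<integral>\<^sup>+\<xi>. ennreal (exp (- (norm (\<eta> - ?P \<xi>))\<^sup>2 / 4) * tgauss V \<xi>) \<partial>lborel) \<partial>lborel)"
      by (intro nn_integral_cong nn_integral_cmult) measurable
    also have "\<dots> = (\<integral>\<^sup>+\<eta>. ennreal (K1 * c1) * (ennreal (?w \<eta> * (norm (fhat \<mu> \<eta>))\<^sup>2) * ennreal (exp (- (norm (\<eta> - ?P \<eta>))\<^sup>2 / 4))) \<partial>lborel)"
    proof (rule nn_integral_cong)
      fix \<eta> :: "real^'n"
      show "?F \<eta> * (\<integral>\<^sup>+\<xi>. ennreal (exp (- (norm (\<eta> - ?P \<xi>))\<^sup>2 / 4) * tgauss V \<xi>) \<partial>lborel) =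
        ennreal (K1 * c1) * (ennreal (?w \<eta> * (norm (fhat \<mu> \<eta>))\<^sup>2) * ennreal (exp (- (norm (\<eta> - ?P \<eta>))\<^sup>2 / 4)))"
        unfolding nn_gauss_shifted[OF V] c1_def[symmetric] using K1 c1 by (simp add: ennreal_mult mult_ac)
    qed
    also have "\<dots> = ennreal (K1 * c1) * (\<integral>\<^sup>+\<eta>. ennreal (?w \<eta> * (norm (fhat \<mu> \<eta>))\<^sup>2) * ennreal (exp (- (norm (\<eta> - ?P \<eta>))\<^sup>2 / 4)) \<partial>lborel)"
      by (rule nn_integral_cmult) measurable
    finally show ?thesis .
  qed
  show thesis by (rule that[of "K1 * c1"]) (use K1 c1 main in auto)
qed

text \<open>Averaged over \<open>V\<close>, the Gaussian in the distance from \<open>\<eta>\<close>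
  to the plane decays like \<open>norm \<eta> powr (- (n - m))\<close>. With the Sobolev weight this
  leaves the exponent \<open>- \<beta>\<close>: \<open>m + a < n\<close> means
  \<open>\<beta> > 0\<close>, and \<open>m + a < s\<close> is the growth condition of
  \<open>fhat_weighted_finite\<close>.\<close>

lemma sobolev_average_finite:
  fixes \<mu> :: "(real^'n) measure"
  assumes \<mu>: "borel_finite \<mu>" and g: "growth s \<mu>" and a: "0 \<le> a" "real m + a < s" "real m + a < real CARD('n)"
  shows "(\<integral>\<^sup>+V. sobolev a (damp \<mu>) V \<partial>\<gamma>) < \<infinity>"
proof -
  interpret A: borel_finite \<mu> by fact
  obtain V0 :: "(real^'n) set" where V0: "V0 \<in> grassmannian m" using exists_plane by blast
  obtain C where C: "0 < C" "\<And>V. V \<in> grassmannian m \<Longrightarrow>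
    sobolev a (damp \<mu>) V \<le> ennreal C * (\<integral>\<^sup>+\<eta>. ennreal ((1 + (norm \<eta>)\<^sup>2 / 2) powr (a / 2) * (norm (fhat \<mu> \<eta>))\<^sup>2) *
      ennreal (exp (- (norm (\<eta> - orth_proj V \<eta>))\<^sup>2 / 4)) \<partial>lborel)"
    by (rule sobolev_le[OF \<mu> a(1)]) (rule that)
  obtain D where D: "0 < D" "\<And>w. coproj.\<psi> w \<le> ennreal (D * (1 + (norm w)\<^sup>2) powr (- real (CARD('n) - m) / 2))"
    by (rule coproj.\<psi>_upper) (rule that)
  interpret L: pair_sigma_finite \<gamma> "lborel :: (real^'n) measure" ..
  define \<beta> where "\<beta> = (real CARD('n) - real m - a) / 2"
  have \<beta>: "0 < \<beta>" "real CARD('n) - 2 * \<beta> < s" using a by (auto simp: \<beta>_def field_simps)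
  let ?w = "\<lambda>\<eta>::real^'n. (1 + (norm \<eta>)\<^sup>2 / 2) powr (a / 2)"
  have "(\<integral>\<^sup>+V. sobolev a (damp \<mu>) V \<partial>\<gamma>) \<le> (\<integral>\<^sup>+V. ennreal C * (\<integral>\<^sup>+\<eta>. ennreal (?w \<eta> * (norm (fhat \<mu> \<eta>))\<^sup>2) *
      ennreal (exp (- (norm (\<eta> - orth_proj V \<eta>))\<^sup>2 / 4)) \<partial>lborel) \<partial>\<gamma>)"
    by (intro nn_integral_mono C) simp
  also have "\<dots> = ennreal C * (\<integral>\<^sup>+V. (\<integral>\<^sup>+\<eta>. ennreal (?w \<eta> * (norm (fhat \<mu> \<eta>))\<^sup>2) *
      ennreal (exp (- (norm (\<eta> - orth_proj V \<eta>))\<^sup>2 / 4)) \<partial>lborel) \<partial>\<gamma>)"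
    by (rule nn_integral_cmult) measurable
  also have "(\<integral>\<^sup>+V. (\<integral>\<^sup>+\<eta>. ennreal (?w \<eta> * (norm (fhat \<mu> \<eta>))\<^sup>2) * ennreal (exp (- (norm (\<eta> - orth_proj V \<eta>))\<^sup>2 / 4)) \<partial>lborel) \<partial>\<gamma>) =
    (\<integral>\<^sup>+\<eta>. (\<integral>\<^sup>+V. ennreal (?w \<eta> * (norm (fhat \<mu> \<eta>))\<^sup>2) * ennreal (exp (- (norm (\<eta> - orth_proj V \<eta>))\<^sup>2 / 4)) \<partial>\<gamma>) \<partial>lborel)"
    by (rule L.Fubini'[symmetric]) measurable
  also have "\<dots> \<le> (\<integral>\<^sup>+\<eta>. ennreal D * ennreal ((1 + (norm \<eta>)\<^sup>2 / 2) powr (- \<beta>) * (norm (fhat \<mu> \<eta>))\<^sup>2) \<partial>lborel)"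
  proof (rule nn_integral_mono)
    fix \<eta> :: "real^'n"
    have "(\<integral>\<^sup>+V. ennreal (?w \<eta> * (norm (fhat \<mu> \<eta>))\<^sup>2) * ennreal (exp (- (norm (\<eta> - orth_proj V \<eta>))\<^sup>2 / 4)) \<partial>\<gamma>) =
      ennreal (?w \<eta> * (norm (fhat \<mu> \<eta>))\<^sup>2) * (\<integral>\<^sup>+V. ennreal (exp (- (norm (\<eta> - orth_proj V \<eta>))\<^sup>2 / 4)) \<partial>\<gamma>)"
      by (rule nn_integral_cmult) measurable
    also have "(\<integral>\<^sup>+V. ennreal (exp (- (norm (\<eta> - orth_proj V \<eta>))\<^sup>2 / 4)) \<partial>\<gamma>) = coproj.\<psi> ((1 / sqrt 2) *\<^sub>R \<eta>)"
      unfolding coproj.\<psi>_def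
    proof (rule nn_integral_cong)
      fix V assume "V \<in> space \<gamma>"
      then have "(norm ((1 / sqrt 2) *\<^sub>R \<eta> - orth_proj V ((1 / sqrt 2) *\<^sub>R \<eta>)))\<^sup>2 = (1 / sqrt 2)\<^sup>2 * (norm (\<eta> - orth_proj V \<eta>))\<^sup>2"
        by (intro coproj.q_scale) simp
      then show "ennreal (exp (- (norm (\<eta> - orth_proj V \<eta>))\<^sup>2 / 4)) = ennreal (exp (- (norm ((1 / sqrt 2) *\<^sub>R \<eta> - orth_proj V ((1 / sqrt 2) *\<^sub>R \<eta>)))\<^sup>2 / 2))"
        by (simp add: power_divide)
    qed
    also have "\<dots> \<le> ennreal (D * (1 + (norm ((1 / sqrt 2) *\<^sub>R \<eta>))\<^sup>2) powr (- real (CARD('n) - m) / 2))" by (rule D)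
    also have "(norm ((1 / sqrt 2) *\<^sub>R \<eta>))\<^sup>2 = (norm \<eta>)\<^sup>2 / 2" by (simp add: power_divide)
    finally have "(\<integral>\<^sup>+V. ennreal (?w \<eta> * (norm (fhat \<mu> \<eta>))\<^sup>2) * ennreal (exp (- (norm (\<eta> - orth_proj V \<eta>))\<^sup>2 / 4)) \<partial>\<gamma>) \<le>
      ennreal (?w \<eta> * (norm (fhat \<mu> \<eta>))\<^sup>2) * ennreal (D * (1 + (norm \<eta>)\<^sup>2 / 2) powr (- real (CARD('n) - m) / 2))"
      by (simp add: mult_left_mono)
    also have "\<dots> = ennreal (D * ((?w \<eta> * (1 + (norm \<eta>)\<^sup>2 / 2) powr (- real (CARD('n) - m) / 2)) * (norm (fhat \<mu> \<eta>))\<^sup>2))"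
      using D by (simp add: mult_ac flip: ennreal_mult)
    also have "?w \<eta> * (1 + (norm \<eta>)\<^sup>2 / 2) powr (- real (CARD('n) - m) / 2) = (1 + (norm \<eta>)\<^sup>2 / 2) powr (- \<beta>)"
    proof -
      have "a / 2 + - real (CARD('n) - m) / 2 = - \<beta>" using mn by (simp add: \<beta>_def of_nat_diff field_simps)
      then show ?thesis by (simp only: powr_add[symmetric])
    qed
    finally show "(\<integral>\<^sup>+V. ennreal (?w \<eta> * (norm (fhat \<mu> \<eta>))\<^sup>2) * ennreal (exp (- (norm (\<eta> - orth_proj V \<eta>))\<^sup>2 / 4)) \<partial>\<gamma>) \<le>
       ennreal D * ennreal ((1 + (norm \<eta>)\<^sup>2 / 2) powr (- \<beta>) * (norm (fhat \<mu> \<eta>))\<^sup>2)"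
      using D by (simp add: ennreal_mult)
  qed
  also have "\<dots> = ennreal D * (\<integral>\<^sup>+\<eta>. ennreal ((1 + (norm \<eta>)\<^sup>2 / 2) powr (- \<beta>) * (norm (fhat \<mu> \<eta>))\<^sup>2) \<partial>lborel)"
    by (rule nn_integral_cmult) measurable
  finally have "(\<integral>\<^sup>+V. sobolev a (damp \<mu>) V \<partial>\<gamma>) \<le> ennreal C * (ennreal D * (\<integral>\<^sup>+\<eta>. ennreal ((1 + (norm \<eta>)\<^sup>2 / 2) powr (- \<beta>) * (norm (fhat \<mu> \<eta>))\<^sup>2) \<partial>lborel))"
    by (simp add: mult_left_mono)
  also have "\<dots> < \<infinity>"
    using fhat_weighted_finite[OF \<mu> V0 _ g _ \<beta>] a mn m1 by (auto simp: ennreal_mult_less_top)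
  finally show ?thesis .
qed

lemma proj_\<psi>_scaled:
  assumes "0 < \<tau>"
  shows "(\<integral>\<^sup>+V. ennreal (exp (- (norm (orth_proj V z))\<^sup>2 / (2 * \<tau>))) \<partial>\<gamma>) = proj.\<psi> ((1 / sqrt \<tau>) *\<^sub>R z)"
  unfolding proj.\<psi>_def
proof (rule nn_integral_cong)
  fix V assume "V \<in> space \<gamma>"
  then have "(norm (orth_proj V ((1 / sqrt \<tau>) *\<^sub>R z)))\<^sup>2 = (1 / sqrt \<tau>)\<^sup>2 * (norm (orth_proj V z))\<^sup>2"
    by (intro proj.q_scale) simp
  also have "\<dots> = (norm (orth_proj V z))\<^sup>2 / \<tau>" using assms by (simp add: power_divide)
  finally show "ennreal (exp (- (norm (orth_proj V z))\<^sup>2 / (2 * \<tau>))) = ennreal (exp (- (norm (orth_proj V ((1 / sqrt \<tau>) *\<^sub>R z)))\<^sup>2 / 2))"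
    by (simp add: mult.commute)
qed

text \<open>For fixed \<open>\<tau>\<close> the average over planes is at most a multiple of
  \<open>1 + |x - y|^2 / \<tau>\<close> to the power \<open>- m / 2\<close>; since
  \<open>t < m\<close>, growth bounds its double integral by a multiple of
  \<open>\<tau> powr (t / 2)\<close>. Against the kernel this leaves
  \<open>\<tau> powr ((t - r) / 2 - 1)\<close>, integrable at 0 as \<open>r < t\<close>.\<close>

lemma energy_average_finite:
  fixes \<nu> :: "(real^'n) measure"
  assumes \<nu>: "borel_finite \<nu>" and g: "growth t \<nu>" and r: "r < t" "t < real m"
  shows "(\<integral>\<^sup>+V. energy r \<nu> V \<partial>\<gamma>) < \<infinity>"
proof -
  interpret A: borel_finite \<nu> by fact
  interpret F: finite_measure "\<nu> \<Otimes>\<^sub>M \<nu>" using pair_borel_finite[OF \<nu> \<nu>] by simp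
  note [measurable_cong] = A.sets_eq
  interpret L: pair_sigma_finite \<gamma> "\<nu> \<Otimes>\<^sub>M \<nu>" ..
  interpret L1: pair_sigma_finite \<gamma> "lborel :: real measure" ..
  interpret L2: pair_sigma_finite "\<nu> \<Otimes>\<^sub>M \<nu>" "lborel :: real measure" ..
  obtain C where C: "0 < C" "\<And>\<tau>. 0 < \<tau> \<Longrightarrow>
    (\<integral>\<^sup>+p. ennreal ((1 + (norm (fst p - snd p))\<^sup>2 / \<tau>) powr (- real m / 2)) \<partial>(\<nu> \<Otimes>\<^sub>M \<nu>)) \<le> ennreal (C * \<tau> powr (t / 2))"
  proof (rule growth_pair_integral[OF \<nu> g r(2)])
    show "0 < real m" using m1 by simp
  qed (rule that)
  obtain D where D: "0 < D" "\<And>w. proj.\<psi> w \<le> ennreal (D * (1 + (norm w)\<^sup>2) powr (- real m / 2))"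
    by (rule proj.\<psi>_upper) (rule that)
  let ?e = "(t - r) / 2"
  have e: "0 < ?e" using r by simp
  let ?f = "\<lambda>\<tau>. ennreal (indicator {0<..} \<tau> * (\<tau> powr (- r / 2 - 1) * exp (- \<tau>)))"
  let ?h = "\<lambda>V p \<tau>. ennreal (exp (- (norm (orth_proj V (fst p - snd p)))\<^sup>2 / (2 * \<tau>)))"
  have riesz_kernel: "riesz_kernel r ((norm (orth_proj V (fst p - snd p)))\<^sup>2) = (\<integral>\<^sup>+\<tau>. ?f \<tau> * ?h V p \<tau> \<partial>lborel)" for V :: "(real^'n) set" and p
    unfolding riesz_kernel_def by (intro nn_integral_cong) (simp add: mult.assoc flip: ennreal_mult)
  have "(\<integral>\<^sup>+V. energy r \<nu> V \<partial>\<gamma>) = (\<integral>\<^sup>+V. (\<integral>\<^sup>+p. (\<integral>\<^sup>+\<tau>. ?f \<tau> * ?h V p \<tau> \<partial>lborel) \<partial>(\<nu> \<Otimes>\<^sub>M \<nu>)) \<partial>\<gamma>)"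
    unfolding energy_def riesz_kernel ..
  also have "\<dots> = (\<integral>\<^sup>+p. (\<integral>\<^sup>+V. (\<integral>\<^sup>+\<tau>. ?f \<tau> * ?h V p \<tau> \<partial>lborel) \<partial>\<gamma>) \<partial>(\<nu> \<Otimes>\<^sub>M \<nu>))"
    by (rule L.Fubini'[symmetric]) measurable
  also have "\<dots> = (\<integral>\<^sup>+p. (\<integral>\<^sup>+\<tau>. (\<integral>\<^sup>+V. ?f \<tau> * ?h V p \<tau> \<partial>\<gamma>) \<partial>lborel) \<partial>(\<nu> \<Otimes>\<^sub>M \<nu>))"
    by (intro nn_integral_cong L1.Fubini'[symmetric]) measurable
  also have "\<dots> = (\<integral>\<^sup>+\<tau>. (\<integral>\<^sup>+p. (\<integral>\<^sup>+V. ?f \<tau> * ?h V p \<tau> \<partial>\<gamma>) \<partial>(\<nu> \<Otimes>\<^sub>M \<nu>)) \<partial>lborel)"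
    by (rule L2.Fubini'[symmetric]) measurable
  also have "\<dots> \<le> (\<integral>\<^sup>+\<tau>. ennreal (D * C) * ennreal (indicator {0<..} \<tau> * (\<tau> powr (?e - 1) * exp (- (\<tau> * 1)))) \<partial>lborel)"
  proof (rule nn_integral_mono)
    fix \<tau> :: real
    show "(\<integral>\<^sup>+p. (\<integral>\<^sup>+V. ?f \<tau> * ?h V p \<tau> \<partial>\<gamma>) \<partial>(\<nu> \<Otimes>\<^sub>M \<nu>)) \<le> ennreal (D * C) * ennreal (indicator {0<..} \<tau> * (\<tau> powr (?e - 1) * exp (- (\<tau> * 1))))"
    proof (cases "0 < \<tau>")
      case True
      have "(\<integral>\<^sup>+p. (\<integral>\<^sup>+V. ?f \<tau> * ?h V p \<tau> \<partial>\<gamma>) \<partial>(\<nu> \<Otimes>\<^sub>M \<nu>)) = (\<integral>\<^sup>+p. ?f \<tau> * proj.\<psi> ((1 / sqrt \<tau>) *\<^sub>R (fst p - snd p)) \<partial>(\<nu> \<Otimes>\<^sub>M \<nu>))"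
      proof (rule nn_integral_cong)
        fix p :: "(real^'n) \<times> (real^'n)"
        show "(\<integral>\<^sup>+V. ?f \<tau> * ?h V p \<tau> \<partial>\<gamma>) = ?f \<tau> * proj.\<psi> ((1 / sqrt \<tau>) *\<^sub>R (fst p - snd p))"
          unfolding proj_\<psi>_scaled[OF True, symmetric] by (rule nn_integral_cmult) measurable
      qed
      also have "\<dots> = ?f \<tau> * (\<integral>\<^sup>+p. proj.\<psi> ((1 / sqrt \<tau>) *\<^sub>R (fst p - snd p)) \<partial>(\<nu> \<Otimes>\<^sub>M \<nu>))"
        by (rule nn_integral_cmult) measurable
      also have "(\<integral>\<^sup>+p. proj.\<psi> ((1 / sqrt \<tau>) *\<^sub>R (fst p - snd p)) \<partial>(\<nu> \<Otimes>\<^sub>M \<nu>)) \<le>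
        (\<integral>\<^sup>+p. ennreal D * ennreal ((1 + (norm (fst p - snd p))\<^sup>2 / \<tau>) powr (- real m / 2)) \<partial>(\<nu> \<Otimes>\<^sub>M \<nu>))"
      proof (rule nn_integral_mono)
        fix p :: "(real^'n) \<times> (real^'n)"
        have "(norm ((1 / sqrt \<tau>) *\<^sub>R (fst p - snd p)))\<^sup>2 = (norm (fst p - snd p))\<^sup>2 / \<tau>"
          using True by (simp add: power_divide)
        then show "proj.\<psi> ((1 / sqrt \<tau>) *\<^sub>R (fst p - snd p)) \<le> ennreal D * ennreal ((1 + (norm (fst p - snd p))\<^sup>2 / \<tau>) powr (- real m / 2))"
          using D(2)[of "(1 / sqrt \<tau>) *\<^sub>R (fst p - snd p)"] D(1) by (simp add: ennreal_mult)
      qed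
      also have "\<dots> = ennreal D * (\<integral>\<^sup>+p. ennreal ((1 + (norm (fst p - snd p))\<^sup>2 / \<tau>) powr (- real m / 2)) \<partial>(\<nu> \<Otimes>\<^sub>M \<nu>))"
        by (rule nn_integral_cmult) measurable
      also have "\<dots> \<le> ennreal D * ennreal (C * \<tau> powr (t / 2))" by (intro mult_left_mono C True) auto
      finally have "(\<integral>\<^sup>+p. (\<integral>\<^sup>+V. ?f \<tau> * ?h V p \<tau> \<partial>\<gamma>) \<partial>(\<nu> \<Otimes>\<^sub>M \<nu>)) \<le> ?f \<tau> * (ennreal D * ennreal (C * \<tau> powr (t / 2)))"
        by (simp add: mult_left_mono)
      also have "\<dots> = ennreal ((D * C) * ((\<tau> powr (- r / 2 - 1) * \<tau> powr (t / 2)) * exp (- \<tau>)))"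
        using True C D by (simp add: mult_ac flip: ennreal_mult)
      also have "\<tau> powr (- r / 2 - 1) * \<tau> powr (t / 2) = \<tau> powr (?e - 1)"
        by (simp add: field_simps flip: powr_add)
      finally show ?thesis using True C D by (simp add: ennreal_mult)
    qed simp
  qed
  also have "\<dots> = ennreal (D * C) * (\<integral>\<^sup>+\<tau>. ennreal (indicator {0<..} \<tau> * (\<tau> powr (?e - 1) * exp (- (\<tau> * 1)))) \<partial>lborel)"
    by (rule nn_integral_cmult) measurable
  also have "\<dots> < \<infinity>"
    by (subst nn_integral_Gamma[OF e]) (auto simp: ennreal_mult_less_top)
  finally show ?thesis .
qed

text \<open>All differences \<open>x - y\<close> are bounded by some \<open>R'\<close>, so the
  average over planes of the Gaussian is at least of order
  \<open>(R' / sqrt \<tau>) powr (- m)\<close>, and the normalisation cancels the dependence on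
  \<open>\<tau>\<close>.\<close>

lemma overlap_average_lower:
  fixes \<mu> \<nu> :: "(real^'n) measure"
  assumes \<mu>: "borel_finite \<mu>" and \<nu>: "borel_finite \<nu>"
    and K: "AE x in \<mu>. norm x \<le> R" "AE x in \<nu>. norm x \<le> R" and pos: "0 < measure \<mu> UNIV" "0 < measure \<nu> UNIV"
  obtains c where "0 < c" "\<And>\<tau>. 0 < \<tau> \<Longrightarrow> \<tau> \<le> 1 \<Longrightarrow>
    ennreal c \<le> (\<integral>\<^sup>+V. ennreal (\<tau> powr (- real m / 2) * overlap V \<tau> \<mu> \<nu>) \<partial>\<gamma>)"
proof -
  interpret A: borel_finite \<mu> by fact
  interpret B: borel_finite \<nu> by fact
  interpret F: finite_measure "\<mu> \<Otimes>\<^sub>M \<nu>" using pair_borel_finite[OF \<mu> \<nu>] by simp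
  note [measurable_cong] = A.sets_eq B.sets_eq
  interpret L: pair_sigma_finite \<gamma> "\<mu> \<Otimes>\<^sub>M \<nu>" ..
  interpret MN: pair_sigma_finite \<mu> \<nu> ..
  obtain c R0 where c: "0 < c" "0 < R0" "\<And>w. R0 \<le> norm w \<Longrightarrow> ennreal (c * norm w powr (- real m)) \<le> proj.\<psi> w"
    by (rule proj.\<psi>_lower[OF mn]) (rule that)
  define R' where "R' = max R0 (2 * R)"
  have R': "0 < R'" "R0 \<le> R'" "2 * R \<le> R'" using c by (auto simp: R'_def)
  have AEp: "AE p in \<mu> \<Otimes>\<^sub>M \<nu>. norm (fst p - snd p) \<le> R'"
  proof (rule MN.AE_pair_measure)
    show "{p \<in> space (\<mu> \<Otimes>\<^sub>M \<nu>). norm (fst p - snd p) \<le> R'} \<in> sets (\<mu> \<Otimes>\<^sub>M \<nu>)" by measurable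
    show "AE x in \<mu>. AE y in \<nu>. norm (fst (x, y) - snd (x, y)) \<le> R'"
    proof (rule AE_mp[OF K(1)], rule AE_I2, rule impI)
      fix x :: "real^'n" assume x: "norm x \<le> R"
      show "AE y in \<nu>. norm (fst (x, y) - snd (x, y)) \<le> R'"
      proof (rule AE_mp[OF K(2)], rule AE_I2, rule impI)
        fix y :: "real^'n" assume "norm y \<le> R"
        then show "norm (fst (x, y) - snd (x, y)) \<le> R'"
          using x norm_triangle_ineq4[of x y] R' by simp
      qed
    qed
  qed
  define c2 where "c2 = c * R' powr (- real m) * (measure \<mu> UNIV * measure \<nu> UNIV)"
  have c2: "0 < c2" using c R' pos by (simp add: c2_def)
  obtain e :: "real^'n" where e: "norm e = 1" using norm_Basis SOME_Basis by blast
  have "ennreal c2 \<le> (\<integral>\<^sup>+V. ennreal (\<tau> powr (- real m / 2) * overlap V \<tau> \<mu> \<nu>) \<partial>\<gamma>)" if \<tau>: "0 < \<tau>" "\<tau> \<le> 1" for \<tau>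
  proof -
    let ?t = "\<tau> powr (- real m / 2)"
    have "(\<integral>\<^sup>+V. ennreal (?t * overlap V \<tau> \<mu> \<nu>) \<partial>\<gamma>) = (\<integral>\<^sup>+V. ennreal ?t * (\<integral>\<^sup>+p. ennreal (exp (- (norm (orth_proj V (fst p - snd p)))\<^sup>2 / (2 * \<tau>))) \<partial>(\<mu> \<Otimes>\<^sub>M \<nu>)) \<partial>\<gamma>)"
    proof (rule nn_integral_cong)
      fix V assume "V \<in> space \<gamma>"
      then have sV: "subspace V" by (simp add: grassmannian_subspace)
      show "ennreal (?t * overlap V \<tau> \<mu> \<nu>) = ennreal ?t * (\<integral>\<^sup>+p. ennreal (exp (- (norm (orth_proj V (fst p - snd p)))\<^sup>2 / (2 * \<tau>))) \<partial>(\<mu> \<Otimes>\<^sub>M \<nu>))"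
        using nn_overlap[OF \<mu> \<nu> sV \<tau>(1)] by (simp add: ennreal_mult)
    qed
    also have "\<dots> = ennreal ?t * (\<integral>\<^sup>+V. (\<integral>\<^sup>+p. ennreal (exp (- (norm (orth_proj V (fst p - snd p)))\<^sup>2 / (2 * \<tau>))) \<partial>(\<mu> \<Otimes>\<^sub>M \<nu>)) \<partial>\<gamma>)"
      by (rule nn_integral_cmult) measurable
    also have "(\<integral>\<^sup>+V. (\<integral>\<^sup>+p. ennreal (exp (- (norm (orth_proj V (fst p - snd p)))\<^sup>2 / (2 * \<tau>))) \<partial>(\<mu> \<Otimes>\<^sub>M \<nu>)) \<partial>\<gamma>) =
      (\<integral>\<^sup>+p. (\<integral>\<^sup>+V. ennreal (exp (- (norm (orth_proj V (fst p - snd p)))\<^sup>2 / (2 * \<tau>))) \<partial>\<gamma>) \<partial>(\<mu> \<Otimes>\<^sub>M \<nu>))"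
      by (rule L.Fubini'[symmetric]) measurable
    also have "\<dots> = (\<integral>\<^sup>+p. proj.\<psi> ((1 / sqrt \<tau>) *\<^sub>R (fst p - snd p)) \<partial>(\<mu> \<Otimes>\<^sub>M \<nu>))"
      by (simp only: proj_\<psi>_scaled[OF \<tau>(1)])
    finally have eq: "(\<integral>\<^sup>+V. ennreal (?t * overlap V \<tau> \<mu> \<nu>) \<partial>\<gamma>) = ennreal ?t * (\<integral>\<^sup>+p. proj.\<psi> ((1 / sqrt \<tau>) *\<^sub>R (fst p - snd p)) \<partial>(\<mu> \<Otimes>\<^sub>M \<nu>))" .
    have "(\<integral>\<^sup>+p. ennreal (c * (R' / sqrt \<tau>) powr (- real m)) \<partial>(\<mu> \<Otimes>\<^sub>M \<nu>)) \<le> (\<integral>\<^sup>+p. proj.\<psi> ((1 / sqrt \<tau>) *\<^sub>R (fst p - snd p)) \<partial>(\<mu> \<Otimes>\<^sub>M \<nu>))"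
    proof (rule nn_integral_mono_AE, rule AE_mp[OF AEp], intro AE_I2 impI)
      fix p :: "(real^'n) \<times> (real^'n)" assume p: "norm (fst p - snd p) \<le> R'"
      \<comment> \<open>A comparison vector at least as long as all rescaled differences. As
        \<open>\<tau> \<le> 1\<close> it also lies beyond the radius \<open>R0\<close> from which
        the lower bound holds, while \<open>x - y\<close> itself may be short.\<close>
      define w where "w = (R' / sqrt \<tau>) *\<^sub>R e"
      have st: "0 < sqrt \<tau>" "sqrt \<tau> \<le> 1" using \<tau> by auto
      have nw: "norm w = R' / sqrt \<tau>" using e R' \<tau> by (simp add: w_def)
      have "R' * sqrt \<tau> \<le> R' * 1" using st R' by (intro mult_left_mono) auto
      then have "R' \<le> R' / sqrt \<tau>" using st by (simp add: le_divide_eq)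
      then have "ennreal (c * norm w powr (- real m)) \<le> proj.\<psi> w" using R' by (intro c) (simp add: nw)
      also have "\<dots> \<le> proj.\<psi> ((1 / sqrt \<tau>) *\<^sub>R (fst p - snd p))"
        using p st by (intro proj.\<psi>_antimono) (simp add: nw divide_right_mono)
      finally show "ennreal (c * (R' / sqrt \<tau>) powr (- real m)) \<le> proj.\<psi> ((1 / sqrt \<tau>) *\<^sub>R (fst p - snd p))"
        by (simp add: nw)
    qed
    then have "ennreal ?t * (\<integral>\<^sup>+p. ennreal (c * (R' / sqrt \<tau>) powr (- real m)) \<partial>(\<mu> \<Otimes>\<^sub>M \<nu>)) \<le> (\<integral>\<^sup>+V. ennreal (?t * overlap V \<tau> \<mu> \<nu>) \<partial>\<gamma>)"
      unfolding eq by (intro mult_left_mono) auto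
    moreover have "(\<integral>\<^sup>+p. ennreal (c * (R' / sqrt \<tau>) powr (- real m)) \<partial>(\<mu> \<Otimes>\<^sub>M \<nu>)) =
      ennreal (c * (R' / sqrt \<tau>) powr (- real m) * (measure \<mu> UNIV * measure \<nu> UNIV))"
      using c pair_borel_finite(3,4)[OF \<mu> \<nu>] by (simp add: F.emeasure_eq_measure flip: ennreal_mult)
    moreover have "?t * (c * (R' / sqrt \<tau>) powr (- real m) * (measure \<mu> UNIV * measure \<nu> UNIV)) = c2"
    proof -
      have "(R' / sqrt \<tau>) powr (- real m) = R' powr (- real m) / sqrt \<tau> powr (- real m)"
        using R' \<tau> by (simp add: powr_divide)
      also have "sqrt \<tau> powr (- real m) = ?t" using \<tau> by (simp add: powr_half_sqrt[symmetric] powr_powr)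
      finally show ?thesis using \<tau> by (simp add: c2_def)
    qed
    ultimately show ?thesis using c by (simp flip: ennreal_mult)
  qed
  then show thesis using that c2 by blast
qed

end

section \<open>Measures with disjoint projections\<close>

text \<open>Cauchy-Schwarz with a free parameter, pointwise on the Fourier side: with
  \<open>w\<close> the Sobolev weight, the product of the moduli \<open>x\<close> and
  \<open>y\<close> is at most \<open>\<delta>\<close> times \<open>w * x^2\<close> plus
  \<open>1 / \<delta>\<close> times \<open>y^2 / w\<close>. A small \<open>\<delta>\<close> absorbs
  the finite norm of \<open>\<mu>\<close> before that of \<open>\<nu>\<close> is made small.\<close>

lemma overlap_le_sobolev:
  fixes V :: "(real^'n) set" and \<mu> \<nu> :: "(real^'n) measure"
  assumes \<mu>: "borel_finite \<mu>" and \<nu>: "borel_finite \<nu>" and V: "V \<in> grassmannian m" and \<tau>: "0 < \<tau>" and \<delta>: "0 < \<delta>"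
  shows "ennreal ((2 * pi) powr (CARD('n) / 2) * \<tau> powr (- real m / 2) * overlap V \<tau> \<mu> \<nu>) \<le>
    ennreal \<delta> * sobolev a \<mu> V + ennreal (1 / \<delta>) * sobolev (- a) \<nu> V"
proof -
  interpret A: borel_finite \<mu> by fact
  interpret B: borel_finite \<nu> by fact
  have sV: "subspace V" using V by (rule grassmannian_subspace)
  note [measurable] = borel_measurable_orth_proj[OF sV]
  let ?P = "orth_proj V"
  let ?F = "\<lambda>\<xi>. (exp (- (\<tau> * (norm (?P \<xi>))\<^sup>2) / 2) * tgauss V \<xi>) *\<^sub>R (fhat \<mu> (?P \<xi>) * cnj (fhat \<nu> (?P \<xi>)))"
  have "ennreal ((2 * pi) powr (CARD('n) / 2) * \<tau> powr (- real m / 2) * overlap V \<tau> \<mu> \<nu>) = ennreal (norm (CLINT \<xi>|lborel. ?F \<xi>))"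
    unfolding overlap_fhat[OF \<mu> \<nu> V \<tau>] norm_of_real using nn_overlap(2)[OF \<mu> \<nu> sV \<tau>] by (simp add: abs_mult)
  also have "\<dots> \<le> (\<integral>\<^sup>+\<xi>. ennreal (norm (?F \<xi>)) \<partial>lborel)"
  proof (cases "integrable lborel ?F")
    case True
    then show ?thesis by (rule integral_norm_bound_ennreal)
  next
    case False
    then have "(CLINT \<xi>|lborel. ?F \<xi>) = 0" by (rule not_integrable_integral_eq)
    then show ?thesis by (simp only: norm_zero ennreal_0 zero_le)
  qed
  also have "\<dots> \<le> (\<integral>\<^sup>+\<xi>. ennreal \<delta> * ennreal ((1 + (norm (?P \<xi>))\<^sup>2 / 2) powr (a / 2) * tgauss V \<xi> * (norm (fhat \<mu> (?P \<xi>)))\<^sup>2) +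
      ennreal (1 / \<delta>) * ennreal ((1 + (norm (?P \<xi>))\<^sup>2 / 2) powr (- a / 2) * tgauss V \<xi> * (norm (fhat \<nu> (?P \<xi>)))\<^sup>2) \<partial>lborel)"
  proof (rule nn_integral_mono)
    fix \<xi>
    define x where "x = norm (fhat \<mu> (?P \<xi>))"
    define y where "y = norm (fhat \<nu> (?P \<xi>))"
    define w where "w = (1 + (norm (?P \<xi>))\<^sup>2 / 2) powr (a / 2)"
    have xy: "0 \<le> x" "0 \<le> y" by (auto simp: x_def y_def)
    have w: "0 < w" "(1 + (norm (?P \<xi>))\<^sup>2 / 2) powr (- a / 2) = 1 / w"
      by (auto simp: w_def powr_minus_divide add_pos_nonneg add_nonneg_eq_0_iff)
    have "0 \<le> (\<delta> * w * x - y)\<^sup>2" by simp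
    then have "2 * (\<delta> * w * x * y) \<le> (\<delta> * w * x)\<^sup>2 + y\<^sup>2" by (simp add: power2_diff)
    moreover have "0 \<le> \<delta> * w * x * y" using \<delta> w xy by simp
    ultimately have "\<delta> * w * x * y \<le> (\<delta> * w * x)\<^sup>2 + y\<^sup>2" by linarith
    then have "x * y \<le> \<delta> * (w * x\<^sup>2) + 1 / \<delta> * (1 / w * y\<^sup>2)"
      using \<delta> w by (simp add: field_simps power2_eq_square)
    then have *: "tgauss V \<xi> * (x * y) \<le> tgauss V \<xi> * (\<delta> * (w * x\<^sup>2) + 1 / \<delta> * (1 / w * y\<^sup>2))"
      by (intro mult_left_mono) auto
    have "norm (?F \<xi>) = exp (- (\<tau> * (norm (?P \<xi>))\<^sup>2) / 2) * (tgauss V \<xi> * (x * y))"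
      by (simp add: norm_mult x_def y_def)
    also have "\<dots> \<le> 1 * (tgauss V \<xi> * (x * y))"
      using \<tau> xy by (intro mult_right_mono) auto
    also have "\<dots> \<le> \<delta> * (w * tgauss V \<xi> * x\<^sup>2) + 1 / \<delta> * (1 / w * tgauss V \<xi> * y\<^sup>2)"
      using * by (simp add: algebra_simps)
    finally have le: "norm (?F \<xi>) \<le> \<delta> * (w * tgauss V \<xi> * x\<^sup>2) + 1 / \<delta> * (1 / w * tgauss V \<xi> * y\<^sup>2)" .
    have split: "ennreal (\<delta> * p + 1 / \<delta> * q) = ennreal \<delta> * ennreal p + ennreal (1 / \<delta>) * ennreal q" if "0 \<le> p" "0 \<le> q" for p q
      using that \<delta> by (simp add: ennreal_plus flip: ennreal_mult)
    show "ennreal (norm (?F \<xi>)) \<le> ennreal \<delta> * ennreal ((1 + (norm (?P \<xi>))\<^sup>2 / 2) powr (a / 2) * tgauss V \<xi> * (norm (fhat \<mu> (?P \<xi>)))\<^sup>2) +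
      ennreal (1 / \<delta>) * ennreal ((1 + (norm (?P \<xi>))\<^sup>2 / 2) powr (- a / 2) * tgauss V \<xi> * (norm (fhat \<nu> (?P \<xi>)))\<^sup>2)"
      unfolding x_def[symmetric] y_def[symmetric] w_def[symmetric] w(2)
      using le w(1) by (subst split[symmetric]) (auto intro: ennreal_leI)
  qed
  also have "\<dots> = ennreal \<delta> * sobolev a \<mu> V + ennreal (1 / \<delta>) * sobolev (- a) \<nu> V"
    unfolding sobolev_def by (subst nn_integral_add) (simp_all add: nn_integral_cmult)
  finally show ?thesis .
qed

text \<open>The negative weight is a Gamma integral of Gaussians, and each Gaussian integral is an
  overlap of \<open>\<nu>\<close> with itself. The powers of \<open>\<tau>\<close> combine as
  \<open>(a / 2 - 1) - m / 2 = - (m - a) / 2 - 1\<close>, the exponent in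
  \<open>riesz_kernel\<close>.\<close>

lemma sobolev_neg_eq_energy:
  fixes V :: "(real^'n) set" and \<nu> :: "(real^'n) measure"
  assumes \<nu>: "borel_finite \<nu>" and V: "V \<in> grassmannian m" and a: "0 < a"
  shows "ennreal (Gamma (a / 2)) * sobolev (- a) \<nu> V = ennreal ((2 * pi) powr (CARD('n) / 2)) * energy (real m - a) \<nu> V"
proof -
  interpret B: borel_finite \<nu> by fact
  interpret F: finite_measure "\<nu> \<Otimes>\<^sub>M \<nu>" using pair_borel_finite[OF \<nu> \<nu>] by simp
  note [measurable_cong] = B.sets_eq
  interpret L2: pair_sigma_finite "\<nu> \<Otimes>\<^sub>M \<nu>" "lborel :: real measure" ..
  have sV: "subspace V" using V by (rule grassmannian_subspace)
  note [measurable] = borel_measurable_orth_proj[OF sV]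
  let ?P = "orth_proj V"
  let ?c = "(2 * pi) powr (CARD('n) / 2)"
  have a2: "0 < a / 2" using a by simp
  have \<Gamma>: "0 < Gamma (a / 2)" by (rule Gamma_real_pos[OF a2])
  let ?f = "\<lambda>\<tau>. ennreal (indicator {0<..} \<tau> * (\<tau> powr (a / 2 - 1) * exp (- \<tau>)))"
  let ?h = "\<lambda>\<tau> \<xi>. ennreal (exp (- (\<tau> * (norm (?P \<xi>))\<^sup>2) / 2) * tgauss V \<xi> * (norm (fhat \<nu> (?P \<xi>)))\<^sup>2)"
  have "ennreal (Gamma (a / 2)) * sobolev (- a) \<nu> V = (\<integral>\<^sup>+\<xi>. ennreal (Gamma (a / 2)) * ennreal ((1 + (norm (?P \<xi>))\<^sup>2 / 2) powr (- a / 2) * tgauss V \<xi> * (norm (fhat \<nu> (?P \<xi>)))\<^sup>2) \<partial>lborel)"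
    unfolding sobolev_def by (rule nn_integral_cmult[symmetric]) measurable
  also have "\<dots> = (\<integral>\<^sup>+\<xi>. (\<integral>\<^sup>+\<tau>. ?f \<tau> * ?h \<tau> \<xi> \<partial>lborel) \<partial>lborel)"
  proof (rule nn_integral_cong)
    fix \<xi>
    have A: "0 < 1 + (norm (?P \<xi>))\<^sup>2 / 2" by (simp add: add_pos_nonneg)
    have m2: "- a / 2 = - (a / 2)" by simp
    have "ennreal (Gamma (a / 2)) * ennreal ((1 + (norm (?P \<xi>))\<^sup>2 / 2) powr (- a / 2) * tgauss V \<xi> * (norm (fhat \<nu> (?P \<xi>)))\<^sup>2) =
      ennreal (Gamma (a / 2) * (1 + (norm (?P \<xi>))\<^sup>2 / 2) powr (- (a / 2))) * ennreal (tgauss V \<xi> * (norm (fhat \<nu> (?P \<xi>)))\<^sup>2)"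
      unfolding m2 using \<Gamma> by (simp add: mult.assoc flip: ennreal_mult)
    also have "\<dots> = (\<integral>\<^sup>+\<tau>. ennreal (indicator {0<..} \<tau> * (\<tau> powr (a / 2 - 1) * exp (- (\<tau> * (1 + (norm (?P \<xi>))\<^sup>2 / 2))))) * ennreal (tgauss V \<xi> * (norm (fhat \<nu> (?P \<xi>)))\<^sup>2) \<partial>lborel)"
      unfolding nn_integral_Gamma[OF a2 A, symmetric] by (rule nn_integral_multc[symmetric]) measurable
    also have "\<dots> = (\<integral>\<^sup>+\<tau>. ?f \<tau> * ?h \<tau> \<xi> \<partial>lborel)"
    proof (rule nn_integral_cong)
      fix \<tau> :: real
      have e: "exp (- (\<tau> * (1 + (norm (?P \<xi>))\<^sup>2 / 2))) = exp (- \<tau>) * exp (- (\<tau> * (norm (?P \<xi>))\<^sup>2) / 2)"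
        by (simp add: algebra_simps flip: exp_add)
      show "ennreal (indicator {0<..} \<tau> * (\<tau> powr (a / 2 - 1) * exp (- (\<tau> * (1 + (norm (?P \<xi>))\<^sup>2 / 2))))) * ennreal (tgauss V \<xi> * (norm (fhat \<nu> (?P \<xi>)))\<^sup>2) = ?f \<tau> * ?h \<tau> \<xi>"
        unfolding e by (simp add: mult.assoc flip: ennreal_mult)
    qed
    finally show "ennreal (Gamma (a / 2)) * ennreal ((1 + (norm (?P \<xi>))\<^sup>2 / 2) powr (- a / 2) * tgauss V \<xi> * (norm (fhat \<nu> (?P \<xi>)))\<^sup>2) = (\<integral>\<^sup>+\<tau>. ?f \<tau> * ?h \<tau> \<xi> \<partial>lborel)" .
  qed
  also have "\<dots> = (\<integral>\<^sup>+\<tau>. (\<integral>\<^sup>+\<xi>. ?f \<tau> * ?h \<tau> \<xi> \<partial>lborel) \<partial>lborel)"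
    by (rule lborel_pair.Fubini') measurable
  also have "\<dots> = (\<integral>\<^sup>+\<tau>. ?f \<tau> * (\<integral>\<^sup>+\<xi>. ?h \<tau> \<xi> \<partial>lborel) \<partial>lborel)"
    by (intro nn_integral_cong nn_integral_cmult) measurable
  also have "\<dots> = (\<integral>\<^sup>+\<tau>. (\<integral>\<^sup>+p. ennreal ?c * ennreal (indicator {0<..} \<tau> * (\<tau> powr (- (real m - a) / 2 - 1) * exp (- \<tau>) * exp (- (norm (?P (fst p - snd p)))\<^sup>2 / (2 * \<tau>)))) \<partial>(\<nu> \<Otimes>\<^sub>M \<nu>)) \<partial>lborel)"
  proof (rule nn_integral_cong)
    fix \<tau> :: real
    show "?f \<tau> * (\<integral>\<^sup>+\<xi>. ?h \<tau> \<xi> \<partial>lborel) = (\<integral>\<^sup>+p. ennreal ?c * ennreal (indicator {0<..} \<tau> * (\<tau> powr (- (real m - a) / 2 - 1) * exp (- \<tau>) * exp (- (norm (?P (fst p - snd p)))\<^sup>2 / (2 * \<tau>)))) \<partial>(\<nu> \<Otimes>\<^sub>M \<nu>))"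
    proof (cases "0 < \<tau>")
      case True
      have "?f \<tau> * (\<integral>\<^sup>+\<xi>. ?h \<tau> \<xi> \<partial>lborel) = ?f \<tau> * (ennreal (?c * \<tau> powr (- real m / 2)) * ennreal (overlap V \<tau> \<nu> \<nu>))"
        unfolding nn_overlap_fhat[OF \<nu> V True] using nn_overlap(2)[OF \<nu> \<nu> sV True] by (simp add: ennreal_mult)
      also have "\<dots> = ennreal (?c * (\<tau> powr (a / 2 - 1) * \<tau> powr (- real m / 2) * exp (- \<tau>))) * ennreal (overlap V \<tau> \<nu> \<nu>)"
        using True by (simp add: mult_ac flip: ennreal_mult mult.assoc[of "ennreal _" "ennreal _" "ennreal _"])
      also have "\<tau> powr (a / 2 - 1) * \<tau> powr (- real m / 2) = \<tau> powr (- (real m - a) / 2 - 1)"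
      proof -
        have "a / 2 - 1 + - real m / 2 = - (real m - a) / 2 - 1" by (simp add: field_simps)
        then show ?thesis by (simp only: powr_add[symmetric])
      qed
      also have "ennreal (?c * (\<tau> powr (- (real m - a) / 2 - 1) * exp (- \<tau>))) * ennreal (overlap V \<tau> \<nu> \<nu>) =
        (\<integral>\<^sup>+p. ennreal (?c * (\<tau> powr (- (real m - a) / 2 - 1) * exp (- \<tau>))) * ennreal (exp (- (norm (?P (fst p - snd p)))\<^sup>2 / (2 * \<tau>))) \<partial>(\<nu> \<Otimes>\<^sub>M \<nu>))"
        unfolding nn_overlap(1)[OF \<nu> \<nu> sV True] by (rule nn_integral_cmult[symmetric]) measurable
      finally show ?thesis using True by (simp add: mult.assoc flip: ennreal_mult)
    qed simp
  qed
  also have "\<dots> = (\<integral>\<^sup>+p. (\<integral>\<^sup>+\<tau>. ennreal ?c * ennreal (indicator {0<..} \<tau> * (\<tau> powr (- (real m - a) / 2 - 1) * exp (- \<tau>) * exp (- (norm (?P (fst p - snd p)))\<^sup>2 / (2 * \<tau>)))) \<partial>lborel) \<partial>(\<nu> \<Otimes>\<^sub>M \<nu>))"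
    by (rule L2.Fubini') measurable
  also have "\<dots> = (\<integral>\<^sup>+p. ennreal ?c * riesz_kernel (real m - a) ((norm (?P (fst p - snd p)))\<^sup>2) \<partial>(\<nu> \<Otimes>\<^sub>M \<nu>))"
    unfolding riesz_kernel_def by (intro nn_integral_cong nn_integral_cmult) measurable
  also have "\<dots> = ennreal ?c * energy (real m - a) \<nu> V"
    unfolding energy_def by (rule nn_integral_cmult) measurable
  finally show ?thesis .
qed

text \<open>A density keeps the measure on the whole space, so the restricted measure is again
  \<open>borel_finite\<close> and can enter \<open>sobolev\<close> and
  \<open>energy\<close>.\<close>

definition cut :: "(real^'n) measure \<Rightarrow> (real^'n) set \<Rightarrow> (real^'n) measure" where
  "cut \<nu> D = density \<nu> (indicator D)"

lemma cut_borel_finite: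
  assumes "borel_finite \<nu>" "D \<in> sets borel"
  shows "borel_finite (cut \<nu> D)"
proof -
  interpret A: borel_finite \<nu> by fact
  have "emeasure (cut \<nu> D) UNIV = emeasure \<nu> D"
    unfolding cut_def using assms(2) by (subst emeasure_density) (auto simp: A.sets_eq)
  then have "emeasure (cut \<nu> D) (space (cut \<nu> D)) \<noteq> \<infinity>" by (simp add: cut_def A.emeasure_eq_measure)
  then have "finite_measure (cut \<nu> D)" by (rule finite_measureI)
  then show ?thesis
    by (simp add: borel_finite_def borel_finite_axioms_def cut_def A.sets_eq)
qed

lemma nn_integral_cut:
  assumes "borel_finite \<nu>" "D \<in> sets borel" "f \<in> borel_measurable borel"
  shows "(\<integral>\<^sup>+x. f x \<partial>cut \<nu> D) = (\<integral>\<^sup>+x. indicator D x * f x \<partial>\<nu>)"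
proof -
  interpret A: borel_finite \<nu> by fact
  show ?thesis unfolding cut_def using assms(2,3)
    by (intro nn_integral_density) (auto simp: A.sets_eq cong: measurable_cong_sets)
qed

lemma nn_integral_pair_cut:
  fixes \<nu> :: "(real^'n) measure"
  assumes \<nu>: "borel_finite \<nu>" and D [measurable]: "D \<in> sets borel" and f [measurable]: "f \<in> borel_measurable (borel \<Otimes>\<^sub>M borel)"
  shows "(\<integral>\<^sup>+p. f p \<partial>(cut \<nu> D \<Otimes>\<^sub>M cut \<nu> D)) = (\<integral>\<^sup>+p. indicator D (fst p) * indicator D (snd p) * f p \<partial>(\<nu> \<Otimes>\<^sub>M \<nu>))"
proof -
  interpret A: borel_finite \<nu> by fact
  note c = cut_borel_finite[OF \<nu> D]
  interpret C: borel_finite "cut \<nu> D" by (rule c)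
  note [measurable_cong] = A.sets_eq C.sets_eq
  have "(\<integral>\<^sup>+p. f p \<partial>(cut \<nu> D \<Otimes>\<^sub>M cut \<nu> D)) = (\<integral>\<^sup>+x. \<integral>\<^sup>+y. f (x, y) \<partial>cut \<nu> D \<partial>cut \<nu> D)"
    by (rule C.nn_integral_pair[OF c f])
  also have "\<dots> = (\<integral>\<^sup>+x. indicator D x * (\<integral>\<^sup>+y. f (x, y) \<partial>cut \<nu> D) \<partial>\<nu>)"
    by (rule nn_integral_cut[OF \<nu> D]) measurable
  also have "\<dots> = (\<integral>\<^sup>+x. indicator D x * (\<integral>\<^sup>+y. indicator D y * f (x, y) \<partial>\<nu>) \<partial>\<nu>)"
    by (intro nn_integral_cong) (subst nn_integral_cut[OF \<nu> D], measurable)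
  also have "\<dots> = (\<integral>\<^sup>+x. (\<integral>\<^sup>+y. indicator D x * (indicator D y * f (x, y)) \<partial>\<nu>) \<partial>\<nu>)"
    by (intro nn_integral_cong nn_integral_cmult[symmetric]) measurable
  also have "\<dots> = (\<integral>\<^sup>+p. indicator D (fst p) * indicator D (snd p) * f p \<partial>(\<nu> \<Otimes>\<^sub>M \<nu>))"
    by (subst A.nn_integral_pair[OF \<nu>]) (simp_all add: mult.assoc)
  finally show ?thesis .
qed

text \<open>A point whose projection has distance at least \<open>d\<close> from \<open>C\<close>
  sees \<open>\<mu>\<close> only through kernel values of at most
  \<open>exp (- d^2 / (2 * \<tau>))\<close>; that part disappears faster than any power of
  \<open>\<tau>\<close>.\<close>

lemma overlap_split:
  fixes V :: "(real^'n) set" and \<mu> \<nu> :: "(real^'n) measure"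
  assumes \<mu>: "borel_finite \<mu>" and \<nu>: "borel_finite \<nu>" and V: "subspace V" and \<tau>: "0 < \<tau>" and d: "0 < d"
    and C: "AE x in \<mu>. orth_proj V x \<in> C"
  defines "D \<equiv> {y. infdist (orth_proj V y) C < d}"
  shows "ennreal (overlap V \<tau> \<mu> \<nu>) \<le> ennreal (overlap V \<tau> \<mu> (cut \<nu> D)) + ennreal (exp (- d\<^sup>2 / (2 * \<tau>)) * (measure \<mu> UNIV * measure \<nu> UNIV))"
proof -
  interpret A: borel_finite \<mu> by fact
  interpret B: borel_finite \<nu> by fact
  note [measurable] = borel_measurable_orth_proj[OF V]
  let ?P = "orth_proj V"
  have [measurable]: "(\<lambda>x. infdist x C) \<in> borel_measurable borel"
    by (intro borel_measurable_continuous_onI continuous_intros)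
  have D: "D \<in> sets borel" unfolding D_def by measurable
  note [measurable] = D
  note c = cut_borel_finite[OF \<nu> D]
  interpret E: borel_finite "cut \<nu> D" by (rule c)
  note [measurable_cong] = A.sets_eq B.sets_eq E.sets_eq
  let ?h = "\<lambda>x y. ennreal (exp (- (norm (?P (x - y)))\<^sup>2 / (2 * \<tau>)))"
  have G: "ennreal (overlap V \<tau> \<mu> \<rho>) = (\<integral>\<^sup>+x. \<integral>\<^sup>+y. ?h x y \<partial>\<rho> \<partial>\<mu>)" if \<rho>: "borel_finite \<rho>" for \<rho>
  proof -
    interpret R: borel_finite \<rho> by fact
    show ?thesis unfolding nn_overlap(1)[OF \<mu> \<rho> V \<tau>] by (subst R.nn_integral_pair[OF \<mu>]) simp_all
  qed
  have "ennreal (overlap V \<tau> \<mu> \<nu>) = (\<integral>\<^sup>+x. \<integral>\<^sup>+y. ?h x y \<partial>\<nu> \<partial>\<mu>)" by (rule G[OF \<nu>])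
  also have "\<dots> \<le> (\<integral>\<^sup>+x. (\<integral>\<^sup>+y. ?h x y \<partial>cut \<nu> D) + ennreal (exp (- d\<^sup>2 / (2 * \<tau>)) * measure \<nu> UNIV) \<partial>\<mu>)"
  proof (rule nn_integral_mono_AE, rule AE_mp[OF C], rule AE_I2, rule impI)
    fix x assume x: "?P x \<in> C"
    have "(\<integral>\<^sup>+y. ?h x y \<partial>\<nu>) \<le> (\<integral>\<^sup>+y. indicator D y * ?h x y + ennreal (exp (- d\<^sup>2 / (2 * \<tau>))) \<partial>\<nu>)"
    proof (rule nn_integral_mono)
      fix y
      show "?h x y \<le> indicator D y * ?h x y + ennreal (exp (- d\<^sup>2 / (2 * \<tau>)))"
      proof (cases "y \<in> D")
        case False
        then have "d \<le> infdist (?P y) C" by (simp add: D_def)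
        also have "\<dots> \<le> dist (?P y) (?P x)" by (rule infdist_le[OF x])
        also have "\<dots> = norm (?P (x - y))" by (simp add: dist_norm norm_minus_commute linear_diff[OF linear_orth_proj[OF V]])
        finally have "d\<^sup>2 \<le> (norm (?P (x - y)))\<^sup>2" using d by (intro power_mono) auto
        then show ?thesis using False \<tau> by (simp add: ennreal_leI divide_right_mono)
      qed simp
    qed
    also have "\<dots> = (\<integral>\<^sup>+y. indicator D y * ?h x y \<partial>\<nu>) + (\<integral>\<^sup>+y. ennreal (exp (- d\<^sup>2 / (2 * \<tau>))) \<partial>\<nu>)"
      by (rule nn_integral_add) measurable
    also have "(\<integral>\<^sup>+y. ennreal (exp (- d\<^sup>2 / (2 * \<tau>))) \<partial>\<nu>) = ennreal (exp (- d\<^sup>2 / (2 * \<tau>)) * measure \<nu> UNIV)"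
      by (simp add: B.emeasure_eq_measure ennreal_mult)
    also have "(\<integral>\<^sup>+y. indicator D y * ?h x y \<partial>\<nu>) = (\<integral>\<^sup>+y. ?h x y \<partial>cut \<nu> D)"
      by (rule nn_integral_cut[OF \<nu> D, symmetric]) measurable
    finally show "(\<integral>\<^sup>+y. ?h x y \<partial>\<nu>) \<le> (\<integral>\<^sup>+y. ?h x y \<partial>cut \<nu> D) + ennreal (exp (- d\<^sup>2 / (2 * \<tau>)) * measure \<nu> UNIV)" .
  qed
  also have "\<dots> = (\<integral>\<^sup>+x. (\<integral>\<^sup>+y. ?h x y \<partial>cut \<nu> D) \<partial>\<mu>) + (\<integral>\<^sup>+x. ennreal (exp (- d\<^sup>2 / (2 * \<tau>)) * measure \<nu> UNIV) \<partial>\<mu>)"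
    by (rule nn_integral_add) measurable
  also have "(\<integral>\<^sup>+x. (\<integral>\<^sup>+y. ?h x y \<partial>cut \<nu> D) \<partial>\<mu>) = ennreal (overlap V \<tau> \<mu> (cut \<nu> D))" by (rule G[OF c, symmetric])
  also have "(\<integral>\<^sup>+x. ennreal (exp (- d\<^sup>2 / (2 * \<tau>)) * measure \<nu> UNIV) \<partial>\<mu>) = ennreal (exp (- d\<^sup>2 / (2 * \<tau>)) * (measure \<mu> UNIV * measure \<nu> UNIV))"
    by (simp add: A.emeasure_eq_measure mult_ac flip: ennreal_mult)
  finally show ?thesis .
qed

lemma powr_exp_tendsto_0:
  assumes "0 \<le> b" "0 < (d::real)"
  shows "(\<lambda>k. (1 / real (Suc k)) powr (- b) * exp (- d / (1 / real (Suc k)))) \<longlonglongrightarrow> 0"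
proof -
  obtain C where C: "0 < C" "\<And>y. 0 \<le> y \<Longrightarrow> (1 + y) powr b \<le> C * exp (d / 2 * y)"
    using powr_le_exp[of b "d / 2"] assms by auto
  have q: "0 < exp (- d / 2)" "exp (- d / 2) < 1" using assms by auto
  show ?thesis
  proof (rule real_tendsto_sandwich[of "\<lambda>_. 0"])
    show "(\<lambda>k. C * exp (- d / 2) ^ k) \<longlonglongrightarrow> 0"
      using tendsto_mult_right_zero[OF LIMSEQ_power_zero[of "exp (- d / 2)"], of C] q by simp
    show "\<forall>\<^sub>F k in sequentially. (1 / real (Suc k)) powr (- b) * exp (- d / (1 / real (Suc k))) \<le> C * exp (- d / 2) ^ k"
    proof (rule always_eventually, rule allI)
      fix k
      have "(1 / real (Suc k)) powr (- b) = (1 + real k) powr b" by (simp add: powr_divide powr_minus_divide add.commute)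
      also have "\<dots> \<le> C * exp (d / 2 * real k)" by (rule C) simp
      finally have "(1 / real (Suc k)) powr (- b) * exp (- d / (1 / real (Suc k))) \<le> C * exp (d / 2 * real k) * exp (- d / (1 / real (Suc k)))"
        by (intro mult_right_mono) auto
      also have "\<dots> = C * exp (d / 2 * real k + - d / (1 / real (Suc k)))" by (simp only: exp_add mult.assoc)
      also have "\<dots> \<le> C * exp (real k * (- d / 2))"
        using C assms by (intro mult_left_mono) (auto simp: field_simps)
      also have "\<dots> = C * exp (- d / 2) ^ k" by (simp only: exp_of_nat_mult)
      finally show "(1 / real (Suc k)) powr (- b) * exp (- d / (1 / real (Suc k))) \<le> C * exp (- d / 2) ^ k" .
    qed
  qed auto
qed

text \<open>Integrate only over \<open>\<tau>\<close> between the square of \<open>\<rho>\<close>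
  and twice it. There \<open>\<tau> \<le> 2\<close> and \<open>w / (2 * \<tau>) \<le> 1/2\<close>,
  which yields \<open>exp (- 5/2)\<close>.\<close>

lemma riesz_kernel_lower:
  assumes "0 \<le> r" "0 < \<rho>" "\<rho> \<le> 1" "0 \<le> w" "w \<le> \<rho>\<^sup>2"
  shows "ennreal (2 powr (- r / 2 - 1) * exp (- 5 / 2) * \<rho> powr (- r)) \<le> riesz_kernel r w"
proof -
  let ?c = "(2 * \<rho>\<^sup>2) powr (- r / 2 - 1) * exp (- 5 / 2)"
  have "ennreal ?c * emeasure lborel {\<rho>\<^sup>2..2 * \<rho>\<^sup>2} = (\<integral>\<^sup>+\<tau>. ennreal ?c * indicator {\<rho>\<^sup>2..2 * \<rho>\<^sup>2} \<tau> \<partial>lborel)"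
    by (rule nn_integral_cmult_indicator[symmetric]) simp
  also have "\<dots> \<le> riesz_kernel r w"
    unfolding riesz_kernel_def
  proof (rule nn_integral_mono)
    fix \<tau> :: real
    show "ennreal ?c * indicator {\<rho>\<^sup>2..2 * \<rho>\<^sup>2} \<tau> \<le> ennreal (indicator {0<..} \<tau> * (\<tau> powr (- r / 2 - 1) * exp (- \<tau>) * exp (- w / (2 * \<tau>))))"
    proof (cases "\<tau> \<in> {\<rho>\<^sup>2..2 * \<rho>\<^sup>2}")
      case True
      then have \<tau>: "0 < \<tau>" "\<rho>\<^sup>2 \<le> \<tau>" "\<tau> \<le> 2 * \<rho>\<^sup>2" using assms(2) by (auto intro: less_le_trans[OF zero_less_power])
      have "\<rho>\<^sup>2 \<le> 1" using assms by (simp add: power_le_one)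
      then have "\<tau> \<le> 2" using \<tau> by linarith
      moreover have "w / (2 * \<tau>) \<le> 1 / 2" using \<tau> assms by (simp add: field_simps)
      ultimately have "exp (- 5 / 2) \<le> exp (- \<tau>) * exp (- w / (2 * \<tau>))" by (simp flip: exp_add)
      moreover have "(2 * \<rho>\<^sup>2) powr (- r / 2 - 1) \<le> \<tau> powr (- r / 2 - 1)"
        using \<tau> assms by (intro powr_mono2') auto
      ultimately have "?c \<le> \<tau> powr (- r / 2 - 1) * (exp (- \<tau>) * exp (- w / (2 * \<tau>)))" by (intro mult_mono) auto
      then show ?thesis using True \<tau> by (simp add: ennreal_leI mult.assoc)
    qed simp
  qed
  finally have le: "ennreal (?c * \<rho>\<^sup>2) \<le> riesz_kernel r w" by (simp add: ennreal_mult)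
  have eq: "?c * \<rho>\<^sup>2 = 2 powr (- r / 2 - 1) * exp (- 5 / 2) * \<rho> powr (- r)"
  proof -
    have "(2 * \<rho>\<^sup>2) powr (- r / 2 - 1) * \<rho>\<^sup>2 = 2 powr (- r / 2 - 1) * ((\<rho> powr 2) powr (- r / 2 - 1) * \<rho> powr 2)"
      using assms by (simp add: powr_mult powr_numeral)
    also have "(\<rho> powr 2) powr (- r / 2 - 1) * \<rho> powr 2 = \<rho> powr (- r)"
      by (simp add: powr_powr field_simps del: powr_numeral flip: powr_add)
    finally show ?thesis by (simp add: mult_ac)
  qed
  show ?thesis using le unfolding eq .
qed

text \<open>Later estimates need positive radii, so covering sets of diameter 0 get one from a
  summable budget \<open>e i\<close>. Covers at scale 1 are enough.\<close>

lemma hausdorff_pre_zero_cover: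
  fixes S :: "'a::metric_space set"
  assumes H: "hausdorff_measure r S = 0" and r: "0 < r" and \<epsilon>: "0 < \<epsilon>"
  obtains C \<rho> where "S \<subseteq> (\<Union>i::nat. C i)" "\<And>i x y. x \<in> C i \<Longrightarrow> y \<in> C i \<Longrightarrow> dist x y \<le> \<rho> i" "\<And>i. 0 < \<rho> i" "\<And>i. \<rho> i \<le> (1::real)"
    "(\<Sum>i. ennreal (\<rho> i powr r)) \<le> ennreal \<epsilon>"
proof -
  have "hausdorff_pre r 1 S \<le> hausdorff_measure r S"
    unfolding hausdorff_measure_def by (rule SUP_upper) auto
  then have "hausdorff_pre r 1 S < ennreal (\<epsilon> / 2)" using H \<epsilon> by simp
  then obtain C where C: "S \<subseteq> (\<Union>i. C i)" "\<And>i. bounded (C i)" "\<And>i. diameter (C i) \<le> 1"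
    "(\<Sum>i. ennreal (diameter (C i) powr r)) < ennreal (\<epsilon> / 2)"
    unfolding hausdorff_pre_def INF_less_iff by auto
  define e where "e i = \<epsilon> / 2 * (1/2) ^ Suc i" for i
  have e: "0 < e i" for i using \<epsilon> by (simp add: e_def)
  define \<rho> where "\<rho> i = (if diameter (C i) > 0 then diameter (C i) else min 1 (e i powr (1 / r)))" for i
  have d0: "0 \<le> diameter (C i)" for i by (rule diameter_ge_0[OF C(2)])
  have \<rho>: "0 < \<rho> i" "\<rho> i \<le> 1" for i using C(3)[of i] e[of i] by (auto simp: \<rho>_def)
  have dr: "diameter (C i) \<le> \<rho> i" for i using d0[of i] e[of i] by (auto simp: \<rho>_def)
  have "\<rho> i powr r \<le> diameter (C i) powr r + e i" for i
  proof (cases "diameter (C i) > 0")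
    case True
    then show ?thesis using e[of i] by (simp add: \<rho>_def)
  next
    case False
    then have "\<rho> i powr r \<le> (e i powr (1 / r)) powr r" using e[of i] r by (intro powr_mono2) (auto simp: \<rho>_def)
    also have "\<dots> = e i" using e[of i] r by (simp add: powr_powr)
    finally show ?thesis by (simp add: add_increasing)
  qed
  then have "(\<Sum>i. ennreal (\<rho> i powr r)) \<le> (\<Sum>i. ennreal (diameter (C i) powr r) + ennreal (e i))"
    using e by (intro suminf_le) (auto simp: less_imp_le simp flip: ennreal_plus intro!: ennreal_leI)
  also have "\<dots> = (\<Sum>i. ennreal (diameter (C i) powr r)) + (\<Sum>i. ennreal (e i))"
    by (rule suminf_add[symmetric]) auto
  also have "(\<Sum>i. ennreal (e i)) = ennreal (\<epsilon> / 2)"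
    unfolding e_def using \<epsilon> sums_mult[OF power_half_series, of "\<epsilon> / 2"] by (intro suminf_ennreal_eq) auto
  also have "(\<Sum>i. ennreal (diameter (C i) powr r)) + ennreal (\<epsilon> / 2) \<le> ennreal (\<epsilon> / 2) + ennreal (\<epsilon> / 2)"
    using C(4) by (intro add_right_mono) auto
  also have "\<dots> = ennreal \<epsilon>" using \<epsilon> by (simp flip: ennreal_plus)
  finally have sum: "(\<Sum>i. ennreal (\<rho> i powr r)) \<le> ennreal \<epsilon>" .
  have "dist x y \<le> \<rho> i" if "x \<in> C i" "y \<in> C i" for i x y
    using diameter_bounded_bound[OF C(2) that] dr[of i] by linarith
  then show thesis using that[of C \<rho>] C(1) \<rho> sum by blast
qed

text \<open>Where the potential \<open>p\<close> is at most \<open>M\<close>, the kernel bound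
  limits the mass near a projected point to a multiple of \<open>M * \<rho> powr r\<close>, and a
  cheap cover of \<open>S\<close> makes the corresponding part null. Finite energy makes
  \<open>p\<close> finite almost everywhere, so countably many \<open>M\<close> suffice.\<close>

lemma energy_null:
  fixes V :: "(real^'n) set" and \<nu> :: "(real^'n) measure"
  assumes \<nu>: "borel_finite \<nu>" and V: "subspace V" and E: "energy r \<nu> V < \<infinity>" and r: "0 < r"
    and S: "S \<in> sets borel" and H: "hausdorff_measure r S = 0"
  shows "AE x in \<nu>. orth_proj V x \<notin> S"
proof -
  interpret B: borel_finite \<nu> by fact
  note [measurable] = borel_measurable_orth_proj[OF V] S
  note [measurable_cong] = B.sets_eq
  let ?P = "orth_proj V"
  define p where "p x = (\<integral>\<^sup>+y. riesz_kernel r ((norm (?P (x - y)))\<^sup>2) \<partial>\<nu>)" for x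
  have pm [measurable]: "p \<in> borel_measurable borel" unfolding p_def by measurable
  have "energy r \<nu> V = (\<integral>\<^sup>+x. p x \<partial>\<nu>)"
    unfolding energy_def p_def by (subst B.nn_integral_pair[OF \<nu>]) simp_all
  then have "(\<integral>\<^sup>+x. p x \<partial>\<nu>) \<noteq> \<infinity>" using E by simp
  then have fin: "AE x in \<nu>. p x \<noteq> \<infinity>" by (intro nn_integral_PInf_AE) measurable
  define c0 where "c0 = 2 powr (- r / 2 - 1) * exp (- 5 / 2)"
  have c0: "0 < c0" by (simp add: c0_def)
  have null: "AE x in \<nu>. \<not> (?P x \<in> S \<and> p x \<le> ennreal (real M))" for M :: nat
  proof -
    define A where "A = {x. ?P x \<in> S \<and> p x \<le> ennreal (real M)}"
    have A: "A \<in> sets \<nu>" unfolding A_def by measurable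
    have "emeasure \<nu> A \<le> 0 + ennreal e" if e: "0 < e" for e
    proof -
      define \<epsilon> where "\<epsilon> = e / ((real M + 1) / c0)"
      have \<epsilon>: "0 < \<epsilon>" using e c0 by (simp add: \<epsilon>_def)
      obtain C \<rho> where C: "S \<subseteq> (\<Union>i::nat. C i)" "\<And>i x y. x \<in> C i \<Longrightarrow> y \<in> C i \<Longrightarrow> dist x y \<le> \<rho> i" "\<And>i. 0 < \<rho> i" "\<And>i. \<rho> i \<le> 1"
        "(\<Sum>i. ennreal (\<rho> i powr r)) \<le> ennreal \<epsilon>"
        by (rule hausdorff_pre_zero_cover[OF H r \<epsilon>]) (rule that)
      \<comment> \<open>The mass bound holds only around points of \<open>A\<close>, so each
        covering set that meets the projection of \<open>A\<close> is replaced by a ball of radius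
        \<open>\<rho> i\<close> centred at such a projected point; \<open>N i\<close> is its
        preimage.\<close>
      define N where "N i = (if \<exists>x0\<in>A. ?P x0 \<in> C i then {y. norm (?P ((SOME x0. x0 \<in> A \<and> ?P x0 \<in> C i) - y)) \<le> \<rho> i} else {})" for i
      have Ncase: "N i = {} \<or> (\<exists>x0\<in>A. ?P x0 \<in> C i \<and> N i = {y. norm (?P (x0 - y)) \<le> \<rho> i})" for i
      proof (cases "\<exists>x0\<in>A. ?P x0 \<in> C i")
        case True
        then have "\<exists>x0. x0 \<in> A \<and> ?P x0 \<in> C i" by blast
        then have "(SOME x0. x0 \<in> A \<and> ?P x0 \<in> C i) \<in> A \<and> ?P (SOME x0. x0 \<in> A \<and> ?P x0 \<in> C i) \<in> C i"
          by (rule someI_ex)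
        then show ?thesis using True by (auto simp: N_def)
      qed (auto simp: N_def)
      have Nm: "N i \<in> sets \<nu>" for i
        using Ncase[of i]
      proof
        assume "\<exists>x0\<in>A. ?P x0 \<in> C i \<and> N i = {y. norm (?P (x0 - y)) \<le> \<rho> i}"
        then obtain x0 where N: "N i = {y. norm (?P (x0 - y)) \<le> \<rho> i}" by blast
        show ?thesis unfolding N by measurable
      qed simp
      have Nle: "emeasure \<nu> (N i) \<le> ennreal (real M / c0) * ennreal (\<rho> i powr r)" for i
        using Ncase[of i]
      proof
        assume "\<exists>x0\<in>A. ?P x0 \<in> C i \<and> N i = {y. norm (?P (x0 - y)) \<le> \<rho> i}"
        then obtain x0 where x0: "x0 \<in> A" and N: "N i = {y. norm (?P (x0 - y)) \<le> \<rho> i}" by blast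
        have "ennreal (c0 * \<rho> i powr (- r)) * emeasure \<nu> (N i) = (\<integral>\<^sup>+y. ennreal (c0 * \<rho> i powr (- r)) * indicator (N i) y \<partial>\<nu>)"
          by (rule nn_integral_cmult_indicator[symmetric, OF Nm])
        also have "\<dots> \<le> p x0"
          unfolding p_def
        proof (rule nn_integral_mono)
          fix y
          show "ennreal (c0 * \<rho> i powr (- r)) * indicator (N i) y \<le> riesz_kernel r ((norm (?P (x0 - y)))\<^sup>2)"
          proof (cases "y \<in> N i")
            case True
            then have "(norm (?P (x0 - y)))\<^sup>2 \<le> (\<rho> i)\<^sup>2" by (intro power_mono) (auto simp: N)
            then show ?thesis using True riesz_kernel_lower[of r "\<rho> i" "(norm (?P (x0 - y)))\<^sup>2"] r C(3)[of i] C(4)[of i] by (simp add: c0_def)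
          qed simp
        qed
        also have "\<dots> \<le> ennreal (real M)" using x0 by (simp add: A_def)
        finally have "ennreal (\<rho> i powr r / c0) * (ennreal (c0 * \<rho> i powr (- r)) * emeasure \<nu> (N i)) \<le> ennreal (\<rho> i powr r / c0) * ennreal (real M)"
          by (rule mult_left_mono) simp
        moreover have "ennreal (\<rho> i powr r / c0) * (ennreal (c0 * \<rho> i powr (- r)) * emeasure \<nu> (N i)) = emeasure \<nu> (N i)"
        proof -
          have "\<rho> i powr r / c0 * (c0 * \<rho> i powr (- r)) = 1" using c0 C(3)[of i] by (simp flip: powr_add)
          then have "ennreal (\<rho> i powr r / c0) * ennreal (c0 * \<rho> i powr (- r)) = 1"
            using c0 by (simp flip: ennreal_mult)
          then show ?thesis by (simp flip: mult.assoc)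
        qed
        ultimately show ?thesis using c0 by (simp add: mult.commute flip: ennreal_mult)
      qed simp
      have "A \<subseteq> (\<Union>i. N i)"
      proof
        fix x assume x: "x \<in> A"
        then obtain i where i: "?P x \<in> C i" using C(1) by (auto simp: A_def)
        define x0 where "x0 = (SOME x0. x0 \<in> A \<and> ?P x0 \<in> C i)"
        have ex: "\<exists>x0\<in>A. ?P x0 \<in> C i" using x i by blast
        then have "\<exists>x0. x0 \<in> A \<and> ?P x0 \<in> C i" by blast
        then have x0: "x0 \<in> A \<and> ?P x0 \<in> C i" unfolding x0_def by (rule someI_ex)
        have "norm (?P (x0 - x)) = dist (?P x0) (?P x)" by (simp add: dist_norm linear_diff[OF linear_orth_proj[OF V]])
        also have "\<dots> \<le> \<rho> i" using x0 i by (intro C) auto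
        finally have "x \<in> N i" using ex by (simp add: N_def x0_def)
        then show "x \<in> (\<Union>i. N i)" by blast
      qed
      then have "emeasure \<nu> A \<le> emeasure \<nu> (\<Union>i. N i)" using Nm by (intro emeasure_mono) auto
      also have "\<dots> \<le> (\<Sum>i. emeasure \<nu> (N i))" using Nm by (intro emeasure_subadditive_countably) auto
      also have "\<dots> \<le> (\<Sum>i. ennreal (real M / c0) * ennreal (\<rho> i powr r))" by (intro suminf_le Nle) auto
      also have "\<dots> = ennreal (real M / c0) * (\<Sum>i. ennreal (\<rho> i powr r))" by simp
      also have "\<dots> \<le> ennreal (real M / c0) * ennreal \<epsilon>" by (intro mult_left_mono C) auto
      also have "\<dots> = ennreal (real M / c0 * \<epsilon>)" using c0 \<epsilon> by (simp flip: ennreal_mult)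
      also have "\<dots> \<le> ennreal e"
      proof (rule ennreal_leI)
        have "real M / c0 * \<epsilon> \<le> (real M + 1) / c0 * \<epsilon>" using c0 \<epsilon> by (intro mult_right_mono divide_right_mono) auto
        also have "\<dots> = e" using c0 by (simp add: \<epsilon>_def)
        finally show "real M / c0 * \<epsilon> \<le> e" .
      qed
      finally show ?thesis by simp
    qed
    then have "emeasure \<nu> A \<le> 0" by (rule ennreal_le_epsilon)
    then have "A \<in> null_sets \<nu>" using A by (intro null_setsI) auto
    then show ?thesis by (rule AE_I'[of A]) (auto simp: A_def)
  qed
  have "AE x in \<nu>. \<forall>M::nat. \<not> (?P x \<in> S \<and> p x \<le> ennreal (real M))"
    unfolding AE_all_countable using null by blast
  then show ?thesis
    using fin
  proof (rule AE_mp[OF _ AE_mp[OF _ AE_I2]], intro impI)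
    fix x assume p: "p x \<noteq> \<infinity>" and n: "\<forall>M::nat. \<not> (?P x \<in> S \<and> p x \<le> ennreal (real M))"
    obtain b where b: "p x = ennreal b" "0 \<le> b" using p by (cases "p x") auto
    obtain M :: nat where "b \<le> real M" using real_arch_simple by blast
    then have "p x \<le> ennreal (real M)" using b by (simp add: ennreal_leI)
    then show "?P x \<notin> S" using n by blast
  qed
qed

text \<open>Near \<open>C\<close> the measure \<open>\<nu>\<close> is cut to \<open>D j\<close>,
  whose energy tends to 0 by dominated convergence because the projection of \<open>\<nu>\<close>
  does not charge \<open>C\<close>. The order of choices is \<open>\<delta>\<close>, then
  \<open>j\<close>, then small \<open>\<tau>\<close> for the part away from
  \<open>C\<close>.\<close>

lemma overlap_vanish:
  fixes V :: "(real^'n) set" and \<mu> \<nu> :: "(real^'n) measure"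
  assumes \<mu>: "borel_finite \<mu>" and \<nu>: "borel_finite \<nu>" and V: "V \<in> grassmannian m" and a: "0 < a"
    and Wf: "sobolev a \<mu> V < \<infinity>" and Ef: "energy (real m - a) \<nu> V < \<infinity>"
    and C: "closed C" "C \<noteq> {}" "AE x in \<mu>. orth_proj V x \<in> C" and null: "AE x in \<nu>. orth_proj V x \<notin> C"
  shows "(\<lambda>k. (1 / real (Suc k)) powr (- real m / 2) * overlap V (1 / real (Suc k)) \<mu> \<nu>) \<longlonglongrightarrow> 0"
proof -
  interpret A: borel_finite \<mu> by fact
  interpret B: borel_finite \<nu> by fact
  interpret F: finite_measure "\<nu> \<Otimes>\<^sub>M \<nu>" using pair_borel_finite[OF \<nu> \<nu>] by simp
  have V': "subspace V" using V by (rule grassmannian_subspace)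
  note [measurable] = borel_measurable_orth_proj[OF V']
  note [measurable_cong] = A.sets_eq B.sets_eq
  let ?P = "orth_proj V"
  let ?c = "(2 * pi) powr (CARD('n) / 2)"
  define c3 where "c3 = ?c / Gamma (a / 2)"
  have \<Gamma>: "0 < Gamma (a / 2)" using a by (intro Gamma_real_pos) simp
  have c3: "0 < c3" using \<Gamma> by (simp add: c3_def)
  have Wneg: "sobolev (- a) \<rho> V = ennreal c3 * energy (real m - a) \<rho> V" if \<rho>: "borel_finite \<rho>" for \<rho>
  proof -
    have "ennreal (1 / Gamma (a / 2)) * (ennreal (Gamma (a / 2)) * sobolev (- a) \<rho> V) = ennreal (1 / Gamma (a / 2)) * (ennreal ?c * energy (real m - a) \<rho> V)"
      by (simp only: sobolev_neg_eq_energy[OF \<rho> V a])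
    then show ?thesis using \<Gamma> by (simp add: c3_def flip: ennreal_mult mult.assoc)
  qed
  have infm [measurable]: "(\<lambda>x. infdist x C) \<in> borel_measurable borel"
    by (intro borel_measurable_continuous_onI continuous_intros)
  define D where "D j = {y. infdist (?P y) C < 1 / real (Suc j)}" for j
  have Dm [measurable]: "D j \<in> sets borel" for j unfolding D_def by measurable
  let ?k = "\<lambda>p. riesz_kernel (real m - a) ((norm (?P (fst p - snd p)))\<^sup>2)"
  have km: "?k \<in> borel_measurable (borel \<Otimes>\<^sub>M borel)" by measurable
  have EnD: "(\<lambda>j. energy (real m - a) (cut \<nu> (D j)) V) \<longlonglongrightarrow> 0"
  proof -
    have "(\<lambda>j. \<integral>\<^sup>+p. indicator (D j) (fst p) * indicator (D j) (snd p) * ?k p \<partial>(\<nu> \<Otimes>\<^sub>M \<nu>)) \<longlonglongrightarrow> (\<integral>\<^sup>+p. 0 \<partial>(\<nu> \<Otimes>\<^sub>M \<nu>))"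
    proof (rule nn_integral_dominated_convergence[where w = ?k])
      show "(\<integral>\<^sup>+p. ?k p \<partial>(\<nu> \<Otimes>\<^sub>M \<nu>)) < \<infinity>" using Ef by (simp add: energy_def)
      show "AE p in \<nu> \<Otimes>\<^sub>M \<nu>. indicator (D j) (fst p) * indicator (D j) (snd p) * ?k p \<le> ?k p" for j
        by (rule AE_I2) (auto simp: indicator_def)
      interpret P: pair_sigma_finite \<nu> \<nu> ..
      have "AE p in \<nu> \<Otimes>\<^sub>M \<nu>. ?P (fst p) \<notin> C"
      proof (rule P.AE_pair_measure)
        have [measurable]: "C \<in> sets borel" using C(1) by simp
        show "{p \<in> space (\<nu> \<Otimes>\<^sub>M \<nu>). ?P (fst p) \<notin> C} \<in> sets (\<nu> \<Otimes>\<^sub>M \<nu>)" by measurable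
        show "AE x in \<nu>. AE y in \<nu>. ?P (fst (x, y)) \<notin> C" using null by (rule AE_mp) (rule AE_I2, simp)
      qed
      then show "AE p in \<nu> \<Otimes>\<^sub>M \<nu>. (\<lambda>j. indicator (D j) (fst p) * indicator (D j) (snd p) * ?k p) \<longlonglongrightarrow> 0"
      proof (rule AE_mp, intro AE_I2 impI)
        fix p :: "(real^'n) \<times> (real^'n)" assume "?P (fst p) \<notin> C"
        then have "infdist (?P (fst p)) C > 0"
          using in_closed_iff_infdist_zero[OF C(1,2), of "?P (fst p)"] infdist_nonneg[of "?P (fst p)" C] by linarith
        then obtain j0 where j0: "1 / real (Suc j0) < infdist (?P (fst p)) C" using nat_approx_posE by blast
        have "indicator (D j) (fst p) * indicator (D j) (snd p) * ?k p = 0" if "j0 \<le> j" for j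
        proof -
          have "1 / real (Suc j) \<le> 1 / real (Suc j0)" using that by (intro divide_left_mono) auto
          then have "fst p \<notin> D j" using j0 by (simp add: D_def)
          then show ?thesis by simp
        qed
        then show "(\<lambda>j. indicator (D j) (fst p) * indicator (D j) (snd p) * ?k p) \<longlonglongrightarrow> 0"
          by (intro tendsto_eventually) (auto simp: eventually_sequentially)
      qed
    qed measurable
    then show ?thesis unfolding energy_def by (simp add: nn_integral_pair_cut[OF \<nu> Dm km])
  qed
  define J where "J k = (1 / real (Suc k)) powr (- real m / 2) * overlap V (1 / real (Suc k)) \<mu> \<nu>" for k
  have J0: "0 \<le> J k" for k unfolding J_def using nn_overlap(2)[OF \<mu> \<nu> V'] by simp
  obtain w where w: "sobolev a \<mu> V = ennreal w" "0 \<le> w" using Wf by (cases "sobolev a \<mu> V") auto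
  have "\<forall>\<^sub>F k in sequentially. J k < e" if e: "0 < e" for e
  proof -
    \<comment> \<open>Three contributions of size \<open>e'\<close> arise, two from
      \<open>overlap_le_sobolev\<close> and one from the far part; a quarter leaves a strict
      inequality.\<close>
    define e' where "e' = ?c * e / 4"
    have e': "0 < e'" using e by (simp add: e'_def)
    define \<delta> where "\<delta> = e' / (w + 1)"
    have \<delta>: "0 < \<delta>" "\<delta> * w \<le> e'" using e' w by (auto simp: \<delta>_def field_simps)
    define e2 where "e2 = e' * \<delta> / c3"
    have e2: "0 < e2" using e' \<delta> c3 by (simp add: e2_def)
    have "\<forall>\<^sub>F j in sequentially. energy (real m - a) (cut \<nu> (D j)) V < ennreal e2"
      using EnD e2 by (auto intro: order_tendstoD(2))
    then obtain j where j: "energy (real m - a) (cut \<nu> (D j)) V < ennreal e2"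
      by (auto simp: eventually_sequentially)
    let ?d = "1 / real (Suc j)"
    have cf: "borel_finite (cut \<nu> (D j))" by (rule cut_borel_finite[OF \<nu> Dm])
    let ?MM = "measure \<mu> UNIV * measure \<nu> UNIV"
    have bound: "?c * J k \<le> 2 * e' + ?c * ?MM * ((1 / real (Suc k)) powr (- (real m / 2)) * exp (- (?d\<^sup>2 / 2) / (1 / real (Suc k))))" for k
    proof -
      define \<tau> where "\<tau> = 1 / real (Suc k)"
      have \<tau>: "0 < \<tau>" by (simp add: \<tau>_def)
      let ?t = "\<tau> powr (- real m / 2)"
      have G0: "0 \<le> overlap V \<tau> \<mu> (cut \<nu> (D j))" by (rule nn_overlap(2)[OF \<mu> cf V' \<tau>])
      have "ennreal (?c * ?t * overlap V \<tau> \<mu> \<nu>) = ennreal (?c * ?t) * ennreal (overlap V \<tau> \<mu> \<nu>)"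
        using nn_overlap(2)[OF \<mu> \<nu> V' \<tau>] by (simp add: ennreal_mult)
      also have "\<dots> \<le> ennreal (?c * ?t) * (ennreal (overlap V \<tau> \<mu> (cut \<nu> (D j))) + ennreal (exp (- ?d\<^sup>2 / (2 * \<tau>)) * ?MM))"
        unfolding D_def by (intro mult_left_mono overlap_split[OF \<mu> \<nu> V' \<tau> _ C(3)]) auto
      also have "\<dots> = ennreal (?c * ?t * overlap V \<tau> \<mu> (cut \<nu> (D j))) + ennreal (?c * ?t * (exp (- ?d\<^sup>2 / (2 * \<tau>)) * ?MM))"
        using G0 by (simp add: distrib_left flip: ennreal_mult)
      also have "ennreal (?c * ?t * overlap V \<tau> \<mu> (cut \<nu> (D j))) \<le> ennreal \<delta> * sobolev a \<mu> V + ennreal (1 / \<delta>) * sobolev (- a) (cut \<nu> (D j)) V"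
        by (rule overlap_le_sobolev[OF \<mu> cf V \<tau> \<delta>(1)])
      also have "\<dots> \<le> ennreal e' + ennreal e'"
      proof (rule add_mono)
        show "ennreal \<delta> * sobolev a \<mu> V \<le> ennreal e'" using \<delta> w by (auto simp flip: ennreal_mult intro: ennreal_leI)
        have "ennreal (1 / \<delta>) * sobolev (- a) (cut \<nu> (D j)) V \<le> ennreal (1 / \<delta>) * (ennreal c3 * ennreal e2)"
          unfolding Wneg[OF cf] using j by (intro mult_left_mono) auto
        also have "\<dots> = ennreal (1 / \<delta> * (c3 * e2))"
          using \<delta> c3 e2 by (subst ennreal_mult, simp, simp, subst ennreal_mult, simp_all)
        also have "1 / \<delta> * (c3 * e2) = e'" using \<delta> c3 by (simp add: e2_def)
        finally show "ennreal (1 / \<delta>) * sobolev (- a) (cut \<nu> (D j)) V \<le> ennreal e'" .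
      qed
      finally have "ennreal (?c * ?t * overlap V \<tau> \<mu> \<nu>) \<le> ennreal e' + ennreal e' + ennreal (?c * ?t * (exp (- ?d\<^sup>2 / (2 * \<tau>)) * ?MM))"
        by (simp add: add_right_mono)
      also have "\<dots> = ennreal (2 * e' + ?c * ?t * (exp (- ?d\<^sup>2 / (2 * \<tau>)) * ?MM))"
        using e' by (simp flip: ennreal_plus)
      finally have "?c * ?t * overlap V \<tau> \<mu> \<nu> \<le> 2 * e' + ?c * ?t * (exp (- ?d\<^sup>2 / (2 * \<tau>)) * ?MM)"
        by (subst (asm) ennreal_le_iff) (use e' in \<open>auto intro: add_nonneg_nonneg\<close>)
      moreover have "- ?d\<^sup>2 / (2 * \<tau>) = - (?d\<^sup>2 / 2) / \<tau>" by simp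
      moreover have "?c * J k = ?c * ?t * overlap V \<tau> \<mu> \<nu>" by (simp add: J_def \<tau>_def mult.assoc)
      moreover have "- real m / 2 = - (real m / 2)" by simp
      ultimately show ?thesis unfolding \<tau>_def[symmetric] by (simp only: mult_ac)
    qed
    have "(\<lambda>k. ?c * ?MM * ((1 / real (Suc k)) powr (- (real m / 2)) * exp (- (?d\<^sup>2 / 2) / (1 / real (Suc k))))) \<longlonglongrightarrow> 0"
      by (intro tendsto_mult_right_zero powr_exp_tendsto_0) auto
    then have "\<forall>\<^sub>F k in sequentially. ?c * ?MM * ((1 / real (Suc k)) powr (- (real m / 2)) * exp (- (?d\<^sup>2 / 2) / (1 / real (Suc k)))) < e'"
      using e' by (rule order_tendstoD(2))
    then show ?thesis
    proof (rule eventually_mono)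
      fix k assume "?c * ?MM * ((1 / real (Suc k)) powr (- (real m / 2)) * exp (- (?d\<^sup>2 / 2) / (1 / real (Suc k)))) < e'"
      then have "?c * J k < 3 * e'" using bound[of k] by linarith
      also have "\<dots> < ?c * e" using e by (simp add: e'_def)
      finally show "J k < e" by simp
    qed
  qed
  then have "J \<longlonglongrightarrow> 0"
    using J0 by (intro tendstoI) (auto simp: dist_real_def)
  then show ?thesis by (simp add: J_def[abs_def])
qed

section \<open>Projections with square integrable density\<close>

lemma gauss_plane:
  fixes V :: "(real^'n) set"
  assumes V: "V \<in> grassmannian m" and \<tau>: "0 < \<tau>"
  shows "(\<integral>\<^sup>+\<xi>. ennreal (tgauss V \<xi> * (\<tau> powr (- real m / 2) * exp (- (norm (orth_proj V \<xi> - orth_proj V y))\<^sup>2 / (2 * \<tau>)))) \<partial>lborel) =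
    ennreal ((2 * pi) powr (CARD('n) / 2))"
proof -
  have sV: "subspace V" using V by (rule grassmannian_subspace)
  have lin: "linear (orth_proj V)" by (rule linear_orth_proj[OF sV])
  note [measurable] = borel_measurable_orth_proj[OF sV]
  let ?P = "orth_proj V"
  let ?h = "\<lambda>\<xi>. ennreal (tgauss V \<xi> * (\<tau> powr (- real m / 2) * exp (- (norm (?P \<xi> - ?P y))\<^sup>2 / (2 * \<tau>))))"
  \<comment> \<open>Translation by \<open>?P y\<close> centres the kernel and leaves the transverse
    part of \<open>\<xi>\<close> unchanged, so the value depends neither on \<open>y\<close> nor,
    thanks to the normalising power, on \<open>\<tau>\<close>.\<close>
  have "(\<integral>\<^sup>+\<xi>. ?h \<xi> \<partial>lborel) = (\<integral>\<^sup>+\<xi>. ?h \<xi> \<partial>distr lborel borel ((+) (?P y)))"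
    by (simp add: lborel_distr_plus)
  also have "\<dots> = (\<integral>\<^sup>+\<xi>. ?h (?P y + \<xi>) \<partial>lborel)"
    by (subst nn_integral_distr) auto
  also have "\<dots> = (\<integral>\<^sup>+\<xi>. ennreal (\<tau> powr (- real m / 2)) * ennreal (exp (- (1 / \<tau> * (norm (?P \<xi>))\<^sup>2 + 1 * (norm (\<xi> - ?P \<xi>))\<^sup>2) / 2)) \<partial>lborel)"
  proof (rule nn_integral_cong)
    fix \<xi>
    have P: "?P (?P y + \<xi>) = ?P y + ?P \<xi>" using sV by (simp add: linear_add[OF lin])
    have E1: "?P (?P y + \<xi>) - ?P y = ?P \<xi>" by (simp add: P)
    have E2: "(?P y + \<xi>) - ?P (?P y + \<xi>) = \<xi> - ?P \<xi>" by (simp add: P)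
    have "exp (- (norm (\<xi> - ?P \<xi>))\<^sup>2 / 2) * exp (- (norm (?P \<xi>))\<^sup>2 / (2 * \<tau>)) = exp (- (1 / \<tau> * (norm (?P \<xi>))\<^sup>2 + 1 * (norm (\<xi> - ?P \<xi>))\<^sup>2) / 2)"
      by (simp add: field_simps flip: exp_add)
    then show "?h (?P y + \<xi>) = ennreal (\<tau> powr (- real m / 2)) * ennreal (exp (- (1 / \<tau> * (norm (?P \<xi>))\<^sup>2 + 1 * (norm (\<xi> - ?P \<xi>))\<^sup>2) / 2))"
      unfolding E1 E2 by (subst ennreal_mult[symmetric]) (auto simp: mult_ac)
  qed
  also have "\<dots> = ennreal (\<tau> powr (- real m / 2)) * (\<integral>\<^sup>+\<xi>. ennreal (exp (- (1 / \<tau> * (norm (?P \<xi>))\<^sup>2 + 1 * (norm (\<xi> - ?P \<xi>))\<^sup>2) / 2)) \<partial>lborel)"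
    by (rule nn_integral_cmult) measurable
  also have "\<dots> = ennreal (\<tau> powr (- real m / 2)) * ennreal ((2 * pi) powr (CARD('n) / 2) * (1 / \<tau>) powr (- real m / 2) * 1 powr (- real (CARD('n) - m) / 2))"
    using \<tau> by (subst nn_gauss_grassmannian[OF V]) auto
  also have "\<dots> = ennreal ((2 * pi) powr (CARD('n) / 2))"
  proof -
    have "\<tau> powr (- real m / 2) * (1 / \<tau>) powr (- real m / 2) = 1"
      using \<tau> by (simp add: powr_divide)
    then have "\<tau> powr (- real m / 2) * ((2 * pi) powr (CARD('n) / 2) * (1 / \<tau>) powr (- real m / 2)) = (2 * pi) powr (CARD('n) / 2)"
      by (simp add: mult.left_commute)
    then show ?thesis by (subst ennreal_mult[symmetric]) auto
  qed
  finally show ?thesis .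
qed

text \<open>The projected measure convolved with the Gaussian of variance \<open>\<tau>\<close> on
  \<open>V\<close>, without the factor \<open>(2 * pi) powr (- m / 2)\<close>.\<close>

definition mollified :: "(real^'n) set \<Rightarrow> nat \<Rightarrow> real \<Rightarrow> (real^'n) measure \<Rightarrow> real^'n \<Rightarrow> ennreal" where
  "mollified V m \<tau> \<nu> u = (\<integral>\<^sup>+y. ennreal (\<tau> powr (- real m / 2) * exp (- (norm (u - orth_proj V y))\<^sup>2 / (2 * \<tau>))) \<partial>\<nu>)"

text \<open>A multiple of Lebesgue measure of \<open>U \<inter> V\<close> in \<open>V\<close>.\<close>

definition plane_measure :: "(real^'n) set \<Rightarrow> (real^'n) set \<Rightarrow> ennreal" where
  "plane_measure V U = (\<integral>\<^sup>+\<xi>. ennreal (tgauss V \<xi>) * indicator U (orth_proj V \<xi>) \<partial>lborel)"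

text \<open>Mass of \<open>\<nu>\<close> that projects at distance at least \<open>d\<close> from
  \<open>F\<close> is seen by the mollification off \<open>F\<close>, up to what leaks into
  \<open>F\<close>. There half of the exponent is traded for
  \<open>exp (- d^2 / (4 * \<tau>))\<close>; the other half is the kernel at
  \<open>2 * \<tau>\<close>, which has the same total integral.\<close>

lemma mollified_mass:
  fixes V :: "(real^'n) set" and \<nu> :: "(real^'n) measure"
  assumes \<nu>: "borel_finite \<nu>" and V: "V \<in> grassmannian m" and \<tau>: "0 < \<tau>" and d: "0 < d" and F: "closed F"
  shows "ennreal ((2 * pi) powr (CARD('n) / 2)) * emeasure \<nu> {y. \<forall>z\<in>F. d \<le> dist (orth_proj V y) z} \<le>
    (\<integral>\<^sup>+\<xi>. indicator (- F) (orth_proj V \<xi>) * (ennreal (tgauss V \<xi>) * mollified V m \<tau> \<nu> (orth_proj V \<xi>)) \<partial>lborel) +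
    ennreal ((2 * pi) powr (CARD('n) / 2) * (2 powr (real m / 2) * exp (- d\<^sup>2 / (4 * \<tau>))) * measure \<nu> UNIV)"
proof -
  interpret B: borel_finite \<nu> by fact
  have sV: "subspace V" using V by (rule grassmannian_subspace)
  note [measurable] = borel_measurable_orth_proj[OF sV]
  note [measurable_cong] = B.sets_eq
  have [measurable]: "F \<in> sets borel" using F by simp
  interpret L: pair_sigma_finite "lborel :: (real^'n) measure" \<nu> ..
  let ?P = "orth_proj V"
  let ?c = "(2 * pi) powr (CARD('n) / 2)"
  let ?s = "?c * (2 powr (real m / 2) * exp (- d\<^sup>2 / (4 * \<tau>)))"
  define Y where "Y = {y. \<forall>z\<in>F. d \<le> dist (?P y) z}"
  have "Y = ?P -` (\<Inter>z\<in>F. {u. d \<le> dist u z})" by (auto simp: Y_def)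
  moreover have "closed (\<Inter>z\<in>F. {u. d \<le> dist u z})"
    by (intro closed_INT ballI closed_Collect_le continuous_intros)
  ultimately have Y: "Y \<in> sets \<nu>"
    using measurable_sets[OF borel_measurable_orth_proj[OF sV], of "\<Inter>z\<in>F. {u. d \<le> dist u z}"] by (simp add: B.sets_eq)
  let ?v = "\<lambda>\<tau> \<xi> y. tgauss V \<xi> * (\<tau> powr (- real m / 2) * exp (- (norm (?P \<xi> - ?P y))\<^sup>2 / (2 * \<tau>)))"
  have key: "ennreal ?c * indicator Y y \<le> (\<integral>\<^sup>+\<xi>. indicator (- F) (?P \<xi>) * ennreal (?v \<tau> \<xi> y) \<partial>lborel) + ennreal ?s" for y
  proof (cases "y \<in> Y")
    case True
    have "ennreal ?c = (\<integral>\<^sup>+\<xi>. ennreal (?v \<tau> \<xi> y) \<partial>lborel)" by (rule gauss_plane[OF V \<tau>, symmetric])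
    also have "\<dots> \<le> (\<integral>\<^sup>+\<xi>. indicator (- F) (?P \<xi>) * ennreal (?v \<tau> \<xi> y) + ennreal (2 powr (real m / 2) * exp (- d\<^sup>2 / (4 * \<tau>))) * ennreal (?v (2 * \<tau>) \<xi> y) \<partial>lborel)"
    proof (rule nn_integral_mono)
      fix \<xi>
      show "ennreal (?v \<tau> \<xi> y) \<le> indicator (- F) (?P \<xi>) * ennreal (?v \<tau> \<xi> y) + ennreal (2 powr (real m / 2) * exp (- d\<^sup>2 / (4 * \<tau>))) * ennreal (?v (2 * \<tau>) \<xi> y)"
      proof (cases "?P \<xi> \<in> F")
        case True
        define R where "R = norm (?P \<xi> - ?P y)"
        have "d \<le> R" using \<open>y \<in> Y\<close> True by (auto simp: Y_def R_def dist_norm norm_minus_commute)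
        then have "d\<^sup>2 \<le> R\<^sup>2" using d by (intro power_mono) auto
        then have "- R\<^sup>2 / (2 * \<tau>) \<le> - d\<^sup>2 / (4 * \<tau>) + - R\<^sup>2 / (2 * (2 * \<tau>))" using \<tau> by (simp add: field_simps)
        then have "exp (- R\<^sup>2 / (2 * \<tau>)) \<le> exp (- d\<^sup>2 / (4 * \<tau>)) * exp (- R\<^sup>2 / (2 * (2 * \<tau>)))"
          by (simp only: exp_add[symmetric] exp_le_cancel_iff)
        then have "tgauss V \<xi> * \<tau> powr (- real m / 2) * exp (- R\<^sup>2 / (2 * \<tau>)) \<le> tgauss V \<xi> * \<tau> powr (- real m / 2) * (exp (- d\<^sup>2 / (4 * \<tau>)) * exp (- R\<^sup>2 / (2 * (2 * \<tau>))))"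
          by (intro mult_left_mono) auto
        moreover have "\<tau> powr (- real m / 2) = 2 powr (real m / 2) * (2 * \<tau>) powr (- real m / 2)"
          using \<tau> by (simp add: powr_mult flip: powr_add mult.assoc)
        ultimately have "?v \<tau> \<xi> y \<le> 2 powr (real m / 2) * exp (- d\<^sup>2 / (4 * \<tau>)) * ?v (2 * \<tau>) \<xi> y"
          unfolding R_def by (simp only: mult_ac)
        then have "ennreal (?v \<tau> \<xi> y) \<le> ennreal (2 powr (real m / 2) * exp (- d\<^sup>2 / (4 * \<tau>))) * ennreal (?v (2 * \<tau>) \<xi> y)"
          by (subst ennreal_mult[symmetric]) (auto intro: ennreal_leI)
        then show ?thesis using True by simp
      qed simp
    qed
    also have "\<dots> = (\<integral>\<^sup>+\<xi>. indicator (- F) (?P \<xi>) * ennreal (?v \<tau> \<xi> y) \<partial>lborel) + (\<integral>\<^sup>+\<xi>. ennreal (2 powr (real m / 2) * exp (- d\<^sup>2 / (4 * \<tau>))) * ennreal (?v (2 * \<tau>) \<xi> y) \<partial>lborel)"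
      by (rule nn_integral_add) measurable
    also have "(\<integral>\<^sup>+\<xi>. ennreal (2 powr (real m / 2) * exp (- d\<^sup>2 / (4 * \<tau>))) * ennreal (?v (2 * \<tau>) \<xi> y) \<partial>lborel) =
       ennreal (2 powr (real m / 2) * exp (- d\<^sup>2 / (4 * \<tau>))) * (\<integral>\<^sup>+\<xi>. ennreal (?v (2 * \<tau>) \<xi> y) \<partial>lborel)"
      by (rule nn_integral_cmult) measurable
    also have "(\<integral>\<^sup>+\<xi>. ennreal (?v (2 * \<tau>) \<xi> y) \<partial>lborel) = ennreal ?c" using \<tau> by (intro gauss_plane[OF V]) auto
    also have "ennreal (2 powr (real m / 2) * exp (- d\<^sup>2 / (4 * \<tau>))) * ennreal ?c = ennreal ?s"
      by (subst ennreal_mult[symmetric]) (auto simp: mult.commute)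
    finally show ?thesis using True by simp
  qed simp
  have "ennreal ?c * emeasure \<nu> Y = (\<integral>\<^sup>+y. ennreal ?c * indicator Y y \<partial>\<nu>)"
    by (rule nn_integral_cmult_indicator[symmetric, OF Y])
  also have "\<dots> \<le> (\<integral>\<^sup>+y. (\<integral>\<^sup>+\<xi>. indicator (- F) (?P \<xi>) * ennreal (?v \<tau> \<xi> y) \<partial>lborel) + ennreal ?s \<partial>\<nu>)"
    by (intro nn_integral_mono key)
  also have "\<dots> = (\<integral>\<^sup>+y. (\<integral>\<^sup>+\<xi>. indicator (- F) (?P \<xi>) * ennreal (?v \<tau> \<xi> y) \<partial>lborel) \<partial>\<nu>) + (\<integral>\<^sup>+y. ennreal ?s \<partial>\<nu>)"
    by (rule nn_integral_add) measurable
  also have "(\<integral>\<^sup>+y. ennreal ?s \<partial>\<nu>) = ennreal (?s * measure \<nu> UNIV)" by (simp add: B.emeasure_eq_measure ennreal_mult)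
  also have "(\<integral>\<^sup>+y. (\<integral>\<^sup>+\<xi>. indicator (- F) (?P \<xi>) * ennreal (?v \<tau> \<xi> y) \<partial>lborel) \<partial>\<nu>) =
    (\<integral>\<^sup>+\<xi>. (\<integral>\<^sup>+y. indicator (- F) (?P \<xi>) * ennreal (?v \<tau> \<xi> y) \<partial>\<nu>) \<partial>lborel)"
    by (rule L.Fubini') measurable
  also have "\<dots> = (\<integral>\<^sup>+\<xi>. indicator (- F) (?P \<xi>) * (ennreal (tgauss V \<xi>) * mollified V m \<tau> \<nu> (?P \<xi>)) \<partial>lborel)"
  proof (rule nn_integral_cong)
    fix \<xi>
    have "ennreal (tgauss V \<xi>) * mollified V m \<tau> \<nu> (?P \<xi>) = (\<integral>\<^sup>+y. ennreal (tgauss V \<xi>) * ennreal (\<tau> powr (- real m / 2) * exp (- (norm (?P \<xi> - ?P y))\<^sup>2 / (2 * \<tau>))) \<partial>\<nu>)"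
      unfolding mollified_def by (rule nn_integral_cmult[symmetric]) measurable
    also have "\<dots> = (\<integral>\<^sup>+y. ennreal (?v \<tau> \<xi> y) \<partial>\<nu>)"
      by (intro nn_integral_cong ennreal_mult[symmetric]) auto
    finally have "ennreal (tgauss V \<xi>) * mollified V m \<tau> \<nu> (?P \<xi>) = (\<integral>\<^sup>+y. ennreal (?v \<tau> \<xi> y) \<partial>\<nu>)" .
    then show "(\<integral>\<^sup>+y. indicator (- F) (?P \<xi>) * ennreal (?v \<tau> \<xi> y) \<partial>\<nu>) = indicator (- F) (?P \<xi>) * (ennreal (tgauss V \<xi>) * mollified V m \<tau> \<nu> (?P \<xi>))"
      by (subst nn_integral_cmult) auto
  qed
  finally show ?thesis by (simp add: Y_def)
qed

text \<open>By the parallelogram law a product of two Gaussians of variance \<open>\<tau>\<close> is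
  one of variance \<open>\<tau> / 2\<close> about the midpoint times one of variance
  \<open>2 * \<tau>\<close> in the difference of the centres. The square integral of the
  mollification is thus an overlap of \<open>\<nu>\<close> with itself, bounded on the Fourier side
  uniformly in \<open>\<tau>\<close>.\<close>

lemma mollified_square:
  fixes V :: "(real^'n) set" and \<nu> :: "(real^'n) measure"
  assumes \<nu>: "borel_finite \<nu>" and V: "V \<in> grassmannian m" and \<tau>: "0 < \<tau>"
  shows "(\<integral>\<^sup>+\<xi>. ennreal (tgauss V \<xi>) * (mollified V m \<tau> \<nu> (orth_proj V \<xi>) * mollified V m \<tau> \<nu> (orth_proj V \<xi>)) \<partial>lborel) \<le> sobolev 0 \<nu> V"
proof -
  interpret B: borel_finite \<nu> by fact
  interpret F: finite_measure "\<nu> \<Otimes>\<^sub>M \<nu>" using pair_borel_finite[OF \<nu> \<nu>] by simp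
  have sV: "subspace V" using V by (rule grassmannian_subspace)
  have lin: "linear (orth_proj V)" by (rule linear_orth_proj[OF sV])
  note [measurable] = borel_measurable_orth_proj[OF sV]
  note [measurable_cong] = B.sets_eq
  interpret L: pair_sigma_finite "lborel :: (real^'n) measure" "\<nu> \<Otimes>\<^sub>M \<nu>" ..
  let ?P = "orth_proj V"
  let ?c = "(2 * pi) powr (CARD('n) / 2)"
  let ?e = "\<lambda>\<xi> y. \<tau> powr (- real m / 2) * exp (- (norm (?P \<xi> - ?P y))\<^sup>2 / (2 * \<tau>))"
  have sq: "ennreal (tgauss V \<xi>) * (mollified V m \<tau> \<nu> (?P \<xi>) * mollified V m \<tau> \<nu> (?P \<xi>)) = (\<integral>\<^sup>+p. ennreal (tgauss V \<xi> * (?e \<xi> (fst p) * ?e \<xi> (snd p))) \<partial>(\<nu> \<Otimes>\<^sub>M \<nu>))" for \<xi>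
  proof -
    have "(\<integral>\<^sup>+p. ennreal (tgauss V \<xi> * (?e \<xi> (fst p) * ?e \<xi> (snd p))) \<partial>(\<nu> \<Otimes>\<^sub>M \<nu>)) = (\<integral>\<^sup>+x. \<integral>\<^sup>+y. ennreal (tgauss V \<xi> * ?e \<xi> x) * ennreal (?e \<xi> y) \<partial>\<nu> \<partial>\<nu>)"
      by (subst B.nn_integral_pair[OF \<nu>]) (auto simp: mult.assoc simp flip: ennreal_mult)
    also have "\<dots> = (\<integral>\<^sup>+x. ennreal (tgauss V \<xi> * ?e \<xi> x) * mollified V m \<tau> \<nu> (?P \<xi>) \<partial>\<nu>)"
      unfolding mollified_def by (intro nn_integral_cong nn_integral_cmult) measurable
    also have "\<dots> = (\<integral>\<^sup>+x. ennreal (tgauss V \<xi> * ?e \<xi> x) \<partial>\<nu>) * mollified V m \<tau> \<nu> (?P \<xi>)"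
      by (rule nn_integral_multc) measurable
    also have "(\<integral>\<^sup>+x. ennreal (tgauss V \<xi> * ?e \<xi> x) \<partial>\<nu>) = (\<integral>\<^sup>+x. ennreal (tgauss V \<xi>) * ennreal (?e \<xi> x) \<partial>\<nu>)"
      by (intro nn_integral_cong ennreal_mult) auto
    also have "\<dots> = ennreal (tgauss V \<xi>) * mollified V m \<tau> \<nu> (?P \<xi>)"
      unfolding mollified_def by (rule nn_integral_cmult) measurable
    finally show ?thesis by (simp add: mult.assoc)
  qed
  have "(\<integral>\<^sup>+\<xi>. ennreal (tgauss V \<xi>) * (mollified V m \<tau> \<nu> (?P \<xi>) * mollified V m \<tau> \<nu> (?P \<xi>)) \<partial>lborel) =
    (\<integral>\<^sup>+\<xi>. (\<integral>\<^sup>+p. ennreal (tgauss V \<xi> * (?e \<xi> (fst p) * ?e \<xi> (snd p))) \<partial>(\<nu> \<Otimes>\<^sub>M \<nu>)) \<partial>lborel)"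
    by (simp only: sq)
  also have "\<dots> = (\<integral>\<^sup>+p. (\<integral>\<^sup>+\<xi>. ennreal (tgauss V \<xi> * (?e \<xi> (fst p) * ?e \<xi> (snd p))) \<partial>lborel) \<partial>(\<nu> \<Otimes>\<^sub>M \<nu>))"
    by (rule L.Fubini'[symmetric]) measurable
  also have "\<dots> = (\<integral>\<^sup>+p. ennreal (?c * (2 * \<tau>) powr (- real m / 2)) * ennreal (exp (- (norm (?P (fst p - snd p)))\<^sup>2 / (2 * (2 * \<tau>)))) \<partial>(\<nu> \<Otimes>\<^sub>M \<nu>))"
  proof (rule nn_integral_cong)
    fix p :: "(real^'n) \<times> (real^'n)"
    obtain x y where p: "p = (x, y)" by (cases p)
    define z where "z = (1/2) *\<^sub>R (x + y)"
    have par: "(norm (u - a))\<^sup>2 + (norm (u - b))\<^sup>2 = 2 * (norm (u - (1/2) *\<^sub>R (a + b)))\<^sup>2 + (norm (a - b))\<^sup>2 / 2" for u a b :: "real^'n"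
      by (simp add: power2_norm_eq_inner inner_diff_left inner_diff_right inner_add_left inner_add_right inner_commute field_simps)
    have Pz: "?P z = (1/2) *\<^sub>R (?P x + ?P y)" by (simp add: z_def linear_scale[OF lin] linear_add[OF lin])
    have pw: "\<tau> powr (- real m / 2) * \<tau> powr (- real m / 2) = (2 * \<tau>) powr (- real m / 2) * (\<tau> / 2) powr (- real m / 2)"
      using \<tau> by (simp flip: powr_mult)
    have ex: "exp (- (norm (?P \<xi> - ?P x))\<^sup>2 / (2 * \<tau>)) * exp (- (norm (?P \<xi> - ?P y))\<^sup>2 / (2 * \<tau>)) =
       exp (- (norm (?P \<xi> - ?P z))\<^sup>2 / (2 * (\<tau> / 2))) * exp (- (norm (?P (x - y)))\<^sup>2 / (2 * (2 * \<tau>)))" for \<xi>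
    proof -
      have "- (norm (?P \<xi> - ?P x))\<^sup>2 / (2 * \<tau>) + - (norm (?P \<xi> - ?P y))\<^sup>2 / (2 * \<tau>) = - ((norm (?P \<xi> - ?P x))\<^sup>2 + (norm (?P \<xi> - ?P y))\<^sup>2) / (2 * \<tau>)"
        by (simp add: add_divide_distrib diff_divide_distrib)
      also have "\<dots> = - (norm (?P \<xi> - ?P z))\<^sup>2 / (2 * (\<tau> / 2)) + - (norm (?P (x - y)))\<^sup>2 / (2 * (2 * \<tau>))"
        unfolding par Pz[symmetric] linear_diff[OF lin] using \<tau> by (simp add: field_simps)
      finally show ?thesis by (simp only: exp_add[symmetric])
    qed
    have "(\<integral>\<^sup>+\<xi>. ennreal (tgauss V \<xi> * (?e \<xi> x * ?e \<xi> y)) \<partial>lborel) =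
      (\<integral>\<^sup>+\<xi>. ennreal ((2 * \<tau>) powr (- real m / 2) * exp (- (norm (?P (x - y)))\<^sup>2 / (2 * (2 * \<tau>)))) *
         ennreal (tgauss V \<xi> * ((\<tau> / 2) powr (- real m / 2) * exp (- (norm (?P \<xi> - ?P z))\<^sup>2 / (2 * (\<tau> / 2))))) \<partial>lborel)"
    proof (rule nn_integral_cong)
      fix \<xi>
      have "tgauss V \<xi> * (?e \<xi> x * ?e \<xi> y) = tgauss V \<xi> * ((\<tau> powr (- real m / 2) * \<tau> powr (- real m / 2)) *
        (exp (- (norm (?P \<xi> - ?P x))\<^sup>2 / (2 * \<tau>)) * exp (- (norm (?P \<xi> - ?P y))\<^sup>2 / (2 * \<tau>))))" by (simp only: mult_ac)
      also have "\<dots> = ((2 * \<tau>) powr (- real m / 2) * exp (- (norm (?P (x - y)))\<^sup>2 / (2 * (2 * \<tau>)))) *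
         (tgauss V \<xi> * ((\<tau> / 2) powr (- real m / 2) * exp (- (norm (?P \<xi> - ?P z))\<^sup>2 / (2 * (\<tau> / 2)))))"
        unfolding pw ex by (simp only: mult_ac)
      finally show "ennreal (tgauss V \<xi> * (?e \<xi> x * ?e \<xi> y)) = ennreal ((2 * \<tau>) powr (- real m / 2) * exp (- (norm (?P (x - y)))\<^sup>2 / (2 * (2 * \<tau>)))) *
         ennreal (tgauss V \<xi> * ((\<tau> / 2) powr (- real m / 2) * exp (- (norm (?P \<xi> - ?P z))\<^sup>2 / (2 * (\<tau> / 2)))))"
        by (subst ennreal_mult[symmetric]) auto
    qed
    also have "\<dots> = ennreal ((2 * \<tau>) powr (- real m / 2) * exp (- (norm (?P (x - y)))\<^sup>2 / (2 * (2 * \<tau>)))) *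
         (\<integral>\<^sup>+\<xi>. ennreal (tgauss V \<xi> * ((\<tau> / 2) powr (- real m / 2) * exp (- (norm (?P \<xi> - ?P z))\<^sup>2 / (2 * (\<tau> / 2))))) \<partial>lborel)"
      by (rule nn_integral_cmult) measurable
    also have "(\<integral>\<^sup>+\<xi>. ennreal (tgauss V \<xi> * ((\<tau> / 2) powr (- real m / 2) * exp (- (norm (?P \<xi> - ?P z))\<^sup>2 / (2 * (\<tau> / 2))))) \<partial>lborel) = ennreal ?c"
      using \<tau> by (intro gauss_plane[OF V]) auto
    also have "ennreal ((2 * \<tau>) powr (- real m / 2) * exp (- (norm (?P (x - y)))\<^sup>2 / (2 * (2 * \<tau>)))) * ennreal ?c =
      ennreal (?c * (2 * \<tau>) powr (- real m / 2)) * ennreal (exp (- (norm (?P (x - y)))\<^sup>2 / (2 * (2 * \<tau>))))"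
      by (subst (1 2) ennreal_mult[symmetric]) (auto simp: mult_ac)
    finally show "(\<integral>\<^sup>+\<xi>. ennreal (tgauss V \<xi> * (?e \<xi> (fst p) * ?e \<xi> (snd p))) \<partial>lborel) =
      ennreal (?c * (2 * \<tau>) powr (- real m / 2)) * ennreal (exp (- (norm (?P (fst p - snd p)))\<^sup>2 / (2 * (2 * \<tau>))))"
      by (simp only: p fst_conv snd_conv)
  qed
  also have "\<dots> = ennreal (?c * (2 * \<tau>) powr (- real m / 2)) * (\<integral>\<^sup>+p. ennreal (exp (- (norm (?P (fst p - snd p)))\<^sup>2 / (2 * (2 * \<tau>)))) \<partial>(\<nu> \<Otimes>\<^sub>M \<nu>))"
    by (rule nn_integral_cmult) measurable
  also have "\<dots> = ennreal (?c * (2 * \<tau>) powr (- real m / 2) * overlap V (2 * \<tau>) \<nu> \<nu>)"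
  proof -
    have \<tau>2: "0 < 2 * \<tau>" using \<tau> by simp
    show ?thesis unfolding nn_overlap(1)[OF \<nu> \<nu> sV \<tau>2, symmetric]
      using nn_overlap(2)[OF \<nu> \<nu> sV \<tau>2] by (subst ennreal_mult[symmetric]) auto
  qed
  also have "\<dots> = (\<integral>\<^sup>+\<xi>. ennreal (exp (- ((2 * \<tau>) * (norm (?P \<xi>))\<^sup>2) / 2) * tgauss V \<xi> * (norm (fhat \<nu> (?P \<xi>)))\<^sup>2) \<partial>lborel)"
    using \<tau> by (intro nn_overlap_fhat[OF \<nu> V, symmetric]) auto
  also have "\<dots> \<le> sobolev 0 \<nu> V"
    unfolding sobolev_def
  proof (intro nn_integral_mono ennreal_leI mult_right_mono)
    fix \<xi>
    have "0 < 1 + (norm (?P \<xi>))\<^sup>2 / 2" by (simp add: add_pos_nonneg)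
    then have "(1 + (norm (?P \<xi>))\<^sup>2 / 2) powr (0 / 2) = 1" by simp
    moreover have "exp (- (2 * \<tau> * (norm (?P \<xi>))\<^sup>2) / 2) \<le> 1" using \<tau> by simp
    ultimately show "exp (- (2 * \<tau> * (norm (?P \<xi>))\<^sup>2) / 2) \<le> (1 + (norm (?P \<xi>))\<^sup>2 / 2) powr (0 / 2)" by simp
  qed auto
  finally show ?thesis .
qed

text \<open>On the ball the indicator is controlled by \<open>exp 2\<close> times a Gaussian of
  variance \<open>R^2\<close> centred at a projected point of the ball, since distances there are
  below \<open>2 * R\<close>; \<open>gauss_plane\<close> gives its integral. The centre
  \<open>x\<close> need not lie in \<open>V\<close>.\<close>

lemma plane_measure_ball:
  fixes V :: "(real^'n) set"
  assumes V: "V \<in> grassmannian m" and R: "0 < R"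
  shows "plane_measure V (ball x R) \<le> ennreal (exp 2 * (2 * pi) powr (CARD('n) / 2) * R powr real m)"
proof (cases "\<exists>y. orth_proj V y \<in> ball x R")
  case True
  then obtain y where y: "orth_proj V y \<in> ball x R" by blast
  have sV: "subspace V" using V by (rule grassmannian_subspace)
  note [measurable] = borel_measurable_orth_proj[OF sV]
  let ?P = "orth_proj V"
  let ?v = "\<lambda>\<xi>. tgauss V \<xi> * ((R\<^sup>2) powr (- real m / 2) * exp (- (norm (?P \<xi> - ?P y))\<^sup>2 / (2 * R\<^sup>2)))"
  have Rm: "R powr real m * (R\<^sup>2) powr (- real m / 2) = 1"
  proof -
    have "(R powr 2) powr (- real m / 2) = R powr (- real m)" by (simp add: powr_powr del: powr_numeral)
    then have "(R\<^sup>2) powr (- real m / 2) = R powr (- real m)" using R by (simp add: powr_numeral)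
    then show ?thesis using R by (simp flip: powr_add)
  qed
  have "plane_measure V (ball x R) \<le> (\<integral>\<^sup>+\<xi>. ennreal (exp 2 * R powr real m) * ennreal (?v \<xi>) \<partial>lborel)"
    unfolding plane_measure_def
  proof (rule nn_integral_mono)
    fix \<xi>
    show "ennreal (tgauss V \<xi>) * indicator (ball x R) (?P \<xi>) \<le> ennreal (exp 2 * R powr real m) * ennreal (?v \<xi>)"
    proof (cases "?P \<xi> \<in> ball x R")
      case True
      have "norm (?P \<xi> - ?P y) \<le> 2 * R"
        using True y dist_triangle3[of "?P \<xi>" "?P y" x] by (simp add: dist_norm)
      then have "(norm (?P \<xi> - ?P y))\<^sup>2 \<le> (2 * R)\<^sup>2" by (intro power_mono) auto
      then have "- 2 \<le> - (norm (?P \<xi> - ?P y))\<^sup>2 / (2 * R\<^sup>2)" using R by (simp add: field_simps power_mult_distrib)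
      then have "1 \<le> exp 2 * exp (- (norm (?P \<xi> - ?P y))\<^sup>2 / (2 * R\<^sup>2))" by (simp flip: exp_add)
      then have "tgauss V \<xi> * 1 \<le> tgauss V \<xi> * (exp 2 * exp (- (norm (?P \<xi> - ?P y))\<^sup>2 / (2 * R\<^sup>2)))"
        by (intro mult_left_mono) auto
      also have "\<dots> = tgauss V \<xi> * (exp 2 * exp (- (norm (?P \<xi> - ?P y))\<^sup>2 / (2 * R\<^sup>2))) * (R powr real m * (R\<^sup>2) powr (- real m / 2))"
        unfolding Rm by simp
      also have "\<dots> = exp 2 * R powr real m * ?v \<xi>" by (simp only: mult_ac)
      finally show ?thesis using True by (subst ennreal_mult[symmetric]) (auto intro: ennreal_leI)
    qed simp
  qed
  also have "\<dots> = ennreal (exp 2 * R powr real m) * (\<integral>\<^sup>+\<xi>. ennreal (?v \<xi>) \<partial>lborel)"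
    by (rule nn_integral_cmult) measurable
  also have "(\<integral>\<^sup>+\<xi>. ennreal (?v \<xi>) \<partial>lborel) = ennreal ((2 * pi) powr (CARD('n) / 2))"
    using R by (intro gauss_plane[OF V]) auto
  also have "ennreal (exp 2 * R powr real m) * ennreal ((2 * pi) powr (CARD('n) / 2)) = ennreal (exp 2 * (2 * pi) powr (CARD('n) / 2) * R powr real m)"
    by (subst ennreal_mult[symmetric]) (auto simp: mult_ac)
  finally show ?thesis .
qed (simp add: plane_measure_def)

lemma exp_small:
  assumes "0 < d" "0 < (e::real)" "0 \<le> K"
  obtains \<tau> where "0 < \<tau>" "K * exp (- d / \<tau>) \<le> e"
proof -
  define \<tau> where "\<tau> = d * e / (K + e)"
  have \<tau>: "0 < \<tau>" using assms by (simp add: \<tau>_def add_nonneg_pos)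
  have "d / \<tau> = (K + e) / e" using assms by (simp add: \<tau>_def)
  then have "(K + e) / e \<le> exp (d / \<tau>)" using exp_ge_add_one_self[of "d / \<tau>"] by linarith
  then have "K \<le> e * exp (d / \<tau>)" using assms by (simp add: field_simps)
  then have "K * exp (- d / \<tau>) \<le> e" by (simp add: exp_minus field_simps)
  then show thesis using that \<tau> by blast
qed

lemma emeasure_complement_SUP:
  fixes V :: "(real^'n) set" and \<nu> :: "(real^'n) measure"
  assumes \<nu>: "borel_finite \<nu>" and V: "subspace V" and F: "closed F"
    and le: "\<And>d. 0 < d \<Longrightarrow> emeasure \<nu> {y. \<forall>z\<in>F. d \<le> dist (orth_proj V y) z} \<le> X"
  shows "emeasure \<nu> {y. orth_proj V y \<notin> F} \<le> X"
proof -
  interpret B: borel_finite \<nu> by fact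
  let ?P = "orth_proj V"
  define Y where "Y k = {y. \<forall>z\<in>F. 1 / real (Suc k) \<le> dist (?P y) z}" for k
  have Ym: "Y k \<in> sets \<nu>" for k
  proof -
    have "Y k = ?P -` (\<Inter>z\<in>F. {u. 1 / real (Suc k) \<le> dist u z})" by (auto simp: Y_def)
    moreover have "closed (\<Inter>z\<in>F. {u. 1 / real (Suc k) \<le> dist u z})"
      by (intro closed_INT ballI closed_Collect_le continuous_intros)
    ultimately show ?thesis
      using measurable_sets[OF borel_measurable_orth_proj[OF V], of "\<Inter>z\<in>F. {u. 1 / real (Suc k) \<le> dist u z}"] by (simp add: B.sets_eq)
  qed
  have "{y. ?P y \<notin> F} = (\<Union>k. Y k)"
  proof (intro equalityI subsetI)
    fix y assume "y \<in> {y. ?P y \<notin> F}"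
    then have "?P y \<in> - F" by simp
    moreover have "open (- F)" using F by (simp add: open_Compl)
    ultimately obtain e where e: "0 < e" "ball (?P y) e \<subseteq> - F" by (auto simp: open_contains_ball)
    obtain k where k: "1 / real (Suc k) < e" using nat_approx_posE[OF e(1)] by blast
    have "1 / real (Suc k) \<le> dist (?P y) z" if "z \<in> F" for z
    proof (rule ccontr)
      assume "\<not> ?thesis"
      then have "z \<in> ball (?P y) e" using k by simp
      then show False using e that by blast
    qed
    then show "y \<in> (\<Union>k. Y k)" by (auto simp: Y_def)
  next
    fix y assume "y \<in> (\<Union>k. Y k)"
    then obtain k where k: "\<forall>z\<in>F. 1 / real (Suc k) \<le> dist (?P y) z" by (auto simp: Y_def)
    have "?P y \<notin> F"
    proof
      assume "?P y \<in> F"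
      then have "1 / real (Suc k) \<le> dist (?P y) (?P y)" using k by blast
      then show False by simp
    qed
    then show "y \<in> {y. ?P y \<notin> F}" by simp
  qed
  moreover have incY: "incseq Y"
  proof (rule incseq_SucI)
    fix k
    have "1 / real (Suc (Suc k)) \<le> 1 / real (Suc k)" by (intro divide_left_mono) auto
    then show "Y k \<subseteq> Y (Suc k)" unfolding Y_def by (auto intro: order_trans)
  qed
  ultimately have "emeasure \<nu> {y. ?P y \<notin> F} = (SUP k. emeasure \<nu> (Y k))"
    using SUP_emeasure_incseq[OF _ incY, of \<nu>] Ym by (simp add: image_subset_iff)
  also have "\<dots> \<le> X" by (rule SUP_least) (auto simp: Y_def intro!: le)
  finally show ?thesis .
qed

text \<open>Cauchy-Schwarz for the density, applied to mollifications so that no density has to be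
  constructed: off \<open>F\<close> one has \<open>x \<le> \<delta> * x^2 + 1 / \<delta>\<close>,
  the square integrals are bounded uniformly in \<open>\<tau>\<close>, and the leak into
  \<open>F\<close> vanishes with \<open>\<tau>\<close>.\<close>

lemma L2_mass_le:
  fixes V :: "(real^'n) set" and \<nu> :: "(real^'n) measure"
  assumes \<nu>: "borel_finite \<nu>" and V: "V \<in> grassmannian m" and \<delta>: "0 < \<delta>" and F: "closed F"
  shows "ennreal ((2 * pi) powr (CARD('n) / 2)) * emeasure \<nu> {y. orth_proj V y \<notin> F} \<le> ennreal \<delta> * sobolev 0 \<nu> V + ennreal (1 / \<delta>) * plane_measure V (- F)"
proof -
  interpret B: borel_finite \<nu> by fact
  have sV: "subspace V" using V by (rule grassmannian_subspace)
  note [measurable] = borel_measurable_orth_proj[OF sV]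
  note [measurable_cong] = B.sets_eq
  have [measurable]: "F \<in> sets borel" using F by simp
  let ?P = "orth_proj V"
  let ?c = "(2 * pi) powr (CARD('n) / 2)"
  let ?X = "ennreal \<delta> * sobolev 0 \<nu> V + ennreal (1 / \<delta>) * plane_measure V (- F)"
  have cc: "ennreal (1 / ?c) * (ennreal ?c * x) = x" for x
    by (simp flip: mult.assoc ennreal_mult)
  have "emeasure \<nu> {y. \<forall>z\<in>F. d \<le> dist (?P y) z} \<le> ennreal (1 / ?c) * ?X" if d: "0 < d" for d
  proof -
    have "ennreal ?c * emeasure \<nu> {y. \<forall>z\<in>F. d \<le> dist (?P y) z} \<le> ?X"
    proof (rule ennreal_le_epsilon)
      fix e :: real assume e: "0 < e"
      obtain \<tau> where \<tau>: "0 < \<tau>" "(?c * 2 powr (real m / 2) * measure \<nu> UNIV) * exp (- (d\<^sup>2 / 4) / \<tau>) \<le> e"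
        using exp_small[of "d\<^sup>2 / 4" e "?c * 2 powr (real m / 2) * measure \<nu> UNIV"] d e by auto
      have molm [measurable]: "mollified V m \<tau> \<nu> \<in> borel_measurable borel" unfolding mollified_def by measurable
      have "ennreal ?c * emeasure \<nu> {y. \<forall>z\<in>F. d \<le> dist (?P y) z} \<le>
        (\<integral>\<^sup>+\<xi>. indicator (- F) (?P \<xi>) * (ennreal (tgauss V \<xi>) * mollified V m \<tau> \<nu> (?P \<xi>)) \<partial>lborel) +
        ennreal (?c * (2 powr (real m / 2) * exp (- d\<^sup>2 / (4 * \<tau>))) * measure \<nu> UNIV)"
        by (rule mollified_mass[OF \<nu> V \<tau>(1) d F])
      also have "(\<integral>\<^sup>+\<xi>. indicator (- F) (?P \<xi>) * (ennreal (tgauss V \<xi>) * mollified V m \<tau> \<nu> (?P \<xi>)) \<partial>lborel) \<le>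
        (\<integral>\<^sup>+\<xi>. ennreal \<delta> * (ennreal (tgauss V \<xi>) * (mollified V m \<tau> \<nu> (?P \<xi>) * mollified V m \<tau> \<nu> (?P \<xi>))) + ennreal (1 / \<delta>) * (ennreal (tgauss V \<xi>) * indicator (- F) (?P \<xi>)) \<partial>lborel)"
      proof (rule nn_integral_mono)
        fix \<xi>
        let ?x = "mollified V m \<tau> \<nu> (?P \<xi>)"
        have "?x \<le> ennreal \<delta> * (?x * ?x) + ennreal (1 / \<delta>)"
        proof (cases "?x \<le> ennreal (1 / \<delta>)")
          case False
          then have "ennreal (1 / \<delta>) * ?x \<le> ?x * ?x" by (intro mult_right_mono) auto
          then have "ennreal \<delta> * (ennreal (1 / \<delta>) * ?x) \<le> ennreal \<delta> * (?x * ?x)" by (intro mult_left_mono) auto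
          moreover have "ennreal \<delta> * (ennreal (1 / \<delta>) * ?x) = ?x" using \<delta> by (simp flip: mult.assoc ennreal_mult)
          ultimately show ?thesis by (simp add: add_increasing2)
        qed (simp add: add_increasing)
        then have "ennreal (tgauss V \<xi>) * ?x \<le> ennreal (tgauss V \<xi>) * (ennreal \<delta> * (?x * ?x) + ennreal (1 / \<delta>))"
          by (intro mult_left_mono) auto
        also have "\<dots> = ennreal \<delta> * (ennreal (tgauss V \<xi>) * (?x * ?x)) + ennreal (1 / \<delta>) * ennreal (tgauss V \<xi>)"
          by (simp add: distrib_left mult_ac)
        finally show "indicator (- F) (?P \<xi>) * (ennreal (tgauss V \<xi>) * ?x) \<le>
          ennreal \<delta> * (ennreal (tgauss V \<xi>) * (?x * ?x)) + ennreal (1 / \<delta>) * (ennreal (tgauss V \<xi>) * indicator (- F) (?P \<xi>))"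
          by (auto simp: indicator_def)
      qed
      also have "\<dots> = ennreal \<delta> * (\<integral>\<^sup>+\<xi>. ennreal (tgauss V \<xi>) * (mollified V m \<tau> \<nu> (?P \<xi>) * mollified V m \<tau> \<nu> (?P \<xi>)) \<partial>lborel) + ennreal (1 / \<delta>) * plane_measure V (- F)"
        unfolding plane_measure_def by (subst nn_integral_add) (simp_all add: nn_integral_cmult)
      also have "\<dots> \<le> ?X"
        by (intro add_right_mono mult_left_mono mollified_square[OF \<nu> V \<tau>(1)]) auto
      finally have "ennreal ?c * emeasure \<nu> {y. \<forall>z\<in>F. d \<le> dist (?P y) z} \<le> ?X + ennreal (?c * (2 powr (real m / 2) * exp (- d\<^sup>2 / (4 * \<tau>))) * measure \<nu> UNIV)"
        by (simp add: add_right_mono)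
      also have "\<dots> \<le> ?X + ennreal e"
      proof (intro add_left_mono ennreal_leI)
        have "- d\<^sup>2 / (4 * \<tau>) = - (d\<^sup>2 / 4) / \<tau>" by simp
        then show "?c * (2 powr (real m / 2) * exp (- d\<^sup>2 / (4 * \<tau>))) * measure \<nu> UNIV \<le> e" using \<tau>(2) by (simp only: mult_ac)
      qed
      finally show "ennreal ?c * emeasure \<nu> {y. \<forall>z\<in>F. d \<le> dist (?P y) z} \<le> ?X + ennreal e" .
    qed
    then have "ennreal (1 / ?c) * (ennreal ?c * emeasure \<nu> {y. \<forall>z\<in>F. d \<le> dist (?P y) z}) \<le> ennreal (1 / ?c) * ?X"
      by (rule mult_left_mono) simp
    then show ?thesis by (simp only: cc)
  qed
  then have "emeasure \<nu> {y. ?P y \<notin> F} \<le> ennreal (1 / ?c) * ?X"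
    by (rule emeasure_complement_SUP[OF \<nu> sV F])
  then have "ennreal ?c * emeasure \<nu> {y. ?P y \<notin> F} \<le> ennreal ?c * (ennreal (1 / ?c) * ?X)"
    by (intro mult_left_mono) auto
  also have "\<dots> = ?X" by (simp flip: mult.assoc ennreal_mult)
  finally show ?thesis .
qed

text \<open>A set of \<open>m\<close>-dimensional measure zero has open neighbourhoods of
  arbitrarily small plane measure, and \<open>L2_mass_le\<close> bounds what the projection of
  \<open>\<nu>\<close> gives to them.\<close>

lemma L2_null:
  fixes V :: "(real^'n) set" and \<nu> :: "(real^'n) measure"
  assumes \<nu>: "borel_finite \<nu>" and V: "V \<in> grassmannian m" and m: "1 \<le> m" and Wf: "sobolev 0 \<nu> V < \<infinity>"
    and S: "S \<in> sets borel" and H: "hausdorff_measure (real m) S = 0"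
  shows "AE y in \<nu>. orth_proj V y \<notin> S"
proof -
  interpret B: borel_finite \<nu> by fact
  have sV: "subspace V" using V by (rule grassmannian_subspace)
  note [measurable] = borel_measurable_orth_proj[OF sV] S
  note [measurable_cong] = B.sets_eq
  let ?P = "orth_proj V"
  let ?c = "(2 * pi) powr (CARD('n) / 2)"
  define K where "K = exp 2 * ?c * 2 powr real m"
  have K: "0 < K" by (simp add: K_def)
  obtain w where w: "sobolev 0 \<nu> V = ennreal w" "0 \<le> w" using Wf by (cases "sobolev 0 \<nu> V") auto
  define Y where "Y = {y. ?P y \<in> S}"
  have Y: "Y \<in> sets \<nu>" unfolding Y_def by measurable
  have "ennreal ?c * emeasure \<nu> Y \<le> 0 + ennreal e" if e: "0 < e" for e
  proof -
    \<comment> \<open>\<open>\<delta>\<close> settles the Sobolev term first;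
      \<open>\<epsilon>\<close> is then small enough for the plane measure divided by
      \<open>\<delta>\<close>.\<close>
    define \<delta> where "\<delta> = e / 2 / (w + 1)"
    have \<delta>: "0 < \<delta>" "\<delta> * w \<le> e / 2" using e w by (auto simp: \<delta>_def field_simps)
    define \<epsilon> where "\<epsilon> = e / 2 * \<delta> / K"
    have \<epsilon>: "0 < \<epsilon>" using e \<delta> K by (simp add: \<epsilon>_def)
    have m0: "0 < real m" using m by simp
    obtain C \<rho> where C: "S \<subseteq> (\<Union>i::nat. C i)" "\<And>i x y. x \<in> C i \<Longrightarrow> y \<in> C i \<Longrightarrow> dist x y \<le> \<rho> i" "\<And>i. 0 < \<rho> i" "\<And>i. \<rho> i \<le> 1"
        "(\<Sum>i. ennreal (\<rho> i powr real m)) \<le> ennreal \<epsilon>"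
      by (rule hausdorff_pre_zero_cover[OF H m0 \<epsilon>]) (rule that)
    define x where "x i = (SOME x. x \<in> C i)" for i
    \<comment> \<open>Doubling the radius makes the open balls contain the covering sets, so that
      the complement of \<open>U\<close> is closed, as \<open>L2_mass_le\<close> requires.\<close>
    define U where "U = (\<Union>i. ball (x i) (2 * \<rho> i))"
    have SU: "S \<subseteq> U"
    proof
      fix s assume "s \<in> S"
      then obtain i where i: "s \<in> C i" using C(1) by blast
      then have "x i \<in> C i" unfolding x_def by (rule someI)
      then have "dist (x i) s \<le> \<rho> i" using i by (rule C(2))
      then have "dist (x i) s < 2 * \<rho> i" using C(3)[of i] by linarith
      then show "s \<in> U" by (auto simp: U_def)
    qed
    have Uo: "open U" unfolding U_def by (intro open_UN ballI open_ball)
    have "plane_measure V U \<le> (\<integral>\<^sup>+\<xi>. (\<Sum>i. ennreal (tgauss V \<xi>) * indicator (ball (x i) (2 * \<rho> i)) (?P \<xi>)) \<partial>lborel)"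
      unfolding plane_measure_def
    proof (rule nn_integral_mono)
      fix \<xi>
      show "ennreal (tgauss V \<xi>) * indicator U (?P \<xi>) \<le> (\<Sum>i. ennreal (tgauss V \<xi>) * indicator (ball (x i) (2 * \<rho> i)) (?P \<xi>))"
      proof (cases "?P \<xi> \<in> U")
        case True
        then obtain i where i: "?P \<xi> \<in> ball (x i) (2 * \<rho> i)" by (auto simp: U_def)
        have "ennreal (tgauss V \<xi>) * indicator U (?P \<xi>) = (\<Sum>i\<in>{i}. ennreal (tgauss V \<xi>) * indicator (ball (x i) (2 * \<rho> i)) (?P \<xi>))"
          using True i by simp
        also have "\<dots> \<le> (\<Sum>i. ennreal (tgauss V \<xi>) * indicator (ball (x i) (2 * \<rho> i)) (?P \<xi>))"
          by (intro sum_le_suminf) auto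
        finally show ?thesis .
      qed simp
    qed
    also have "\<dots> = (\<Sum>i. plane_measure V (ball (x i) (2 * \<rho> i)))"
      unfolding plane_measure_def
    proof (rule nn_integral_suminf)
      fix i
      have [measurable]: "ball (x i) (2 * \<rho> i) \<in> sets borel" by simp
      show "(\<lambda>\<xi>. ennreal (tgauss V \<xi>) * indicator (ball (x i) (2 * \<rho> i)) (?P \<xi>)) \<in> borel_measurable lborel"
        by measurable
    qed
    also have "\<dots> \<le> (\<Sum>i. ennreal K * ennreal (\<rho> i powr real m))"
    proof (rule suminf_le)
      fix i
      have "0 < 2 * \<rho> i" using C(3)[of i] by simp
      from plane_measure_ball[OF V this, of "x i"]
      have "plane_measure V (ball (x i) (2 * \<rho> i)) \<le> ennreal (exp 2 * ?c * (2 * \<rho> i) powr real m)" .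
      also have "exp 2 * ?c * (2 * \<rho> i) powr real m = K * \<rho> i powr real m"
        using C(3)[of i] by (simp add: K_def powr_mult)
      finally show "plane_measure V (ball (x i) (2 * \<rho> i)) \<le> ennreal K * ennreal (\<rho> i powr real m)"
        using K by (simp add: ennreal_mult)
    qed auto
    also have "\<dots> = ennreal K * (\<Sum>i. ennreal (\<rho> i powr real m))" by simp
    also have "\<dots> \<le> ennreal K * ennreal \<epsilon>" by (intro mult_left_mono C) auto
    finally have LU: "plane_measure V U \<le> ennreal (K * \<epsilon>)" using K \<epsilon> by (simp add: ennreal_mult)
    have "{y. ?P y \<notin> - U} = ?P -` U" by auto
    then have Um: "{y. ?P y \<notin> - U} \<in> sets \<nu>"
      using measurable_sets[OF borel_measurable_orth_proj[OF sV], of U] Uo by (simp add: B.sets_eq)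
    have "ennreal ?c * emeasure \<nu> Y \<le> ennreal ?c * emeasure \<nu> {y. ?P y \<notin> - U}"
      using SU Um by (intro mult_left_mono emeasure_mono) (auto simp: Y_def)
    also have "\<dots> \<le> ennreal \<delta> * sobolev 0 \<nu> V + ennreal (1 / \<delta>) * plane_measure V (- (- U))"
      by (rule L2_mass_le[OF \<nu> V \<delta>(1)]) (use Uo in auto)
    also have "\<dots> \<le> ennreal (e / 2) + ennreal (e / 2)"
    proof (rule add_mono)
      show "ennreal \<delta> * sobolev 0 \<nu> V \<le> ennreal (e / 2)" using \<delta> w by (auto simp flip: ennreal_mult intro: ennreal_leI)
      have "ennreal (1 / \<delta>) * plane_measure V (- (- U)) \<le> ennreal (1 / \<delta>) * ennreal (K * \<epsilon>)"
        using LU by (intro mult_left_mono) auto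
      also have "\<dots> = ennreal (1 / \<delta> * (K * \<epsilon>))" using \<delta> K \<epsilon> by (subst ennreal_mult) auto
      also have "1 / \<delta> * (K * \<epsilon>) = e / 2" using \<delta> K by (simp add: \<epsilon>_def)
      finally show "ennreal (1 / \<delta>) * plane_measure V (- (- U)) \<le> ennreal (e / 2)" .
    qed
    also have "\<dots> = 0 + ennreal e" using e by (simp flip: ennreal_plus)
    finally show ?thesis .
  qed
  then have "ennreal ?c * emeasure \<nu> Y \<le> 0" by (rule ennreal_le_epsilon)
  then have "emeasure \<nu> Y = 0" by auto
  then have "Y \<in> null_sets \<nu>" using Y by (intro null_setsI) auto
  then show ?thesis by (rule AE_I'[of Y]) (auto simp: Y_def)
qed

section \<open>Projections with continuous density\<close>

lemma cnj_measurable [measurable]: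
  "f \<in> borel_measurable M \<Longrightarrow> (\<lambda>x. cnj (f x)) \<in> borel_measurable M"
  using measurable_compose[of f M borel cnj borel] borel_measurable_continuous_onI[of cnj] by (simp add: continuous_on_cnj)

lemma borel_finite_return: "borel_finite (return borel u)"
  using prob_space.finite_measure[OF prob_space_return[of u borel]]
  by (simp add: borel_finite_def borel_finite_axioms_def)

lemma fhat_return: "fhat (return borel u) \<xi> = cis (\<xi> \<bullet> u)"
  unfolding fhat_def by (rule integral_return) auto

text \<open>A point mass in place of the second measure turns the overlap into a mollified density
  at \<open>u\<close>, up to normalisation, so the Fourier formulas for pairs of measures also
  describe densities.\<close>

lemma overlap_return:
  fixes V :: "(real^'n) set" and \<mu> :: "(real^'n) measure"
  assumes \<mu>: "borel_finite \<mu>" and V: "subspace V" and \<tau>: "0 < \<tau>"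
  shows "ennreal (overlap V \<tau> \<mu> (return borel u)) = (\<integral>\<^sup>+x. ennreal (exp (- (norm (orth_proj V (x - u)))\<^sup>2 / (2 * \<tau>))) \<partial>\<mu>)"
proof -
  interpret D: borel_finite "return borel u" by (rule borel_finite_return)
  note [measurable] = borel_measurable_orth_proj[OF V]
  show ?thesis
    unfolding nn_overlap(1)[OF \<mu> borel_finite_return V \<tau>]
    by (subst D.nn_integral_pair[OF \<mu>], measurable) (simp add: nn_integral_return)
qed

lemma overlap_Fubini:
  fixes V :: "(real^'n) set" and \<mu> \<nu> :: "(real^'n) measure"
  assumes \<mu>: "borel_finite \<mu>" and \<nu>: "borel_finite \<nu>" and V: "subspace V" and \<tau>: "0 < \<tau>"
  shows "ennreal (overlap V \<tau> \<mu> \<nu>) = (\<integral>\<^sup>+y. ennreal (overlap V \<tau> \<mu> (return borel y)) \<partial>\<nu>)"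
proof -
  interpret A: borel_finite \<mu> by fact
  interpret B: borel_finite \<nu> by fact
  interpret P: pair_sigma_finite \<mu> \<nu> ..
  note [measurable_cong] = A.sets_eq B.sets_eq
  note [measurable] = borel_measurable_orth_proj[OF V]
  have "ennreal (overlap V \<tau> \<mu> \<nu>) = (\<integral>\<^sup>+x. \<integral>\<^sup>+y. ennreal (exp (- (norm (orth_proj V (x - y)))\<^sup>2 / (2 * \<tau>))) \<partial>\<nu> \<partial>\<mu>)"
    unfolding nn_overlap(1)[OF \<mu> \<nu> V \<tau>] by (subst B.nn_integral_pair[OF \<mu>]) simp_all
  also have "\<dots> = (\<integral>\<^sup>+y. \<integral>\<^sup>+x. ennreal (exp (- (norm (orth_proj V (x - y)))\<^sup>2 / (2 * \<tau>))) \<partial>\<mu> \<partial>\<nu>)"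
    by (rule P.Fubini'[symmetric]) measurable
  finally show ?thesis by (simp only: overlap_return[OF \<mu> V \<tau>])
qed

lemma mollified_eq_overlap_return:
  fixes V :: "(real^'n) set" and \<mu> :: "(real^'n) measure"
  assumes \<mu>: "borel_finite \<mu>" and V: "subspace V" and \<tau>: "0 < \<tau>"
  shows "mollified V m \<tau> \<mu> (orth_proj V u) = ennreal (\<tau> powr (- real m / 2) * overlap V \<tau> \<mu> (return borel u))"
proof -
  interpret A: borel_finite \<mu> by fact
  note [measurable_cong] = A.sets_eq
  note [measurable] = borel_measurable_orth_proj[OF V]
  have "mollified V m \<tau> \<mu> (orth_proj V u) = (\<integral>\<^sup>+x. ennreal (\<tau> powr (- real m / 2)) * ennreal (exp (- (norm (orth_proj V (x - u)))\<^sup>2 / (2 * \<tau>))) \<partial>\<mu>)"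
    unfolding mollified_def
    by (intro nn_integral_cong) (simp add: linear_diff[OF linear_orth_proj[OF V]] norm_minus_commute flip: ennreal_mult)
  also have "\<dots> = ennreal (\<tau> powr (- real m / 2)) * ennreal (overlap V \<tau> \<mu> (return borel u))"
    unfolding overlap_return[OF \<mu> V \<tau>] by (rule nn_integral_cmult) measurable
  finally show ?thesis using nn_overlap(2)[OF \<mu> borel_finite_return V \<tau>] by (simp add: ennreal_mult)
qed

text \<open>A point mass at 0 has Fourier transform of modulus 1, so this integral is its negative
  Sobolev norm. That is an energy of negative order \<open>m - a\<close>, a convergent Gamma
  integral.\<close>

lemma gauss_weight_finite:
  fixes V :: "(real^'n) set"
  assumes V: "V \<in> grassmannian m" and a: "real m < a"
  shows "(\<integral>\<^sup>+\<xi>. ennreal ((1 + (norm (orth_proj V \<xi>))\<^sup>2 / 2) powr (- a / 2) * tgauss V \<xi>) \<partial>lborel) < \<infinity>"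
proof -
  let ?\<delta> = "return borel (0 :: real^'n)"
  interpret D: borel_finite ?\<delta> by (rule borel_finite_return)
  have sV: "subspace V" using V by (rule grassmannian_subspace)
  note [measurable] = borel_measurable_orth_proj[OF sV]
  have P0: "orth_proj V 0 = 0" using linear_orth_proj[OF sV] by (rule linear_0)
  have "energy (real m - a) ?\<delta> V = riesz_kernel (real m - a) 0"
    unfolding energy_def by (subst D.nn_integral_pair[OF borel_finite_return], measurable) (simp add: nn_integral_return P0)
  also have "\<dots> = (\<integral>\<^sup>+\<tau>. ennreal (indicator {0<..} \<tau> * (\<tau> powr ((a - real m) / 2 - 1) * exp (- (\<tau> * 1)))) \<partial>lborel)"
  proof -
    have "- (real m - a) / 2 = (a - real m) / 2" by simp
    then show ?thesis unfolding riesz_kernel_def by simp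
  qed
  also have "\<dots> < \<infinity>"
    using a by (subst nn_integral_Gamma) auto
  finally have "ennreal ((2 * pi) powr (CARD('n) / 2)) * energy (real m - a) ?\<delta> V < \<infinity>"
    by (auto simp: ennreal_mult_less_top)
  then have fin: "ennreal (Gamma (a / 2)) * sobolev (- a) ?\<delta> V < \<infinity>"
    using a by (subst sobolev_neg_eq_energy[OF borel_finite_return V]) auto
  have "0 < Gamma (a / 2)" using a by (intro Gamma_real_pos) auto
  then have "ennreal (1 / Gamma (a / 2)) * (ennreal (Gamma (a / 2)) * sobolev (- a) ?\<delta> V) = sobolev (- a) ?\<delta> V"
    by (simp flip: mult.assoc ennreal_mult)
  moreover have "ennreal (1 / Gamma (a / 2)) * (ennreal (Gamma (a / 2)) * sobolev (- a) ?\<delta> V) < \<infinity>"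
    unfolding infinity_ennreal_def
    by (rule iffD2[OF ennreal_mult_less_top], intro disjI2 conjI ennreal_less_top, rule fin[unfolded infinity_ennreal_def])
  ultimately have "sobolev (- a) ?\<delta> V < \<infinity>" by simp
  then show ?thesis by (simp add: sobolev_def fhat_return)
qed

text \<open>With the Sobolev weight \<open>w\<close> one has \<open>x \<le> w * x^2 + 1 / w\<close>;
  the first term is the Sobolev norm, and the second is finite by
  \<open>gauss_weight_finite\<close>, where \<open>a > m\<close> enters.\<close>

lemma integrable_fhat_plane:
  fixes V :: "(real^'n) set" and \<mu> :: "(real^'n) measure"
  assumes \<mu>: "borel_finite \<mu>" and V: "V \<in> grassmannian m" and a: "real m < a" and Wf: "sobolev a \<mu> V < \<infinity>"
  shows "integrable lborel (\<lambda>\<xi>. tgauss V \<xi> * norm (fhat \<mu> (orth_proj V \<xi>)))"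
proof (rule integrableI_bounded)
  interpret A: borel_finite \<mu> by fact
  have sV: "subspace V" using V by (rule grassmannian_subspace)
  note [measurable] = borel_measurable_orth_proj[OF sV]
  let ?P = "orth_proj V"
  show "(\<lambda>\<xi>. tgauss V \<xi> * norm (fhat \<mu> (?P \<xi>))) \<in> borel_measurable lborel" by measurable
  have "(\<integral>\<^sup>+\<xi>. ennreal (norm (tgauss V \<xi> * norm (fhat \<mu> (?P \<xi>)))) \<partial>lborel) \<le>
    (\<integral>\<^sup>+\<xi>. ennreal ((1 + (norm (?P \<xi>))\<^sup>2 / 2) powr (a / 2) * tgauss V \<xi> * (norm (fhat \<mu> (?P \<xi>)))\<^sup>2) +
      ennreal ((1 + (norm (?P \<xi>))\<^sup>2 / 2) powr (- a / 2) * tgauss V \<xi>) \<partial>lborel)"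
  proof (rule nn_integral_mono)
    fix \<xi>
    define x where "x = norm (fhat \<mu> (?P \<xi>))"
    define w where "w = (1 + (norm (?P \<xi>))\<^sup>2 / 2) powr (a / 2)"
    have w: "0 < w" "(1 + (norm (?P \<xi>))\<^sup>2 / 2) powr (- a / 2) = 1 / w"
      by (auto simp: w_def powr_minus_divide add_pos_nonneg add_nonneg_eq_0_iff)
    have x: "0 \<le> x" by (simp add: x_def)
    have "0 \<le> (w * x - 1)\<^sup>2" by simp
    then have "2 * (w * x) \<le> (w * x)\<^sup>2 + 1" by (simp add: power2_diff)
    moreover have "0 \<le> w * x" using w x by simp
    ultimately have "w * x \<le> (w * x)\<^sup>2 + 1" by linarith
    then have "x \<le> w * x\<^sup>2 + 1 / w" using w(1) by (simp add: field_simps power2_eq_square)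
    then have "tgauss V \<xi> * x \<le> tgauss V \<xi> * (w * x\<^sup>2 + 1 / w)" by (intro mult_left_mono) auto
    then have "tgauss V \<xi> * x \<le> w * tgauss V \<xi> * x\<^sup>2 + 1 / w * tgauss V \<xi>" by (simp add: algebra_simps)
    then show "ennreal (norm (tgauss V \<xi> * norm (fhat \<mu> (?P \<xi>)))) \<le> ennreal ((1 + (norm (?P \<xi>))\<^sup>2 / 2) powr (a / 2) * tgauss V \<xi> * (norm (fhat \<mu> (?P \<xi>)))\<^sup>2) +
      ennreal ((1 + (norm (?P \<xi>))\<^sup>2 / 2) powr (- a / 2) * tgauss V \<xi>)"
      unfolding x_def[symmetric] w_def[symmetric] w(2)
      using w(1) x by (subst ennreal_plus[symmetric]) (auto simp del: ennreal_plus intro!: ennreal_leI)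
  qed
  also have "\<dots> = sobolev a \<mu> V + (\<integral>\<^sup>+\<xi>. ennreal ((1 + (norm (?P \<xi>))\<^sup>2 / 2) powr (- a / 2) * tgauss V \<xi>) \<partial>lborel)"
    unfolding sobolev_def by (rule nn_integral_add) measurable
  also have "\<dots> < \<infinity>" using Wf gauss_weight_finite[OF V a] by simp
  finally show "(\<integral>\<^sup>+\<xi>. ennreal (norm (tgauss V \<xi> * norm (fhat \<mu> (?P \<xi>)))) \<partial>lborel) < \<infinity>" .
qed

text \<open>Up to a constant, the density of the image of \<open>\<mu>\<close> under the projection, by Fourier inversion.\<close>

definition proj_density :: "(real^'n) set \<Rightarrow> (real^'n) measure \<Rightarrow> real^'n \<Rightarrow> real" where
  "proj_density V \<mu> u = Re (CLINT \<xi>|lborel. tgauss V \<xi> *\<^sub>R (fhat \<mu> (orth_proj V \<xi>) * cnj (cis (orth_proj V \<xi> \<bullet> u))))"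

text \<open>The integrated gap between the transform and its version damped by a Gaussian. It does
  not involve the point \<open>u\<close>, so it controls mollified densities uniformly.\<close>

definition density_error :: "(real^'n) set \<Rightarrow> real \<Rightarrow> (real^'n) measure \<Rightarrow> real" where
  "density_error V \<tau> \<mu> = (LINT \<xi>|lborel. (1 - exp (- (\<tau> * (norm (orth_proj V \<xi>))\<^sup>2) / 2)) * (tgauss V \<xi> * norm (fhat \<mu> (orth_proj V \<xi>))))"

locale plane_density = borel_finite \<mu> for \<mu> :: "(real^'n) measure" +
  fixes V :: "(real^'n) set" and m :: nat
  assumes V: "V \<in> grassmannian m"
    and fint: "integrable lborel (\<lambda>\<xi>. tgauss V \<xi> * norm (fhat \<mu> (orth_proj V \<xi>)))"
begin

lemma bf: "borel_finite \<mu>" ..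

lemma sV: "subspace V" using V by (rule grassmannian_subspace)

lemma P_meas [measurable]: "orth_proj V \<in> borel_measurable borel" by (rule borel_measurable_orth_proj[OF sV])

lemma density_error_bound:
  assumes \<tau>: "0 < \<tau>"
  shows "\<bar>(2 * pi) powr (CARD('n) / 2) * (\<tau> powr (- real m / 2) * overlap V \<tau> \<mu> (return borel u)) - proj_density V \<mu> u\<bar> \<le> density_error V \<tau> \<mu>"
proof -
  let ?P = "orth_proj V"
  let ?e = "\<lambda>\<xi>. exp (- (\<tau> * (norm (?P \<xi>))\<^sup>2) / 2)"
  let ?f = "\<lambda>\<xi>. fhat \<mu> (?P \<xi>) * cnj (cis (?P \<xi> \<bullet> u))"
  have e1: "0 \<le> 1 - ?e \<xi>" "?e \<xi> \<le> 1" for \<xi> using \<tau> by auto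
  have i0: "integrable lborel (\<lambda>\<xi>. tgauss V \<xi> *\<^sub>R ?f \<xi>)"
    by (rule Bochner_Integration.integrable_bound[OF fint]) (measurable, auto simp: norm_mult)
  have i1: "integrable lborel (\<lambda>\<xi>. (?e \<xi> * tgauss V \<xi>) *\<^sub>R ?f \<xi>)"
  proof (rule Bochner_Integration.integrable_bound[OF i0], measurable, rule AE_I2)
    fix \<xi>
    have "?e \<xi> * norm (tgauss V \<xi> *\<^sub>R ?f \<xi>) \<le> 1 * norm (tgauss V \<xi> *\<^sub>R ?f \<xi>)" using e1 by (intro mult_right_mono) auto
    then show "norm ((?e \<xi> * tgauss V \<xi>) *\<^sub>R ?f \<xi>) \<le> norm (tgauss V \<xi> *\<^sub>R ?f \<xi>)" by (simp add: norm_mult mult.assoc)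
  qed
  have "\<bar>(2 * pi) powr (CARD('n) / 2) * (\<tau> powr (- real m / 2) * overlap V \<tau> \<mu> (return borel u)) - proj_density V \<mu> u\<bar> =
    \<bar>Re ((CLINT \<xi>|lborel. (?e \<xi> * tgauss V \<xi>) *\<^sub>R ?f \<xi>) - (CLINT \<xi>|lborel. tgauss V \<xi> *\<^sub>R ?f \<xi>))\<bar>"
    using overlap_fhat[OF bf borel_finite_return V \<tau>, of u] by (simp add: proj_density_def fhat_return mult.assoc)
  also have "\<dots> \<le> norm ((CLINT \<xi>|lborel. (?e \<xi> * tgauss V \<xi>) *\<^sub>R ?f \<xi>) - (CLINT \<xi>|lborel. tgauss V \<xi> *\<^sub>R ?f \<xi>))"
    by (rule abs_Re_le_cmod)
  also have "\<dots> = norm (CLINT \<xi>|lborel. (?e \<xi> * tgauss V \<xi>) *\<^sub>R ?f \<xi> - tgauss V \<xi> *\<^sub>R ?f \<xi>)"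
    by (subst Bochner_Integration.integral_diff[OF i1 i0]) simp
  also have "\<dots> \<le> (LINT \<xi>|lborel. norm ((?e \<xi> * tgauss V \<xi>) *\<^sub>R ?f \<xi> - tgauss V \<xi> *\<^sub>R ?f \<xi>))"
    by (rule integral_norm_bound)
  also have "\<dots> = density_error V \<tau> \<mu>"
    unfolding density_error_def
  proof (rule Bochner_Integration.integral_cong[OF refl])
    fix \<xi>
    have "(?e \<xi> * tgauss V \<xi>) *\<^sub>R ?f \<xi> - tgauss V \<xi> *\<^sub>R ?f \<xi> = - (((1 - ?e \<xi>) * tgauss V \<xi>) *\<^sub>R ?f \<xi>)"
      by (simp add: algebra_simps)
    then have "norm ((?e \<xi> * tgauss V \<xi>) *\<^sub>R ?f \<xi> - tgauss V \<xi> *\<^sub>R ?f \<xi>) = norm (((1 - ?e \<xi>) * tgauss V \<xi>) *\<^sub>R ?f \<xi>)"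
      by (simp only: norm_minus_cancel)
    also have "\<dots> = (1 - ?e \<xi>) * (tgauss V \<xi> * norm (fhat \<mu> (?P \<xi>)))"
      using e1 by (simp add: norm_mult abs_mult)
    finally show "norm ((?e \<xi> * tgauss V \<xi>) *\<^sub>R ?f \<xi> - tgauss V \<xi> *\<^sub>R ?f \<xi>) = (1 - ?e \<xi>) * (tgauss V \<xi> * norm (fhat \<mu> (?P \<xi>)))" .
  qed
  finally show ?thesis .
qed

lemma density_error_tendsto: "(\<lambda>k. density_error V (1 / real (Suc k)) \<mu>) \<longlonglongrightarrow> 0"
proof -
  let ?P = "orth_proj V"
  have "(\<lambda>k. density_error V (1 / real (Suc k)) \<mu>) \<longlonglongrightarrow> (LINT \<xi>|(lborel :: (real^'n) measure). 0)"
    unfolding density_error_def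
  proof (rule integral_dominated_convergence[where w = "\<lambda>\<xi>. tgauss V \<xi> * norm (fhat \<mu> (?P \<xi>))"])
    show "AE \<xi> in lborel. (\<lambda>k. (1 - exp (- (1 / real (Suc k) * (norm (?P \<xi>))\<^sup>2) / 2)) * (tgauss V \<xi> * norm (fhat \<mu> (?P \<xi>)))) \<longlonglongrightarrow> 0"
    proof (rule AE_I2)
      fix \<xi>
      have "(\<lambda>k. (1 - exp (- (1 / real (Suc k) * (norm (?P \<xi>))\<^sup>2) / 2)) * (tgauss V \<xi> * norm (fhat \<mu> (?P \<xi>)))) \<longlonglongrightarrow>
        (1 - exp (- (0 * (norm (?P \<xi>))\<^sup>2) / 2)) * (tgauss V \<xi> * norm (fhat \<mu> (?P \<xi>)))"
        by (intro tendsto_intros lim_1_over_n[THEN LIMSEQ_Suc, unfolded divide_inverse] LIMSEQ_Suc[OF lim_1_over_n]) simp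
      then show "(\<lambda>k. (1 - exp (- (1 / real (Suc k) * (norm (?P \<xi>))\<^sup>2) / 2)) * (tgauss V \<xi> * norm (fhat \<mu> (?P \<xi>)))) \<longlonglongrightarrow> 0" by simp
    qed
    show "AE \<xi> in lborel. norm ((1 - exp (- (1 / real (Suc k) * (norm (?P \<xi>))\<^sup>2) / 2)) * (tgauss V \<xi> * norm (fhat \<mu> (?P \<xi>)))) \<le> tgauss V \<xi> * norm (fhat \<mu> (?P \<xi>))" for k
    proof (rule AE_I2)
      fix \<xi>
      have "\<bar>1 - exp (- (1 / real (Suc k) * (norm (?P \<xi>))\<^sup>2) / 2)\<bar> \<le> 1"
        by (simp add: abs_le_iff)
      then have "\<bar>1 - exp (- (1 / real (Suc k) * (norm (?P \<xi>))\<^sup>2) / 2)\<bar> * (tgauss V \<xi> * norm (fhat \<mu> (?P \<xi>))) \<le> 1 * (tgauss V \<xi> * norm (fhat \<mu> (?P \<xi>)))"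
        by (intro mult_right_mono) auto
      then show "norm ((1 - exp (- (1 / real (Suc k) * (norm (?P \<xi>))\<^sup>2) / 2)) * (tgauss V \<xi> * norm (fhat \<mu> (?P \<xi>)))) \<le> tgauss V \<xi> * norm (fhat \<mu> (?P \<xi>))"
        by (simp add: abs_mult)
    qed
    show "integrable lborel (\<lambda>\<xi>. tgauss V \<xi> * norm (fhat \<mu> (?P \<xi>)))" by (rule fint)
  qed measurable
  then show ?thesis by simp
qed

lemma continuous_proj_density: "continuous_on UNIV (proj_density V \<mu>)"
proof (rule continuous_on_sequentiallyI)
  let ?P = "orth_proj V"
  fix u :: "nat \<Rightarrow> real^'n" and b assume u: "u \<longlonglongrightarrow> b"
  have "(\<lambda>k. CLINT \<xi>|lborel. tgauss V \<xi> *\<^sub>R (fhat \<mu> (?P \<xi>) * cnj (cis (?P \<xi> \<bullet> u k)))) \<longlonglongrightarrow>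
    (CLINT \<xi>|lborel. tgauss V \<xi> *\<^sub>R (fhat \<mu> (?P \<xi>) * cnj (cis (?P \<xi> \<bullet> b))))"
  proof (rule integral_dominated_convergence[OF _ _ fint])
    show "AE \<xi> in lborel. (\<lambda>k. tgauss V \<xi> *\<^sub>R (fhat \<mu> (?P \<xi>) * cnj (cis (?P \<xi> \<bullet> u k)))) \<longlonglongrightarrow> tgauss V \<xi> *\<^sub>R (fhat \<mu> (?P \<xi>) * cnj (cis (?P \<xi> \<bullet> b)))"
      unfolding cis_conv_exp by (intro AE_I2 tendsto_intros u)
    show "AE \<xi> in lborel. norm (tgauss V \<xi> *\<^sub>R (fhat \<mu> (?P \<xi>) * cnj (cis (?P \<xi> \<bullet> u k)))) \<le> tgauss V \<xi> * norm (fhat \<mu> (?P \<xi>))" for k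
      by (simp add: norm_mult)
  qed measurable
  then show "(\<lambda>k. proj_density V \<mu> (u k)) \<longlonglongrightarrow> proj_density V \<mu> b" unfolding proj_density_def by (rule tendsto_Re)
qed

lemma proj_density_tendsto:
  "(\<lambda>k. (2 * pi) powr (CARD('n) / 2) * ((1 / real (Suc k)) powr (- real m / 2) * overlap V (1 / real (Suc k)) \<mu> (return borel u))) \<longlonglongrightarrow> proj_density V \<mu> u"
proof (rule LIM_zero_cancel, rule Lim_null_comparison[OF _ density_error_tendsto])
  have "norm ((2 * pi) powr (CARD('n) / 2) * ((1 / real (Suc k)) powr (- real m / 2) * overlap V (1 / real (Suc k)) \<mu> (return borel u)) - proj_density V \<mu> u)
          \<le> density_error V (1 / real (Suc k)) \<mu>" for k
    unfolding real_norm_def by (rule density_error_bound) simp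
  then show "\<forall>\<^sub>F k in sequentially. norm ((2 * pi) powr (CARD('n) / 2) * ((1 / real (Suc k)) powr (- real m / 2) * overlap V (1 / real (Suc k)) \<mu> (return borel u)) - proj_density V \<mu> u)
          \<le> density_error V (1 / real (Suc k)) \<mu>" by simp
qed

lemma proj_density_nonneg: "0 \<le> proj_density V \<mu> u"
  using proj_density_tendsto[of u] by (rule LIMSEQ_le_const) (auto simp: nn_overlap(2)[OF bf borel_finite_return sV])

lemma proj_density_orth_proj: "proj_density V \<mu> (orth_proj V u) = proj_density V \<mu> u"
  unfolding proj_density_def by (simp add: orth_proj_inner[OF sV, symmetric] sV)

text \<open>At distance \<open>d\<close> from the closed set that carries the projected measure the
  mollified density is at most a power of \<open>\<tau>\<close> times
  \<open>exp (- d^2 / (2 * \<tau>))\<close>, and this tends to 0.\<close>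

lemma proj_density_eq_0:
  assumes C: "closed C" "AE x in \<mu>. orth_proj V x \<in> C" and u: "orth_proj V u \<notin> C"
  shows "proj_density V \<mu> u = 0"
proof (rule LIMSEQ_unique[OF proj_density_tendsto])
  let ?P = "orth_proj V"
  let ?c = "(2 * pi) powr (CARD('n) / 2)"
  have "open (- C)" using C(1) by (simp add: open_Compl)
  then obtain d where d: "0 < d" "ball (?P u) d \<subseteq> - C" using u unfolding open_contains_ball by blast
  have G: "overlap V \<tau> \<mu> (return borel u) \<le> exp (- (d\<^sup>2 / 2) / \<tau>) * measure \<mu> UNIV" if \<tau>: "0 < \<tau>" for \<tau>
  proof -
    have "ennreal (overlap V \<tau> \<mu> (return borel u)) \<le> (\<integral>\<^sup>+x. ennreal (exp (- (d\<^sup>2 / 2) / \<tau>)) \<partial>\<mu>)"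
      unfolding overlap_return[OF bf sV \<tau>]
    proof (rule nn_integral_mono_AE, rule AE_mp[OF C(2)], rule AE_I2, rule impI)
      fix x assume "?P x \<in> C"
      then have "?P x \<notin> ball (?P u) d" using d by auto
      then have "d \<le> norm (?P (x - u))" by (simp add: linear_diff[OF linear_orth_proj[OF sV]] dist_norm norm_minus_commute)
      then have "d\<^sup>2 \<le> (norm (?P (x - u)))\<^sup>2" using d by (intro power_mono) auto
      then show "ennreal (exp (- (norm (?P (x - u)))\<^sup>2 / (2 * \<tau>))) \<le> ennreal (exp (- (d\<^sup>2 / 2) / \<tau>))"
        using \<tau> by (intro ennreal_leI) (simp add: field_simps)
    qed
    also have "\<dots> = ennreal (exp (- (d\<^sup>2 / 2) / \<tau>) * measure \<mu> UNIV)" by (simp add: emeasure_eq_measure ennreal_mult)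
    finally show ?thesis by (subst (asm) ennreal_le_iff) auto
  qed
  have lim: "(\<lambda>k. ?c * measure \<mu> UNIV * ((1 / real (Suc k)) powr (- (real m / 2)) * exp (- (d\<^sup>2 / 2) / (1 / real (Suc k))))) \<longlonglongrightarrow> 0"
    using d by (intro tendsto_mult_right_zero powr_exp_tendsto_0) auto
  have "norm (?c * ((1 / real (Suc k)) powr (- real m / 2) * overlap V (1 / real (Suc k)) \<mu> (return borel u))) \<le>
    ?c * measure \<mu> UNIV * ((1 / real (Suc k)) powr (- (real m / 2)) * exp (- (d\<^sup>2 / 2) / (1 / real (Suc k))))" for k
  proof -
    define \<tau> where "\<tau> = 1 / real (Suc k)"
    have \<tau>: "0 < \<tau>" by (simp add: \<tau>_def)
    have "norm (?c * (\<tau> powr (- real m / 2) * overlap V \<tau> \<mu> (return borel u))) = ?c * \<tau> powr (- real m / 2) * overlap V \<tau> \<mu> (return borel u)"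
      using nn_overlap(2)[OF bf borel_finite_return sV \<tau>] by (simp add: abs_mult)
    also have "\<dots> \<le> ?c * \<tau> powr (- real m / 2) * (exp (- (d\<^sup>2 / 2) / \<tau>) * measure \<mu> UNIV)"
      using G[OF \<tau>] by (intro mult_left_mono) auto
    finally show ?thesis unfolding \<tau>_def[symmetric] by (simp add: mult_ac)
  qed
  then show "(\<lambda>k. ?c * ((1 / real (Suc k)) powr (- real m / 2) * overlap V (1 / real (Suc k)) \<mu> (return borel u))) \<longlonglongrightarrow> 0"
    by (intro Lim_null_comparison[OF _ lim] always_eventually allI)
qed

end

text \<open>If both densities were positive at a point of \<open>V\<close>, they would be so on a
  relatively open subset of \<open>C \<inter> C'\<close>. So the density of \<open>\<nu>\<close>
  vanishes where that of \<open>\<mu>\<close> is positive; hence almost every point projects into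
  \<open>F\<close> under \<open>\<nu>\<close>, where the density of \<open>\<mu>\<close> is zero and
  the normalised overlap is at most a multiple of the uniform error.\<close>

lemma overlap_vanish_interior:
  fixes V :: "(real^'n) set" and \<mu> \<nu> :: "(real^'n) measure"
  assumes \<mu>: "borel_finite \<mu>" and \<nu>: "borel_finite \<nu>" and V: "V \<in> grassmannian m" and a: "real m < a"
    and Wf: "sobolev a \<mu> V < \<infinity>" "sobolev a \<nu> V < \<infinity>"
    and C: "closed C" "bounded C" "AE x in \<mu>. orth_proj V x \<in> C"
    and C': "closed C'" "AE x in \<nu>. orth_proj V x \<in> C'"
    and empty: "\<And>U. openin (top_of_set V) U \<Longrightarrow> U \<subseteq> C \<inter> C' \<Longrightarrow> U = {}"
  shows "(\<lambda>k. (1 / real (Suc k)) powr (- real m / 2) * overlap V (1 / real (Suc k)) \<mu> \<nu>) \<longlonglongrightarrow> 0"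
proof -
  interpret M: plane_density \<mu> V m
    using \<mu> V integrable_fhat_plane[OF \<mu> V a Wf(1)] by (simp add: plane_density_def plane_density_axioms_def)
  interpret N: plane_density \<nu> V m
    using \<nu> V integrable_fhat_plane[OF \<nu> V a Wf(2)] by (simp add: plane_density_def plane_density_axioms_def)
  note sV = M.sV
  let ?P = "orth_proj V"
  let ?c = "(2 * pi) powr (CARD('n) / 2)"
  let ?\<tau> = "\<lambda>k::nat. 1 / real (Suc k)"
  have PV: "?P u \<in> V" for u using orth_proj_works[OF sV] by auto
  have disj: "proj_density V \<nu> u = 0" if "u \<in> V" "0 < proj_density V \<mu> u" for u
  proof (rule ccontr)
    assume "proj_density V \<nu> u \<noteq> 0"
    then have pos: "0 < proj_density V \<nu> u" using N.proj_density_nonneg[of u] by simp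
    let ?U = "V \<inter> ({x. 0 < proj_density V \<mu> x} \<inter> {x. 0 < proj_density V \<nu> x})"
    have "open ({x. 0 < proj_density V \<mu> x} \<inter> {x. 0 < proj_density V \<nu> x})"
      by (intro open_Int open_Collect_less continuous_on_const M.continuous_proj_density N.continuous_proj_density)
    then have "openin (top_of_set V) ?U" by (rule openin_open_Int)
    moreover have "?U \<subseteq> C \<inter> C'"
    proof
      fix x assume x: "x \<in> ?U"
      then have "?P x = x" by (intro orth_proj_id[OF sV]) auto
      then show "x \<in> C \<inter> C'" using x M.proj_density_eq_0[OF C(1,3), of x] N.proj_density_eq_0[OF C', of x] by auto
    qed
    ultimately have "?U = {}" by (rule empty)
    then show False using that pos by blast
  qed
  define F where "F = {u. proj_density V \<mu> u \<le> 0}"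
  have F: "closed F" unfolding F_def by (intro closed_Collect_le continuous_on_const M.continuous_proj_density)
  obtain R0 where R0: "\<And>x. x \<in> C \<Longrightarrow> norm x \<le> R0" using C(2) by (auto simp: bounded_iff)
  define R where "R = max R0 0 + 1"
  have R: "0 < R" "C \<subseteq> ball 0 R" using R0 by (force simp: R_def)+
  \<comment> \<open>The uniform error for \<open>\<nu>\<close> will be integrated over the part of
    \<open>V\<close> outside \<open>F\<close>; boundedness of \<open>C\<close> makes this part of
    finite measure.\<close>
  have fin: "plane_measure V (- F) < \<infinity>"
  proof -
    have "plane_measure V (- F) \<le> plane_measure V (ball 0 R)" unfolding plane_measure_def
    proof (rule nn_integral_mono, rule mult_left_mono)
      fix \<xi>
      have "?P \<xi> \<in> ball 0 R" if "?P \<xi> \<notin> F"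
      proof -
        have "?P \<xi> \<in> C" using that M.proj_density_eq_0[OF C(1,3), of "?P \<xi>"] sV by (auto simp: F_def)
        then show ?thesis using R by blast
      qed
      then show "(indicator (- F) (?P \<xi>) :: ennreal) \<le> indicator (ball 0 R) (?P \<xi>)" by (auto simp: indicator_def)
    qed simp
    also have "\<dots> \<le> ennreal (exp 2 * ?c * R powr real m)" by (rule plane_measure_ball[OF V R(1)])
    also have "\<dots> < \<infinity>" by simp
    finally show ?thesis .
  qed
  then obtain l where l: "plane_measure V (- F) = ennreal l" "0 \<le> l" by (cases "plane_measure V (- F)") auto
  \<comment> \<open>Outside \<open>F\<close> the mollified density of \<open>\<nu>\<close> is at
    most its error up to a constant, so both terms of \<open>mollified_mass\<close> tend to 0 with
    \<open>\<tau>\<close>.\<close>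
  have "emeasure \<nu> {y. \<forall>z\<in>F. d \<le> dist (?P y) z} \<le> 0" if d: "0 < d" for d
  proof -
    let ?Y = "{y. \<forall>z\<in>F. d \<le> dist (?P y) z}"
    have "?c * measure \<nu> ?Y \<le> density_error V (?\<tau> k) \<nu> / ?c * l + ?c * 2 powr (real m / 2) * measure \<nu> UNIV * exp (- (d\<^sup>2 / 4) / ?\<tau> k)" for k
    proof -
      define \<tau> where "\<tau> = ?\<tau> k"
      have \<tau>: "0 < \<tau>" by (simp add: \<tau>_def)
      have er0: "0 \<le> density_error V \<tau> \<nu>" using N.density_error_bound[OF \<tau>, of 0] by linarith
      have "ennreal ?c * emeasure \<nu> ?Y \<le> (\<integral>\<^sup>+\<xi>. indicator (- F) (?P \<xi>) * (ennreal (tgauss V \<xi>) * mollified V m \<tau> \<nu> (?P \<xi>)) \<partial>lborel) +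
          ennreal (?c * (2 powr (real m / 2) * exp (- d\<^sup>2 / (4 * \<tau>))) * measure \<nu> UNIV)"
        by (rule mollified_mass[OF \<nu> V \<tau> d F])
      also have "(\<integral>\<^sup>+\<xi>. indicator (- F) (?P \<xi>) * (ennreal (tgauss V \<xi>) * mollified V m \<tau> \<nu> (?P \<xi>)) \<partial>lborel) \<le>
        (\<integral>\<^sup>+\<xi>. ennreal (density_error V \<tau> \<nu> / ?c) * (ennreal (tgauss V \<xi>) * indicator (- F) (?P \<xi>)) \<partial>lborel)"
      proof (rule nn_integral_mono)
        fix \<xi>
        show "indicator (- F) (?P \<xi>) * (ennreal (tgauss V \<xi>) * mollified V m \<tau> \<nu> (?P \<xi>)) \<le> ennreal (density_error V \<tau> \<nu> / ?c) * (ennreal (tgauss V \<xi>) * indicator (- F) (?P \<xi>))"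
        proof (cases "?P \<xi> \<in> F")
          case False
          then have "proj_density V \<nu> (?P \<xi>) = 0" by (intro disj PV) (simp add: F_def)
          then have "?c * (\<tau> powr (- real m / 2) * overlap V \<tau> \<nu> (return borel (?P \<xi>))) \<le> density_error V \<tau> \<nu>"
            using N.density_error_bound[OF \<tau>, of "?P \<xi>"] by linarith
          then have "\<tau> powr (- real m / 2) * overlap V \<tau> \<nu> (return borel (?P \<xi>)) \<le> density_error V \<tau> \<nu> / ?c"
            by (simp add: field_simps)
          then have "mollified V m \<tau> \<nu> (?P \<xi>) \<le> ennreal (density_error V \<tau> \<nu> / ?c)"
            using mollified_eq_overlap_return[OF \<nu> sV \<tau>, of m "?P \<xi>"] sV by (simp add: ennreal_leI)
          then have "ennreal (tgauss V \<xi>) * mollified V m \<tau> \<nu> (?P \<xi>) \<le> ennreal (tgauss V \<xi>) * ennreal (density_error V \<tau> \<nu> / ?c)"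
            by (intro mult_left_mono) auto
          then show ?thesis using False by (simp add: mult.commute)
        qed simp
      qed
      also have "\<dots> = ennreal (density_error V \<tau> \<nu> / ?c) * plane_measure V (- F)"
      proof -
        have [measurable]: "F \<in> sets borel" using F by simp
        show ?thesis unfolding plane_measure_def by (rule nn_integral_cmult) measurable
      qed
      also have "\<dots> = ennreal (density_error V \<tau> \<nu> / ?c * l)" unfolding l(1) using er0 l(2) by (intro ennreal_mult[symmetric]) auto
      finally have "ennreal (?c * measure \<nu> ?Y) \<le> ennreal (density_error V \<tau> \<nu> / ?c * l + ?c * (2 powr (real m / 2) * exp (- d\<^sup>2 / (4 * \<tau>))) * measure \<nu> UNIV)"
        using er0 l by (simp add: N.emeasure_eq_measure ennreal_mult add_right_mono)
      then have "?c * measure \<nu> ?Y \<le> density_error V \<tau> \<nu> / ?c * l + ?c * (2 powr (real m / 2) * exp (- d\<^sup>2 / (4 * \<tau>))) * measure \<nu> UNIV"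
        using er0 l by (subst (asm) ennreal_le_iff) auto
      moreover have "- d\<^sup>2 / (4 * \<tau>) = - (d\<^sup>2 / 4) / \<tau>" by simp
      ultimately show ?thesis unfolding \<tau>_def[symmetric] by (simp only: mult_ac)
    qed
    moreover have "(\<lambda>k. density_error V (?\<tau> k) \<nu> / ?c * l + ?c * 2 powr (real m / 2) * measure \<nu> UNIV * exp (- (d\<^sup>2 / 4) / ?\<tau> k)) \<longlonglongrightarrow> 0 / ?c * l + ?c * 2 powr (real m / 2) * measure \<nu> UNIV * 0"
    proof (intro tendsto_add tendsto_mult tendsto_divide tendsto_const N.density_error_tendsto)
      have "(\<lambda>k. (?\<tau> k) powr (- 0) * exp (- (d\<^sup>2 / 4) / ?\<tau> k)) \<longlonglongrightarrow> 0"
        using d by (intro powr_exp_tendsto_0) auto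
      then show "(\<lambda>k. exp (- (d\<^sup>2 / 4) / ?\<tau> k)) \<longlonglongrightarrow> 0" by simp
    qed simp
    ultimately have "?c * measure \<nu> ?Y \<le> 0 / ?c * l + ?c * 2 powr (real m / 2) * measure \<nu> UNIV * 0"
      by (intro LIMSEQ_le_const) auto
    then have "measure \<nu> ?Y \<le> 0" by (simp add: mult_le_0_iff)
    then show ?thesis by (simp add: N.emeasure_eq_measure ennreal_neg)
  qed
  then have "emeasure \<nu> {y. ?P y \<notin> F} \<le> 0"
    by (rule emeasure_complement_SUP[OF \<nu> sV F])
  then have "{y. ?P y \<notin> F} \<in> null_sets \<nu>"
  proof (intro null_setsI)
    have "{y. ?P y \<notin> F} = ?P -` (- F)" by auto
    then show "{y. ?P y \<notin> F} \<in> sets \<nu>"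
      using measurable_sets[OF N.P_meas, of "- F"] F by (simp add: N.sets_eq)
  qed simp
  then have AF: "AE y in \<nu>. ?P y \<in> F" by (rule AE_I'[of "{y. ?P y \<notin> F}"]) auto
  show ?thesis
  proof (rule Lim_null_comparison)
    show "(\<lambda>k. density_error V (?\<tau> k) \<mu> / ?c * measure \<nu> UNIV) \<longlonglongrightarrow> 0"
      using tendsto_mult[OF tendsto_divide[OF M.density_error_tendsto tendsto_const[of ?c]] tendsto_const[of "measure \<nu> UNIV"]] by simp
    have "norm ((?\<tau> k) powr (- real m / 2) * overlap V (?\<tau> k) \<mu> \<nu>) \<le> density_error V (?\<tau> k) \<mu> / ?c * measure \<nu> UNIV" for k
    proof -
      define \<tau> where "\<tau> = ?\<tau> k"
      have \<tau>: "0 < \<tau>" by (simp add: \<tau>_def)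
      let ?t = "\<tau> powr (- real m / 2)"
      have er0: "0 \<le> density_error V \<tau> \<mu>" using M.density_error_bound[OF \<tau>, of 0] by linarith
      have G0: "0 \<le> overlap V \<tau> \<mu> \<nu>" by (rule nn_overlap(2)[OF \<mu> \<nu> sV \<tau>])
      have "ennreal (overlap V \<tau> \<mu> \<nu>) \<le> (\<integral>\<^sup>+y. ennreal (density_error V \<tau> \<mu> / ?c / ?t) \<partial>\<nu>)"
        unfolding overlap_Fubini[OF \<mu> \<nu> sV \<tau>]
      proof (rule nn_integral_mono_AE, rule AE_mp[OF AF], rule AE_I2, rule impI, rule ennreal_leI)
        fix y assume "?P y \<in> F"
        then have "proj_density V \<mu> y \<le> 0" using M.proj_density_orth_proj[of y] by (simp add: F_def)
        then have "?c * (?t * overlap V \<tau> \<mu> (return borel y)) \<le> density_error V \<tau> \<mu>" using M.density_error_bound[OF \<tau>, of y] by linarith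
        moreover have "0 < ?t" using \<tau> by simp
        ultimately show "overlap V \<tau> \<mu> (return borel y) \<le> density_error V \<tau> \<mu> / ?c / ?t" by (simp add: field_simps)
      qed
      also have "\<dots> = ennreal (density_error V \<tau> \<mu> / ?c / ?t * measure \<nu> UNIV)"
        using er0 by (simp add: N.emeasure_eq_measure flip: ennreal_mult)
      finally have "overlap V \<tau> \<mu> \<nu> \<le> density_error V \<tau> \<mu> / ?c / ?t * measure \<nu> UNIV"
        using er0 by (subst (asm) ennreal_le_iff) auto
      then have "?t * overlap V \<tau> \<mu> \<nu> \<le> ?t * (density_error V \<tau> \<mu> / ?c / ?t * measure \<nu> UNIV)" by (intro mult_left_mono) auto
      also have "\<dots> = density_error V \<tau> \<mu> / ?c * measure \<nu> UNIV" using \<tau> by simp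
      finally show ?thesis unfolding \<tau>_def[symmetric] using G0 by (simp add: abs_mult)
    qed
    then show "\<forall>\<^sub>F k in sequentially. norm ((?\<tau> k) powr (- real m / 2) * overlap V (?\<tau> k) \<mu> \<nu>) \<le> density_error V (?\<tau> k) \<mu> / ?c * measure \<nu> UNIV" by simp
  qed
qed

section \<open>Hausdorff dimension of the intersections\<close>

lemma hausdorff_pre_mono: "A \<subseteq> B \<Longrightarrow> hausdorff_pre s \<delta> A \<le> hausdorff_pre s \<delta> B"
  unfolding hausdorff_pre_def by (rule INF_superset_mono) auto

lemma hausdorff_pre_antimono: "\<delta> \<le> \<delta>' \<Longrightarrow> hausdorff_pre s \<delta>' A \<le> hausdorff_pre s \<delta> A"
  unfolding hausdorff_pre_def by (rule INF_superset_mono) (auto intro: order_trans)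

lemma hausdorff_measure_mono: "A \<subseteq> B \<Longrightarrow> hausdorff_measure s A \<le> hausdorff_measure s B"
  unfolding hausdorff_measure_def by (rule SUP_mono') (rule hausdorff_pre_mono)

text \<open>At scales up to 1 a larger exponent makes every term of a cover smaller, and only small
  scales matter.\<close>

lemma hausdorff_measure_zero_mono:
  assumes A: "hausdorff_measure s A = 0" and st: "s \<le> t"
  shows "hausdorff_measure t A = 0"
proof -
  have 1: "hausdorff_pre t \<delta> A \<le> hausdorff_pre s \<delta> A" if "\<delta> \<le> 1" for \<delta>
    unfolding hausdorff_pre_def
  proof (rule INF_mono)
    fix C assume C: "C \<in> {C :: nat \<Rightarrow> 'a set. A \<subseteq> (\<Union>i. C i) \<and> (\<forall>i. bounded (C i) \<and> diameter (C i) \<le> \<delta>)}"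
    have "diameter (C i) powr t \<le> diameter (C i) powr s" for i
      using C that st by (intro powr_mono') (auto simp: diameter_ge_0 intro: order_trans)
    then have "(\<Sum>i. ennreal (diameter (C i) powr t)) \<le> (\<Sum>i. ennreal (diameter (C i) powr s))"
      by (intro suminf_le) (auto intro: ennreal_leI)
    then show "\<exists>D\<in>{C :: nat \<Rightarrow> 'a set. A \<subseteq> (\<Union>i. C i) \<and> (\<forall>i. bounded (C i) \<and> diameter (C i) \<le> \<delta>)}.
      (\<Sum>i. ennreal (diameter (D i) powr t)) \<le> (\<Sum>i. ennreal (diameter (C i) powr s))"
      using C by blast
  qed
  have "hausdorff_pre t \<delta> A \<le> 0" if "0 < \<delta>" for \<delta>
  proof -
    have "hausdorff_pre t \<delta> A \<le> hausdorff_pre t (min \<delta> 1) A" by (rule hausdorff_pre_antimono) simp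
    also have "\<dots> \<le> hausdorff_pre s (min \<delta> 1) A" by (rule 1) simp
    also have "\<dots> \<le> hausdorff_measure s A" unfolding hausdorff_measure_def by (rule SUP_upper) (use that in auto)
    finally show ?thesis using A by simp
  qed
  then have "hausdorff_measure t A \<le> 0" unfolding hausdorff_measure_def by (intro SUP_least) auto
  then show ?thesis by simp
qed

lemma hausdorff_measure_pos_of_lt_dim:
  assumes "0 < s" "s < hausdorff_dim A"
  shows "0 < hausdorff_measure s A"
proof (rule ccontr)
  assume "\<not> 0 < hausdorff_measure s A"
  then have "s \<in> {s. s > 0 \<and> hausdorff_measure s A = 0}" using assms by simp
  moreover have "bdd_below {s. s > 0 \<and> hausdorff_measure s A = 0}" by (rule bdd_belowI[of _ 0]) auto
  ultimately have "hausdorff_dim A \<le> s" unfolding hausdorff_dim_def by (rule cInf_lower)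
  then show False using assms by simp
qed

text \<open>For radii up to 1 the powers compare; for larger ones the total mass is a sufficient
  bound.\<close>

lemma growth_mono:
  assumes \<mu>: "finite_measure \<mu>" and g: "growth s \<mu>" and t: "0 \<le> t" "t \<le> s"
  shows "growth t \<mu>"
proof -
  interpret finite_measure \<mu> by fact
  obtain C where C: "0 < C" "\<And>x r. 0 < r \<Longrightarrow> measure \<mu> (cball x r) \<le> C * r powr s"
    using g by (auto simp: growth_def)
  have "measure \<mu> (cball x r) \<le> (C + measure \<mu> (space \<mu>)) * r powr t" if r: "0 < r" for x r
  proof (cases "r \<le> 1")
    case True
    then have "r powr s \<le> r powr t" using r t by (intro powr_mono') auto
    then have "C * r powr s \<le> C * r powr t" using C(1) by (intro mult_left_mono) auto
    also have "\<dots> \<le> (C + measure \<mu> (space \<mu>)) * r powr t" by (intro mult_right_mono) auto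
    finally show ?thesis using C(2)[OF r, of x] by linarith
  next
    case False
    then have "1 \<le> r powr t" using t by (intro ge_one_powr_ge_zero) auto
    have "measure \<mu> (cball x r) \<le> measure \<mu> (space \<mu>)" by (rule bounded_measure)
    also have "\<dots> \<le> (C + measure \<mu> (space \<mu>)) * 1" using C(1) by simp
    also have "\<dots> \<le> (C + measure \<mu> (space \<mu>)) * r powr t"
      using \<open>1 \<le> r powr t\<close> C(1) by (intro mult_left_mono) auto
    finally show ?thesis .
  qed
  moreover have "0 < C + measure \<mu> (space \<mu>)" using C(1) by (simp add: add_pos_nonneg)
  ultimately show ?thesis unfolding growth_def by blast
qed

lemma damp_AE:
  assumes \<mu>: "borel_finite \<mu>" and AE: "AE x in \<mu>. Q x"
  shows "AE x in damp \<mu>. Q x"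
proof -
  interpret A: borel_finite \<mu> by fact
  have "(\<lambda>x. ennreal (exp (- (norm x)\<^sup>2 / 2))) \<in> borel_measurable \<mu>" by (auto simp: A.sets_eq cong: measurable_cong_sets)
  from AE_density[OF this] show ?thesis unfolding damp_def using AE by auto
qed

lemma damp_mass_pos:
  assumes "borel_finite \<mu>" "prob_space \<mu>"
  shows "0 < measure (damp \<mu>) UNIV"
proof -
  interpret A: borel_finite \<mu> by fact
  interpret Q: prob_space \<mu> by fact
  interpret D: borel_finite "damp \<mu>" by (rule damp_borel_finite) fact
  have m: "(\<lambda>x. ennreal (exp (- (norm x)\<^sup>2 / 2))) \<in> borel_measurable \<mu>" by (auto simp: A.sets_eq cong: measurable_cong_sets)
  have "emeasure (damp \<mu>) UNIV = (\<integral>\<^sup>+x. ennreal (exp (- (norm x)\<^sup>2 / 2)) * indicator UNIV x \<partial>\<mu>)"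
    unfolding damp_def by (rule emeasure_density[OF m]) (simp add: A.sets_eq)
  moreover have "(\<integral>\<^sup>+x. ennreal (exp (- (norm x)\<^sup>2 / 2)) \<partial>\<mu>) \<noteq> 0"
    using nn_integral_0_iff_AE[OF m] Q.AE_const[of False] by (auto simp: ennreal_eq_0_iff not_le)
  ultimately show ?thesis by (auto simp: D.emeasure_eq_measure zero_less_measure_iff)
qed

lemma sobolev_mono:
  fixes \<mu> :: "(real^'n) measure"
  assumes "a \<le> b"
  shows "sobolev a \<mu> V \<le> sobolev b \<mu> V"
  unfolding sobolev_def
proof (intro nn_integral_mono ennreal_leI mult_right_mono)
  fix \<xi> :: "real^'n"
  show "(1 + (norm (orth_proj V \<xi>))\<^sup>2 / 2) powr (a / 2) \<le> (1 + (norm (orth_proj V \<xi>))\<^sup>2 / 2) powr (b / 2)"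
    using assms by (intro powr_mono) auto
qed auto

context haar_grassmannian
begin

text \<open>The Gaussian integral of the squared transform is at most of order
  \<open>\<tau> powr ((s - n) / 2)\<close>, yet it increases as \<open>\<tau>\<close> decreases. For
  \<open>s > n\<close> it would have to be 0, which forces the double integral of a positive
  function, and with it the mass, to vanish.\<close>

lemma growth_le_card:
  fixes \<mu> :: "(real^'n) measure"
  assumes \<mu>: "borel_finite \<mu>" and pos: "0 < measure \<mu> UNIV" and g: "growth s \<mu>" and s: "0 < s"
  shows "s \<le> real CARD('n)"
proof (rule ccontr)
  assume "\<not> s \<le> real CARD('n)"
  then have s': "real CARD('n) < s" by simp
  interpret A: borel_finite \<mu> by fact
  interpret F: finite_measure "\<mu> \<Otimes>\<^sub>M \<mu>" using pair_borel_finite[OF \<mu> \<mu>] by simp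
  note [measurable_cong] = A.sets_eq
  obtain V0 :: "(real^'n) set" where V0: "V0 \<in> grassmannian m" using exists_plane by blast
  obtain C where C: "0 < C" "\<And>\<tau>. 0 < \<tau> \<Longrightarrow>
    (\<integral>\<^sup>+p. ennreal (exp (- (norm (fst p - snd p))\<^sup>2 / (2 * \<tau>))) \<partial>(\<mu> \<Otimes>\<^sub>M \<mu>)) \<le> ennreal (C * \<tau> powr (s / 2))"
    by (rule gaussian_pair_integral[OF \<mu> g s]) (rule that)
  let ?c = "(2 * pi) powr (CARD('n) / 2)"
  let ?I = "\<lambda>\<tau>. \<integral>\<^sup>+\<eta>. ennreal (exp (- (\<tau> * (norm \<eta>)\<^sup>2) / 2) * (norm (fhat \<mu> \<eta>))\<^sup>2) \<partial>lborel"
  have I: "?I \<tau> = ennreal (?c * \<tau> powr (- real (CARD('n)) / 2)) *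
      (\<integral>\<^sup>+p. ennreal (exp (- (norm (fst p - snd p))\<^sup>2 / (2 * \<tau>))) \<partial>(\<mu> \<Otimes>\<^sub>M \<mu>))" if "0 < \<tau>" for \<tau>
    by (rule nn_fhat_space[OF \<mu> V0 _ that]) (use mn in simp)
  have le: "?I 1 \<le> ennreal (?c * C * \<tau> powr ((s - real CARD('n)) / 2))" if \<tau>: "0 < \<tau>" "\<tau> \<le> 1" for \<tau>
  proof -
    have "?I 1 \<le> ?I \<tau>"
    proof (intro nn_integral_mono ennreal_leI mult_right_mono)
      fix \<eta> :: "real^'n"
      have "\<tau> * (norm \<eta>)\<^sup>2 \<le> 1 * (norm \<eta>)\<^sup>2" using \<tau> by (intro mult_right_mono) auto
      then show "exp (- (1 * (norm \<eta>)\<^sup>2) / 2) \<le> exp (- (\<tau> * (norm \<eta>)\<^sup>2) / 2)" by simp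
    qed auto
    also have "\<dots> \<le> ennreal (?c * \<tau> powr (- real (CARD('n)) / 2)) * ennreal (C * \<tau> powr (s / 2))"
      unfolding I[OF \<tau>(1)] by (intro mult_left_mono C \<tau>) auto
    also have "\<dots> = ennreal (?c * C * (\<tau> powr (- real (CARD('n)) / 2) * \<tau> powr (s / 2)))"
      using C by (subst ennreal_mult[symmetric]) (auto simp: mult_ac)
    also have "\<tau> powr (- real (CARD('n)) / 2) * \<tau> powr (s / 2) = \<tau> powr ((s - real CARD('n)) / 2)"
      by (simp add: diff_divide_distrib flip: powr_add)
    finally show ?thesis .
  qed
  have "(\<lambda>k. ?c * C * (inverse (real (Suc k))) powr ((s - real CARD('n)) / 2)) \<longlonglongrightarrow> ?c * C * 0"
  proof (intro tendsto_mult tendsto_const)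
    have "(\<lambda>k. (inverse (real (Suc k))) powr ((s - real CARD('n)) / 2)) \<longlonglongrightarrow> 0 powr ((s - real CARD('n)) / 2)"
      using s' by (intro tendsto_powr2 LIMSEQ_inverse_real_of_nat tendsto_const) auto
    then show "(\<lambda>k. (inverse (real (Suc k))) powr ((s - real CARD('n)) / 2)) \<longlonglongrightarrow> 0" by simp
  qed
  then have "(\<lambda>k. ennreal (?c * C * (inverse (real (Suc k))) powr ((s - real CARD('n)) / 2))) \<longlonglongrightarrow> ennreal (?c * C * 0)"
    by (rule tendsto_ennrealI)
  moreover have "?I 1 \<le> ennreal (?c * C * (inverse (real (Suc k))) powr ((s - real CARD('n)) / 2))" for k
    by (rule le) (auto simp: inverse_eq_divide divide_le_eq)
  ultimately have "?I 1 \<le> ennreal (?c * C * 0)"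
    by (intro LIMSEQ_le_const[of _ "ennreal (?c * C * 0)"] exI[of _ 0] allI impI)
  then have "?I 1 = 0" by simp
  then have "(\<integral>\<^sup>+p. ennreal (exp (- (norm (fst p - snd p))\<^sup>2 / (2 * 1))) \<partial>(\<mu> \<Otimes>\<^sub>M \<mu>)) = 0"
    unfolding I[OF zero_less_one] by simp
  then have "emeasure (\<mu> \<Otimes>\<^sub>M \<mu>) {p \<in> space (\<mu> \<Otimes>\<^sub>M \<mu>). ennreal (exp (- (norm (fst p - snd p))\<^sup>2 / (2 * 1))) \<noteq> 0} = 0"
    by (subst (asm) nn_integral_0_iff) auto
  moreover have "{p \<in> space (\<mu> \<Otimes>\<^sub>M \<mu>). ennreal (exp (- (norm (fst p - snd p))\<^sup>2 / (2 * 1))) \<noteq> 0} = UNIV"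
    using pair_borel_finite(3)[OF \<mu> \<mu>] by (auto simp: ennreal_eq_0_iff not_le)
  ultimately have "emeasure (\<mu> \<Otimes>\<^sub>M \<mu>) UNIV = 0" by simp
  then have "measure (\<mu> \<Otimes>\<^sub>M \<mu>) UNIV = 0"
    by (simp add: measure_def)
  then show False using pos pair_borel_finite(4)[OF \<mu> \<mu>] by simp
qed

text \<open>Through Frostman's theorem positive measure of order \<open>s\<close> would yield a
  nonzero measure of growth \<open>s\<close>, an exponent beyond the dimension of the space.\<close>

lemma hausdorff_measure_above_card:
  assumes s: "real CARD('n) < s"
  shows "hausdorff_measure s (S :: (real^'n) set) = 0"
proof -
  have s0: "0 < s" using s by (rule le_less_trans[rotated]) simp
  have "\<not> 0 < hausdorff_measure s (UNIV :: (real^'n) set)"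
  proof
    assume H: "0 < hausdorff_measure s (UNIV :: (real^'n) set)"
    have U: "(UNIV :: (real^'n) set) \<in> sets borel" by simp
    obtain K and \<mu> :: "(real^'n) measure" where \<mu>: "compact K" "K \<subseteq> UNIV" "prob_space \<mu>" "sets \<mu> = sets borel" "AE x in \<mu>. x \<in> K" "growth s \<mu>"
      by (rule frostman[OF U s0 H]) (rule that)
    interpret Q: prob_space \<mu> by fact
    have bf: "borel_finite \<mu>"
      using Q.finite_measure \<mu>(4) by (simp add: borel_finite_def borel_finite_axioms_def)
    interpret B: borel_finite \<mu> by (rule bf)
    have "0 < measure \<mu> UNIV" using Q.prob_space by simp
    from growth_le_card[OF bf this \<mu>(6) s0] s show False by simp
  qed
  then have "hausdorff_measure s (UNIV :: (real^'n) set) = 0" by simp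
  then show ?thesis using hausdorff_measure_mono[of S UNIV s] by simp
qed

text \<open>The infimum in \<open>hausdorff_dim\<close> is over a nonempty set, so its value can be
  compared with exponents from both sides.\<close>

lemma hausdorff_zero_exponents_nonempty:
  "{s. s > 0 \<and> hausdorff_measure s (S :: (real^'n) set) = 0} \<noteq> {}"
proof -
  have "real CARD('n) + 1 \<in> {s. s > 0 \<and> hausdorff_measure s S = 0}"
    using hausdorff_measure_above_card[of "real CARD('n) + 1" S] by (simp add: add_pos_nonneg)
  then show ?thesis by blast
qed

lemma hausdorff_dim_nonneg: "0 \<le> hausdorff_dim (S :: (real^'n) set)"
  unfolding hausdorff_dim_def by (rule cInf_greatest[OF hausdorff_zero_exponents_nonempty]) auto

lemma hausdorff_dim_le_card: "hausdorff_dim (S :: (real^'n) set) \<le> real CARD('n)"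
proof (rule ccontr)
  assume *: "\<not> ?thesis"
  define s where "s = (real CARD('n) + hausdorff_dim S) / 2"
  have "real CARD('n) < s" "s < hausdorff_dim S" using * by (auto simp: s_def)
  moreover have "0 \<le> real CARD('n)" by simp
  ultimately show False
    using hausdorff_measure_above_card[of s S] hausdorff_measure_pos_of_lt_dim[of s S] by force
qed

lemma hausdorff_measure_zero_of_dim_lt:
  assumes "hausdorff_dim (S :: (real^'n) set) < r"
  shows "hausdorff_measure r S = 0"
proof -
  have "Inf {s. s > 0 \<and> hausdorff_measure s S = 0} < r" using assms by (simp add: hausdorff_dim_def)
  then obtain s where "s \<in> {s. s > 0 \<and> hausdorff_measure s S = 0}" "s < r"
    using cInf_lessD[OF hausdorff_zero_exponents_nonempty] by blast
  then show ?thesis using hausdorff_measure_zero_mono[of s S r] by simp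
qed

section \<open>Frostman measures against vanishing overlap\<close>

lemma frostman_damped:
  fixes A :: "(real^'n) set"
  assumes A: "A \<in> sets borel" and s: "0 < s" "s < hausdorff_dim A"
  obtains K \<mu> where "compact K" "K \<subseteq> A" "K \<noteq> {}" "borel_finite \<mu>" "growth s \<mu>" "growth s (damp \<mu>)"
    "0 < measure (damp \<mu>) UNIV" "AE x in damp \<mu>. x \<in> K"
proof -
  have H: "0 < hausdorff_measure s A" using s by (rule hausdorff_measure_pos_of_lt_dim)
  obtain K \<mu> where \<mu>: "compact K" "K \<subseteq> A" "prob_space \<mu>" "sets \<mu> = sets borel" "AE x in \<mu>. x \<in> K" "growth s \<mu>"
    by (rule frostman[OF A s(1) H]) (rule that)
  interpret Q: prob_space \<mu> by (rule \<mu>(3))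
  have bf: "borel_finite \<mu>"
    using Q.finite_measure \<mu>(4) by (simp add: borel_finite_def borel_finite_axioms_def)
  have "K \<noteq> {}"
  proof
    assume "K = {}"
    then have "AE x in \<mu>. False" using \<mu>(5) by simp
    then show False using Q.AE_False by simp
  qed
  then show thesis
    by (rule that[OF \<mu>(1,2) _ bf \<mu>(6) growth_damp[OF bf \<mu>(6)] damp_mass_pos[OF bf \<mu>(3)] damp_AE[OF bf \<mu>(5)]])
qed

text \<open>\<open>D\<close> is left open because the dominating function differs: a positive plus a
  negative Sobolev norm for (i) and (iii), two positive ones for (ii).\<close>

lemma overlap_not_AE_vanishing:
  fixes \<mu> \<nu> :: "(real^'n) measure"
  assumes \<mu>: "borel_finite \<mu>" and \<nu>: "borel_finite \<nu>"
    and K: "bounded K" "AE x in \<mu>. x \<in> K" and L: "bounded L" "AE x in \<nu>. x \<in> L"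
    and pos: "0 < measure \<mu> UNIV" "0 < measure \<nu> UNIV" and c: "0 < c"
    and D [measurable]: "D \<in> borel_measurable \<gamma>" and Dfin: "(\<integral>\<^sup>+V. D V \<partial>\<gamma>) < \<infinity>"
    and dom: "\<And>V \<tau>. V \<in> grassmannian m \<Longrightarrow> 0 < \<tau> \<Longrightarrow> ennreal (c * \<tau> powr (- real m / 2) * overlap V \<tau> \<mu> \<nu>) \<le> D V"
    and van: "AE V in \<gamma>. (\<lambda>k. (1 / real (Suc k)) powr (- real m / 2) * overlap V (1 / real (Suc k)) \<mu> \<nu>) \<longlonglongrightarrow> 0"
  shows False
proof -
  interpret A: borel_finite \<mu> by fact
  interpret B: borel_finite \<nu> by fact
  interpret F: finite_measure "\<mu> \<Otimes>\<^sub>M \<nu>" using pair_borel_finite[OF \<mu> \<nu>] by simp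
  note [measurable_cong] = A.sets_eq B.sets_eq
  obtain R1 R2 where R: "\<And>x. x \<in> K \<Longrightarrow> norm x \<le> R1" "\<And>x. x \<in> L \<Longrightarrow> norm x \<le> R2"
    using K(1) L(1) by (auto simp: bounded_iff)
  have b: "AE x in \<mu>. norm x \<le> max R1 R2" "AE x in \<nu>. norm x \<le> max R1 R2"
    using K(2) L(2) R by (auto elim!: eventually_mono simp: le_max_iff_disj)
  obtain c0 where c0: "0 < c0" "\<And>\<tau>. 0 < \<tau> \<Longrightarrow> \<tau> \<le> 1 \<Longrightarrow>
    ennreal c0 \<le> (\<integral>\<^sup>+V. ennreal (\<tau> powr (- real m / 2) * overlap V \<tau> \<mu> \<nu>) \<partial>\<gamma>)"
    by (rule overlap_average_lower[OF \<mu> \<nu> b pos]) (rule that)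
  let ?J = "\<lambda>k V. (1 / real (Suc k)) powr (- real m / 2) * overlap V (1 / real (Suc k)) \<mu> \<nu>"
  have Jm [measurable]: "(\<lambda>V. ennreal (?J k V)) \<in> borel_measurable \<gamma>" for k
  proof -
    have "ennreal (?J k V) = ennreal ((1 / real (Suc k)) powr (- real m / 2)) *
        (\<integral>\<^sup>+p. ennreal (exp (- (norm (orth_proj V (fst p - snd p)))\<^sup>2 / (2 * (1 / real (Suc k))))) \<partial>(\<mu> \<Otimes>\<^sub>M \<nu>))"
      if "V \<in> space \<gamma>" for V
    proof -
      have sV: "subspace V" and \<tau>: "0 < 1 / real (Suc k)" using that by (auto intro: grassmannian_subspace)
      show ?thesis unfolding nn_overlap(1)[OF \<mu> \<nu> sV \<tau>, symmetric]
        using nn_overlap(2)[OF \<mu> \<nu> sV \<tau>] by (intro ennreal_mult) auto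
    qed
    moreover have "(\<lambda>V. ennreal ((1 / real (Suc k)) powr (- real m / 2)) *
        (\<integral>\<^sup>+p. ennreal (exp (- (norm (orth_proj V (fst p - snd p)))\<^sup>2 / (2 * (1 / real (Suc k))))) \<partial>(\<mu> \<Otimes>\<^sub>M \<nu>))) \<in> borel_measurable \<gamma>"
      by measurable
    ultimately show ?thesis by (subst measurable_cong)
  qed
  have "(\<lambda>k. \<integral>\<^sup>+V. ennreal c * ennreal (?J k V) \<partial>\<gamma>) \<longlonglongrightarrow> (\<integral>\<^sup>+V. 0 \<partial>\<gamma>)"
  proof (rule nn_integral_dominated_convergence[where w = D])
    show "AE V in \<gamma>. ennreal c * ennreal (?J k V) \<le> D V" for k
    proof (rule AE_I2)
      fix V assume "V \<in> space \<gamma>"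
      then have "ennreal (c * (1 / real (Suc k)) powr (- real m / 2) * overlap V (1 / real (Suc k)) \<mu> \<nu>) \<le> D V"
        by (intro dom) auto
      then show "ennreal c * ennreal (?J k V) \<le> D V"
        using c by (simp only: ennreal_mult'[symmetric] less_imp_le mult.assoc)
    qed
    show "AE V in \<gamma>. (\<lambda>k. ennreal c * ennreal (?J k V)) \<longlonglongrightarrow> 0"
    proof (rule AE_mp[OF van], rule AE_I2, rule impI)
      fix V assume "(\<lambda>k. ?J k V) \<longlonglongrightarrow> 0"
      then have "(\<lambda>k. ennreal (c * ?J k V)) \<longlonglongrightarrow> ennreal (c * 0)"
        by (intro tendsto_ennrealI tendsto_mult tendsto_const)
      then show "(\<lambda>k. ennreal c * ennreal (?J k V)) \<longlonglongrightarrow> 0"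
        using c by (simp only: ennreal_mult'[symmetric] less_imp_le mult_zero_right ennreal_0)
    qed
    show "(\<integral>\<^sup>+V. D V \<partial>\<gamma>) < \<infinity>" by (rule Dfin)
    show "(\<lambda>V. ennreal c * ennreal (?J k V)) \<in> borel_measurable \<gamma>" for k
      by (intro borel_measurable_times_ennreal Jm borel_measurable_const)
    show "D \<in> borel_measurable \<gamma>" by (rule D)
    show "(\<lambda>V. 0) \<in> borel_measurable \<gamma>" by (rule borel_measurable_const)
  qed
  then have lim: "(\<lambda>k. \<integral>\<^sup>+V. ennreal c * ennreal (?J k V) \<partial>\<gamma>) \<longlonglongrightarrow> 0" by simp
  have "ennreal c * ennreal c0 \<le> (\<integral>\<^sup>+V. ennreal c * ennreal (?J k V) \<partial>\<gamma>)" for k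
    by (subst nn_integral_cmult[OF Jm]) (intro mult_left_mono c0, auto)
  then have "ennreal c * ennreal c0 \<le> 0" by (intro LIMSEQ_le_const[OF lim]) auto
  moreover have "0 < c * c0" using c c0(1) by simp
  ultimately show False using c by (simp add: not_le flip: ennreal_mult')
qed

lemma AE_\<gamma>_finite:
  assumes "f \<in> borel_measurable \<gamma>" "(\<integral>\<^sup>+V. f V \<partial>\<gamma>) < \<infinity>"
  shows "AE V in \<gamma>. f V < \<infinity>"
proof -
  have "AE V in \<gamma>. f V \<noteq> \<infinity>"
    by (rule nn_integral_PInf_AE[OF assms(1)]) (use assms(2) in auto)
  then show ?thesis by (rule eventually_mono) (simp add: top.not_eq_extremum)
qed

text \<open>Shared by (i) and (iii), which differ in how they obtain \<open>null\<close>: from a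
  square integrable density or from finite energy.\<close>

lemma projections_meet:
  fixes \<mu> \<nu> :: "(real^'n) measure"
  assumes \<mu>: "borel_finite \<mu>" and \<nu>: "borel_finite \<nu>" and gs: "growth s \<mu>" and gt: "growth t \<nu>"
    and a: "0 < a" "real m + a < s" "real m + a < real CARD('n)" "real m - a < t" "t < real m"
    and K: "compact K" "K \<noteq> {}" "AE x in damp \<mu>. x \<in> K" and L: "bounded L" "AE x in \<nu>. x \<in> L"
    and pos: "0 < measure (damp \<mu>) UNIV" "0 < measure \<nu> UNIV"
    and null: "AE V in \<gamma>. AE y in \<nu>. orth_proj V y \<notin> orth_proj V ` K"
  shows False
proof (rule overlap_not_AE_vanishing[where D = "\<lambda>V. sobolev a (damp \<mu>) V + sobolev (- a) \<nu> V"])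
  have d\<mu>: "borel_finite (damp \<mu>)" by (rule damp_borel_finite[OF \<mu>])
  show "borel_finite (damp \<mu>)" "borel_finite \<nu>" by fact+
  note [measurable] = sobolev_measurable[OF d\<mu>] sobolev_measurable[OF \<nu>] energy_measurable[OF \<nu>]
  show "bounded K" by (rule compact_imp_bounded[OF K(1)])
  show "0 < (2 * pi) powr (CARD('n) / 2)" by simp
  show "(\<lambda>V. sobolev a (damp \<mu>) V + sobolev (- a) \<nu> V) \<in> borel_measurable \<gamma>" by measurable
  have Wf: "(\<integral>\<^sup>+V. sobolev a (damp \<mu>) V \<partial>\<gamma>) < \<infinity>" using a by (intro sobolev_average_finite[OF \<mu> gs]) auto
  have Ef: "(\<integral>\<^sup>+V. energy (real m - a) \<nu> V \<partial>\<gamma>) < \<infinity>" by (rule energy_average_finite[OF \<nu> gt a(4,5)])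
  have "0 < Gamma (a / 2)" using a by (intro Gamma_real_pos) auto
  then have \<Gamma>: "ennreal (Gamma (a / 2)) \<noteq> 0" by (simp add: ennreal_eq_0_iff)
  have "ennreal (Gamma (a / 2)) * (\<integral>\<^sup>+V. sobolev (- a) \<nu> V \<partial>\<gamma>) = (\<integral>\<^sup>+V. ennreal (Gamma (a / 2)) * sobolev (- a) \<nu> V \<partial>\<gamma>)"
    by (rule nn_integral_cmult[symmetric]) measurable
  also have "\<dots> = (\<integral>\<^sup>+V. ennreal ((2 * pi) powr (CARD('n) / 2)) * energy (real m - a) \<nu> V \<partial>\<gamma>)"
    by (intro nn_integral_cong sobolev_neg_eq_energy[OF \<nu> _ a(1)]) simp
  also have "\<dots> = ennreal ((2 * pi) powr (CARD('n) / 2)) * (\<integral>\<^sup>+V. energy (real m - a) \<nu> V \<partial>\<gamma>)"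
    by (rule nn_integral_cmult) measurable
  also have "\<dots> < \<infinity>" using Ef by (simp add: ennreal_mult_less_top)
  finally have Wn: "(\<integral>\<^sup>+V. sobolev (- a) \<nu> V \<partial>\<gamma>) < \<infinity>" using \<Gamma> by (auto simp: ennreal_mult_less_top)
  show "(\<integral>\<^sup>+V. sobolev a (damp \<mu>) V + sobolev (- a) \<nu> V \<partial>\<gamma>) < \<infinity>"
    by (subst nn_integral_add, measurable) (use Wf Wn in simp)
  show "ennreal ((2 * pi) powr (CARD('n) / 2) * \<tau> powr (- real m / 2) * overlap V \<tau> (damp \<mu>) \<nu>) \<le> sobolev a (damp \<mu>) V + sobolev (- a) \<nu> V"
    if "V \<in> grassmannian m" "0 < \<tau>" for V \<tau>
    using overlap_le_sobolev[OF d\<mu> \<nu> that zero_less_one, of a] by simp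
  have AW: "AE V in \<gamma>. sobolev a (damp \<mu>) V < \<infinity>" by (rule AE_\<gamma>_finite[OF _ Wf]) measurable
  have AE: "AE V in \<gamma>. energy (real m - a) \<nu> V < \<infinity>" by (rule AE_\<gamma>_finite[OF _ Ef]) measurable
  show "AE V in \<gamma>. (\<lambda>k. (1 / real (Suc k)) powr (- real m / 2) * overlap V (1 / real (Suc k)) (damp \<mu>) \<nu>) \<longlonglongrightarrow> 0"
    using AE_space AW AE null
  proof eventually_elim
    fix V :: "(real^'n) set"
    assume V: "V \<in> space \<gamma>" and W: "sobolev a (damp \<mu>) V < \<infinity>" and E: "energy (real m - a) \<nu> V < \<infinity>"
      and n: "AE y in \<nu>. orth_proj V y \<notin> orth_proj V ` K"
    have V': "V \<in> grassmannian m" using V by simp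
    have "compact (orth_proj V ` K)"
      using K(1) by (intro compact_continuous_image continuous_orth_proj grassmannian_subspace[OF V'])
    then have "closed (orth_proj V ` K)" by (rule compact_imp_closed)
    moreover have "AE x in damp \<mu>. orth_proj V x \<in> orth_proj V ` K"
      using K(3) by (rule eventually_mono) simp
    ultimately show "(\<lambda>k. (1 / real (Suc k)) powr (- real m / 2) * overlap V (1 / real (Suc k)) (damp \<mu>) \<nu>) \<longlonglongrightarrow> 0"
      using K(2) by (intro overlap_vanish[OF d\<mu> \<nu> V' a(1) W E _ _ _ n]) auto
  qed
qed (rule K L pos)+

lemma orth_proj_Int_closed:
  assumes "compact K" "compact L" "V \<in> grassmannian m"
  shows "closed (orth_proj V ` K \<inter> orth_proj V ` L)"
  using assms by (intro compact_imp_closed compact_Int compact_continuous_image continuous_orth_proj grassmannian_subspace)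

lemma AE_notin_image:
  assumes "AE y in \<nu>. y \<in> L" "AE y in \<nu>. orth_proj V y \<notin> orth_proj V ` K \<inter> orth_proj V ` L"
  shows "AE y in \<nu>. orth_proj V y \<notin> orth_proj V ` K"
  using assms by eventually_elim auto

lemma positive_measure_of_intersections:
  fixes A B :: "(real^'n) set"
  assumes A: "A \<in> sets borel" and B: "B \<in> sets borel" and dA: "real m < hausdorff_dim A" and dB: "real m < hausdorff_dim B"
  shows "pos_measure \<gamma> {V \<in> grassmannian m. hausdorff_measure (real m) (orth_proj V ` A \<inter> orth_proj V ` B) > 0}"
  unfolding pos_measure_def
proof
  assume "\<exists>N\<in>null_sets \<gamma>. {V \<in> grassmannian m. hausdorff_measure (real m) (orth_proj V ` A \<inter> orth_proj V ` B) > 0} \<subseteq> N"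
  then obtain N where N: "N \<in> null_sets \<gamma>" "{V \<in> grassmannian m. hausdorff_measure (real m) (orth_proj V ` A \<inter> orth_proj V ` B) > 0} \<subseteq> N"
    by blast
  \<comment> \<open>The three bounds give \<open>0 \<le> m - a / 2\<close>,
    \<open>m + 2 * a < hausdorff_dim A\<close> and \<open>m + a < n\<close>.\<close>
  define a where "a = min (min (real m / 2) ((hausdorff_dim A - real m) / 4)) ((real CARD('n) - real m) / 2)"
  have a: "0 < a" "a \<le> real m / 2" "a \<le> (hausdorff_dim A - real m) / 4" "a \<le> (real CARD('n) - real m) / 2"
    using dA m1 mn by (auto simp: a_def min_def)
  define s where "s = real m + 2 * a"
  have s: "0 < s" "s < hausdorff_dim A" "real m + a < s" using a dA by (auto simp: s_def)
  define t where "t = (real m + hausdorff_dim B) / 2"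
  have t: "0 < t" "t < hausdorff_dim B" "real m < t" using dB m1 by (auto simp: t_def)
  obtain K \<mu> where \<mu>: "compact K" "K \<subseteq> A" "K \<noteq> {}" "borel_finite \<mu>" "growth s \<mu>" "growth s (damp \<mu>)"
    "0 < measure (damp \<mu>) UNIV" "AE x in damp \<mu>. x \<in> K"
    by (rule frostman_damped[OF A s(1,2)]) (rule that)
  obtain L \<nu> where \<nu>: "compact L" "L \<subseteq> B" "L \<noteq> {}" "borel_finite \<nu>" "growth t \<nu>" "growth t (damp \<nu>)"
    "0 < measure (damp \<nu>) UNIV" "AE x in damp \<nu>. x \<in> L"
    by (rule frostman_damped[OF B t(1,2)]) (rule that)
  have d\<nu>: "borel_finite (damp \<nu>)" by (rule damp_borel_finite[OF \<nu>(4)])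
  interpret D: borel_finite "damp \<nu>" by (rule d\<nu>)
  \<comment> \<open>\<open>energy_average_finite\<close> asks for an exponent below
    \<open>m\<close>, while the measure has growth \<open>t > m\<close>; so the exponent is lowered
    to a value strictly between \<open>m - a\<close> and \<open>m\<close>.\<close>
  have g: "growth (real m - a / 2) (damp \<nu>)"
    by (rule growth_mono[OF D.finite_measure_axioms \<nu>(6)]) (use a t in auto)
  \<comment> \<open>Growth above \<open>m\<close> makes the projections of the damped measure square
    integrable for almost every plane, which is what \<open>L2_null\<close> uses at the exponent
    \<open>m\<close> itself.\<close>
  have "(\<integral>\<^sup>+V. sobolev 0 (damp \<nu>) V \<partial>\<gamma>) < \<infinity>"
    using t mn by (intro sobolev_average_finite[OF \<nu>(4,5)]) auto
  then have W0: "AE V in \<gamma>. sobolev 0 (damp \<nu>) V < \<infinity>" by (rule AE_\<gamma>_finite[OF sobolev_measurable[OF d\<nu>]])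
  show False
  proof (rule projections_meet[OF \<mu>(4) d\<nu> \<mu>(5) g a(1) s(3) _ _ _ \<mu>(1,3,8) compact_imp_bounded[OF \<nu>(1)] \<nu>(8) \<mu>(7) \<nu>(7)])
    show "real m + a < real CARD('n)" "real m - a < real m - a / 2" "real m - a / 2 < real m" using a mn by auto
    show "AE V in \<gamma>. AE y in damp \<nu>. orth_proj V y \<notin> orth_proj V ` K"
      using AE_space AE_not_in[OF N(1)] W0
    proof eventually_elim
      fix V :: "(real^'n) set" assume V: "V \<in> space \<gamma>" "V \<notin> N" and W: "sobolev 0 (damp \<nu>) V < \<infinity>"
      have V': "V \<in> grassmannian m" using V by simp
      let ?S = "orth_proj V ` K \<inter> orth_proj V ` L"
      have "hausdorff_measure (real m) (orth_proj V ` A \<inter> orth_proj V ` B) = 0" using N(2) V V' by (force simp: zero_less_iff_neq_zero)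
      moreover have "?S \<subseteq> orth_proj V ` A \<inter> orth_proj V ` B" using \<mu>(2) \<nu>(2) by auto
      ultimately have H: "hausdorff_measure (real m) ?S = 0"
        using hausdorff_measure_mono[of ?S "orth_proj V ` A \<inter> orth_proj V ` B" "real m"] by simp
      have "?S \<in> sets borel" by (intro borel_closed orth_proj_Int_closed \<mu>(1) \<nu>(1) V')
      then have "AE y in damp \<nu>. orth_proj V y \<notin> ?S" by (rule L2_null[OF d\<nu> V' m1 W _ H])
      then show "AE y in damp \<nu>. orth_proj V y \<notin> orth_proj V ` K" by (rule AE_notin_image[OF \<nu>(8)])
    qed
  qed
qed

lemma large_dimension_of_intersections:
  fixes A B :: "(real^'n) set"
  assumes A: "A \<in> sets borel" and B: "B \<in> sets borel" and dA: "real m < hausdorff_dim A" and dB: "hausdorff_dim B \<le> real m"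
    and dAB: "2 * real m < hausdorff_dim A + hausdorff_dim B" and \<epsilon>: "0 < \<epsilon>"
  shows "pos_measure \<gamma> {V \<in> grassmannian m. hausdorff_dim (orth_proj V ` A \<inter> orth_proj V ` B) > hausdorff_dim B - \<epsilon>}"
  unfolding pos_measure_def
proof
  assume "\<exists>N\<in>null_sets \<gamma>. {V \<in> grassmannian m. hausdorff_dim (orth_proj V ` A \<inter> orth_proj V ` B) > hausdorff_dim B - \<epsilon>} \<subseteq> N"
  then obtain N where N: "N \<in> null_sets \<gamma>" "{V \<in> grassmannian m. hausdorff_dim (orth_proj V ` A \<inter> orth_proj V ` B) > hausdorff_dim B - \<epsilon>} \<subseteq> N"
    by blast
  have small: "hausdorff_dim (orth_proj V ` A \<inter> orth_proj V ` B) \<le> hausdorff_dim B - \<epsilon>" if "V \<in> space \<gamma>" "V \<notin> N" for V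
    using N(2) that by force
  \<comment> \<open>Outside \<open>N\<close> the intersection has dimension at most
    \<open>hausdorff_dim B - \<epsilon>\<close>; were the dimension of \<open>B\<close> not positive
    this would be negative, and the null set \<open>N\<close> would exhaust the
    Grassmannian.\<close>
  have B0: "0 < hausdorff_dim B"
  proof (rule ccontr)
    assume "\<not> 0 < hausdorff_dim B"
    then have no: False if "V \<in> space \<gamma>" "V \<notin> N" for V
      using small[OF that] hausdorff_dim_nonneg[of "orth_proj V ` A \<inter> orth_proj V ` B"] \<epsilon> by linarith
    have "AE V in \<gamma>. False" using AE_space AE_not_in[OF N(1)] by eventually_elim (rule no)
    then show False using \<gamma>.AE_False by simp
  qed
  \<comment> \<open>The midpoint between the dimension of \<open>B\<close> and the largest lower
    bound required: positivity, the loss \<open>\<epsilon>\<close>, and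
    \<open>2 * m - hausdorff_dim A\<close>, which makes \<open>m + a\<close> smaller than the
    dimension of \<open>A\<close>.\<close>
  define r where "r = (max (max 0 (hausdorff_dim B - \<epsilon>)) (2 * real m - hausdorff_dim A) + hausdorff_dim B) / 2"
  have r: "0 < r" "hausdorff_dim B - \<epsilon> < r" "2 * real m - hausdorff_dim A < r" "r < hausdorff_dim B"
    using B0 \<epsilon> dAB by (auto simp: r_def max_def)
  define a where "a = real m - r"
  have a: "0 < a" "real m - a = r" using r dB by (auto simp: a_def)
  define s where "s = (real m + a + hausdorff_dim A) / 2"
  have s: "0 < s" "s < hausdorff_dim A" "real m + a < s" using a r by (auto simp: s_def a_def)
  define t where "t = (r + hausdorff_dim B) / 2"
  have t: "0 < t" "t < hausdorff_dim B" "r < t" using r by (auto simp: t_def)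
  obtain K \<mu> where \<mu>: "compact K" "K \<subseteq> A" "K \<noteq> {}" "borel_finite \<mu>" "growth s \<mu>" "growth s (damp \<mu>)"
    "0 < measure (damp \<mu>) UNIV" "AE x in damp \<mu>. x \<in> K"
    by (rule frostman_damped[OF A s(1,2)]) (rule that)
  obtain L \<nu> where \<nu>: "compact L" "L \<subseteq> B" "L \<noteq> {}" "borel_finite \<nu>" "growth t \<nu>" "growth t (damp \<nu>)"
    "0 < measure (damp \<nu>) UNIV" "AE x in damp \<nu>. x \<in> L"
    by (rule frostman_damped[OF B t(1,2)]) (rule that)
  have d\<nu>: "borel_finite (damp \<nu>)" by (rule damp_borel_finite[OF \<nu>(4)])
  have tm: "t < real m" using t dB by simp
  have E: "AE V in \<gamma>. energy r (damp \<nu>) V < \<infinity>"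
    by (rule AE_\<gamma>_finite[OF energy_measurable[OF d\<nu>] energy_average_finite[OF d\<nu> \<nu>(6) t(3) tm]])
  show False
  proof (rule projections_meet[OF \<mu>(4) d\<nu> \<mu>(5) \<nu>(6) a(1) s(3) _ _ tm \<mu>(1,3,8) compact_imp_bounded[OF \<nu>(1)] \<nu>(8) \<mu>(7) \<nu>(7)])
    show "real m + a < real CARD('n)" using s hausdorff_dim_le_card[of A] by linarith
    show "real m - a < t" using a t by simp
    show "AE V in \<gamma>. AE y in damp \<nu>. orth_proj V y \<notin> orth_proj V ` K"
      using AE_space AE_not_in[OF N(1)] E
    proof eventually_elim
      fix V :: "(real^'n) set" assume V: "V \<in> space \<gamma>" "V \<notin> N" and E: "energy r (damp \<nu>) V < \<infinity>"
      have V': "V \<in> grassmannian m" using V by simp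
      let ?S = "orth_proj V ` K \<inter> orth_proj V ` L"
      have "hausdorff_measure r (orth_proj V ` A \<inter> orth_proj V ` B) = 0"
        using small[OF V] r by (intro hausdorff_measure_zero_of_dim_lt) simp
      moreover have "?S \<subseteq> orth_proj V ` A \<inter> orth_proj V ` B" using \<mu>(2) \<nu>(2) by auto
      ultimately have H: "hausdorff_measure r ?S = 0"
        using hausdorff_measure_mono[of ?S "orth_proj V ` A \<inter> orth_proj V ` B" r] by simp
      have "?S \<in> sets borel" by (intro borel_closed orth_proj_Int_closed \<mu>(1) \<nu>(1) V')
      then have "AE y in damp \<nu>. orth_proj V y \<notin> ?S" by (rule energy_null[OF d\<nu> grassmannian_subspace[OF V'] E r(1) _ H])
      then show "AE y in damp \<nu>. orth_proj V y \<notin> orth_proj V ` K" by (rule AE_notin_image[OF \<nu>(8)])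
    qed
  qed
qed

lemma interior_of_intersections:
  fixes A B :: "(real^'n) set"
  assumes A: "A \<in> sets borel" and B: "B \<in> sets borel" and dA: "2 * real m < hausdorff_dim A" and dB: "2 * real m < hausdorff_dim B"
  shows "pos_measure \<gamma> {V \<in> grassmannian m. (top_of_set V) interior_of (orth_proj V ` A \<inter> orth_proj V ` B) \<noteq> {}}"
  unfolding pos_measure_def
proof
  assume "\<exists>N\<in>null_sets \<gamma>. {V \<in> grassmannian m. (top_of_set V) interior_of (orth_proj V ` A \<inter> orth_proj V ` B) \<noteq> {}} \<subseteq> N"
  then obtain N where N: "N \<in> null_sets \<gamma>" "{V \<in> grassmannian m. (top_of_set V) interior_of (orth_proj V ` A \<inter> orth_proj V ` B) \<noteq> {}} \<subseteq> N"
    by blast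
  \<comment> \<open>Any \<open>s\<close> between \<open>2 * m\<close> and both dimensions will do;
    its half \<open>a\<close> then satisfies \<open>m < a\<close> and
    \<open>m + a < s\<close>.\<close>
  define s where "s = (2 * real m + min (hausdorff_dim A) (hausdorff_dim B)) / 2"
  have s: "0 < s" "s < hausdorff_dim A" "s < hausdorff_dim B" "2 * real m < s"
    using dA dB m1 by (auto simp: s_def min_def)
  define a where "a = s / 2"
  have a: "0 < a" "real m < a" "real m + a < s" "real m + a < real CARD('n)"
    using s hausdorff_dim_le_card[of A] by (auto simp: a_def)
  obtain K \<mu> where \<mu>: "compact K" "K \<subseteq> A" "K \<noteq> {}" "borel_finite \<mu>" "growth s \<mu>" "growth s (damp \<mu>)"
    "0 < measure (damp \<mu>) UNIV" "AE x in damp \<mu>. x \<in> K"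
    by (rule frostman_damped[OF A s(1,2)]) (rule that)
  obtain L \<nu> where \<nu>: "compact L" "L \<subseteq> B" "L \<noteq> {}" "borel_finite \<nu>" "growth s \<nu>" "growth s (damp \<nu>)"
    "0 < measure (damp \<nu>) UNIV" "AE x in damp \<nu>. x \<in> L"
    by (rule frostman_damped[OF B s(1,3)]) (rule that)
  have d\<mu>: "borel_finite (damp \<mu>)" by (rule damp_borel_finite[OF \<mu>(4)])
  have d\<nu>: "borel_finite (damp \<nu>)" by (rule damp_borel_finite[OF \<nu>(4)])
  note [measurable] = sobolev_measurable[OF d\<mu>] sobolev_measurable[OF d\<nu>]
  have W1: "(\<integral>\<^sup>+V. sobolev a (damp \<mu>) V \<partial>\<gamma>) < \<infinity>" using a by (intro sobolev_average_finite[OF \<mu>(4,5)]) auto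
  have W2: "(\<integral>\<^sup>+V. sobolev a (damp \<nu>) V \<partial>\<gamma>) < \<infinity>" using a by (intro sobolev_average_finite[OF \<nu>(4,5)]) auto
  show False
  proof (rule overlap_not_AE_vanishing[OF d\<mu> d\<nu> compact_imp_bounded[OF \<mu>(1)] \<mu>(8) compact_imp_bounded[OF \<nu>(1)] \<nu>(8) \<mu>(7) \<nu>(7),
        where D = "\<lambda>V. sobolev a (damp \<mu>) V + sobolev a (damp \<nu>) V"])
    show "0 < (2 * pi) powr (CARD('n) / 2)" by simp
    show "(\<lambda>V. sobolev a (damp \<mu>) V + sobolev a (damp \<nu>) V) \<in> borel_measurable \<gamma>" by measurable
    show "(\<integral>\<^sup>+V. sobolev a (damp \<mu>) V + sobolev a (damp \<nu>) V \<partial>\<gamma>) < \<infinity>"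
      by (subst nn_integral_add, measurable) (use W1 W2 in simp)
    show "ennreal ((2 * pi) powr (CARD('n) / 2) * \<tau> powr (- real m / 2) * overlap V \<tau> (damp \<mu>) (damp \<nu>)) \<le> sobolev a (damp \<mu>) V + sobolev a (damp \<nu>) V"
      if "V \<in> grassmannian m" "0 < \<tau>" for V \<tau>
    proof -
      have "ennreal ((2 * pi) powr (CARD('n) / 2) * \<tau> powr (- real m / 2) * overlap V \<tau> (damp \<mu>) (damp \<nu>)) \<le> sobolev a (damp \<mu>) V + sobolev (- a) (damp \<nu>) V"
        using overlap_le_sobolev[OF d\<mu> d\<nu> that zero_less_one, of a] by simp
      \<comment> \<open>The negative norm is at most the positive one, whose average is finite here
        for both measures.\<close>
      also have "\<dots> \<le> sobolev a (damp \<mu>) V + sobolev a (damp \<nu>) V" using a by (intro add_left_mono sobolev_mono) simp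
      finally show ?thesis .
    qed
    have AW1: "AE V in \<gamma>. sobolev a (damp \<mu>) V < \<infinity>" by (rule AE_\<gamma>_finite[OF _ W1]) measurable
    have AW2: "AE V in \<gamma>. sobolev a (damp \<nu>) V < \<infinity>" by (rule AE_\<gamma>_finite[OF _ W2]) measurable
    show "AE V in \<gamma>. (\<lambda>k. (1 / real (Suc k)) powr (- real m / 2) * overlap V (1 / real (Suc k)) (damp \<mu>) (damp \<nu>)) \<longlonglongrightarrow> 0"
      using AE_space AE_not_in[OF N(1)] AW1 AW2
    proof eventually_elim
      fix V :: "(real^'n) set" assume V: "V \<in> space \<gamma>" "V \<notin> N" and W: "sobolev a (damp \<mu>) V < \<infinity>" "sobolev a (damp \<nu>) V < \<infinity>"
      have V': "V \<in> grassmannian m" using V by simp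
      have comp: "compact (orth_proj V ` K)" "compact (orth_proj V ` L)"
        using \<mu>(1) \<nu>(1) by (auto intro!: compact_continuous_image continuous_orth_proj grassmannian_subspace[OF V'])
      have empty: "(top_of_set V) interior_of (orth_proj V ` A \<inter> orth_proj V ` B) = {}" using N V V' by auto
      show "(\<lambda>k. (1 / real (Suc k)) powr (- real m / 2) * overlap V (1 / real (Suc k)) (damp \<mu>) (damp \<nu>)) \<longlonglongrightarrow> 0"
      proof (rule overlap_vanish_interior[OF d\<mu> d\<nu> V' a(2) W compact_imp_closed[OF comp(1)] compact_imp_bounded[OF comp(1)] _ compact_imp_closed[OF comp(2)]])
        show "AE x in damp \<mu>. orth_proj V x \<in> orth_proj V ` K" using \<mu>(8) by (rule eventually_mono) simp
        show "AE x in damp \<nu>. orth_proj V x \<in> orth_proj V ` L" using \<nu>(8) by (rule eventually_mono) simp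
        fix U assume U: "openin (top_of_set V) U" "U \<subseteq> orth_proj V ` K \<inter> orth_proj V ` L"
        have "U \<subseteq> orth_proj V ` A \<inter> orth_proj V ` B"
          using U(2) image_mono[OF \<mu>(2), of "orth_proj V"] image_mono[OF \<nu>(2), of "orth_proj V"] by blast
        then have "U \<subseteq> (top_of_set V) interior_of (orth_proj V ` A \<inter> orth_proj V ` B)"
          using U(1) by (rule interior_of_maximal)
        then show "U = {}" using empty by simp
      qed
    qed
  qed
qed

end

theorem theorem1p1:
  fixes A B :: "(real^'n) set" and m :: nat and \<gamma> :: "(real^'n) set measure"
  assumes "A \<in> sets borel" and "B \<in> sets borel"
    and "1 \<le> m" and "m < CARD('n)"
    and "grassmann_haar m \<gamma>"
  shows "(hausdorff_dim A > real m \<and> hausdorff_dim B > real m \<longrightarrow>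
            pos_measure \<gamma> {V \<in> grassmannian m.
               hausdorff_measure (real m) (orth_proj V ` A \<inter> orth_proj V ` B) > 0})
       \<and> (hausdorff_dim A > 2 * real m \<and> hausdorff_dim B > 2 * real m \<longrightarrow>
            pos_measure \<gamma> {V \<in> grassmannian m.
               (top_of_set V) interior_of (orth_proj V ` A \<inter> orth_proj V ` B) \<noteq> {}})
       \<and> (hausdorff_dim A > real m \<and> hausdorff_dim B \<le> real m \<and>
          hausdorff_dim A + hausdorff_dim B > 2 * real m \<longrightarrow>
            (\<forall>\<epsilon>>0. pos_measure \<gamma> {V \<in> grassmannian m.
               hausdorff_dim (orth_proj V ` A \<inter> orth_proj V ` B) > hausdorff_dim B - \<epsilon>}))"
proof -
  interpret haar_grassmannian m \<gamma> using assms by unfold_locales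
  show ?thesis
    by (intro conjI impI allI; elim conjE)
      (rule positive_measure_of_intersections[OF assms(1,2)] interior_of_intersections[OF assms(1,2)]
        large_dimension_of_intersections[OF assms(1,2)]; assumption)+
qed

end
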